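(* Let $T>0$, $L>0$, $\Omega=(0,L)$, $Q=(0,T)\times\Omega$ and $\gamma\in\mathbb{R}$. Let $\omega_0,\omega$ be nonempty open subsets of $\Omega$ with $\overline{\omega_0}\subseteq\omega$, and let $\phi\in C^4(\overline\Omega)$ be a real-valued function such that $$\phi>0\ \text{ in }\Omega,\qquad \phi=0\ \text{ on }\partial\Omega,\qquad |\phi_x(x)|>0\ \text{ for all }x\in\overline{\Omega\setminus\omega_0}.$$ For $s>0$ put $$\rho(t,x)=\frac{e^{s\phi(x)}-e^{2s|\phi|_{C(\overline\Omega)}}}{t(T-t)},\qquad \varphi(t,x)=\frac{e^{s\phi(x)}}{t(T-t)} .$$ Then there exists a constant $s_0>0$ such that for every $s\ge s_0$ one can find two positive constants $\lambda_0=\lambda_0(s)$ and $C=C(s)$ such that for all $v\in H^4(Q)$ satisfying $(\gamma\partial_t+\partial_x^4)v=f$ in $Q$ with $f\in L^2(Q)$, and satisfying either $v=v_x=0$ on $(0,T)\times\partial\Omega$ or $v=v_{xx}=0$ on $(0,T)\times\partial\Omega$, and for all $\lambda\ge\lambda_0$, it holds that $$\int_Q \lambda s^2\varphi\, e^{2\lambda\rho}\Big(|\partial_x^3 v|^2+\lambda^2s^2\varphi^2|\partial_x^2 v|^2+\lambda^4s^4\varphi^4|\partial_x v|^2+\lambda^6s^6\varphi^6|v|^2\Big)dx\,dt$$ $$\le\ C\int_Q e^{2\lambda\rho}|f|^2\,dx\,dt+C\int_0^T\!\!\int_\omega \lambda^7s^8\varphi^7e^{2\lambda\rho}|v|^2\,dx\,dt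 .$$
   Context: $|\phi|_{C(\overline\Omega)}=\max_{x\in\overline\Omega}|\phi(x)|$. A function $\phi$ with the stated properties is known to exist; it is fixed throughout. Subscripts $x$ denote derivatives in $x$. $\partial\Omega=\{0,L\}$. Here $v$ is real-valued. *)

theory Defs
  imports "HOL-Analysis.Analysis"
begin

subsection \<open>Classical differentiability\<close>

text \<open>The class of \<open>k\<close> times continuously differentiable functions on \<open>S\<close>, where \<open>S\<close> is meant to
  be a nondegenerate interval; derivatives are taken within \<open>S\<close>, so they are one-sided at an
  end point belonging to \<open>S\<close>.\<close>

primrec Ck_on :: "nat \<Rightarrow> real set \<Rightarrow> (real \<Rightarrow> real) \<Rightarrow> bool" where
  "Ck_on 0 S g \<longleftrightarrow> continuous_on S g"
| "Ck_on (Suc k) S g \<longleftrightarrow> (\<forall>x\<in>S. g differentiable (at x within S)) \<and>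
     Ck_on k S (\<lambda>x. vector_derivative g (at x within S))"

text \<open>Points of the plane are pairs \<open>(t, x)\<close>.\<close>

definition pd_t :: "(real \<times> real \<Rightarrow> real) \<Rightarrow> real \<times> real \<Rightarrow> real" where
  "pd_t u = (\<lambda>(t, x). deriv (\<lambda>\<tau>. u (\<tau>, x)) t)"

definition pd_x :: "(real \<times> real \<Rightarrow> real) \<Rightarrow> real \<times> real \<Rightarrow> real" where
  "pd_x u = (\<lambda>(t, x). deriv (\<lambda>\<xi>. u (t, \<xi>)) x)"

primrec Ck_plane :: "nat \<Rightarrow> (real \<times> real \<Rightarrow> real) \<Rightarrow> bool" where
  "Ck_plane 0 u \<longleftrightarrow> continuous_on UNIV u"
| "Ck_plane (Suc k) u \<longleftrightarrow> continuous_on UNIV u \<and>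
     (\<forall>t x. (\<lambda>\<tau>. u (\<tau>, x)) differentiable (at t) \<and> (\<lambda>\<xi>. u (t, \<xi>)) differentiable (at x)) \<and>
     Ck_plane k (pd_t u) \<and> Ck_plane k (pd_x u)"

definition smooth_plane :: "(real \<times> real \<Rightarrow> real) \<Rightarrow> bool" where
  "smooth_plane u \<longleftrightarrow> (\<forall>k. Ck_plane k u)"

definition test_function :: "(real \<times> real) set \<Rightarrow> (real \<times> real \<Rightarrow> real) \<Rightarrow> bool" where
  "test_function Q \<psi> \<longleftrightarrow> smooth_plane \<psi> \<and> (\<exists>K. compact K \<and> K \<subseteq> Q \<and> (\<forall>z. z \<notin> K \<longrightarrow> \<psi> z = 0))"

subsection \<open>Sobolev spaces\<close>

definition L2_on :: "'a::euclidean_space set \<Rightarrow> ('a \<Rightarrow> real) \<Rightarrow> bool" where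
  "L2_on A u \<longleftrightarrow> set_borel_measurable lebesgue A u \<and> set_integrable lebesgue A (\<lambda>z. (u z)\<^sup>2)"

definition locally_integrable :: "(real \<times> real) set \<Rightarrow> (real \<times> real \<Rightarrow> real) \<Rightarrow> bool" where
  "locally_integrable Q u \<longleftrightarrow> (\<forall>K. compact K \<and> K \<subseteq> Q \<longrightarrow> u absolutely_integrable_on K)"

text \<open>\<open>g\<close> is the distributional derivative of order \<open>i\<close> in \<open>t\<close> and \<open>j\<close> in \<open>x\<close> of \<open>u\<close> in \<open>Q\<close>.\<close>

definition has_weak_deriv ::
    "(real \<times> real) set \<Rightarrow> nat \<Rightarrow> nat \<Rightarrow> (real \<times> real \<Rightarrow> real) \<Rightarrow> (real \<times> real \<Rightarrow> real) \<Rightarrow> bool" where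
  "has_weak_deriv Q i j u g \<longleftrightarrow> locally_integrable Q u \<and> locally_integrable Q g \<and>
     (\<forall>\<psi>. test_function Q \<psi> \<longrightarrow>
        (LINT z:Q|lebesgue. u z * (pd_t ^^ i) ((pd_x ^^ j) \<psi>) z) =
        (- 1) ^ (i + j) * (LINT z:Q|lebesgue. g z * \<psi> z))"

text \<open>A weak derivative is determined only up to a null set; \<open>weak_deriv\<close> picks a representative.\<close>

definition weak_deriv ::
    "(real \<times> real) set \<Rightarrow> nat \<Rightarrow> nat \<Rightarrow> (real \<times> real \<Rightarrow> real) \<Rightarrow> real \<times> real \<Rightarrow> real" where
  "weak_deriv Q i j u = (SOME g. has_weak_deriv Q i j u g)"

text \<open>The space $H^k(Q)$.\<close>

definition sobolev :: "(real \<times> real) set \<Rightarrow> nat \<Rightarrow> (real \<times> real \<Rightarrow> real) \<Rightarrow> bool" where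
  "sobolev Q k u \<longleftrightarrow> L2_on Q u \<and>
     (\<forall>i j. i + j \<le> k \<longrightarrow> (\<exists>g. has_weak_deriv Q i j u g \<and> L2_on Q g))"

subsection \<open>Traces on the lateral boundary\<close>

text \<open>For \<open>b \<in> {0, L}\<close>: \<open>g\<close> is the trace on \<open>(0,T) \<times> {b}\<close> of the $H^1$ function \<open>u\<close>. The trace operator
  is the continuous extension of the restriction map from functions smooth up to the boundary,
  so its graph consists of the limits of pairs (smooth function, its restriction).\<close>

definition has_trace ::
    "real \<Rightarrow> real \<Rightarrow> real \<Rightarrow> (real \<times> real \<Rightarrow> real) \<Rightarrow> (real \<Rightarrow> real) \<Rightarrow> bool" where
  "has_trace T L b u g \<longleftrightarrow>
     (let Q = {0<..<T} \<times> {0<..<L} in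
      sobolev Q 1 u \<and> L2_on {0<..<T} g \<and>
      (\<exists>w :: nat \<Rightarrow> real \<times> real \<Rightarrow> real. (\<forall>n. smooth_plane (w n)) \<and>
         (\<lambda>n. LINT z:Q|lebesgue. (w n z - u z)\<^sup>2 + (pd_t (w n) z - weak_deriv Q 1 0 u z)\<^sup>2
                + (pd_x (w n) z - weak_deriv Q 0 1 u z)\<^sup>2) \<longlonglongrightarrow> 0 \<and>
         (\<lambda>n. LINT t:{0<..<T}|lebesgue. (w n (t, b) - g t)\<^sup>2) \<longlonglongrightarrow> 0))"

definition vanishes_on_lateral_boundary :: "real \<Rightarrow> real \<Rightarrow> (real \<times> real \<Rightarrow> real) \<Rightarrow> bool" where
  "vanishes_on_lateral_boundary T L u \<longleftrightarrow> (\<forall>b\<in>{0, L}. has_trace T L b u (\<lambda>_. 0))"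

subsection \<open>Carleman weights\<close>

definition sup_norm :: "real \<Rightarrow> (real \<Rightarrow> real) \<Rightarrow> real" where
  "sup_norm L \<phi> = (SUP x\<in>{0..L}. \<bar>\<phi> x\<bar>)"

definition weight_rho :: "real \<Rightarrow> real \<Rightarrow> (real \<Rightarrow> real) \<Rightarrow> real \<Rightarrow> real \<times> real \<Rightarrow> real" where
  "weight_rho T L \<phi> s = (\<lambda>(t, x). (exp (s * \<phi> x) - exp (2 * s * sup_norm L \<phi>)) / (t * (T - t)))"

definition weight_phi :: "real \<Rightarrow> (real \<Rightarrow> real) \<Rightarrow> real \<Rightarrow> real \<times> real \<Rightarrow> real" where
  "weight_phi T \<phi> s = (\<lambda>(t, x). exp (s * \<phi> x) / (t * (T - t)))"

end

theory Submission
  imports Defs "HOL-Computational_Algebra.Polynomial"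
begin

text \<open>Write \<open>\<rho> = \<theta>(t) \<alpha>(x)\<close> with \<open>\<theta> = 1 / (t (T - t))\<close> and \<open>\<alpha> < 0\<close>, put \<open>\<tau> = \<lambda> \<theta>\<close>, and conjugate:
  \<open>w = exp (\<tau> \<alpha>) v\<close>. For large \<open>s\<close>, both \<open>\<alpha>''\<close> and \<open>\<bar>\<alpha>'\<bar>\<close> are bounded below outside \<open>\<omega>\<^sub>0\<close>. Up to lower order
  terms the conjugated operator is \<open>S + A\<close> with \<open>S = \<partial>\<^sub>x\<^sup>4 + 6 \<tau>\<^sup>2 \<partial>\<^sub>x \<alpha>'\<^sup>2 \<partial>\<^sub>x + \<tau>\<^sup>4 \<alpha>'\<^sup>4\<close> symmetric and
  \<open>A = \<gamma> \<partial>\<^sub>t - 4 \<tau> \<alpha>' \<partial>\<^sub>x\<^sup>3 - 4 \<tau>\<^sup>3 \<alpha>'\<^sup>3 \<partial>\<^sub>x - \<dots>\<close> antisymmetric. For almost every fixed time, integration by parts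
  in the spatial part of \<open>2 \<langle>S w, A w\<rangle>\<close> gives the left-hand side of the estimate where \<open>\<alpha>'' > 0\<close>, with boundary
  terms of the right sign because \<open>\<alpha>'\<close> points into the interval; in \<open>\<omega>\<^sub>0\<close> the deficit is controlled by
  \<open>\<parallel>S w\<parallel>\<^sup>2\<close> and a local term in \<open>w\<close> alone. The pairing \<open>\<langle>S w, \<gamma> w\<^sub>t\<rangle>\<close> is a total time derivative up to terms with
  \<open>\<tau>' = O(\<tau>\<^sup>2 / \<lambda>)\<close>, which are absorbed for large \<open>\<lambda>\<close>. Integrations by parts are justified on almost every
  line parallel to the axes, where functions with weak derivatives are absolutely continuous.\<close>

section \<open>Test functions on the line\<close>

text \<open>Convexity comes from \<open>s\<close> alone: \<alpha>'' = (s \<phi>'' + s^2 \<phi>'^2)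
  exp (s \<phi>) is positive wherever \<phi>' is bounded away from zero and \<open>s\<close> is
  large. Since the constants may depend on \<open>s\<close>, it is then frozen: one constant
  \<open>A\<close> bounds all derivatives of the weight, and \<tau> \<ge> 4 \<lambda> / T^2 is the
  only large parameter. With \<tau> counted as one derivative, the four energy terms are all of
  order 7, and whatever has order 6 is absorbed. The obstacle is the time derivative. The estimate
  controls neither w_t nor the fourth derivative, so the pairing of S w with \<gamma> w_t cannot be
  estimated and has to be an exact derivative; hence S is kept formally self-adjoint, and the square
  of A w is dropped. This pairing is also the only place where the second boundary condition enters:
  the spatial boundary terms have a sign as soon as w = 0. It involves the derivative of order one
  in t and two in x, which H^4 provides in L^2.\<close>

primrec Ck_line :: "nat \<Rightarrow> (real \<Rightarrow> real) \<Rightarrow> bool" where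
  "Ck_line 0 f \<longleftrightarrow> continuous_on UNIV f"
| "Ck_line (Suc k) f \<longleftrightarrow> (\<exists>f'. (\<forall>x. (f has_real_derivative f' x) (at x)) \<and> Ck_line k f')"

definition smooth_line :: "(real \<Rightarrow> real) \<Rightarrow> bool" where
  "smooth_line f \<longleftrightarrow> (\<forall>k. Ck_line k f)"

definition test_line :: "real \<Rightarrow> (real \<Rightarrow> real) \<Rightarrow> bool" where
  "test_line L f \<longleftrightarrow> smooth_line f \<and> (\<exists>c d. 0 < c \<and> d < L \<and> (\<forall>x. x \<notin> {c..d} \<longrightarrow> f x = 0))"

lemma Ck_line_continuous: "Ck_line k f \<Longrightarrow> continuous_on UNIV f"
proof (cases k)
  case (Suc n)
  assume "Ck_line k f"
  then obtain f' where "\<And>x. (f has_real_derivative f' x) (at x)" using Suc by auto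
  then show ?thesis by (intro DERIV_continuous_on[of _ f f']) (auto intro: has_field_derivative_at_within)
qed auto

lemma Ck_line_Suc_D: "Ck_line (Suc k) f \<Longrightarrow> Ck_line k f"
proof (induction k arbitrary: f)
  case 0
  then show ?case using Ck_line_continuous[of "Suc 0" f] by auto
next
  case (Suc k)
  then show ?case by (metis Ck_line.simps(2))
qed

lemma Ck_line_add: "Ck_line k f \<Longrightarrow> Ck_line k g \<Longrightarrow> Ck_line k (\<lambda>x. f x + g x)"
proof (induction k arbitrary: f g)
  case 0
  then show ?case by (auto intro: continuous_intros)
next
  case (Suc k)
  then obtain f' g' where "\<forall>x. (f has_real_derivative f' x) (at x)" "Ck_line k f'"
    "\<forall>x. (g has_real_derivative g' x) (at x)" "Ck_line k g'" by auto
  then show ?case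
    using Suc.IH by (auto intro!: exI[of _ "\<lambda>x. f' x + g' x"] DERIV_add)
qed

lemma Ck_line_mult: "Ck_line k f \<Longrightarrow> Ck_line k g \<Longrightarrow> Ck_line k (\<lambda>x. f x * g x)"
proof (induction k arbitrary: f g)
  case 0
  then show ?case by (auto intro: continuous_intros)
next
  case (Suc k)
  then obtain f' g' where fg: "\<forall>x. (f has_real_derivative f' x) (at x)" "Ck_line k f'"
    "\<forall>x. (g has_real_derivative g' x) (at x)" "Ck_line k g'" by auto
  have "Ck_line k f" "Ck_line k g" using Suc.prems by (auto intro: Ck_line_Suc_D simp del: Ck_line.simps)
  then have "Ck_line k (\<lambda>x. f' x * g x + g' x * f x)"
    using fg Suc.IH by (intro Ck_line_add) auto
  then show ?case
    using fg by (auto intro!: exI[of _ "\<lambda>x. f' x * g x + g' x * f x"] DERIV_mult)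
qed

lemma Ck_line_const: "Ck_line k (\<lambda>x. c)"
  by (induction k arbitrary: c) (auto intro!: exI[of _ "\<lambda>x. 0"])

lemma Ck_line_affine: "Ck_line k f \<Longrightarrow> Ck_line k (\<lambda>x. f (m * x + c))"
proof (induction k arbitrary: f)
  case 0
  then show ?case by (auto intro!: continuous_intros continuous_on_compose2[of UNIV f])
next
  case (Suc k)
  then obtain f' where f': "\<forall>x. (f has_real_derivative f' x) (at x)" "Ck_line k f'" by auto
  have "((\<lambda>x. f (m * x + c)) has_real_derivative f' (m * x + c) * m) (at x)" for x
    by (rule DERIV_chain2[of f]) (use f' in \<open>auto intro!: derivative_eq_intros\<close>)
  moreover have "Ck_line k (\<lambda>x. f' (m * x + c) * m)"
    using Suc.IH[OF f'(2)] by (intro Ck_line_mult Ck_line_const)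
  ultimately show ?case
    unfolding Ck_line.simps by (intro exI[of _ "\<lambda>x. f' (m * x + c) * m"]) auto
qed

section \<open>Flat exponentials and bump functions\<close>

definition exp_flat :: "real \<Rightarrow> real poly \<Rightarrow> real \<Rightarrow> real" where
  "exp_flat e p x = (if x > 0 then poly p (1 / x) * exp (- (e / x)) else 0)"

lemma exp_flat_tendsto_0:
  assumes "e > 0"
  shows "(exp_flat e p \<longlongrightarrow> 0) (at_right 0)"
proof -
  have pw: "((\<lambda>y. y ^ n * exp (- (e * y))) \<longlongrightarrow> 0) at_top" for n :: nat
  proof -
    have "((\<lambda>y. (e * y) ^ n / exp (e * y)) \<longlongrightarrow> 0) at_top"
      using tendsto_power_div_exp_0 filterlim_tendsto_pos_mult_at_top[OF tendsto_const assms filterlim_ident]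
      by (rule filterlim_compose)
    then have "((\<lambda>y. inverse (e ^ n) * ((e * y) ^ n / exp (e * y))) \<longlongrightarrow> inverse (e ^ n) * 0) at_top"
      by (intro tendsto_mult tendsto_const)
    then show ?thesis using assms
      by (simp add: exp_minus field_simps)
  qed
  have "((\<lambda>y. poly p y * exp (- (e * y))) \<longlongrightarrow> (\<Sum>i\<le>degree p. coeff p i * 0)) at_top"
    unfolding poly_altdef sum_distrib_right mult.assoc
    by (intro tendsto_sum tendsto_mult tendsto_const pw)
  then have "((\<lambda>y. poly p y * exp (- (e * y))) \<longlongrightarrow> 0) at_top" by simp
  then have "((\<lambda>x. poly p (inverse x) * exp (- (e * inverse x))) \<longlongrightarrow> 0) (at_right 0)"
    using filterlim_inverse_at_top_right by (rule filterlim_compose)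
  then show ?thesis
    by (rule Lim_transform_eventually)
      (auto simp: eventually_at_right_less exp_flat_def inverse_eq_divide intro!: eventually_at_rightI[of 0 1])
qed

text \<open>In the variable y = 1/x the derivative of p(y) exp (- e y) is y^2 (e p(y) - p'(y)) exp
  (- e y), so flat exponentials are closed under differentiation and smoothness follows by
  induction.\<close>

lemma exp_flat_deriv:
  assumes "e > 0"
  shows "(exp_flat e p has_real_derivative exp_flat e ([:0,0,1:] * (smult e p - pderiv p)) x) (at x)"
proof -
  let ?q = "[:0,0,1:] * (smult e p - pderiv p)"
  consider "x < 0" | "x = 0" | "x > 0" by linarith
  then show ?thesis
  proof cases
    case 1
    have "((\<lambda>x. 0) has_real_derivative 0) (at x)" by simp
    then show ?thesis
      by (subst DERIV_cong_ev[of x x _ "\<lambda>x. 0" _ 0])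
        (use 1 in \<open>auto simp: exp_flat_def eventually_nhds intro!: exI[of _ "{..<0}"]\<close>)
  next
    case 3
    have "((\<lambda>x. poly p (1 / x) * exp (- (e / x))) has_real_derivative
        poly ?q (1 / x) * exp (- (e / x))) (at x)"
      using 3 by (auto intro!: derivative_eq_intros DERIV_chain2[OF poly_DERIV]
          simp: field_simps power2_eq_square)
    then show ?thesis
      by (subst DERIV_cong_ev[of x x _ "\<lambda>x. poly p (1 / x) * exp (- (e / x))" _ "poly ?q (1 / x) * exp (- (e / x))"])
        (use 3 in \<open>auto simp: exp_flat_def eventually_nhds intro!: exI[of _ "{0<..}"]\<close>)
  next
    case 2
    \<comment> \<open>The difference quotient at 0 is the flat exponential of the polynomial X p,
      which tends to 0.\<close>
    have "((\<lambda>h. exp_flat e ([:0,1:] * p) h) \<longlongrightarrow> 0) (at_right 0)"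
      by (rule exp_flat_tendsto_0[OF assms])
    then have r: "((\<lambda>h. exp_flat e p h / h) \<longlongrightarrow> 0) (at_right 0)"
      by (rule Lim_transform_eventually)
        (auto simp: exp_flat_def intro!: eventually_at_rightI[of 0 1])
    have l: "((\<lambda>h. exp_flat e p h / h) \<longlongrightarrow> 0) (at_left 0)"
      by (rule Lim_transform_eventually[OF tendsto_const])
        (auto simp: exp_flat_def intro!: eventually_at_leftI[of "-1" 0])
    show ?thesis using 2 l r
      by (auto simp: DERIV_def filterlim_split_at exp_flat_def)
  qed
qed

lemma Ck_line_exp_flat: "e > 0 \<Longrightarrow> Ck_line k (exp_flat e p)"
proof (induction k arbitrary: p)
  case 0
  then show ?case
    using exp_flat_deriv[of e p] Ck_line_continuous[of 1] by (metis DERIV_atLeastAtMost_imp_continuous_on DERIV_isCont continuous_at_imp_continuous_on Ck_line.simps(1))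
next
  case (Suc k)
  then show ?case
    unfolding Ck_line.simps
    by (intro exI[of _ "exp_flat e ([:0,0,1:] * (smult e p - pderiv p))"] conjI allI exp_flat_deriv)
qed

text \<open>The parameter \<open>e\<close> is the steepness: as \<open>e\<close> tends to 0 the
  bumps tend to the indicator of the open interval, staying between 0 and 1.\<close>

definition bump :: "real \<Rightarrow> real \<Rightarrow> real \<Rightarrow> real \<Rightarrow> real" where
  "bump e c d x = exp_flat e 1 (x - c) * exp_flat e 1 (d - x)"

lemma bump_outside: "x \<notin> {c<..<d} \<Longrightarrow> bump e c d x = 0"
  by (auto simp: bump_def exp_flat_def)

lemma test_line_bump:
  assumes "e > 0" "0 < c" "c < d" "d < L"
  shows "test_line L (bump e c d)"
proof -
  have "Ck_line k (\<lambda>x. exp_flat e 1 (1 * x + (- c)) * exp_flat e 1 ((-1) * x + d))" for k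
    by (intro Ck_line_mult Ck_line_affine Ck_line_exp_flat assms)
  then have "smooth_line (bump e c d)"
    unfolding smooth_line_def bump_def by (simp add: algebra_simps)
  moreover have "bump e c d x = 0" if "x \<notin> {c..d}" for x
    using that by (intro bump_outside) auto
  ultimately show ?thesis using assms unfolding test_line_def by blast
qed

lemma bump_bounds: "e > 0 \<Longrightarrow> 0 \<le> bump e c d x" "e > 0 \<Longrightarrow> bump e c d x \<le> 1"
  by (auto simp: bump_def exp_flat_def mult_le_one)

lemma bump_pos: "c < x \<Longrightarrow> x < d \<Longrightarrow> 0 < bump e c d x"
  by (auto simp: bump_def exp_flat_def)

lemma bump_tendsto_indicator:
  "(\<lambda>n. bump (1 / Suc n) c d x) \<longlonglongrightarrow> indicator {c<..<d} x"
proof (cases "x \<in> {c<..<d}")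
  case True
  have "(\<lambda>n. exp (- (1 / real (Suc n) * inverse y))) \<longlonglongrightarrow> exp (- (0 * inverse y))" for y :: real
    by (intro tendsto_intros LIMSEQ_Suc[OF lim_1_over_n])
  from tendsto_mult[OF this[of "x - c"] this[of "d - x"]] True show ?thesis
    by (simp add: bump_def exp_flat_def divide_inverse)
next
  case False
  then show ?thesis by (auto simp: bump_outside)
qed

lemma smooth_line_deriv:
  assumes "smooth_line f"
  shows "smooth_line (deriv f)" "(f has_real_derivative deriv f x) (at x)"
proof -
  obtain f' where f': "\<And>x. (f has_real_derivative f' x) (at x)"
    using assms unfolding smooth_line_def by (metis Ck_line.simps(2))
  then have d: "deriv f = f'" by (auto intro!: ext DERIV_imp_deriv)
  show "(f has_real_derivative deriv f x) (at x)" using f' d by simp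
  have "Ck_line k f'" for k
  proof -
    have "Ck_line (Suc k) f" using assms by (auto simp: smooth_line_def simp del: Ck_line.simps)
    then obtain g where g: "\<And>x. (f has_real_derivative g x) (at x)" "Ck_line k g" by auto
    have "g = f'" using f' g(1) by (auto intro!: ext DERIV_unique)
    then show ?thesis using g by simp
  qed
  then show "smooth_line (deriv f)" using d by (simp add: smooth_line_def)
qed

lemma smooth_line_continuous: "smooth_line f \<Longrightarrow> continuous_on A f"
  unfolding smooth_line_def using Ck_line_continuous continuous_on_subset by blast

lemma test_line_deriv:
  assumes "test_line L f"
  shows "test_line L (deriv f)"
proof -
  obtain c d where cd: "0 < c" "d < L" "\<And>x. x \<notin> {c..d} \<Longrightarrow> f x = 0"
    using assms by (auto simp: test_line_def)
  have "deriv f x = 0" if "x \<notin> {c..d}" for x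
  proof -
    have "((\<lambda>x. 0) has_real_derivative 0) (at x)" by simp
    moreover have "eventually (\<lambda>y. f y = 0) (nhds x)"
      using that cd(3) by (intro eventually_nhds[THEN iffD2] exI[of _ "- {c..d}"]) auto
    ultimately have "(f has_real_derivative 0) (at x)"
      by (subst DERIV_cong_ev[of x x f "\<lambda>x. 0" 0 0]) auto
    then show ?thesis by (rule DERIV_imp_deriv)
  qed
  then show ?thesis using assms cd smooth_line_deriv unfolding test_line_def by blast
qed

lemma test_line_continuous: "test_line L f \<Longrightarrow> continuous_on A f"
  by (auto simp: test_line_def smooth_line_continuous)

lemma test_line_has_deriv: "test_line L f \<Longrightarrow> (f has_real_derivative deriv f x) (at x)"
  by (auto simp: test_line_def smooth_line_deriv)

lemma test_line_zero: "test_line L f \<Longrightarrow> x \<le> 0 \<or> x \<ge> L \<Longrightarrow> f x = 0"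
  by (force simp: test_line_def)

lemma test_line_bounded: "test_line L f \<Longrightarrow> \<exists>B. \<forall>x. \<bar>f x\<bar> \<le> B"
proof -
  assume f: "test_line L f"
  have "bounded (f ` {0..L})"
    by (intro compact_imp_bounded compact_continuous_image test_line_continuous[OF f]) auto
  then obtain B where "\<And>x. x \<in> {0..L} \<Longrightarrow> \<bar>f x\<bar> \<le> B" by (force simp: bounded_iff)
  then have "\<bar>f x\<bar> \<le> max B 0" for x
    using test_line_zero[OF f, of x] by (cases "x \<in> {0..L}") force+
  then show ?thesis by blast
qed

lemma test_line_borel: "test_line L f \<Longrightarrow> f \<in> borel_measurable borel"
  by (intro borel_measurable_continuous_onI test_line_continuous)

text \<open>The zero mean makes the primitive vanish to the right of the support of
  \<open>b\<close>. Hence every test function of zero mean can be used where a weak derivative asks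
  for the derivative of a test function.\<close>

lemma test_line_antideriv:
  assumes L: "0 < L" and b: "test_line L b" and z: "integral {0..L} b = 0"
  obtains B where "test_line L B" "deriv B = b"
proof -
  obtain c d where cd: "0 < c" "d < L" "\<And>x. x \<notin> {c..d} \<Longrightarrow> b x = 0"
    using b by (auto simp: test_line_def)
  define B where "B = (\<lambda>x. integral {0..x} b)"
  have int: "b integrable_on {u..v}" for u v
    using b by (intro integrable_continuous_real test_line_continuous)
  have small: "B x = 0" if "x < c" for x
    unfolding B_def by (rule integral_unique, rule has_integral_is_0) (use that cd(3) in auto)
  have large: "B x = 0" if "x > d" for x
  proof (cases "x \<ge> c")
    case xc: True
    show ?thesis
    proof (cases "x \<le> L")
      case True
      have "integral {0..x} b + integral {x..L} b = integral {0..L} b"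
        using True xc cd int by (intro Henstock_Kurzweil_Integration.integral_combine) auto
      moreover have "integral {x..L} b = 0"
        by (rule integral_unique, rule has_integral_is_0) (use that cd(3) in auto)
      ultimately show ?thesis using z by (simp add: B_def)
    next
      case False
      have "integral {0..L} b + integral {L..x} b = integral {0..x} b"
        using False L int by (intro Henstock_Kurzweil_Integration.integral_combine) auto
      moreover have "integral {L..x} b = 0"
        by (rule integral_unique, rule has_integral_is_0) (use that cd(2,3) in auto)
      ultimately show ?thesis using z by (simp add: B_def)
    qed
  qed (use small in auto)
  have der: "(B has_real_derivative b x) (at x)" for x
  proof (cases "x < c")
    case True
    have "((\<lambda>x. 0) has_real_derivative 0) (at x)" by simp
    moreover have "eventually (\<lambda>y. B y = 0) (nhds x)"
      using True small by (intro eventually_nhds[THEN iffD2] exI[of _ "{..<c}"]) auto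
    ultimately show ?thesis using cd(3)[of x] True
      by (subst DERIV_cong_ev[of x x B "\<lambda>x. 0" "b x" 0]) auto
  next
    case False
    then have "(B has_real_derivative b x) (at x within {0..x+1})"
      unfolding B_def using b cd by (intro integral_has_real_derivative test_line_continuous) auto
    moreover have "at x within {0..x+1} = at x"
      using False cd by (intro at_within_interior) auto
    ultimately show ?thesis by simp
  qed
  have "Ck_line k B" for k
  proof -
    have "Ck_line (Suc k) B" using der b by (auto simp: test_line_def smooth_line_def)
    then show ?thesis by (rule Ck_line_Suc_D)
  qed
  then have "smooth_line B" by (simp add: smooth_line_def)
  moreover have "\<forall>x. x \<notin> {c..d} \<longrightarrow> B x = 0" using small large by auto
  ultimately have "test_line L B"
    using cd(1,2) unfolding test_line_def by blast
  moreover have "deriv B = b" using der by (auto intro!: ext DERIV_imp_deriv)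
  ultimately show ?thesis using that by blast
qed

section \<open>Tensor products of test functions in the plane\<close>

lemma pd_product:
  assumes "smooth_line a" "smooth_line b"
  shows "pd_t (\<lambda>z. a (fst z) * b (snd z)) = (\<lambda>z. deriv a (fst z) * b (snd z))"
    "pd_x (\<lambda>z. a (fst z) * b (snd z)) = (\<lambda>z. a (fst z) * deriv b (snd z))"
proof -
  have "((\<lambda>\<tau>. a \<tau> * c) has_real_derivative deriv a t * c) (at t)"
    "((\<lambda>\<xi>. c * b \<xi>) has_real_derivative c * deriv b t) (at t)" for c t
    using smooth_line_deriv(2)[OF assms(1)] smooth_line_deriv(2)[OF assms(2)]
    by (auto intro: DERIV_cmult DERIV_cmult_right)
  then show "pd_t (\<lambda>z. a (fst z) * b (snd z)) = (\<lambda>z. deriv a (fst z) * b (snd z))"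
    "pd_x (\<lambda>z. a (fst z) * b (snd z)) = (\<lambda>z. a (fst z) * deriv b (snd z))"
    by (auto simp: pd_t_def pd_x_def fun_eq_iff intro!: DERIV_imp_deriv)
qed

lemma smooth_line_derivs: "smooth_line a \<Longrightarrow> smooth_line ((deriv ^^ i) a)"
  by (induction i) (auto simp: smooth_line_deriv)

lemma pds_product:
  assumes "smooth_line a" "smooth_line b"
  shows "(pd_t ^^ i) ((pd_x ^^ j) (\<lambda>z. a (fst z) * b (snd z))) =
    (\<lambda>z. (deriv ^^ i) a (fst z) * (deriv ^^ j) b (snd z))"
proof (induction i)
  case 0
  show ?case
    by (induction j) (auto simp: pd_product smooth_line_derivs assms)
next
  case (Suc i)
  then show ?case by (auto simp: pd_product smooth_line_derivs assms)
qed

lemma continuous_on_product_smooth: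
  assumes "smooth_line a" "smooth_line b"
  shows "continuous_on A (\<lambda>z. a (fst z) * b (snd z))"
proof -
  have "continuous_on A (\<lambda>z. fst z)" "continuous_on A (\<lambda>z. snd z)"
    by (intro continuous_intros)+
  then show ?thesis
    using continuous_on_compose2[OF smooth_line_continuous[OF assms(1), of UNIV], of A fst]
      continuous_on_compose2[OF smooth_line_continuous[OF assms(2), of UNIV], of A snd]
    by (intro continuous_on_mult) auto
qed

lemma Ck_plane_product:
  assumes "smooth_line a" "smooth_line b"
  shows "Ck_plane k (\<lambda>z. a (fst z) * b (snd z))"
  using assms
proof (induction k arbitrary: a b)
  case 0
  then show ?case by (simp add: continuous_on_product_smooth)
next
  case (Suc k)
  have "Ck_plane 0 (\<lambda>z. a (fst z) * b (snd z))"
    using Suc.prems by (simp add: continuous_on_product_smooth)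
  moreover have "a differentiable at t" "b differentiable at t" for t
    using Suc.prems smooth_line_deriv(2) unfolding real_differentiable_def by metis+
  ultimately show ?case using Suc
    by (auto simp: pd_product smooth_line_deriv)
qed

lemma test_function_product:
  assumes "test_line T a" "test_line L b"
  shows "test_function ({0<..<T} \<times> {0<..<L}) (\<lambda>z. a (fst z) * b (snd z))"
proof -
  obtain c d where cd: "0 < c" "d < T" "\<And>x. x \<notin> {c..d} \<Longrightarrow> a x = 0"
    using assms by (auto simp: test_line_def)
  obtain c' d' where cd': "0 < c'" "d' < L" "\<And>x. x \<notin> {c'..d'} \<Longrightarrow> b x = 0"
    using assms by (auto simp: test_line_def)
  have "compact ({c..d} \<times> {c'..d'})" by (intro compact_Times) auto
  moreover have "{c..d} \<times> {c'..d'} \<subseteq> {0<..<T} \<times> {0<..<L}" using cd cd' by auto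
  moreover have "a (fst z) * b (snd z) = 0" if "z \<notin> {c..d} \<times> {c'..d'}" for z
    using that cd(3)[of "fst z"] cd'(3)[of "snd z"] by (cases z) auto
  ultimately show ?thesis
    using assms Ck_plane_product unfolding test_function_def smooth_plane_def test_line_def by blast
qed

section \<open>The fundamental lemma of the calculus of variations\<close>

text \<open>The positive and negative parts of \<open>h\<close> are densities of two finite measures
  that agree on boxes, an intersection-stable generator of the Borel sets; so the measures agree,
  and then their densities do almost everywhere.\<close>

lemma AE_zero_if_box_integrals_zero:
  fixes h :: "'a::euclidean_space \<Rightarrow> real"
  assumes int: "integrable lborel h"
    and z: "\<And>a b. (LINT z:box a b|lborel. h z) = 0"
  shows "AE z in lborel. h z = 0"
proof -
  have [measurable]: "h \<in> borel_measurable borel" using int by auto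
  let ?p = "\<lambda>z. ennreal (max 0 (h z))" and ?m = "\<lambda>z. ennreal (max 0 (- h z))"
  have ip: "integrable lborel (\<lambda>z. max 0 (h z))" "integrable lborel (\<lambda>z. max 0 (- h z))"
    using int by auto
  have sip: "set_integrable lborel A (\<lambda>z. max 0 (h z))" "set_integrable lborel A (\<lambda>z. max 0 (- h z))"
    if "A \<in> sets borel" for A
    unfolding set_integrable_def using that by (auto intro: integrable_mult_indicator simp del: real_scaleR_def simp: ip)
  have em: "emeasure (density lborel ?p) (box a b) = emeasure (density lborel ?m) (box a b)" for a b
  proof -
    have "(LINT z:box a b|lborel. max 0 (h z)) - (LINT z:box a b|lborel. max 0 (- h z))
      = (LINT z:box a b|lborel. max 0 (h z) - max 0 (- h z))"
      by (rule set_integral_diff(2)[symmetric]) (auto intro: sip)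
    also have "(\<lambda>z. max 0 (h z) - max 0 (- h z)) = h" by auto
    finally have eq: "(LINT z:box a b|lborel. max 0 (h z)) = (LINT z:box a b|lborel. max 0 (- h z))"
      using z by simp
    have *: "emeasure (density lborel (\<lambda>z. ennreal (g z))) (box a b) = ennreal (LINT z:box a b|lborel. g z)"
      if g: "integrable lborel g" "\<And>z. 0 \<le> g z" for g :: "'a \<Rightarrow> real"
    proof -
      have [measurable]: "g \<in> borel_measurable borel" using g by auto
      have "emeasure (density lborel (\<lambda>z. ennreal (g z))) (box a b) = (\<integral>\<^sup>+z. ennreal (g z) * indicator (box a b) z \<partial>lborel)"
        by (subst emeasure_density) auto
      also have "\<dots> = (\<integral>\<^sup>+z. ennreal (indicator (box a b) z *\<^sub>R g z) \<partial>lborel)"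
        by (intro nn_integral_cong) (auto simp: indicator_def)
      also have "\<dots> = ennreal (LINT z:box a b|lborel. g z)"
        unfolding set_lebesgue_integral_def
        by (intro nn_integral_eq_integral) (use g in \<open>auto intro: integrable_mult_indicator scaleR_nonneg_nonneg simp del: real_scaleR_def\<close>)
      finally show ?thesis .
    qed
    show ?thesis using *[OF ip(1)] *[OF ip(2)] eq by simp
  qed
  have fin: "emeasure (density lborel ?p) UNIV \<noteq> \<infinity>"
  proof -
    have "emeasure (density lborel ?p) UNIV = (\<integral>\<^sup>+z. ?p z \<partial>lborel)"
      by (subst emeasure_density) auto
    also have "\<dots> = ennreal (integral\<^sup>L lborel (\<lambda>z. max 0 (h z)))"
      by (intro nn_integral_eq_integral ip) auto
    finally show ?thesis by simp
  qed
  have "density lborel ?p = density lborel ?m"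
  proof (rule measure_eqI_generator_eq)
    let ?E = "range (\<lambda>(a, b). box a b :: 'a set)"
    show "Int_stable ?E" by (auto simp: Int_stable_def box_Int_box)
    show "?E \<subseteq> Pow UNIV" "sets (density lborel ?p) = sigma_sets UNIV ?E" "sets (density lborel ?m) = sigma_sets UNIV ?E"
      by (simp_all add: borel_eq_box)
    let ?A = "\<lambda>n::nat. box (- (real n *\<^sub>R One)) (real n *\<^sub>R One) :: 'a set"
    show "range ?A \<subseteq> ?E" "(\<Union>i. ?A i) = UNIV" unfolding UN_box_eq_UNIV by auto
    show "emeasure (density lborel ?p) (?A i) \<noteq> \<infinity>" for i
      using fin emeasure_mono[of "?A i" UNIV "density lborel ?p"] by (auto simp: top_unique)
    show "X \<in> ?E \<Longrightarrow> emeasure (density lborel ?p) X = emeasure (density lborel ?m) X" for X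
      using em by auto
  qed
  then have "AE z in lborel. ?p z = ?m z"
    by (rule sigma_finite_measure.density_unique[OF sigma_finite_lborel, rotated 2]) auto
  then show ?thesis
    by eventually_elim (auto simp: max_def split: if_splits)
qed

lemma borel_measurable_fst_snd [measurable]:
  "(fst :: real \<times> real \<Rightarrow> real) \<in> borel_measurable borel"
  "(snd :: real \<times> real \<Rightarrow> real) \<in> borel_measurable borel"
  using continuous_on_fst[OF continuous_on_id] continuous_on_snd[OF continuous_on_id]
  by (auto intro!: borel_measurable_continuous_onI)

text \<open>Tensor products of bumps of increasing steepness converge to indicators of rectangles,
  so \<open>h\<close> has zero integral over every rectangle compactly inside the domain.\<close>

lemma variational_zero:
  fixes h :: "real \<times> real \<Rightarrow> real"
  assumes h[measurable]: "h \<in> borel_measurable borel"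
    and int: "\<And>c d c' d'. 0 < c \<Longrightarrow> d < T \<Longrightarrow> 0 < c' \<Longrightarrow> d' < L \<Longrightarrow>
      set_integrable lborel ({c..d} \<times> {c'..d'}) h"
    and z: "\<And>a b. test_line T a \<Longrightarrow> test_line L b \<Longrightarrow>
      (LINT z:{0<..<T} \<times> {0<..<L}|lborel. h z * (a (fst z) * b (snd z))) = 0"
  shows "AE z in lborel. z \<in> {0<..<T} \<times> {0<..<L} \<longrightarrow> h z = 0"
proof -
  have rect: "(LINT z:{c<..<d} \<times> {c'<..<d'}|lborel. h z) = 0"
    if cd: "0 < c" "c < d" "d < T" "0 < c'" "c' < d'" "d' < L" for c d c' d'
  proof -
    define a where "a n = bump (1 / Suc n) c d" for n
    define b where "b n = bump (1 / Suc n) c' d'" for n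
    have ab: "test_line T (a n)" "test_line L (b n)" for n
      using cd by (auto simp: a_def b_def intro!: test_line_bump)
    have [measurable]: "a n \<in> borel_measurable borel" "b n \<in> borel_measurable borel" for n
      using ab by (auto intro: test_line_borel)
    let ?Q = "{0<..<T} \<times> {0<..<L}" and ?R = "{c<..<d} \<times> {c'<..<d'}" and ?K = "{c..d} \<times> {c'..d'}"
    have [measurable]: "?Q \<in> sets borel" "?R \<in> sets borel" "?K \<in> sets borel"
      by (intro borel_open open_Times open_greaterThanLessThan borel_closed closed_Times closed_atLeastAtMost)+
    \<comment> \<open>The bumps are bounded by 1 and vanish outside the closed rectangle
      \<open>?K\<close>, where \<open>h\<close> is integrable and serves as majorant.\<close>
    have "(\<lambda>n. LINT z|lborel. indicator ?Q z *\<^sub>R (h z * (a n (fst z) * b n (snd z))))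
        \<longlonglongrightarrow> (LINT z|lborel. indicator ?R z *\<^sub>R h z)"
    proof (rule integral_dominated_convergence)
      show "integrable lborel (\<lambda>z. norm (indicator ?K z *\<^sub>R h z))"
        using int[of c d c' d'] cd by (intro integrable_norm) (auto simp: set_integrable_def)
      show "AE z in lborel. (\<lambda>n. indicator ?Q z *\<^sub>R (h z * (a n (fst z) * b n (snd z)))) \<longlonglongrightarrow> indicator ?R z *\<^sub>R h z"
      proof (rule AE_I2)
        fix z :: "real \<times> real"
        have "(\<lambda>n. h z * (a n (fst z) * b n (snd z))) \<longlonglongrightarrow> h z * (indicator {c<..<d} (fst z) * indicator {c'<..<d'} (snd z))"
          unfolding a_def b_def by (intro tendsto_intros bump_tendsto_indicator)
        also have "h z * (indicator {c<..<d} (fst z) * indicator {c'<..<d'} (snd z)) = indicator ?R z *\<^sub>R h z"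
          by (cases z) (auto simp: indicator_def)
        finally show "(\<lambda>n. indicator ?Q z *\<^sub>R (h z * (a n (fst z) * b n (snd z)))) \<longlonglongrightarrow> indicator ?R z *\<^sub>R h z"
          using cd by (cases "z \<in> ?Q") (auto simp: indicator_def)
      qed
      show "AE z in lborel. norm (indicator ?Q z *\<^sub>R (h z * (a n (fst z) * b n (snd z)))) \<le> norm (indicator ?K z *\<^sub>R h z)" for n
      proof (rule AE_I2)
        fix z :: "real \<times> real"
        have 1: "\<bar>a n (fst z) * b n (snd z)\<bar> \<le> 1"
          unfolding a_def b_def abs_mult by (intro mult_le_one) (auto simp: bump_bounds)
        show "norm (indicator ?Q z *\<^sub>R (h z * (a n (fst z) * b n (snd z)))) \<le> norm (indicator ?K z *\<^sub>R h z)"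
        proof (cases "z \<in> ?K")
          case True
          then show ?thesis using mult_left_le[OF 1, of "\<bar>h z\<bar>"]
            by (auto simp: indicator_def abs_mult)
        next
          case False
          then have "a n (fst z) = 0 \<or> b n (snd z) = 0"
            unfolding a_def b_def by (cases z) (auto intro!: bump_outside)
          then show ?thesis by auto
        qed
      qed
    qed auto
    moreover have "(LINT z|lborel. indicator ?Q z *\<^sub>R (h z * (a n (fst z) * b n (snd z)))) = 0" for n
      using z[OF ab] by (simp add: set_lebesgue_integral_def)
    ultimately have "(\<lambda>n. 0) \<longlonglongrightarrow> (LINT z|lborel. indicator ?R z *\<^sub>R h z)" by simp
    then show ?thesis
      unfolding set_lebesgue_integral_def using LIMSEQ_unique[OF tendsto_const] by metis
  qed
  \<comment> \<open>As \<open>h\<close> is only locally integrable, the rectangle is exhausted by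
    smaller ones at distance 1 / (n + 1) from its boundary.\<close>
  have "AE z in lborel. z \<in> {1 / Suc n<..<T - 1 / Suc n} \<times> {1 / Suc n<..<L - 1 / Suc n} \<longrightarrow> h z = 0" for n
  proof -
    let ?e = "1 / Suc n"
    let ?K = "{?e<..<T - ?e} \<times> {?e<..<L - ?e}"
    have [measurable]: "?K \<in> sets borel" by (intro borel_open open_Times open_greaterThanLessThan)
    have "AE z in lborel. indicator ?K z * h z = 0"
    proof (rule AE_zero_if_box_integrals_zero)
      have "set_integrable lborel ?K h"
        by (rule set_integrable_subset[OF int[of ?e "T - ?e" ?e "L - ?e"]])
          (use \<open>?K \<in> sets borel\<close> in \<open>auto simp del: of_nat_Suc\<close>)
      then show "integrable lborel (\<lambda>z. indicator ?K z * h z)"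
        by (simp add: set_integrable_def)
      fix p q :: "real \<times> real"
      obtain p1 p2 q1 q2 where pq: "p = (p1, p2)" "q = (q1, q2)" by (cases p, cases q)
      have "box p q \<inter> ?K = {max p1 ?e<..<min q1 (T - ?e)} \<times> {max p2 ?e<..<min q2 (L - ?e)}"
        by (auto simp: pq mem_box Basis_prod_def)
      moreover have "(LINT z:box p q|lborel. indicator ?K z * h z) = (LINT z:box p q \<inter> ?K|lborel. h z)"
        by (simp add: set_lebesgue_integral_def indicator_inter_arith mult.assoc)
      ultimately have "(LINT z:box p q|lborel. indicator ?K z * h z)
        = (LINT z:{max p1 ?e<..<min q1 (T - ?e)} \<times> {max p2 ?e<..<min q2 (L - ?e)}|lborel. h z)"
        by (simp only:)
      also have "\<dots> = 0"
      proof (cases "max p1 ?e < min q1 (T - ?e) \<and> max p2 ?e < min q2 (L - ?e)")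
        case True
        have "0 < ?e" by simp
        then show ?thesis using True by (intro rect) linarith+
      next
        case False
        then have "{max p1 ?e<..<min q1 (T - ?e)} \<times> {max p2 ?e<..<min q2 (L - ?e)} = {}"
          by (metis Times_empty greaterThanLessThan_empty_iff linorder_not_le)
        then show ?thesis by (simp only: set_lebesgue_integral_def) simp
      qed
      finally show "(LINT z:box p q|lborel. indicator ?K z * h z) = 0" .
    qed
    then show ?thesis by eventually_elim (auto simp: indicator_def)
  qed
  then have "AE z in lborel. \<forall>n. z \<in> {1 / Suc n<..<T - 1 / Suc n} \<times> {1 / Suc n<..<L - 1 / Suc n} \<longrightarrow> h z = 0"
    by (subst AE_all_countable) auto
  then show ?thesis
  proof eventually_elim
    case (elim z)
    show ?case
    proof
      assume zQ: "z \<in> {0<..<T} \<times> {0<..<L}"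
      obtain t x where tx: "z = (t, x)" by (cases z)
      let ?m = "min (min t (T - t)) (min x (L - x))"
      have "0 < ?m" using zQ tx by auto
      then obtain n where "inverse (real (Suc n)) < ?m" using reals_Archimedean by blast
      then have "1 / Suc n < ?m" by (simp only: inverse_eq_divide)
      then show "h z = 0" using elim[rule_format, of n] tx by auto
    qed
  qed
qed

section \<open>Absolutely continuous functions\<close>

text \<open>Absolute continuity is encoded by the fundamental theorem of calculus, with the
  derivative carried along as an integrable function that matters only up to null sets. This fits
  weak derivatives, which come without pointwise meaning.\<close>

definition ac :: "real \<Rightarrow> (real \<Rightarrow> real) \<Rightarrow> (real \<Rightarrow> real) \<Rightarrow> bool" where
  "ac L f g \<longleftrightarrow> set_integrable lborel {0..L} g \<and>
     (\<forall>x\<in>{0..L}. (LINT y:{0..x}|lborel. g y) = f x - f 0)"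

lemma ac_integral: "ac L f g \<Longrightarrow> x \<in> {0..L} \<Longrightarrow> (LINT y:{0..x}|lborel. g y) = f x - f 0"
  by (simp add: ac_def)

lemma ac_integrable: "ac L f g \<Longrightarrow> set_integrable lborel {0..L} g"
  by (simp add: ac_def)

lemma ac_ftc: "ac L f g \<Longrightarrow> 0 \<le> L \<Longrightarrow> (LINT y:{0..L}|lborel. g y) = f L - f 0"
  by (auto simp: ac_def)

lemma ac_continuous:
  assumes "ac L f g"
  shows "continuous_on {0..L} f"
proof -
  have g: "set_integrable lborel {0..L} g" using assms by (simp add: ac_def)
  have "continuous_on {0..L} (\<lambda>x. f 0 + integral {0..x} g)"
    using set_borel_integral_eq_integral(1)[OF g]
    by (intro continuous_intros indefinite_integral_continuous_1)
  moreover have "f x = f 0 + integral {0..x} g" if "x \<in> {0..L}" for x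
  proof -
    have "set_integrable lborel {0..x} g" using g by (rule set_integrable_subset) (use that in auto)
    then show ?thesis using ac_integral[OF assms that] set_borel_integral_eq_integral(2) by fastforce
  qed
  ultimately show ?thesis using continuous_on_cong by (metis (no_types, lifting))
qed

lemma ac_cong: "(\<And>x. x \<in> {0..L} \<Longrightarrow> f x = f' x) \<Longrightarrow> ac L f g \<Longrightarrow> ac L f' g"
  by (auto simp: ac_def)

text \<open>Measurability of \<open>g'\<close> has to be assumed: \<open>lborel\<close> is not
  complete, so it does not follow from almost everywhere equality.\<close>

lemma ac_cong_AE:
  assumes "ac L f g" and [measurable]: "g' \<in> borel_measurable borel"
    and ae: "AE x in lborel. x \<in> {0..L} \<longrightarrow> g x = g' x"
  shows "ac L f g'"
proof -
  have m: "set_borel_measurable lborel {0..L} g"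
    using assms(1) by (auto simp: ac_def set_integrable_def set_borel_measurable_def)
  have gm: "(\<lambda>x. indicat_real A x *\<^sub>R g x) \<in> borel_measurable lborel" if "A \<subseteq> {0..L}" "A \<in> sets borel" for A
  proof -
    have "(\<lambda>x. indicat_real A x *\<^sub>R (indicator {0..L} x *\<^sub>R g x)) \<in> borel_measurable lborel"
      using m that(2) unfolding set_borel_measurable_def
      by (intro borel_measurable_scaleR[of "indicat_real A" lborel "\<lambda>x. indicator {0..L} x *\<^sub>R g x"]) simp_all
    also have "(\<lambda>x. indicat_real A x *\<^sub>R (indicator {0..L} x *\<^sub>R g x)) = (\<lambda>x. indicat_real A x *\<^sub>R g x)"
      using that by (auto simp: indicator_def fun_eq_iff)
    finally show ?thesis .
  qed
  have eq: "AE x in lborel. indicat_real A x *\<^sub>R g x = indicator A x *\<^sub>R g' x" if "A \<subseteq> {0..L}" for A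
    using ae by eventually_elim (use that in \<open>auto simp: indicator_def\<close>)
  have "set_integrable lborel {0..L} g'"
    using assms(1) integrable_cong_AE[OF gm[of "{0..L}"] _ eq[of "{0..L}"]] unfolding ac_def set_integrable_def by auto
  moreover have "(LINT y:{0..x}|lborel. g y) = (LINT y:{0..x}|lborel. g' y)" if "x \<in> {0..L}" for x
    unfolding set_lebesgue_integral_def
    by (rule integral_cong_AE) (use that gm[of "{0..x}"] eq[of "{0..x}"] in auto)
  ultimately show ?thesis using assms(1) by (auto simp: ac_def)
qed

lemma ac_add:
  assumes "ac L f g" "ac L h k"
  shows "ac L (\<lambda>x. f x + h x) (\<lambda>x. g x + k x)"
proof -
  have i: "set_integrable lborel {0..L} g" "set_integrable lborel {0..L} k" using assms by (auto simp: ac_def)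
  have "(LINT y:{0..x}|lborel. g y + k y) = (LINT y:{0..x}|lborel. g y) + (LINT y:{0..x}|lborel. k y)"
    if "x \<in> {0..L}" for x
    by (rule set_integral_add(2)) (use that i in \<open>auto elim!: set_integrable_subset\<close>)
  then show ?thesis using assms i by (auto simp: ac_def)
qed

lemma ac_cmult: "ac L f g \<Longrightarrow> ac L (\<lambda>x. c * f x) (\<lambda>x. c * g x)"
  by (auto simp: ac_def right_diff_distrib)

lemma ac_const: "ac L (\<lambda>x. c) (\<lambda>x. 0)"
  by (auto simp: ac_def set_integrable_def set_lebesgue_integral_def)

lemma ac_minus: "ac L f g \<Longrightarrow> ac L (\<lambda>x. - f x) (\<lambda>x. - g x)"
  using ac_cmult[of L f g "-1"] by simp

lemma ac_diff: "ac L f g \<Longrightarrow> ac L h k \<Longrightarrow> ac L (\<lambda>x. f x - h x) (\<lambda>x. g x - k x)"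
  using ac_add[OF _ ac_minus] by fastforce

lemma ac_C1:
  assumes "\<And>x. x \<in> {0..L} \<Longrightarrow> (f has_real_derivative g x) (at x within {0..L})"
    and "continuous_on {0..L} g"
  shows "ac L f g"
proof -
  have g: "set_integrable lborel {0..L} g"
    using borel_integrable_atLeastAtMost'[OF assms(2)] .
  moreover have "(LINT y:{0..x}|lborel. g y) = f x - f 0" if "x \<in> {0..L}" for x
  proof -
    have "(g has_integral f x - f 0) {0..x}"
      by (rule fundamental_theorem_of_calculus)
        (use that in \<open>auto simp: has_real_derivative_iff_has_vector_derivative[symmetric]
           intro!: DERIV_subset[OF assms(1)]\<close>)
    moreover have "set_integrable lborel {0..x} g"
      using g by (rule set_integrable_subset) (use that in auto)
    ultimately show ?thesis
      using set_borel_integral_eq_integral(2) by (metis integral_unique)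
  qed
  ultimately show ?thesis by (simp add: ac_def)
qed

lemma set_integrable_mult_continuous:
  fixes f :: "real \<Rightarrow> real"
  assumes "continuous_on {0..L} f" "set_integrable lborel {0..L} g"
  shows "set_integrable lborel {0..L} (\<lambda>x. f x * g x)"
proof -
  obtain B where B: "\<And>x. x \<in> {0..L} \<Longrightarrow> \<bar>f x\<bar> \<le> B"
    using compact_imp_bounded[OF compact_continuous_image[OF assms(1)]]
    by (force simp: bounded_iff)
  have fm: "(\<lambda>x. indicator {0..L} x *\<^sub>R f x) \<in> borel_measurable borel"
    using borel_measurable_continuous_on_indicator[OF _ assms(1)] by auto
  have "(\<lambda>x. (indicator {0..L} x *\<^sub>R f x) * (indicator {0..L} x *\<^sub>R g x)) \<in> borel_measurable lborel"
    using fm assms(2) by (intro borel_measurable_times) (auto simp: set_integrable_def)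
  also have "(\<lambda>x. (indicator {0..L} x *\<^sub>R f x) * (indicator {0..L} x *\<^sub>R g x)) = (\<lambda>x. indicator {0..L} x *\<^sub>R (f x * g x))"
    by (auto simp: indicator_def fun_eq_iff)
  finally have m: "(\<lambda>x. indicator {0..L} x *\<^sub>R (f x * g x)) \<in> borel_measurable lborel" .
  have "integrable lborel (\<lambda>x. B * (indicator {0..L} x *\<^sub>R g x))"
    using assms(2) by (auto simp: set_integrable_def)
  then show ?thesis unfolding set_integrable_def
    by (rule Bochner_Integration.integrable_bound[OF _ m])
      (use B in \<open>auto simp: indicator_def abs_mult intro!: mult_mono order_trans[OF B] abs_ge_self\<close>)
qed

text \<open>Fubini's theorem: the product of the two increments is the double integral of g(y) k(z)
  over a square. Below the diagonal the inner integral gives an increment of \<open>h\<close>, above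
  it one of \<open>f\<close>.\<close>

lemma ac_mult:
  assumes "ac L f g" "ac L h k"
  shows "ac L (\<lambda>x. f x * h x) (\<lambda>x. g x * h x + f x * k x)"
proof -
  have i: "set_integrable lborel {0..L} g" "set_integrable lborel {0..L} k" using assms by (auto simp: ac_def)
  have c: "continuous_on {0..L} f" "continuous_on {0..L} h" using assms ac_continuous by auto
  have ii: "set_integrable lborel {0..L} (\<lambda>x. h x * g x)" "set_integrable lborel {0..L} (\<lambda>x. f x * k x)"
    by (intro set_integrable_mult_continuous c i)+
  have "(LINT y:{0..x}|lborel. g y * h y + f y * k y) = f x * h x - f 0 * h 0" if x: "x \<in> {0..L}" for x
  proof -
    have sx: "set_integrable lborel {0..x} u" if "set_integrable lborel {0..L} u" for u :: "real \<Rightarrow> real"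
      using that by (rule set_integrable_subset) (use x in auto)
    define G where "G y = indicator {0..x} y * g y" for y
    define K where "K y = indicator {0..x} y * k y" for y
    have iG: "integrable lborel G" "integrable lborel K"
      using sx[OF i(1)] sx[OF i(2)] by (auto simp: G_def[abs_def] K_def[abs_def] set_integrable_def)
    have [measurable]: "G \<in> borel_measurable borel" "K \<in> borel_measurable borel" using iG by auto
    have iGK: "integrable (lborel \<Otimes>\<^sub>M lborel) (\<lambda>z. G (fst z) * K (snd z))"
      by (rule lborel_pair.Fubini_integrable) (use iG in \<open>auto simp: abs_mult\<close>)
    have i1: "integrable (lborel \<Otimes>\<^sub>M lborel) (\<lambda>z. indicator {z. snd z \<le> fst z} z * (G (fst z) * K (snd z)))"
      and i2: "integrable (lborel \<Otimes>\<^sub>M lborel) (\<lambda>z. indicator {z. \<not> snd z \<le> fst z} z * (G (fst z) * K (snd z)))"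
      by (rule Bochner_Integration.integrable_bound[OF iGK]; auto simp: indicator_def)+
    \<comment> \<open>The diagonal belongs to one triangle only, so one inner integral runs over a
      half-open interval; a single point does not change it.\<close>
    have fG: "(LINT y|lborel. G y * indicator {y. y < z} y) = f z - f 0"
      and hK: "(LINT y|lborel. K y * indicator {y. y \<le> z} y) = h z - h 0" if z: "z \<in> {0..x}" for z
    proof -
      have "(LINT y|lborel. G y * indicator {y. y < z} y) = (LINT y:{0..z}|lborel. g y)"
      proof -
        have "set_integrable lborel {0..z} g"
          using sx[OF i(1)] by (rule set_integrable_subset) (use z in auto)
        moreover have "AE y in lborel. G y * indicator {y. y < z} y = indicator {0..z} y *\<^sub>R g y"
          using AE_lborel_singleton[of z] by eventually_elim (use z in \<open>auto simp: indicator_def G_def\<close>)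
        ultimately show ?thesis
          unfolding set_lebesgue_integral_def set_integrable_def
          by (intro integral_cong_AE) (auto dest: borel_measurable_integrable simp del: real_scaleR_def)
      qed
      also have "\<dots> = f z - f 0" using assms(1) x z by (auto simp: ac_def)
      finally show "(LINT y|lborel. G y * indicator {y. y < z} y) = f z - f 0" .
      have "(LINT y|lborel. K y * indicator {y. y \<le> z} y) = (LINT y:{0..z}|lborel. k y)"
        unfolding set_lebesgue_integral_def K_def using z 
        by (intro Bochner_Integration.integral_cong) (auto simp: indicator_def)
      also have "\<dots> = h z - h 0" using assms(2) x z by (auto simp: ac_def)
      finally show "(LINT y|lborel. K y * indicator {y. y \<le> z} y) = h z - h 0" .
    qed
    have "(f x - f 0) * (h x - h 0) = (LINT y|lborel. G y) * (LINT y|lborel. K y)"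
      using assms x by (auto simp: ac_def G_def K_def set_lebesgue_integral_def)
    also have "\<dots> = (LINT y|lborel. (LINT z|lborel. G y * K z))" by simp
    also have "\<dots> = (LINT z|(lborel \<Otimes>\<^sub>M lborel). G (fst z) * K (snd z))"
      using lborel_pair.integral_fst'[OF iGK] by simp
    also have "\<dots> = (LINT z|(lborel \<Otimes>\<^sub>M lborel). indicator {z. snd z \<le> fst z} z * (G (fst z) * K (snd z))
        + indicator {z. \<not> snd z \<le> fst z} z * (G (fst z) * K (snd z)))"
      by (intro Bochner_Integration.integral_cong) (auto simp: indicator_def)
    also have "\<dots> = (LINT z|(lborel \<Otimes>\<^sub>M lborel). indicator {z. snd z \<le> fst z} z * (G (fst z) * K (snd z)))
        + (LINT z|(lborel \<Otimes>\<^sub>M lborel). indicator {z. \<not> snd z \<le> fst z} z * (G (fst z) * K (snd z)))"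
      by (intro Bochner_Integration.integral_add i1 i2)
    also have "(LINT z|(lborel \<Otimes>\<^sub>M lborel). indicator {z. snd z \<le> fst z} z * (G (fst z) * K (snd z)))
        = (LINT y|lborel. LINT z|lborel. indicator {z. snd z \<le> fst z} (y, z) * (G y * K z))"
      using lborel_pair.integral_fst'[OF i1] by simp
    also have "\<dots> = (LINT y|lborel. G y * (h y - h 0))"
    proof (intro Bochner_Integration.integral_cong refl)
      fix y
      have "(LINT z|lborel. indicator {z. snd z \<le> fst z} (y, z) * (G y * K z))
        = G y * (LINT z|lborel. K z * indicator {z. z \<le> y} z)"
        unfolding integral_mult_right_zero[symmetric]
        by (intro Bochner_Integration.integral_cong) (auto simp: indicator_def)
      also have "\<dots> = G y * (h y - h 0)" using hK by (cases "y \<in> {0..x}") (auto simp: G_def)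
      finally show "(LINT z|lborel. indicator {z. snd z \<le> fst z} (y, z) * (G y * K z)) = G y * (h y - h 0)" .
    qed
    also have "(LINT z|(lborel \<Otimes>\<^sub>M lborel). indicator {z. \<not> snd z \<le> fst z} z * (G (fst z) * K (snd z)))
        = (LINT z|lborel. LINT y|lborel. indicator {z. \<not> snd z \<le> fst z} (y, z) * (G y * K z))"
      using lborel_pair.integral_snd[of "\<lambda>y z. indicator {z. \<not> snd z \<le> fst z} (y, z) * (G y * K z)"] i2
      by (simp add: case_prod_unfold)
    also have "\<dots> = (LINT z|lborel. K z * (f z - f 0))"
    proof (intro Bochner_Integration.integral_cong refl)
      fix z
      have "(LINT y|lborel. indicator {z. \<not> snd z \<le> fst z} (y, z) * (G y * K z))
        = K z * (LINT y|lborel. G y * indicator {y. y < z} y)"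
        unfolding integral_mult_right_zero[symmetric]
        by (intro Bochner_Integration.integral_cong) (auto simp: indicator_def)
      also have "\<dots> = K z * (f z - f 0)" using fG by (cases "z \<in> {0..x}") (auto simp: K_def)
      finally show "(LINT y|lborel. indicator {z. \<not> snd z \<le> fst z} (y, z) * (G y * K z)) = K z * (f z - f 0)" .
    qed
    finally have e: "(f x - f 0) * (h x - h 0) = (LINT y|lborel. G y * (h y - h 0)) + (LINT z|lborel. K z * (f z - f 0))" .
    have gh: "(LINT y|lborel. G y * (h y - h 0)) = (LINT y:{0..x}|lborel. h y * g y) - h 0 * (LINT y:{0..x}|lborel. g y)"
      and kf: "(LINT y|lborel. K y * (f y - f 0)) = (LINT y:{0..x}|lborel. f y * k y) - f 0 * (LINT y:{0..x}|lborel. k y)"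
    proof -
      have *: "(LINT y|lborel. indicator {0..x} y * u y * (p y - c)) = (LINT y:{0..x}|lborel. p y * u y) - c * (LINT y:{0..x}|lborel. u y)"
        if "set_integrable lborel {0..L} u" "set_integrable lborel {0..L} (\<lambda>y. p y * u y)" for u p :: "real \<Rightarrow> real" and c
      proof -
        have "(LINT y:{0..x}|lborel. p y * u y) - c * (LINT y:{0..x}|lborel. u y)
            = (LINT y:{0..x}|lborel. p y * u y - c * u y)"
          using set_integral_diff(2)[OF sx[OF that(2)], of "\<lambda>y. c * u y"] sx[OF that(1)] by simp
        then show ?thesis
          by (simp add: set_lebesgue_integral_def algebra_simps)
      qed
      show "(LINT y|lborel. G y * (h y - h 0)) = (LINT y:{0..x}|lborel. h y * g y) - h 0 * (LINT y:{0..x}|lborel. g y)"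
        "(LINT y|lborel. K y * (f y - f 0)) = (LINT y:{0..x}|lborel. f y * k y) - f 0 * (LINT y:{0..x}|lborel. k y)"
        unfolding G_def K_def by (intro * i ii)+
    qed
    have "(LINT y:{0..x}|lborel. g y * h y + f y * k y) = (LINT y:{0..x}|lborel. h y * g y) + (LINT y:{0..x}|lborel. f y * k y)"
      using set_integral_add(2)[OF sx[OF ii(1)] sx[OF ii(2)]] by (simp add: mult.commute)
    moreover have "(LINT y:{0..x}|lborel. g y) = f x - f 0" "(LINT y:{0..x}|lborel. k y) = h x - h 0"
      using assms x by (auto simp: ac_def)
    ultimately have "(LINT y:{0..x}|lborel. g y * h y + f y * k y)
        = (f x - f 0) * (h x - h 0) + h 0 * (f x - f 0) + f 0 * (h x - h 0)"
      using e gh kf by simp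
    then show ?thesis by (simp add: algebra_simps)
  qed
  moreover have "set_integrable lborel {0..L} (\<lambda>x. g x * h x + f x * k x)"
    using set_integral_add(1)[OF ii] by (simp add: mult.commute)
  ultimately show ?thesis by (auto simp: ac_def)
qed

section \<open>Slices of functions with weak derivatives\<close>

lemma indicator_rectangle: "indicator (A \<times> B) (t, x) = (indicator A t * indicator B x :: real)"
  by (auto simp: indicator_def)

lemma borel_rectangle [measurable]: "{a..b} \<times> {c..d} \<in> sets (borel :: (real \<times> real) measure)"
  by (intro borel_closed closed_Times closed_atLeastAtMost)

lemma rectangle_fubini:
  fixes k :: "real \<times> real \<Rightarrow> real"
  assumes "set_integrable lborel ({0..T} \<times> {0..L}) k"
  shows "(LINT z:{0..T} \<times> {0..L}|lborel. k z) = (LINT t:{0..T}|lborel. LINT x:{0..L}|lborel. k (t, x))"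
    and "AE t in lborel. t \<in> {0..T} \<longrightarrow> set_integrable lborel {0..L} (\<lambda>x. k (t, x))"
    and "set_integrable lborel {0..T} (\<lambda>t. LINT x:{0..L}|lborel. k (t, x))"
proof -
  have i: "integrable (lborel \<Otimes>\<^sub>M lborel) (\<lambda>z. indicator ({0..T} \<times> {0..L}) z * k z)"
    using assms by (simp add: set_integrable_def lborel_prod)
  have s: "(LINT x|lborel. indicator ({0..T} \<times> {0..L}) (t, x) * k (t, x))
    = indicator {0..T} t * (LINT x:{0..L}|lborel. k (t, x))" for t
    by (simp add: indicator_rectangle set_lebesgue_integral_def mult.assoc)
  show "(LINT z:{0..T} \<times> {0..L}|lborel. k z) = (LINT t:{0..T}|lborel. LINT x:{0..L}|lborel. k (t, x))"
    using lborel_pair.integral_fst'[OF i] by (simp add: set_lebesgue_integral_def s lborel_prod)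
  show "set_integrable lborel {0..T} (\<lambda>t. LINT x:{0..L}|lborel. k (t, x))"
    using lborel_pair.integrable_fst'[OF i] by (simp add: set_integrable_def s)
  show "AE t in lborel. t \<in> {0..T} \<longrightarrow> set_integrable lborel {0..L} (\<lambda>x. k (t, x))"
    using lborel_pair.AE_integrable_fst'[OF i]
    by eventually_elim (auto simp: set_integrable_def indicator_rectangle)
qed

lemma rectangle_swap:
  fixes k :: "real \<times> real \<Rightarrow> real"
  assumes k: "set_integrable lborel ({0..T} \<times> {0..L}) k"
  shows "set_integrable lborel ({0..L} \<times> {0..T}) (\<lambda>z. k (snd z, fst z))"
    and "(LINT z:{0..L} \<times> {0..T}|lborel. k (snd z, fst z)) = (LINT z:{0..T} \<times> {0..L}|lborel. k z)"
proof -
  let ?f = "\<lambda>z. indicator ({0..T} \<times> {0..L}) z * k z"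
  have i: "integrable (lborel \<Otimes>\<^sub>M lborel) ?f"
    using assms by (simp add: set_integrable_def lborel_prod)
  have e: "(\<lambda>(x, y). ?f (y, x)) = (\<lambda>z. indicator ({0..L} \<times> {0..T}) z * k (snd z, fst z))"
    by (auto simp: fun_eq_iff indicator_def)
  show "set_integrable lborel ({0..L} \<times> {0..T}) (\<lambda>z. k (snd z, fst z))"
    using lborel_pair.integrable_product_swap[OF i] unfolding e by (simp add: set_integrable_def lborel_prod)
  have "?f \<in> borel_measurable (lborel \<Otimes>\<^sub>M lborel)" using i by auto
  from lborel_pair.integral_product_swap[OF this]
  show "(LINT z:{0..L} \<times> {0..T}|lborel. k (snd z, fst z)) = (LINT z:{0..T} \<times> {0..L}|lborel. k z)"
    unfolding e by (simp add: set_lebesgue_integral_def lborel_prod)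
qed

lemma AE_slices:
  assumes "AE z in lborel. P (z :: real \<times> real)"
  shows "AE t in lborel. AE x in lborel. P (t, x)"
  by (rule lborel_pair.AE_pair) (rule assms[folded lborel_prod])

lemma AE_swap:
  assumes "AE z in lborel. P (z :: real \<times> real)"
  shows "AE z in lborel. P (snd z, fst z)"
proof -
  obtain N where N: "{z \<in> space lborel. \<not> P z} \<subseteq> N" "N \<in> null_sets (lborel :: (real \<times> real) measure)"
    using assms by (auto simp: eventually_ae_filter)
  then have NN: "N \<in> sets (lborel \<Otimes>\<^sub>M lborel)" "emeasure (lborel \<Otimes>\<^sub>M lborel) N = 0"
    using N(2)[folded lborel_prod] by auto
  let ?M = "(\<lambda>(x, y). (y, x)) -` N \<inter> space (lborel \<Otimes>\<^sub>M lborel)"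
  have "emeasure (lborel \<Otimes>\<^sub>M lborel) N = emeasure (distr (lborel \<Otimes>\<^sub>M lborel) (lborel \<Otimes>\<^sub>M lborel) (\<lambda>(x, y). (y, x))) N"
    using lborel_pair.distr_pair_swap[where ?'a = real and ?'b = real] by metis
  also have "\<dots> = emeasure (lborel \<Otimes>\<^sub>M lborel) ?M"
    using NN(1) by (intro emeasure_distr) (auto intro: measurable_pair_swap')
  finally have "emeasure (lborel \<Otimes>\<^sub>M lborel) ?M = 0" using NN by simp
  moreover have "?M \<in> sets (lborel \<Otimes>\<^sub>M lborel)"
    using NN(1) by (rule measurable_sets[OF measurable_pair_swap'])
  ultimately have "?M \<in> null_sets (lborel \<Otimes>\<^sub>M lborel)"
    by (intro null_setsI)
  then have "?M \<in> null_sets (lborel :: (real \<times> real) measure)"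
    unfolding lborel_prod .
  moreover have "{z \<in> space lborel. \<not> P (snd z, fst z)} \<subseteq> ?M"
    using N(1) by (auto simp: space_pair_measure)
  ultimately show ?thesis by (rule AE_I')
qed

lemma AE_lift_fst:
  assumes "AE t in lborel. P (t :: real)"
  shows "AE z in lborel. P (fst (z :: real \<times> real))"
proof -
  obtain N where N: "{t \<in> space lborel. \<not> P t} \<subseteq> N" "N \<in> null_sets (lborel :: real measure)"
    using assms by (auto simp: eventually_ae_filter)
  have "emeasure (lborel \<Otimes>\<^sub>M lborel) (N \<times> (UNIV :: real set)) = emeasure lborel N * emeasure (lborel :: real measure) UNIV"
    using N(2) by (intro lborel.emeasure_pair_measure_Times) auto
  also have "\<dots> = 0" using N(2) by (auto simp: null_sets_def)
  finally have "emeasure (lborel \<Otimes>\<^sub>M lborel) (N \<times> (UNIV :: real set)) = 0" .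
  moreover have "N \<times> (UNIV :: real set) \<in> sets (lborel \<Otimes>\<^sub>M lborel)"
    using N(2) by (intro pair_measureI) auto
  ultimately have "N \<times> (UNIV :: real set) \<in> null_sets (lborel \<Otimes>\<^sub>M lborel)" by (intro null_setsI)
  then have "N \<times> (UNIV :: real set) \<in> null_sets lborel" unfolding lborel_prod .
  moreover have "{z \<in> space lborel. \<not> P (fst z)} \<subseteq> N \<times> (UNIV :: real set)" using N(1) by auto
  ultimately show ?thesis by (rule AE_I')
qed

lemma set_integrable_fst:
  fixes M :: "real \<Rightarrow> real" and L :: real
  assumes "set_integrable lborel {0..T} M"
  shows "set_integrable lborel ({0..T} \<times> {0..L}) (\<lambda>z. M (fst z))"
proof -
  have [measurable]: "(\<lambda>t. indicator {0..T} t * M t) \<in> borel_measurable borel"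
    and i: "integrable lborel (\<lambda>t. indicator {0..T} t * M t)"
    using assms by (auto simp: set_integrable_def)
  have "integrable lborel (\<lambda>t. \<bar>indicator {0..T} t * M t\<bar> * max 0 (L::real))"
    using i by (intro integrable_mult_left integrable_abs)
  moreover have "(LINT x|lborel. \<bar>indicator {0..T} t * M t * indicator {0..L} x\<bar>) = \<bar>indicator {0..T} t * M t\<bar> * max 0 L" for t
    by (simp add: abs_mult)
  moreover have "integrable lborel (indicat_real {0..L})"
    by (simp add: integrable_indicator_iff emeasure_lborel_Icc_eq)
  ultimately have "integrable (lborel \<Otimes>\<^sub>M lborel) (\<lambda>z. (indicator {0..T} (fst z) * M (fst z)) * indicator {0..L} (snd z))"
    by (intro lborel_pair.Fubini_integrable) (auto simp: abs_mult)
  also have "(\<lambda>z. (indicator {0..T} (fst z) * M (fst z)) * indicator {0..L} (snd z))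
    = (\<lambda>z. indicator ({0..T} \<times> {0..L}) z * M (fst z))"
    by (auto simp: indicator_def fun_eq_iff)
  finally show ?thesis by (simp add: set_integrable_def lborel_prod)
qed

lemma set_integrable_bounded_mult:
  fixes f g :: "'a::euclidean_space \<Rightarrow> real"
  assumes [measurable]: "f \<in> borel_measurable borel" and A[measurable]: "A \<in> sets borel"
    and B: "\<And>x. x \<in> A \<Longrightarrow> \<bar>f x\<bar> \<le> B" and g: "set_integrable lborel A g"
  shows "set_integrable lborel A (\<lambda>x. f x * g x)"
proof -
  have [measurable]: "(\<lambda>x. indicator A x * g x) \<in> borel_measurable borel"
    using g by (auto simp: set_integrable_def)
  have "(\<lambda>x. f x * (indicator A x * g x)) \<in> borel_measurable borel" by measurable
  then have m: "(\<lambda>x. indicator A x *\<^sub>R (f x * g x)) \<in> borel_measurable lborel"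
    by (simp add: mult.left_commute)
  have "integrable lborel (\<lambda>x. B * (indicator A x *\<^sub>R g x))"
    using g by (auto simp: set_integrable_def)
  then show ?thesis unfolding set_integrable_def
  proof (rule Bochner_Integration.integrable_bound[OF _ m])
    show "AE x in lborel. norm (indicator A x *\<^sub>R (f x * g x)) \<le> norm (B * (indicator A x *\<^sub>R g x))"
    proof (rule AE_I2)
      fix x
      have "x \<in> A \<Longrightarrow> \<bar>f x\<bar> * \<bar>g x\<bar> \<le> \<bar>B\<bar> * \<bar>g x\<bar>"
        using B[of x] by (intro mult_right_mono) auto
      then show "norm (indicator A x *\<^sub>R (f x * g x)) \<le> norm (B * (indicator A x *\<^sub>R g x))"
        by (auto simp: indicator_def abs_mult)
    qed
  qed
qed

text \<open>Testing with products \<open>a(t) b(x)\<close> only is enough, and the two partial derivatives of a product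
  commute trivially.\<close>

definition weak_dx :: "real \<Rightarrow> real \<Rightarrow> (real \<times> real \<Rightarrow> real) \<Rightarrow> (real \<times> real \<Rightarrow> real) \<Rightarrow> bool" where
  "weak_dx T L u g \<longleftrightarrow> (\<forall>a b. test_line T a \<longrightarrow> test_line L b \<longrightarrow>
     (LINT z:{0..T} \<times> {0..L}|lborel. a (fst z) * deriv b (snd z) * u z) =
     - (LINT z:{0..T} \<times> {0..L}|lborel. a (fst z) * b (snd z) * g z))"

lemma test_product_borel [measurable]:
  assumes "test_line T a" "test_line L b"
  shows "(\<lambda>z. a (fst z) * b (snd z)) \<in> borel_measurable borel"
proof -
  have [measurable]: "a \<in> borel_measurable borel" "b \<in> borel_measurable borel"
    using assms by (auto intro: test_line_borel)
  show ?thesis by measurable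
qed

lemma test_product_bounded:
  assumes "test_line T a" "test_line L b"
  obtains B where "\<And>z. \<bar>a (fst z) * b (snd z)\<bar> \<le> B"
proof -
  obtain A B where "\<And>x. \<bar>a x\<bar> \<le> A" "\<And>x. \<bar>b x\<bar> \<le> B"
    using test_line_bounded assms by meson
  then have "\<bar>a (fst z) * b (snd z)\<bar> \<le> A * B" for z
    unfolding abs_mult by (intro mult_mono) (auto intro: order_trans[OF abs_ge_zero])
  then show ?thesis using that by blast
qed

lemma test_product_integrable:
  assumes "test_line T a" "test_line L b" "set_integrable lborel ({0..T} \<times> {0..L}) u"
  shows "set_integrable lborel ({0..T} \<times> {0..L}) (\<lambda>z. a (fst z) * b (snd z) * u z)"
proof -
  obtain B where "\<And>z. \<bar>a (fst z) * b (snd z)\<bar> \<le> B" using test_product_bounded assms by metis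
  then show ?thesis using assms
    by (intro set_integrable_bounded_mult[where B = B] test_product_borel) auto
qed

lemma variational_zero_closed:
  assumes h: "h \<in> borel_measurable borel" "set_integrable lborel ({0..T} \<times> {0..L}) h"
    and z: "\<And>a b. test_line T a \<Longrightarrow> test_line L b \<Longrightarrow>
      (LINT z:{0..T} \<times> {0..L}|lborel. a (fst z) * b (snd z) * h z) = 0"
  shows "AE z in lborel. z \<in> {0<..<T} \<times> {0<..<L} \<longrightarrow> h z = 0"
proof (rule variational_zero[OF h(1)])
  show "set_integrable lborel ({c..d} \<times> {c'..d'}) h" if "0 < c" "d < T" "0 < c'" "d' < L" for c d c' d'
    using h(2) by (rule set_integrable_subset) (use that in auto)
  fix a b assume ab: "test_line T a" "test_line L b"
  have "(LINT z:{0<..<T} \<times> {0<..<L}|lborel. h z * (a (fst z) * b (snd z)))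
    = (LINT z:{0..T} \<times> {0..L}|lborel. a (fst z) * b (snd z) * h z)"
    unfolding set_lebesgue_integral_def
  proof (intro Bochner_Integration.integral_cong refl)
    fix z :: "real \<times> real"
    show "indicat_real ({0<..<T} \<times> {0<..<L}) z *\<^sub>R (h z * (a (fst z) * b (snd z)))
      = indicat_real ({0..T} \<times> {0..L}) z *\<^sub>R (a (fst z) * b (snd z) * h z)"
    proof (cases "z \<in> {0<..<T} \<times> {0<..<L}")
      case True
      then show ?thesis by (auto simp: indicator_def)
    next
      case False
      then have "a (fst z) * b (snd z) = 0"
        using test_line_zero[OF ab(1), of "fst z"] test_line_zero[OF ab(2), of "snd z"]
        by (cases z) (auto simp: not_less)
      then show ?thesis using False by auto
    qed
  qed
  then show "(LINT z:{0<..<T} \<times> {0<..<L}|lborel. h z * (a (fst z) * b (snd z))) = 0" using z[OF ab] by simp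
qed

lemma AE_open_rectangle:
  assumes "AE z in lborel. z \<in> {0<..<T} \<times> {0<..<L} \<longrightarrow> P (z :: real \<times> real)"
  shows "AE t in lborel. t \<in> {0..T} \<longrightarrow> (AE x in lborel. x \<in> {0..L} \<longrightarrow> P (t, x))"
  using AE_slices[OF assms] AE_lborel_singleton[of 0] AE_lborel_singleton[of T]
proof eventually_elim
  case (elim t)
  show ?case
  proof
    assume t: "t \<in> {0..T}"
    show "AE x in lborel. x \<in> {0..L} \<longrightarrow> P (t, x)"
      using elim(1) AE_lborel_singleton[of 0] AE_lborel_singleton[of L]
      by eventually_elim (use elim t in auto)
  qed
qed

section \<open>Absolute continuity on almost every line\<close>

lemma test_line_ac:
  assumes "test_line L b"
  shows "ac L b (deriv b)"
  by (intro ac_C1 test_line_continuous[OF test_line_deriv[OF assms]]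
      has_field_derivative_at_within[OF test_line_has_deriv[OF assms]])

text \<open>Subtracting from \<open>u\<close> the primitive \<open>G\<close> of \<open>g\<close> in
  x leaves a function \<open>h\<close> with vanishing weak x-derivative. By the argument of du
  Bois-Reymond it depends on t only, and c(t) + G(t, x) is the absolutely continuous
  representative.\<close>

lemma ac_slices:
  assumes T: "0 < T" and L: "0 < L"
    and [measurable]: "u \<in> borel_measurable borel" "g \<in> borel_measurable borel"
    and u: "set_integrable lborel ({0..T} \<times> {0..L}) u" and g: "set_integrable lborel ({0..T} \<times> {0..L}) g"
    and w: "weak_dx T L u g"
  shows "AE t in lborel. t \<in> {0..T} \<longrightarrow> (\<exists>p. ac L p (\<lambda>x. g (t, x)) \<and>
    (AE x in lborel. x \<in> {0..L} \<longrightarrow> p x = u (t, x)))"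
proof -
  let ?Q = "{0..T} \<times> {0..L}"
  \<comment> \<open>The primitive is defined on the whole plane at once, so that it is jointly
    Borel.\<close>
  define G where "G z = (LINT y:{0..snd z}|lborel. g (fst z, y))" for z
  have [measurable]: "G \<in> borel_measurable borel"
  proof -
    have "(\<lambda>z. LINT y|lborel. (if 0 \<le> y \<and> y \<le> snd z then 1 else 0) * g (fst z, y)) \<in> borel_measurable (borel :: (real \<times> real) measure)"
      by (rule lborel.borel_measurable_lebesgue_integral) measurable
    also have "(\<lambda>z. LINT y|lborel. (if 0 \<le> y \<and> y \<le> snd z then 1 else 0) * g (fst z, y)) = G"
      by (auto simp: G_def set_lebesgue_integral_def fun_eq_iff indicator_def intro!: Bochner_Integration.integral_cong)
    finally show ?thesis .
  qed
  have slG: "AE t in lborel. t \<in> {0..T} \<longrightarrow> ac L (\<lambda>x. G (t, x)) (\<lambda>x. g (t, x))"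
    using rectangle_fubini(2)[OF g]
  proof eventually_elim
    case (elim t)
    have "G (t, 0) = 0"
      unfolding G_def set_lebesgue_integral_def
      by (rule integral_eq_zero_AE) (use AE_lborel_singleton[of "0::real"] in \<open>auto elim!: eventually_mono\<close>)
    then show ?case using elim by (simp add: ac_def G_def)
  qed
  \<comment> \<open>A majorant of \<open>G\<close> that does not depend on x: the L^1 norm of the
    slice of \<open>g\<close>. Its integrability gives that of \<open>G\<close> on the
    rectangle.\<close>
  define M where "M t = (LINT x:{0..L}|lborel. \<bar>g (t, x)\<bar>)" for t
  have gabs: "set_integrable lborel ?Q (\<lambda>z. \<bar>g z\<bar>)" using g by (rule set_integrable_abs)
  have iG: "set_integrable lborel ?Q G"
  proof -
    have b: "AE z in lborel. z \<in> ?Q \<longrightarrow> \<bar>G z\<bar> \<le> M (fst z)"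
    proof -
      have "AE z in (lborel :: (real \<times> real) measure). fst z \<in> {0..T} \<longrightarrow> set_integrable lborel {0..L} (\<lambda>x. g (fst z, x))"
        by (rule AE_lift_fst[OF rectangle_fubini(2)[OF g]])
      then show ?thesis
      proof eventually_elim
        case (elim z)
        show ?case
        proof
          assume z: "z \<in> ?Q"
          have i: "set_integrable lborel {0..L} (\<lambda>x. g (fst z, x))" using elim z by auto
          have i': "set_integrable lborel {0..snd z} (\<lambda>x. g (fst z, x))"
            using i by (rule set_integrable_subset) (use z in auto)
          have "\<bar>G z\<bar> \<le> (LINT x:{0..snd z}|lborel. \<bar>g (fst z, x)\<bar>)"
            unfolding G_def using set_integral_norm_bound[OF i'] by simp
          also have "\<dots> \<le> M (fst z)" unfolding M_def set_lebesgue_integral_def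
            using set_integrable_abs[OF i] set_integrable_abs[OF i'] z
            by (intro integral_mono) (auto simp: set_integrable_def indicator_def)
          finally show "\<bar>G z\<bar> \<le> M (fst z)" .
        qed
      qed
    qed
    have "set_integrable lborel ?Q (\<lambda>z. M (fst z))"
      unfolding M_def by (intro set_integrable_fst rectangle_fubini(3)[OF gabs])
    then show ?thesis unfolding set_integrable_def
      by (rule Bochner_Integration.integrable_bound) (use b in \<open>auto simp: indicator_def elim!: eventually_mono\<close>)
  qed
  define h where "h z = u z - G z" for z
  have [measurable]: "h \<in> borel_measurable borel" unfolding h_def by measurable
  have ih: "set_integrable lborel ?Q h" unfolding h_def by (intro set_integral_diff(1) u iG)
  have wG: "(LINT z:?Q|lborel. a (fst z) * deriv b (snd z) * G z) = - (LINT z:?Q|lborel. a (fst z) * b (snd z) * g z)"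
    if ab: "test_line T a" "test_line L b" for a b
  proof -
    have i1: "set_integrable lborel ?Q (\<lambda>z. a (fst z) * deriv b (snd z) * G z)"
      and i2: "set_integrable lborel ?Q (\<lambda>z. a (fst z) * b (snd z) * g z)"
      by (intro test_product_integrable ab test_line_deriv iG g)+
    have "(LINT z:?Q|lborel. a (fst z) * deriv b (snd z) * G z) + (LINT z:?Q|lborel. a (fst z) * b (snd z) * g z)
      = (LINT z:?Q|lborel. a (fst z) * deriv b (snd z) * G z + a (fst z) * b (snd z) * g z)"
      by (rule set_integral_add(2)[symmetric, OF i1 i2])
    also have "\<dots> = (LINT t:{0..T}|lborel. LINT x:{0..L}|lborel. a t * deriv b x * G (t, x) + a t * b x * g (t, x))"
      using rectangle_fubini(1)[OF set_integral_add(1)[OF i1 i2]] by simp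
    also have "\<dots> = (LINT t:{0..T}|lborel. 0)"
    proof (rule set_lebesgue_integral_cong_AE)
      show "AE t\<in>{0..T} in lborel. (LINT x:{0..L}|lborel. a t * deriv b x * G (t, x) + a t * b x * g (t, x)) = 0"
        using slG
      proof eventually_elim
        case (elim t)
        show ?case
        proof
          assume "t \<in> {0..T}"
          then have "ac L (\<lambda>x. a t * (b x * G (t, x))) (\<lambda>x. a t * (deriv b x * G (t, x) + b x * g (t, x)))"
            using elim by (intro ac_cmult ac_mult test_line_ac ab) auto
          from ac_ftc[OF this] L test_line_zero[OF ab(2), of 0] test_line_zero[OF ab(2), of L]
          show "(LINT x:{0..L}|lborel. a t * deriv b x * G (t, x) + a t * b x * g (t, x)) = 0"
            by (simp add: algebra_simps)
        qed
      qed
      show "(\<lambda>t. LINT x:{0..L}|lborel. a t * deriv b x * G (t, x) + a t * b x * g (t, x)) \<in> borel_measurable lborel"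
      proof -
        have [measurable]: "a \<in> borel_measurable borel" "b \<in> borel_measurable borel" "deriv b \<in> borel_measurable borel"
          using ab by (auto intro: test_line_borel test_line_deriv)
        show ?thesis unfolding set_lebesgue_integral_def by measurable
      qed
    qed auto
    finally show ?thesis by (simp add: set_lebesgue_integral_def)
  qed
  have wh: "(LINT z:?Q|lborel. a (fst z) * deriv b (snd z) * h z) = 0"
    if ab: "test_line T a" "test_line L b" for a b
  proof -
    have i1: "set_integrable lborel ?Q (\<lambda>z. a (fst z) * deriv b (snd z) * G z)"
      and i2: "set_integrable lborel ?Q (\<lambda>z. a (fst z) * deriv b (snd z) * u z)"
      by (intro test_product_integrable ab test_line_deriv iG u)+
    show ?thesis
      using set_integral_diff(2)[OF i2 i1] wG[OF ab] w ab by (simp add: h_def right_diff_distrib weak_dx_def)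
  qed
  \<comment> \<open>A fixed bump of positive mean; subtracting a multiple of it turns any test
    function into one of zero mean, hence into a derivative.\<close>
  define \<beta>0 where "\<beta>0 = bump 1 (L/3) (2*L/3)"
  have b0: "test_line L \<beta>0" unfolding \<beta>0_def using L by (intro test_line_bump) auto
  define m where "m = integral {0..L} \<beta>0"
  have "0 < m"
  proof -
    have c: "continuous_on {0..L} \<beta>0" using b0 by (rule test_line_continuous)
    have "integral {0..L} \<beta>0 \<noteq> 0"
    proof
      assume "integral {0..L} \<beta>0 = 0"
      then have "\<beta>0 (L/2) = 0"
        using integral_eq_0_iff[OF c] L by (auto simp: \<beta>0_def bump_bounds)
      then show False using bump_pos[of "L/3" "L/2" "2*L/3" 1] L by (simp add: \<beta>0_def)
    qed
    moreover have "0 \<le> integral {0..L} \<beta>0"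
      by (intro integral_nonneg integrable_continuous_real c) (simp add: \<beta>0_def bump_bounds)
    ultimately show ?thesis by (simp add: m_def)
  qed
  \<comment> \<open>If \<open>h\<close> is independent of x, it equals its average against the
    normalised bump; this defines the candidate also before independence is known.\<close>
  define c where "c t = (LINT y:{0..L}|lborel. \<beta>0 y / m * h (t, y))" for t
  have [measurable]: "\<beta>0 \<in> borel_measurable borel" using b0 by (rule test_line_borel)
  have [measurable]: "c \<in> borel_measurable borel" unfolding c_def set_lebesgue_integral_def by measurable
  have ibh: "set_integrable lborel ?Q (\<lambda>z. \<beta>0 (snd z) / m * h z)"
  proof (intro set_integrable_bounded_mult[where B = "1 / m"] ih)
    show "\<bar>\<beta>0 (snd z) / m\<bar> \<le> 1 / m" for z :: "real \<times> real"
      using \<open>0 < m\<close> by (simp add: \<beta>0_def bump_bounds divide_right_mono)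
  qed measurable
  have ic: "set_integrable lborel {0..T} c"
    unfolding c_def using rectangle_fubini(3)[OF ibh] by simp
  have ic2: "set_integrable lborel ?Q (\<lambda>z. c (fst z))" by (rule set_integrable_fst[OF ic])
  have "AE z in lborel. z \<in> {0<..<T} \<times> {0<..<L} \<longrightarrow> h z - c (fst z) = 0"
  proof (rule variational_zero_closed)
    show "set_integrable lborel ?Q (\<lambda>z. h z - c (fst z))" by (intro set_integral_diff(1) ih ic2)
    fix a b assume ab: "test_line T a" "test_line L b"
    have [measurable]: "a \<in> borel_measurable borel" "b \<in> borel_measurable borel" using ab by (auto intro: test_line_borel)
    define \<kappa> where "\<kappa> = (LINT x:{0..L}|lborel. b x)"
    have ib: "set_integrable lborel {0..L} b"
      by (rule borel_integrable_atLeastAtMost'[OF test_line_continuous[OF ab(2)]])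
    have \<kappa>: "\<kappa> = integral {0..L} b" unfolding \<kappa>_def by (rule set_borel_integral_eq_integral(2)[OF ib])
    \<comment> \<open>The multiple of \<open>\<beta>0\<close> is chosen to give mean zero; testing
      \<open>h\<close> with the derivative of \<open>Bt\<close> then compares the integral against
      \<open>b\<close> with the average \<open>c\<close>.\<close>
    obtain Bt where Bt: "test_line L Bt" "deriv Bt = (\<lambda>x. b x - \<kappa> / m * \<beta>0 x)"
    proof (rule test_line_antideriv[OF L])
      show "test_line L (\<lambda>x. b x - \<kappa> / m * \<beta>0 x)"
      proof -
        have "Ck_line k (\<lambda>x. b x + (- (\<kappa> / m)) * \<beta>0 x)" for k
          using ab b0 by (intro Ck_line_add Ck_line_mult Ck_line_const) (auto simp: test_line_def smooth_line_def)
        then have s: "smooth_line (\<lambda>x. b x - \<kappa> / m * \<beta>0 x)" by (simp add: smooth_line_def)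
        obtain p q where pq: "0 < p" "q < L" "\<And>x. x \<notin> {p..q} \<Longrightarrow> b x = 0"
          using ab(2) by (auto simp: test_line_def)
        have "b x - \<kappa> / m * \<beta>0 x = 0" if "x \<notin> {min p (L/3)..max q (2*L/3)}" for x
          using that pq(3)[of x] bump_outside[of x "L/3" "2*L/3" 1] by (force simp: \<beta>0_def)
        then show ?thesis using s pq L unfolding test_line_def
          by (intro conjI exI[of _ "min p (L/3)"] exI[of _ "max q (2*L/3)"]) auto
      qed
      have "integral {0..L} (\<lambda>x. b x - \<kappa> / m * \<beta>0 x) = integral {0..L} b - \<kappa> / m * integral {0..L} \<beta>0"
      proof -
        have "b integrable_on {0..L}" "\<beta>0 integrable_on {0..L}"
          using test_line_continuous[OF ab(2)] test_line_continuous[OF b0]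
          by (auto intro: integrable_continuous_real)
        then show ?thesis
          by (subst Henstock_Kurzweil_Integration.integral_diff)
            (simp_all only: integrable_on_mult_right Henstock_Kurzweil_Integration.integral_mult_right)
      qed
      then show "integral {0..L} (\<lambda>x. b x - \<kappa> / m * \<beta>0 x) = 0"
        using \<open>0 < m\<close> by (simp add: \<kappa> m_def)
    qed
    have i0: "set_integrable lborel ?Q (\<lambda>z. a (fst z) * b (snd z) * h z)"
      "set_integrable lborel ?Q (\<lambda>z. a (fst z) * b (snd z) * c (fst z))"
      "set_integrable lborel ?Q (\<lambda>z. a (fst z) * \<beta>0 (snd z) * h z)"
      by (intro test_product_integrable ab b0 ih ic2)+
    have "0 = (LINT z:?Q|lborel. a (fst z) * deriv Bt (snd z) * h z)" using wh[OF ab(1) Bt(1)] by simp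
    also have "\<dots> = (LINT z:?Q|lborel. a (fst z) * b (snd z) * h z - \<kappa> / m * (a (fst z) * \<beta>0 (snd z) * h z))"
      by (simp add: Bt(2) algebra_simps)
    also have "\<dots> = (LINT z:?Q|lborel. a (fst z) * b (snd z) * h z) - \<kappa> / m * (LINT z:?Q|lborel. a (fst z) * \<beta>0 (snd z) * h z)"
      using set_integral_diff(2)[OF i0(1) set_integrable_mult_right[OF i0(3), of "\<kappa> / m"]] by simp
    also have "\<kappa> / m * (LINT z:?Q|lborel. a (fst z) * \<beta>0 (snd z) * h z) = \<kappa> * (LINT t:{0..T}|lborel. a t * c t)"
    proof -
      have "(LINT z:?Q|lborel. a (fst z) * \<beta>0 (snd z) * h z) = (LINT t:{0..T}|lborel. LINT x:{0..L}|lborel. a t * \<beta>0 x * h (t, x))"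
        using rectangle_fubini(1)[OF i0(3)] by simp
      also have "(\<lambda>t. LINT x:{0..L}|lborel. a t * \<beta>0 x * h (t, x)) = (\<lambda>t. m * (a t * c t))"
      proof
        fix t
        have "(LINT x:{0..L}|lborel. a t * \<beta>0 x * h (t, x)) = (LINT x:{0..L}|lborel. (m * a t) * (\<beta>0 x / m * h (t, x)))"
          using \<open>0 < m\<close> by (intro arg_cong[where f = "set_lebesgue_integral lborel {0..L}"] ext) simp
        also have "\<dots> = m * (a t * c t)" unfolding c_def by (subst set_integral_mult_right) simp
        finally show "(LINT x:{0..L}|lborel. a t * \<beta>0 x * h (t, x)) = m * (a t * c t)" .
      qed
      finally show ?thesis using \<open>0 < m\<close> by simp
    qed
    also have "\<dots> = (LINT z:?Q|lborel. a (fst z) * b (snd z) * c (fst z))"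
    proof -
      have "(LINT z:?Q|lborel. a (fst z) * b (snd z) * c (fst z)) = (LINT t:{0..T}|lborel. LINT x:{0..L}|lborel. (a t * c t) * b x)"
        using rectangle_fubini(1)[OF i0(2)] by (simp add: mult.commute mult.left_commute)
      then show ?thesis by (simp add: \<kappa>_def mult.commute)
    qed
    finally show "(LINT z:?Q|lborel. a (fst z) * b (snd z) * (h z - c (fst z))) = 0"
      using set_integral_diff(2)[OF i0(1,2)] by (simp add: right_diff_distrib)
  qed measurable
  from AE_open_rectangle[OF this] slG show ?thesis
  proof eventually_elim
    case (elim t)
    show ?case
    proof
      assume t: "t \<in> {0..T}"
      have "ac L (\<lambda>x. c t + G (t, x)) (\<lambda>x. 0 + g (t, x))"
        using elim t by (intro ac_add ac_const) auto
      moreover have "AE x in lborel. x \<in> {0..L} \<longrightarrow> c t + G (t, x) = u (t, x)"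
        using elim(1) t by (auto simp: h_def algebra_simps elim!: eventually_mono)
      ultimately show "\<exists>p. ac L p (\<lambda>x. g (t, x)) \<and> (AE x in lborel. x \<in> {0..L} \<longrightarrow> p x = u (t, x))"
        by (intro exI[of _ "\<lambda>x. c t + G (t, x)"]) auto
    qed
  qed
qed

lemma rectangle_integral_zero:
  fixes k :: "real \<times> real \<Rightarrow> real"
  assumes "set_integrable lborel ({0..T} \<times> {0..L}) k"
    and "AE t in lborel. t \<in> {0..T} \<longrightarrow> (LINT x:{0..L}|lborel. k (t, x)) = 0"
  shows "(LINT z:{0..T} \<times> {0..L}|lborel. k z) = 0"
proof -
  have "(LINT t:{0..T}|lborel. LINT x:{0..L}|lborel. k (t, x)) = 0"
    unfolding set_lebesgue_integral_def[of _ "{0..T}"]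
    by (rule integral_eq_zero_AE) (use assms(2) in \<open>auto simp: indicator_def elim!: eventually_mono\<close>)
  then show ?thesis using rectangle_fubini(1)[OF assms(1)] by simp
qed

lemma rectangle_integral_nonneg:
  fixes k :: "real \<times> real \<Rightarrow> real"
  assumes "set_integrable lborel ({0..T} \<times> {0..L}) k"
    and "AE t in lborel. t \<in> {0..T} \<longrightarrow> 0 \<le> (LINT x:{0..L}|lborel. k (t, x))"
  shows "0 \<le> (LINT z:{0..T} \<times> {0..L}|lborel. k z)"
proof -
  have "0 \<le> (LINT t:{0..T}|lborel. LINT x:{0..L}|lborel. k (t, x))"
    unfolding set_lebesgue_integral_def[of _ "{0..T}"]
    by (rule integral_nonneg_AE) (use assms(2) in \<open>auto simp: indicator_def elim!: eventually_mono\<close>)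
  then show ?thesis using rectangle_fubini(1)[OF assms(1)] by simp
qed

lemma rectangle_integral_zero_t:
  fixes k :: "real \<times> real \<Rightarrow> real"
  assumes k: "set_integrable lborel ({0..T} \<times> {0..L}) k"
    and "AE x in lborel. x \<in> {0..L} \<longrightarrow> (LINT t:{0..T}|lborel. k (t, x)) = 0"
  shows "(LINT z:{0..T} \<times> {0..L}|lborel. k z) = 0"
proof -
  have "(LINT z:{0..L} \<times> {0..T}|lborel. k (snd z, fst z)) = 0"
    by (rule rectangle_integral_zero[OF rectangle_swap(1)[OF k]]) (use assms(2) in simp)
  then show ?thesis using rectangle_swap(2)[OF k] by simp
qed

section \<open>Time derivatives and vanishing boundary values\<close>

definition weak_dt :: "real \<Rightarrow> real \<Rightarrow> (real \<times> real \<Rightarrow> real) \<Rightarrow> (real \<times> real \<Rightarrow> real) \<Rightarrow> bool" where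
  "weak_dt T L u g \<longleftrightarrow> weak_dx L T (\<lambda>z. u (snd z, fst z)) (\<lambda>z. g (snd z, fst z))"

lemma ac_slices_t:
  assumes "0 < T" "0 < L"
    and [measurable]: "u \<in> borel_measurable borel" "g \<in> borel_measurable borel"
    and u: "set_integrable lborel ({0..T} \<times> {0..L}) u" and g: "set_integrable lborel ({0..T} \<times> {0..L}) g"
    and w: "weak_dt T L u g"
  shows "AE x in lborel. x \<in> {0..L} \<longrightarrow> (\<exists>p. ac T p (\<lambda>t. g (t, x)) \<and>
    (AE t in lborel. t \<in> {0..T} \<longrightarrow> p t = u (t, x)))"
  using ac_slices[OF assms(2,1), of "\<lambda>z. u (snd z, fst z)" "\<lambda>z. g (snd z, fst z)"]
    rectangle_swap(1)[OF u] rectangle_swap(1)[OF g] w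
  by (simp add: weak_dt_def)

lemma separated_mult_integrable:
  fixes L :: real
  assumes a: "test_line T a" and b: "continuous_on UNIV b" and u: "set_integrable lborel ({0..T} \<times> {0..L}) u"
  shows "set_integrable lborel ({0..T} \<times> {0..L}) (\<lambda>z. a (fst z) * b (snd z) * u z)"
proof -
  have [measurable]: "a \<in> borel_measurable borel" "b \<in> borel_measurable borel"
    using a b by (auto intro: test_line_borel borel_measurable_continuous_onI)
  obtain A where A: "\<And>x. \<bar>a x\<bar> \<le> A" using test_line_bounded a by meson
  have "bounded (b ` {0..L})"
    by (intro compact_imp_bounded compact_continuous_image continuous_on_subset[OF b]) auto
  then obtain B where B: "\<And>x. x \<in> {0..L} \<Longrightarrow> \<bar>b x\<bar> \<le> B" by (force simp: bounded_iff)
  have "\<bar>a (fst z) * b (snd z)\<bar> \<le> A * B" if "z \<in> {0..T} \<times> {0..L}" for z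
    unfolding abs_mult using A[of "fst z"] B[of "snd z"] that
    by (intro mult_mono) (auto intro: order_trans[OF abs_ge_zero A])
  then show ?thesis
    by (intro set_integrable_bounded_mult[where B = "A * B"] u) auto
qed

text \<open>Only the t-derivative is moved, so on almost every line x = const the factor
  \<open>b\<close> is a constant. It need not vanish at the boundary, which admits the factors x, L
  - x and 1 of the boundary conditions.\<close>

lemma weak_dt_test:
  assumes TL: "0 < T" "0 < L"
    and [measurable]: "u \<in> borel_measurable borel" "g \<in> borel_measurable borel"
    and u: "set_integrable lborel ({0..T} \<times> {0..L}) u" and g: "set_integrable lborel ({0..T} \<times> {0..L}) g"
    and w: "weak_dt T L u g" and a: "test_line T a" and b: "continuous_on UNIV b"
  shows "(LINT z:{0..T} \<times> {0..L}|lborel. a (fst z) * b (snd z) * g z)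
      = - (LINT z:{0..T} \<times> {0..L}|lborel. deriv a (fst z) * b (snd z) * u z)"
proof -
  have [measurable]: "a \<in> borel_measurable borel" "deriv a \<in> borel_measurable borel" "b \<in> borel_measurable borel"
    using a b by (auto intro: test_line_borel test_line_deriv borel_measurable_continuous_onI)
  note i1 = separated_mult_integrable[OF test_line_deriv[OF a] b u] and i2 = separated_mult_integrable[OF a b g]
  have "(LINT z:{0..T} \<times> {0..L}|lborel. deriv a (fst z) * b (snd z) * u z + a (fst z) * b (snd z) * g z) = 0"
  proof (rule rectangle_integral_zero_t[OF set_integral_add(1)[OF i1 i2]])
    show "AE x in lborel. x \<in> {0..L} \<longrightarrow> (LINT t:{0..T}|lborel. deriv a (fst (t, x)) * b (snd (t, x)) * u (t, x)
        + a (fst (t, x)) * b (snd (t, x)) * g (t, x)) = 0"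
      using ac_slices_t[OF assms(1-7)]
    proof eventually_elim
      case (elim x)
      show ?case
      proof
        assume "x \<in> {0..L}"
        then obtain p where p: "ac T p (\<lambda>t. g (t, x))" "AE t in lborel. t \<in> {0..T} \<longrightarrow> p t = u (t, x)"
          using elim by auto
        have "ac T (\<lambda>t. b x * (a t * p t)) (\<lambda>t. b x * (deriv a t * p t + a t * g (t, x)))"
          by (intro ac_cmult ac_mult test_line_ac a p)
        then have "ac T (\<lambda>t. b x * (a t * p t)) (\<lambda>t. deriv a t * b x * u (t, x) + a t * b x * g (t, x))"
          by (rule ac_cong_AE) (use p(2) in \<open>auto simp: algebra_simps elim!: eventually_mono\<close>)
        from ac_ftc[OF this] TL test_line_zero[OF a, of 0] test_line_zero[OF a, of T]
        show "(LINT t:{0..T}|lborel. deriv a (fst (t, x)) * b (snd (t, x)) * u (t, x)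
          + a (fst (t, x)) * b (snd (t, x)) * g (t, x)) = 0" by simp
      qed
    qed
  qed
  then show "(LINT z:{0..T} \<times> {0..L}|lborel. a (fst z) * b (snd z) * g z)
      = - (LINT z:{0..T} \<times> {0..L}|lborel. deriv a (fst z) * b (snd z) * u z)"
    using set_integral_add(2)[OF i1 i2] by simp
qed

text \<open>Both conditions are integrations by parts in \<open>x\<close>, against \<open>x\<close> and \<open>L - x\<close>: they isolate the
  value of \<open>u\<close> at \<open>L\<close> and at \<open>0\<close>, where \<open>g\<close> plays the role of the derivative of \<open>u\<close>.\<close>

definition zero_bdry :: "real \<Rightarrow> real \<Rightarrow> (real \<times> real \<Rightarrow> real) \<Rightarrow> (real \<times> real \<Rightarrow> real) \<Rightarrow> bool" where
  "zero_bdry T L u g \<longleftrightarrow> (\<forall>a. test_line T a \<longrightarrow>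
     (LINT z:{0..T} \<times> {0..L}|lborel. a (fst z) * (snd z * g z + u z)) = 0 \<and>
     (LINT z:{0..T} \<times> {0..L}|lborel. a (fst z) * ((L - snd z) * g z - u z)) = 0)"

text \<open>The boundary conditions act in x only, so a time derivative can be moved onto the test
  function in t, where it yields another test function.\<close>

lemma zero_bdry_dt:
  assumes TL: "0 < T" "0 < L"
    and m: "u \<in> borel_measurable borel" "g \<in> borel_measurable borel"
      "ut \<in> borel_measurable borel" "gt \<in> borel_measurable borel"
    and i: "set_integrable lborel ({0..T} \<times> {0..L}) u" "set_integrable lborel ({0..T} \<times> {0..L}) g"
      "set_integrable lborel ({0..T} \<times> {0..L}) ut" "set_integrable lborel ({0..T} \<times> {0..L}) gt"
    and w: "weak_dt T L u ut" "weak_dt T L g gt" and z: "zero_bdry T L u g"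
  shows "zero_bdry T L ut gt"
  unfolding zero_bdry_def
proof (intro allI impI)
  fix a assume a: "test_line T a"
  have *: "(LINT z:{0..T} \<times> {0..L}|lborel. a (fst z) * (b (snd z) * gt z + c * ut z))
     = - (LINT z:{0..T} \<times> {0..L}|lborel. deriv a (fst z) * (b (snd z) * g z + c * u z))"
    if b: "continuous_on UNIV b" for b c
  proof -
    have c: "continuous_on UNIV (\<lambda>x::real. c)" by simp
    note U = weak_dt_test[OF TL m(1,3) i(1,3) w(1) a c]
    note G = weak_dt_test[OF TL m(2,4) i(2,4) w(2) a b]
    note iU = separated_mult_integrable[OF a c i(3)] separated_mult_integrable[OF test_line_deriv[OF a] c i(1)]
      separated_mult_integrable[OF a b i(4)] separated_mult_integrable[OF test_line_deriv[OF a] b i(2)]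
    show ?thesis
      using set_integral_add(2)[OF iU(3,1)] set_integral_add(2)[OF iU(4,2)] U G
      by (simp add: algebra_simps)
  qed
  have z': "(LINT z:{0..T} \<times> {0..L}|lborel. deriv a (fst z) * (snd z * g z + u z)) = 0"
     "(LINT z:{0..T} \<times> {0..L}|lborel. deriv a (fst z) * ((L - snd z) * g z - u z)) = 0"
    using z test_line_deriv[OF a] by (auto simp: zero_bdry_def)
  show "(LINT z:{0..T} \<times> {0..L}|lborel. a (fst z) * (snd z * gt z + ut z)) = 0 \<and>
     (LINT z:{0..T} \<times> {0..L}|lborel. a (fst z) * ((L - snd z) * gt z - ut z)) = 0"
    using *[of "\<lambda>x. x" 1] *[of "\<lambda>x. L - x" "-1"] z' by (simp add: continuous_on_diff)
qed

lemma AE_interval_const: "0 < L \<Longrightarrow> AE x in lborel. x \<in> {0..L::real} \<longrightarrow> P \<Longrightarrow> P"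
proof (rule ccontr)
  assume L: "0 < L" and ae: "AE x in lborel. x \<in> {0..L} \<longrightarrow> P" and "\<not> P"
  then have "AE x in lborel. x \<notin> {0..L}" by simp
  then have "{0..L} \<in> null_sets lborel" using AE_iff_null_sets[of "{0..L}" lborel] by simp
  then show False using L by (simp add: null_sets_def)
qed

text \<open>Integrated over x, the two conditions become functions of t annihilated by all test
  functions, hence zero for almost every t; on such a slice they can be integrated by parts for any
  absolutely continuous representative.\<close>

lemma zero_bdry_slices:
  assumes TL: "0 < T" "0 < L"
    and [measurable]: "u \<in> borel_measurable borel" "g \<in> borel_measurable borel"
    and u: "set_integrable lborel ({0..T} \<times> {0..L}) u" and g: "set_integrable lborel ({0..T} \<times> {0..L}) g"
    and z: "zero_bdry T L u g"
  shows "AE t in lborel. t \<in> {0..T} \<longrightarrow> (\<forall>p. ac L p (\<lambda>x. g (t, x)) \<longrightarrow>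
    (AE x in lborel. x \<in> {0..L} \<longrightarrow> p x = u (t, x)) \<longrightarrow> p 0 = 0 \<and> p L = 0)"
proof -
  let ?Q = "{0..T} \<times> {0..L}"
  have vanish: "AE t in lborel. t \<in> {0..T} \<longrightarrow> (LINT x:{0..L}|lborel. k (t, x)) = 0"
    if [measurable]: "k \<in> borel_measurable borel" and k: "set_integrable lborel ?Q k"
      and zk: "\<And>a. test_line T a \<Longrightarrow> (LINT z:?Q|lborel. a (fst z) * k z) = 0" for k
  proof -
    define B where "B t = (LINT x:{0..L}|lborel. k (t, x))" for t
    have [measurable]: "B \<in> borel_measurable borel" unfolding B_def set_lebesgue_integral_def by measurable
    have iB: "set_integrable lborel ?Q (\<lambda>z. B (fst z))"
      unfolding B_def by (intro set_integrable_fst rectangle_fubini(3)[OF k])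
    \<comment> \<open>The variational lemma lives on the rectangle, so \<open>B\<close> is regarded
      as a function constant in x.\<close>
    have "AE z in lborel. z \<in> {0<..<T} \<times> {0<..<L} \<longrightarrow> B (fst z) = 0"
    proof (rule variational_zero_closed[OF _ iB])
      fix a b assume ab: "test_line T a" "test_line L b"
      have [measurable]: "a \<in> borel_measurable borel" using ab by (auto intro: test_line_borel)
      obtain A where A: "\<And>x. \<bar>a x\<bar> \<le> A" using test_line_bounded ab by meson
      have ik: "set_integrable lborel ?Q (\<lambda>z. a (fst z) * k z)"
        using A by (intro set_integrable_bounded_mult[where B = A] k) auto
      have "0 = (LINT t:{0..T}|lborel. LINT x:{0..L}|lborel. a t * k (t, x))"
        using zk[OF ab(1)] rectangle_fubini(1)[OF ik] by simp
      also have "\<dots> = (LINT t:{0..T}|lborel. a t * B t)"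
        by (simp add: B_def)
      finally have "(LINT t:{0..T}|lborel. a t * B t) = 0" by simp
      moreover have "(LINT z:?Q|lborel. a (fst z) * b (snd z) * B (fst z))
        = (LINT t:{0..T}|lborel. LINT x:{0..L}|lborel. (a t * B t) * b x)"
        using rectangle_fubini(1)[OF test_product_integrable[OF ab iB]] by (simp add: mult.commute mult.left_commute)
      ultimately show "(LINT z:?Q|lborel. a (fst z) * b (snd z) * B (fst z)) = 0"
        by simp
    qed measurable
    from AE_open_rectangle[OF this] show ?thesis
    proof eventually_elim
      case (elim t)
      show ?case
      proof
        assume t: "t \<in> {0..T}"
        then have "AE x in lborel. x \<in> {0..L} \<longrightarrow> B t = 0" using elim by simp
        then show "(LINT x:{0..L}|lborel. k (t, x)) = 0"
          unfolding B_def[symmetric] by (rule AE_interval_const[OF TL(2)])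
      qed
    qed
  qed
  have i1: "set_integrable lborel ?Q (\<lambda>z. snd z * g z)" "set_integrable lborel ?Q (\<lambda>z. (L - snd z) * g z)"
    by (intro set_integrable_bounded_mult[where B = L] g; auto)+
  have k1: "AE t in lborel. t \<in> {0..T} \<longrightarrow> (LINT x:{0..L}|lborel. x * g (t, x) + u (t, x)) = 0"
    using vanish[of "\<lambda>z. snd z * g z + u z"] set_integral_add(1)[OF i1(1) u] z by (simp add: zero_bdry_def)
  have k2: "AE t in lborel. t \<in> {0..T} \<longrightarrow> (LINT x:{0..L}|lborel. (L - x) * g (t, x) - u (t, x)) = 0"
    using vanish[of "\<lambda>z. (L - snd z) * g z - u z"] set_integral_diff(1)[OF i1(2) u] z by (simp add: zero_bdry_def)
  from k1 k2 show ?thesis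
  proof eventually_elim
    case (elim t)
    show ?case
    proof (intro impI allI)
      fix p assume t: "t \<in> {0..T}" and p: "ac L p (\<lambda>x. g (t, x))"
        "AE x in lborel. x \<in> {0..L} \<longrightarrow> p x = u (t, x)"
      have x: "ac L (\<lambda>x. x) (\<lambda>x. 1)" "ac L (\<lambda>x. L - x) (\<lambda>x. - 1)"
        by (auto intro!: ac_C1 derivative_eq_intros)
      \<comment> \<open>Integrating these derivatives gives L p(L) here and - L p(0) for the next
        function; both integrals vanish for this t.\<close>
      have "ac L (\<lambda>x. x * p x) (\<lambda>x. x * g (t, x) + u (t, x))"
        by (rule ac_cong_AE[OF ac_mult[OF x(1) p(1)]]) (use p(2) in \<open>auto elim!: eventually_mono\<close>)
      moreover have "ac L (\<lambda>x. (L - x) * p x) (\<lambda>x. (L - x) * g (t, x) - u (t, x))"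
        by (rule ac_cong_AE[OF ac_mult[OF x(2) p(1)]]) (use p(2) in \<open>auto elim!: eventually_mono\<close>)
      ultimately show "p 0 = 0 \<and> p L = 0"
        using elim t TL by (auto dest!: ac_ftc)
    qed
  qed
qed

section \<open>The Carleman estimate on an interval\<close>

lemma ac_power: "ac L f g \<Longrightarrow> ac L (\<lambda>x. f x ^ n) (\<lambda>x. of_nat n * f x ^ (n - 1) * g x)"
proof (induction n)
  case 0
  then show ?case using ac_const[of L 1] by simp
next
  case (Suc n)
  have "ac L (\<lambda>x. f x * f x ^ n) (\<lambda>x. g x * f x ^ n + f x * (of_nat n * f x ^ (n - 1) * g x))"
    by (intro ac_mult Suc)
  also have "(\<lambda>x. g x * f x ^ n + f x * (of_nat n * f x ^ (n - 1) * g x)) = (\<lambda>x. of_nat (Suc n) * f x ^ (Suc n - 1) * g x)"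
    by (cases n) (auto simp: algebra_simps)
  finally show ?case by simp
qed

lemma ac_eq_deriv: "ac L f g \<Longrightarrow> (\<And>x. g x = g' x) \<Longrightarrow> ac L f g'"
  by (metis ext)

lemmas ac_intros = ac_const ac_add ac_diff ac_minus ac_power ac_mult

text \<open>Conjugating \<open>\<partial>\<^sub>x\<^sup>4\<close> with \<open>exp (\<tau> \<alpha>)\<close> gives \<open>(\<partial>\<^sub>x - \<tau> \<alpha>')\<^sup>4\<close>. The next two expressions are its parts of even and odd
  order, up to terms of lower order when \<open>\<tau>\<close> counts as one derivative; \<open>aj\<close> and \<open>wj\<close> stand for \<open>j\<close>-th
  derivatives of \<open>\<alpha>\<close> and of the conjugated function. The even part is kept formally self-adjoint, because
  it is later paired with a time derivative. The last term of the odd part is of lower order too; without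
  it the coefficient of \<open>w1\<^sup>2\<close> in \<open>commutator\<close> would be negative.\<close>

definition sym_part :: "real \<Rightarrow> real \<Rightarrow> real \<Rightarrow> real \<Rightarrow> real \<Rightarrow> real \<Rightarrow> real \<Rightarrow> real" where
  "sym_part \<tau> a1 a2 w0 w1 w2 w4 = w4 + 6 * \<tau>^2 * a1^2 * w2 + 12 * \<tau>^2 * a1 * a2 * w1 + \<tau>^4 * a1^4 * w0"

definition skew_part :: "real \<Rightarrow> real \<Rightarrow> real \<Rightarrow> real \<Rightarrow> real \<Rightarrow> real \<Rightarrow> real" where
  "skew_part \<tau> a1 a2 w0 w1 w3 = - 4 * \<tau> * a1 * w3 - 4 * \<tau>^3 * a1^3 * w1 - 6 * \<tau>^3 * a1^2 * a2 * w0"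

definition energy :: "real \<Rightarrow> real \<Rightarrow> real \<Rightarrow> real \<Rightarrow> real \<Rightarrow> real" where
  "energy \<tau> w0 w1 w2 w3 = \<tau> * w3^2 + \<tau>^3 * w2^2 + \<tau>^5 * w1^2 + \<tau>^7 * w0^2"

lemma energy_nonneg: "0 \<le> \<tau> \<Longrightarrow> 0 \<le> energy \<tau> w0 w1 w2 w3"
  by (simp add: energy_def)

text \<open>The boundary form left when the products in \<open>2 * sym_part * skew_part\<close> are
  integrated by parts until only squares and lower-order products remain in the interior. Its terms
  have order 7, those with \<open>a2\<close> order 6.\<close>

definition flux :: "real \<Rightarrow> real \<Rightarrow> real \<Rightarrow> real \<Rightarrow> real \<Rightarrow> real \<Rightarrow> real \<Rightarrow> real" where
  "flux \<tau> a1 a2 w0 w1 w2 w3 = - 4 * \<tau> * a1 * w3^2 - 8 * \<tau>^3 * a1^3 * w3 * w1 - 20 * \<tau>^3 * a1^3 * w2^2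
     - 20 * \<tau>^5 * a1^5 * w1^2 - 60 * \<tau>^3 * a1^2 * a2 * w1 * w2 - 8 * \<tau>^5 * a1^5 * w0 * w2
     - 32 * \<tau>^5 * a1^4 * a2 * w0 * w1 - 4 * \<tau>^7 * a1^7 * w0^2 - 12 * \<tau>^3 * a1^2 * a2 * w3 * w0"

text \<open>The interior form of the same integration by parts; for exactly symmetric and
  antisymmetric parts it would represent their commutator. The first line has order 7 and the sign
  of \<open>a2\<close>, the other two have order 6.\<close>

definition commutator :: "real \<Rightarrow> real \<Rightarrow> real \<Rightarrow> real \<Rightarrow> real \<Rightarrow> real \<Rightarrow> real \<Rightarrow> real \<Rightarrow> real" where
  "commutator \<tau> a1 a2 a3 w0 w1 w2 w3 =
     a2 * (4 * \<tau> * w3^2 + 120 * \<tau>^3 * a1^2 * w2^2 + 36 * \<tau>^5 * a1^4 * w1^2 + 16 * \<tau>^7 * a1^6 * w0^2)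
     + (2 * a1 * a2^2 + a1^2 * a3) * (60 * \<tau>^3 * w1 * w2 + 12 * \<tau>^3 * w3 * w0)
     + (32 * a1^4 * a3 - 16 * a1^3 * a2^2) * \<tau>^5 * w0 * w1"

lemma ac_flux:
  assumes a: "ac L a1 a2" "ac L a2 a3" and w: "ac L w0 w1" "ac L w1 w2" "ac L w2 w3" "ac L w3 w4"
  shows "ac L (\<lambda>x. flux \<tau> (a1 x) (a2 x) (w0 x) (w1 x) (w2 x) (w3 x))
    (\<lambda>x. 2 * sym_part \<tau> (a1 x) (a2 x) (w0 x) (w1 x) (w2 x) (w4 x) * skew_part \<tau> (a1 x) (a2 x) (w0 x) (w1 x) (w3 x)
      - commutator \<tau> (a1 x) (a2 x) (a3 x) (w0 x) (w1 x) (w2 x) (w3 x))"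
  unfolding flux_def
  apply (rule ac_eq_deriv)
   apply (rule a w ac_intros)+
  apply (simp add: sym_part_def skew_part_def commutator_def)
  apply algebra
  done

text \<open>Where \<open>\<alpha>''\<close> may be negative, the missing positivity comes from adding the derivative of this flux, with
  a cut-off function \<open>e\<close>: it produces the squares of \<open>w3\<close>, \<open>w2\<close>, \<open>w1\<close> at the price of \<open>w0\<^sup>2\<close>. The fourth
  derivative it contains is expressed by \<open>sym_part\<close>, whose square is available.\<close>

definition local_flux :: "real \<Rightarrow> real \<Rightarrow> real \<Rightarrow> real \<Rightarrow> real \<Rightarrow> real \<Rightarrow> real \<Rightarrow> real \<Rightarrow> real \<Rightarrow> real" where
  "local_flux k1 k2 k3 \<tau> e w0 w1 w2 w3 =
     - e * (k3 * \<tau> * w3 * w2 + k2 * \<tau>^3 * w2 * w1 + k1 * \<tau>^5 * w1 * w0)"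

lemma ac_local_flux:
  assumes "ac L e e'" and w: "ac L w0 w1" "ac L w1 w2" "ac L w2 w3" "ac L w3 w4"
  shows "ac L (\<lambda>x. local_flux k1 k2 k3 \<tau> (e x) (w0 x) (w1 x) (w2 x) (w3 x))
    (\<lambda>x. - e' x * (k3 * \<tau> * w3 x * w2 x + k2 * \<tau>^3 * w2 x * w1 x + k1 * \<tau>^5 * w1 x * w0 x)
      - e x * (k3 * \<tau> * w4 x * w2 x + k3 * \<tau> * (w3 x)^2 + k2 * \<tau>^3 * w3 x * w1 x + k2 * \<tau>^3 * (w2 x)^2
         + k1 * \<tau>^5 * w2 x * w0 x + k1 * \<tau>^5 * (w1 x)^2))"
  unfolding local_flux_def
  apply (rule ac_eq_deriv)
   apply (rule assms ac_intros)+
  apply algebra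
  done

section \<open>Pointwise positivity of the spatial form\<close>

lemma cross_bound:
  fixes c :: real
  assumes "\<bar>c\<bar> \<le> K"
  shows "- (K * (x^2 + y^2)) \<le> c * (x * y)"
proof -
  have "\<bar>x * y\<bar> \<le> x^2 + y^2"
  proof -
    have "2 * \<bar>x * y\<bar> \<le> x^2 + y^2"
      using sum_squares_bound[of "\<bar>x\<bar>" "\<bar>y\<bar>"] by (simp add: abs_mult)
    then show ?thesis by linarith
  qed
  then have "\<bar>c * (x * y)\<bar> \<le> K * (x^2 + y^2)"
    unfolding abs_mult[of c] using assms by (intro mult_mono) auto
  then show ?thesis by linarith
qed

text \<open>The constants are fixed from the highest derivative down. One unit of
  \<open>x3^2\<close> absorbs \<open>x3 * x1\<close> at the price k2^2 / 4 put into
  \<open>k1\<close>; \<open>k2\<close> outweighs 6 k3 b and keeps one unit of \<open>x2^2\<close>,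
  which absorbs \<open>x2 * x0\<close> at a price put into \<open>C\<close>.\<close>

lemma localized_form_bound:
  fixes k A b :: real
  defines "k3 \<equiv> k + 1" and "k2 \<equiv> 6 * A^2 * (k + 1) + k + 1"
  defines "k1 \<equiv> k + k2^2 / 4"
  defines "C \<equiv> k + (k1 + k3 * A^4)^2 / 4"
  assumes k: "0 \<le> k" and b: "0 \<le> b" "b \<le> A^2"
  shows "k * (x3^2 + x2^2 + x1^2 + x0^2) \<le> k3 * x3^2 + (k2 - 6 * k3 * b) * x2^2 + (k1 - k3 * b^2) * (x2 * x0)
     + k2 * (x3 * x1) + k1 * x1^2 + C * x0^2"
proof -
  let ?q = "k1 - k3 * b^2"
  have "0 \<le> (x3 + k2 / 2 * x1)^2" "0 \<le> (x2 + ?q / 2 * x0)^2" by simp_all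
  then have e: "0 \<le> x3^2 + k2 * (x3 * x1) + k2^2 / 4 * x1^2" "0 \<le> x2^2 + ?q * (x2 * x0) + ?q^2 / 4 * x0^2"
    by (simp_all add: power2_eq_square algebra_simps)
  have "6 * k3 * b \<le> 6 * A^2 * (k + 1)"
    using mult_left_mono[OF b(2), of "6 * k3"] k unfolding k3_def by (simp add: algebra_simps)
  then have "(k + 1) * x2^2 \<le> (k2 - 6 * k3 * b) * x2^2"
    by (intro mult_right_mono) (auto simp: k2_def)
  moreover have "?q^2 / 4 * x0^2 \<le> (C - k) * x0^2"
  proof (intro mult_right_mono)
    have b2: "b^2 \<le> A^4" using power_mono[OF b(2,1), of 2] by (simp flip: power_mult)
    have "0 \<le> k1" "0 \<le> k3" using k by (auto simp: k1_def k3_def)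
    then have "\<bar>?q\<bar> \<le> k1 + k3 * A^4"
      using mult_left_mono[OF b2 \<open>0 \<le> k3\<close>] mult_nonneg_nonneg[OF \<open>0 \<le> k3\<close> zero_le_power2[of b]]
      unfolding abs_le_iff by linarith
    then show "?q^2 / 4 \<le> C - k" unfolding C_def using power_mono[of "\<bar>?q\<bar>" _ 2] by fastforce
  qed simp
  ultimately show ?thesis using e by (simp add: k3_def k1_def algebra_simps)
qed

text \<open>Either \<open>a2\<close> and |a1| are bounded below, and the interior form is positive
  by itself, or \<open>e\<close> is at least 1 and the derivative of the local flux outweighs it.
  Both cases yield twice \<open>c\<close> times the energy; one half pays for the terms of order 6,
  whose coefficients add up to \<open>B\<close>.\<close>

lemma carleman_pointwise:
  fixes A c0 :: real
  defines "k \<equiv> 122 * A^7" and "c \<equiv> c0^7"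
  defines "k3 \<equiv> k + 1" and "k2 \<equiv> 6 * A^2 * (k + 1) + k + 1"
  defines "k1 \<equiv> k + k2^2 / 4"
  defines "C \<equiv> k + (k1 + k3 * A^4)^2 / 4"
  defines "B \<equiv> 180 * A^3 + 36 * A^3 + 48 * A^5 + k3^2 * A^2 + 12 * k3 * A^3 + (k1 + k2 + k3) * A"
  assumes A: "1 \<le> A" "0 < c0" "c0 \<le> 1" "B \<le> c * \<tau>" "1 \<le> \<tau>"
    and b: "\<bar>a1\<bar> \<le> A" "\<bar>a2\<bar> \<le> A" "\<bar>a3\<bar> \<le> A" "0 \<le> e" "e \<le> A" "\<bar>e'\<bar> \<le> A"
    and pos: "c0 \<le> a2 \<and> c0 \<le> \<bar>a1\<bar> \<or> 1 \<le> e"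
  shows "2 * sym_part \<tau> a1 a2 w0 w1 w2 w4 * skew_part \<tau> a1 a2 w0 w1 w3 - commutator \<tau> a1 a2 a3 w0 w1 w2 w3
      + (- e' * (k3 * \<tau> * w3 * w2 + k2 * \<tau>^3 * w2 * w1 + k1 * \<tau>^5 * w1 * w0)
      - e * (k3 * \<tau> * w4 * w2 + k3 * \<tau> * w3^2 + k2 * \<tau>^3 * w3 * w1 + k2 * \<tau>^3 * w2^2
         + k1 * \<tau>^5 * w2 * w0 + k1 * \<tau>^5 * w1^2))
    \<le> (sym_part \<tau> a1 a2 w0 w1 w2 w4)^2 + 2 * sym_part \<tau> a1 a2 w0 w1 w2 w4 * skew_part \<tau> a1 a2 w0 w1 w3
      - c * energy \<tau> w0 w1 w2 w3 + C * (e * \<tau>^7 * w0^2)"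
proof -
  \<comment> \<open>Square roots distribute the powers of \<tau>: the energy becomes a sum of four
    squares, and terms of order 6 carry the explicit factor \<open>r\<close>.\<close>
  define \<sigma> where "\<sigma> = sqrt \<tau>"
  define r where "r = 1 / \<tau>"
  have \<tau>: "\<tau> = \<sigma>^2" "0 < \<sigma>" "0 < \<tau>" using A by (auto simp: \<sigma>_def)
  define X3 X2 X1 X0 where "X3 = \<sigma> * w3" and "X2 = \<sigma>^3 * w2" and "X1 = \<sigma>^5 * w1" and "X0 = \<sigma>^7 * w0"
  note Xd = X3_def X2_def X1_def X0_def
  define N where "N = X3^2 + X2^2 + X1^2 + X0^2"
  have sq: "\<tau> * w3^2 = X3^2" "\<tau>^3 * w2^2 = X2^2" "\<tau>^5 * w1^2 = X1^2" "\<tau>^7 * w0^2 = X0^2"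
    "\<tau>^5 * w2 * w0 = X2 * X0" "\<tau>^3 * w3 * w1 = X3 * X1"
    "\<tau>^3 * w1 * w2 = r * (X1 * X2)" "\<tau>^3 * w3 * w0 = r * (X3 * X0)" "\<tau>^5 * w0 * w1 = r * (X0 * X1)"
    "\<tau> * w3 * w2 = r * (X3 * X2)" "\<tau>^2 * w2^2 = r * X2^2"
  proof -
    have r\<tau>: "r * \<tau> = 1" using \<tau>(3) by (simp add: r_def)
    show "\<tau> * w3^2 = X3^2" "\<tau>^3 * w2^2 = X2^2" "\<tau>^5 * w1^2 = X1^2" "\<tau>^7 * w0^2 = X0^2"
      "\<tau>^5 * w2 * w0 = X2 * X0" "\<tau>^3 * w3 * w1 = X3 * X1"
      unfolding Xd \<tau>(1) by (simp_all add: eval_nat_numeral mult_ac)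
    have "\<tau>^3 * w1 * w2 = (r * \<tau>) * (\<tau>^3 * w1 * w2)" "\<tau>^3 * w3 * w0 = (r * \<tau>) * (\<tau>^3 * w3 * w0)"
      "\<tau>^5 * w0 * w1 = (r * \<tau>) * (\<tau>^5 * w0 * w1)" "\<tau> * w3 * w2 = (r * \<tau>) * (\<tau> * w3 * w2)"
      "\<tau>^2 * w2^2 = (r * \<tau>) * (\<tau>^2 * w2^2)"
      unfolding r\<tau> by simp_all
    moreover have "(r * \<tau>) * (\<tau>^3 * w1 * w2) = r * (X1 * X2)" "(r * \<tau>) * (\<tau>^3 * w3 * w0) = r * (X3 * X0)"
      "(r * \<tau>) * (\<tau>^5 * w0 * w1) = r * (X0 * X1)" "(r * \<tau>) * (\<tau> * w3 * w2) = r * (X3 * X2)"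
      "(r * \<tau>) * (\<tau>^2 * w2^2) = r * X2^2"
      unfolding Xd \<tau>(1) by (simp_all add: eval_nat_numeral mult_ac)
    ultimately show "\<tau>^3 * w1 * w2 = r * (X1 * X2)" "\<tau>^3 * w3 * w0 = r * (X3 * X0)" "\<tau>^5 * w0 * w1 = r * (X0 * X1)"
      "\<tau> * w3 * w2 = r * (X3 * X2)" "\<tau>^2 * w2^2 = r * X2^2" by simp_all
  qed
  have N: "energy \<tau> w0 w1 w2 w3 = N" unfolding energy_def N_def sq ..
  have r: "0 < r" "r * B \<le> c" using A \<tau> by (auto simp: r_def field_simps)
  have N0: "0 \<le> N" by (simp add: N_def)
  have k: "0 \<le> k" "0 \<le> k1" "0 \<le> k2" "0 \<le> k3"
    using A by (auto simp: k_def k1_def k2_def k3_def)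
  have pw: "\<bar>a1\<bar>^n \<le> A^n" "1 \<le> A^n" for n using b A by (auto intro: power_mono)
  have a1sq: "0 \<le> a1^2" "a1^2 \<le> A^2" using pw(1)[of 2] by auto
  let ?S = "sym_part \<tau> a1 a2 w0 w1 w2 w4"
  let ?main = "a2 * (4 * X3^2 + 120 * (a1^2 * X2^2) + 36 * (a1^4 * X1^2) + 16 * (a1^6 * X0^2))"
  \<comment> \<open>Expressing w4 through \<open>sym_part\<close> in the product
    \<open>w4 * w2\<close> contributes the coefficients with - 6 a1^2 and - a1^4.\<close>
  let ?loc = "k3 * X3^2 + (k2 - 6 * k3 * a1^2) * X2^2 + (k1 - k3 * (a1^2)^2) * (X2 * X0)
     + k2 * (X3 * X1) + k1 * X1^2 + C * X0^2"
  have loc: "k * N \<le> ?loc"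
    unfolding N_def C_def k1_def k2_def k3_def using k a1sq by (intro localized_form_bound) auto
  have main: "2 * c * N \<le> ?main + e * ?loc"
  proof (cases "1 \<le> e")
    case False
    then have p: "c0 \<le> a2" "c0 \<le> \<bar>a1\<bar>" using pos by auto
    have q: "c0^6 \<le> a1^n" if "even n" "n \<le> 6" for n
    proof -
      have "c0^6 \<le> c0^n" using A that by (intro power_decreasing) auto
      also have "\<dots> \<le> \<bar>a1\<bar>^n" using p A by (intro power_mono) auto
      finally show ?thesis using that by (simp add: power_even_abs)
    qed
    have "2 * c0^6 * N \<le> 4 * X3^2 + 120 * (a1^2 * X2^2) + 36 * (a1^4 * X1^2) + 16 * (a1^6 * X0^2)"
    proof -
      have "c0^6 \<le> 1" using A by (intro power_le_one) auto
      then have "2 * c0^6 * X3^2 \<le> 4 * X3^2" by (intro mult_right_mono) auto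
      moreover have "2 * c0^6 * X2^2 \<le> 120 * a1^2 * X2^2" "2 * c0^6 * X1^2 \<le> 36 * a1^4 * X1^2" "2 * c0^6 * X0^2 \<le> 16 * a1^6 * X0^2"
      proof -
        have "c0^6 \<le> a1^2" "c0^6 \<le> a1^4" "c0^6 \<le> a1^6" using q[of 2] q[of 4] q[of 6] by auto
        moreover have "0 \<le> a1^2" "0 \<le> a1^4" "0 \<le> a1^6" by simp_all
        ultimately have "2 * c0^6 \<le> 120 * a1^2" "2 * c0^6 \<le> 36 * a1^4" "2 * c0^6 \<le> 16 * a1^6" by linarith+
        then show "2 * c0^6 * X2^2 \<le> 120 * a1^2 * X2^2" "2 * c0^6 * X1^2 \<le> 36 * a1^4 * X1^2" "2 * c0^6 * X0^2 \<le> 16 * a1^6 * X0^2"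
          by (intro mult_right_mono; simp)+
      qed
      ultimately show ?thesis by (simp add: N_def algebra_simps)
    qed
    then have "c0 * (2 * c0^6 * N) \<le> ?main"
      using p A N0 by (intro mult_mono) auto
    \<comment> \<open>Origin of \<open>c = c0^7\<close>: one factor from \<open>a2\<close>, six from
      the highest power of \<open>a1\<close>.\<close>
    moreover have "c0 * (2 * c0^6 * N) = 2 * c * N" by (simp add: c_def eval_nat_numeral)
    moreover have "0 \<le> e * ?loc" using b loc k N0 by (intro mult_nonneg_nonneg) (auto intro: order_trans[OF mult_nonneg_nonneg])
    ultimately show ?thesis by linarith
  next
    case True
    have q: "a1^n \<le> A^6" if "even n" "n \<le> 6" for n
    proof -
      have "a1^n \<le> A^n" using pw(1)[of n] that by (simp add: power_even_abs)
      also have "\<dots> \<le> A^6" using A that by (intro power_increasing) auto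
      finally show ?thesis .
    qed
    have le: "4 * X3^2 + 120 * (a1^2 * X2^2) + 36 * (a1^4 * X1^2) + 16 * (a1^6 * X0^2) \<le> 120 * A^6 * N"
    proof -
      have gen: "4 * p + 120 * q + 36 * u + 16 * v \<le> 120 * (p' + q' + u' + v')"
        if "q \<le> q'" "u \<le> u'" "v \<le> v'" "p \<le> p'" "0 \<le> u'" "0 \<le> v'" "0 \<le> p'" for p q u v p' q' u' v' :: real
        using that by argo
      have "a1^2 * X2^2 \<le> A^6 * X2^2" "a1^4 * X1^2 \<le> A^6 * X1^2" "a1^6 * X0^2 \<le> A^6 * X0^2" "X3^2 \<le> A^6 * X3^2"
        "0 \<le> A^6 * X1^2" "0 \<le> A^6 * X0^2" "0 \<le> A^6 * X3^2"
        using q[of 2] q[of 4] q[of 6] mult_right_mono[OF pw(2)[of 6], of "X3^2"] A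
        by (auto intro!: mult_right_mono)
      then have "4 * X3^2 + 120 * (a1^2 * X2^2) + 36 * (a1^4 * X1^2) + 16 * (a1^6 * X0^2)
          \<le> 120 * (A^6 * X3^2 + A^6 * X2^2 + A^6 * X1^2 + A^6 * X0^2)" by (rule gen)
      then show ?thesis by (simp add: N_def algebra_simps)
    qed
    \<comment> \<open>Here \<open>a2\<close> may be negative. Of \<open>k = 122 * A^7\<close>, the
      part 120 A^7 pays for this loss, and 2 A^7 leaves the required 2 c.\<close>
    have "\<bar>?main\<bar> \<le> A * (120 * A^6 * N)"
      unfolding abs_mult using b A le by (intro mult_mono) auto
    moreover have "A * (120 * A^6 * N) = 120 * A^7 * N" by (simp add: eval_nat_numeral)
    moreover have "k * N \<le> e * ?loc"
    proof -
      have "k * N \<le> 1 * ?loc" using loc by simp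
      also have "\<dots> \<le> e * ?loc" using True loc k N0
        by (intro mult_right_mono) (auto intro: order_trans[OF mult_nonneg_nonneg])
      finally show ?thesis .
    qed
    moreover have "k * N = 120 * A^7 * N + 2 * A^7 * N" by (simp add: k_def algebra_simps)
    moreover have "2 * c * N \<le> 2 * A^7 * N"
    proof -
      have "c \<le> 1" unfolding c_def using A by (intro power_le_one) auto
      then show ?thesis using pw(2)[of 7] N0 by (intro mult_right_mono) auto
    qed
    ultimately show ?thesis by linarith
  qed
  let ?m = "2 * a1 * a2^2 + a1^2 * a3" and ?n = "32 * a1^4 * a3 - 16 * a1^3 * a2^2"
  \<comment> \<open>All terms of order 6. The last two stem from expressing w4 through
    \<open>sym_part\<close> and then completing the square of \<open>sym_part\<close>.\<close>
  let ?low = "?m * 60 * (X1 * X2) + ?m * 12 * (X3 * X0) + ?n * (X0 * X1) + e' * k3 * (X3 * X2) + e' * k2 * (X1 * X2)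
    + e' * k1 * (X0 * X1) - 12 * e * k3 * a1 * a2 * (X1 * X2) - (e * k3)^2 / 4 * X2^2"
  have low: "- (B * N) \<le> ?low"
  proof -
    have m: "\<bar>?m\<bar> \<le> 3 * A^3"
    proof -
      have "\<bar>a1\<bar> * \<bar>a2\<bar>^2 \<le> A * A^2" "\<bar>a1\<bar>^2 * \<bar>a3\<bar> \<le> A^2 * A"
        using b A by (intro mult_mono power_mono; simp)+
      moreover have "\<bar>?m\<bar> \<le> 2 * (\<bar>a1\<bar> * \<bar>a2\<bar>^2) + \<bar>a1\<bar>^2 * \<bar>a3\<bar>"
        using abs_triangle_ineq[of "2 * a1 * a2^2" "a1^2 * a3"] by (simp add: abs_mult)
      moreover have "A * A^2 = A^3" "A^2 * A = A^3" by (simp_all add: eval_nat_numeral)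
      ultimately show ?thesis by linarith
    qed
    have n: "\<bar>?n\<bar> \<le> 48 * A^5"
    proof -
      have "\<bar>a1\<bar>^4 * \<bar>a3\<bar> \<le> A^4 * A" "\<bar>a1\<bar>^3 * \<bar>a2\<bar>^2 \<le> A^3 * A^2"
        using b A by (intro mult_mono power_mono; simp)+
      moreover have "\<bar>?n\<bar> \<le> 32 * (\<bar>a1\<bar>^4 * \<bar>a3\<bar>) + 16 * (\<bar>a1\<bar>^3 * \<bar>a2\<bar>^2)"
        using abs_triangle_ineq4[of "32 * a1^4 * a3" "16 * a1^3 * a2^2"] by (simp add: abs_mult power_abs)
      moreover have "A^4 * A = A^5" "A^3 * A^2 = A^5" by (simp_all add: eval_nat_numeral)
      ultimately show ?thesis by linarith
    qed
    have ek: "\<bar>e' * q\<bar> \<le> A * q" if "0 \<le> q" for q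
      using b that by (simp add: abs_mult mult_right_mono)
    have "\<bar>- 12 * e * k3 * a1 * a2\<bar> \<le> 12 * k3 * A^3"
    proof -
      have "(\<bar>e\<bar> * \<bar>a1\<bar>) * \<bar>a2\<bar> \<le> (A * A) * A"
        using b A by (intro mult_mono) auto
      then have "12 * k3 * ((\<bar>e\<bar> * \<bar>a1\<bar>) * \<bar>a2\<bar>) \<le> 12 * k3 * ((A * A) * A)"
        using k by (intro mult_left_mono) auto
      then show ?thesis using k by (simp add: abs_mult eval_nat_numeral mult_ac)
    qed
    note t7 = cross_bound[OF this, of X1 X2]
    have "(e * k3)^2 / 4 * X2^2 \<le> k3^2 * A^2 * X2^2"
    proof (intro mult_right_mono)
      have "(e * k3)^2 \<le> (A * k3)^2" using b k A by (intro power_mono mult_right_mono) auto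
      also have "\<dots> = k3^2 * A^2" by (simp add: power_mult_distrib)
      finally have "(e * k3)^2 \<le> k3^2 * A^2" .
      moreover have "0 \<le> (e * k3)^2" by simp
      ultimately show "(e * k3)^2 / 4 \<le> k3^2 * A^2" by linarith
    qed simp
    moreover have "\<bar>?m * 60\<bar> \<le> 180 * A^3" "\<bar>?m * 12\<bar> \<le> 36 * A^3" using m by (auto simp: abs_mult)
    note t1 = cross_bound[OF this(1), of X1 X2] and t2 = cross_bound[OF this(2), of X3 X0]
    note t3 = cross_bound[OF n, of X0 X1] and t4 = cross_bound[OF ek[OF k(4)], of X3 X2]
      and t5 = cross_bound[OF ek[OF k(3)], of X1 X2] and t6 = cross_bound[OF ek[OF k(2)], of X0 X1]
    have up: "K * (x^2 + y^2) \<le> K * N" if "0 \<le> K" "x^2 + y^2 \<le> N" for K x y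
      using that by (intro mult_left_mono)
    have pairs: "X1^2 + X2^2 \<le> N" "X3^2 + X0^2 \<le> N" "X0^2 + X1^2 \<le> N" "X3^2 + X2^2 \<le> N" "X2^2 \<le> N"
      by (auto simp: N_def)
    have Kp: "0 \<le> 180 * A^3" "0 \<le> 36 * A^3" "0 \<le> 48 * A^5" "0 \<le> A * k3" "0 \<le> A * k2" "0 \<le> A * k1" "0 \<le> 12 * k3 * A^3"
      using A k by auto
    have "k3^2 * A^2 * X2^2 \<le> k3^2 * A^2 * N" using pairs by (intro mult_left_mono) auto
    moreover have "B * N = 180 * A^3 * N + 36 * A^3 * N + 48 * A^5 * N + k3^2 * A^2 * N + 12 * k3 * A^3 * N
        + A * k1 * N + A * k2 * N + A * k3 * N"
      by (simp add: B_def algebra_simps)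
    ultimately show ?thesis
      using t1 t2 t3 t4 t5 t6 t7 up[OF Kp(1) pairs(1)] up[OF Kp(2) pairs(2)] up[OF Kp(3) pairs(3)]
        up[OF Kp(4) pairs(4)] up[OF Kp(5) pairs(1)] up[OF Kp(6) pairs(3)] up[OF Kp(7) pairs(1)]
      by linarith
  qed
  have rlow: "- (c * N) \<le> r * ?low"
  proof -
    have "r * (- (B * N)) \<le> r * ?low" using low r by (intro mult_left_mono) auto
    moreover have "(r * B) * N \<le> c * N" using r N0 by (intro mult_right_mono)
    ultimately show ?thesis by (simp add: mult.assoc)
  qed
  have "?S^2 + commutator \<tau> a1 a2 a3 w0 w1 w2 w3 - c * energy \<tau> w0 w1 w2 w3 + C * (e * \<tau>^7 * w0^2)
      - (- e' * (k3 * \<tau> * w3 * w2 + k2 * \<tau>^3 * w2 * w1 + k1 * \<tau>^5 * w1 * w0)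
      - e * (k3 * \<tau> * w4 * w2 + k3 * \<tau> * w3^2 + k2 * \<tau>^3 * w3 * w1 + k2 * \<tau>^3 * w2^2
         + k1 * \<tau>^5 * w2 * w0 + k1 * \<tau>^5 * w1^2))
    = (?S + e * k3 * \<tau> * w2 / 2)^2 + (?main + e * ?loc) + r * ?low - c * N"
  proof -
    have "?S^2 + commutator \<tau> a1 a2 a3 w0 w1 w2 w3 + C * (e * \<tau>^7 * w0^2)
      - (- e' * (k3 * \<tau> * w3 * w2 + k2 * \<tau>^3 * w2 * w1 + k1 * \<tau>^5 * w1 * w0)
      - e * (k3 * \<tau> * w4 * w2 + k3 * \<tau> * w3^2 + k2 * \<tau>^3 * w3 * w1 + k2 * \<tau>^3 * w2^2
         + k1 * \<tau>^5 * w2 * w0 + k1 * \<tau>^5 * w1^2))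
      = (?S + e * k3 * \<tau> * w2 / 2)^2
        + a2 * (4 * (\<tau> * w3^2) + 120 * (a1^2 * (\<tau>^3 * w2^2)) + 36 * (a1^4 * (\<tau>^5 * w1^2)) + 16 * (a1^6 * (\<tau>^7 * w0^2)))
        + e * (k3 * (\<tau> * w3^2) + (k2 - 6 * k3 * a1^2) * (\<tau>^3 * w2^2) + (k1 - k3 * (a1^2)^2) * (\<tau>^5 * w2 * w0)
          + k2 * (\<tau>^3 * w3 * w1) + k1 * (\<tau>^5 * w1^2) + C * (\<tau>^7 * w0^2))
        + (?m * 60 * (\<tau>^3 * w1 * w2) + ?m * 12 * (\<tau>^3 * w3 * w0) + ?n * (\<tau>^5 * w0 * w1)
          + e' * k3 * (\<tau> * w3 * w2) + e' * k2 * (\<tau>^3 * w1 * w2) + e' * k1 * (\<tau>^5 * w0 * w1)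
          - 12 * e * k3 * a1 * a2 * (\<tau>^3 * w1 * w2) - (e * k3)^2 / 4 * (\<tau>^2 * w2^2))"
      unfolding sym_part_def commutator_def by (simp add: field_simps) algebra
    then show ?thesis unfolding sq N by (simp add: algebra_simps)
  qed
  moreover have "0 \<le> (?S + e * k3 * \<tau> * w2 / 2)^2" by simp
  ultimately show ?thesis using main rlow by linarith
qed

text \<open>For w = 0 the flux is - \<tau> a1 P with a positive definite form P in w1, w2, w3, plus
  one term with \<open>a2\<close>. The bound on \<tau> makes that term at most 30 \<tau> |a1| x y,
  and P \<ge> 16 x^2 + 20 y^2 \<ge> 30 x y absorbs it, so the sign of \<open>a1\<close>
  decides.\<close>

lemma flux_boundary:
  assumes "1 \<le> \<tau>" "0 < c0" "c0 \<le> \<bar>a1\<bar>" "\<bar>a2\<bar> \<le> A" "2 * A \<le> c0^2 * \<tau>"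
  shows "a1 < 0 \<Longrightarrow> 0 \<le> flux \<tau> a1 a2 0 w1 w2 w3" "a1 > 0 \<Longrightarrow> flux \<tau> a1 a2 0 w1 w2 w3 \<le> 0"
proof -
  define b where "b = \<bar>a1\<bar>"
  define x y where "x = \<tau>^2 * b^2 * \<bar>w1\<bar>" and "y = \<tau> * b * \<bar>w2\<bar>"
  define P where "P = 4 * w3^2 + 8 * \<tau>^2 * b^2 * w3 * w1 + 20 * \<tau>^2 * b^2 * w2^2 + 20 * \<tau>^4 * b^4 * w1^2"
  have b: "0 < b" "b^2 = a1^2" "b^4 = a1^4" using assms by (auto simp: b_def power_even_abs)
  have "P = 4 * (w3 + \<tau>^2 * b^2 * w1)^2 + 16 * x^2 + 20 * y^2"
    by (simp add: P_def x_def y_def power_mult_distrib power2_sum algebra_simps flip: power_mult power_add)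
  then have "16 * x^2 + 20 * y^2 \<le> P" by simp
  moreover have "2 * (x * y) \<le> x^2 + y^2" using sum_squares_bound[of x y] by simp
  moreover have "0 \<le> y^2" "0 \<le> x * y" using assms b by (auto simp: x_def y_def)
  ultimately have "30 * (x * y) \<le> P" by linarith
  then have "\<tau> * b * (30 * (x * y)) \<le> \<tau> * b * P" using assms b by (intro mult_left_mono) auto
  moreover have "\<bar>60 * \<tau>^3 * a1^2 * a2 * w1 * w2\<bar> \<le> \<tau> * b * (30 * (x * y))"
  proof -
    have "2 * \<bar>a2\<bar> \<le> b^2 * \<tau>"
    proof -
      have "c0^2 \<le> b^2" using assms by (intro power_mono) (auto simp: b_def)
      then have "c0^2 * \<tau> \<le> b^2 * \<tau>" using assms by (intro mult_right_mono) auto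
      then show ?thesis using assms by linarith
    qed
    then have "(30 * \<tau>^3 * b^2 * \<bar>w1\<bar> * \<bar>w2\<bar>) * (2 * \<bar>a2\<bar>) \<le> (30 * \<tau>^3 * b^2 * \<bar>w1\<bar> * \<bar>w2\<bar>) * (b^2 * \<tau>)"
      using assms by (intro mult_left_mono) auto
    moreover have "\<bar>60 * \<tau>^3 * a1^2 * a2 * w1 * w2\<bar> = (30 * \<tau>^3 * b^2 * \<bar>w1\<bar> * \<bar>w2\<bar>) * (2 * \<bar>a2\<bar>)"
      using assms by (simp add: abs_mult b(2))
    moreover have "(30 * \<tau>^3 * b^2 * \<bar>w1\<bar> * \<bar>w2\<bar>) * (b^2 * \<tau>) = \<tau> * b * (30 * (x * y))"
      by (simp add: x_def y_def eval_nat_numeral mult_ac)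
    ultimately show ?thesis by simp
  qed
  ultimately have le: "\<bar>60 * \<tau>^3 * a1^2 * a2 * w1 * w2\<bar> \<le> \<tau> * b * P" by linarith
  have "flux \<tau> a1 a2 0 w1 w2 w3 = - (\<tau> * a1 * P) - 60 * \<tau>^3 * a1^2 * a2 * w1 * w2"
    unfolding flux_def P_def b by (simp add: algebra_simps eval_nat_numeral)
  then show "a1 < 0 \<Longrightarrow> 0 \<le> flux \<tau> a1 a2 0 w1 w2 w3" "a1 > 0 \<Longrightarrow> flux \<tau> a1 a2 0 w1 w2 w3 \<le> 0"
    using le by (auto simp: b_def)
qed

lemma ac_continuous_set_integrable: "continuous_on {0..L} f \<Longrightarrow> set_integrable lborel {0..L::real} (f :: real \<Rightarrow> real)"
  by (rule borel_integrable_atLeastAtMost')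

text \<open>The quantifier order matters: the constants depend on \<open>A\<close> and
  \<open>c0\<close> only, and the same ones serve every large \<tau>, hence all times at
  once.\<close>

lemma carleman_slice_ex:
  fixes A c0 :: real
  assumes A: "1 \<le> A" and c0: "0 < c0" "c0 \<le> 1"
  shows "\<exists>c>0. \<exists>C>0. \<exists>\<tau>0\<ge>1. \<forall>\<tau>\<ge>\<tau>0. \<forall>L a1 a2 a3 e e' w0 w1 w2 w3 w4.
    0 < L \<longrightarrow> ac L a1 a2 \<longrightarrow> ac L a2 a3 \<longrightarrow> ac L e e' \<longrightarrow>
    (\<forall>x\<in>{0..L}. \<bar>a1 x\<bar> \<le> A \<and> \<bar>a2 x\<bar> \<le> A \<and> \<bar>a3 x\<bar> \<le> A \<and> 0 \<le> e x \<and> e x \<le> A \<and> \<bar>e' x\<bar> \<le> A \<and>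
      (c0 \<le> a2 x \<and> c0 \<le> \<bar>a1 x\<bar> \<or> 1 \<le> e x)) \<longrightarrow>
    0 < a1 0 \<longrightarrow> a1 L < 0 \<longrightarrow> e 0 = 0 \<longrightarrow> e L = 0 \<longrightarrow>
    ac L w0 w1 \<longrightarrow> ac L w1 w2 \<longrightarrow> ac L w2 w3 \<longrightarrow> ac L w3 w4 \<longrightarrow> set_integrable lborel {0..L} (\<lambda>x. (w4 x)^2) \<longrightarrow>
    w0 0 = 0 \<longrightarrow> w0 L = 0 \<longrightarrow>
    0 \<le> (LINT x:{0..L}|lborel. (sym_part \<tau> (a1 x) (a2 x) (w0 x) (w1 x) (w2 x) (w4 x))^2
      + 2 * sym_part \<tau> (a1 x) (a2 x) (w0 x) (w1 x) (w2 x) (w4 x) * skew_part \<tau> (a1 x) (a2 x) (w0 x) (w1 x) (w3 x)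
      - c * energy \<tau> (w0 x) (w1 x) (w2 x) (w3 x) + C * (e x * \<tau>^7 * (w0 x)^2))"
proof -
  define k where "k = 122 * A^7"
  define c where "c = c0^7"
  define k3 where "k3 = k + 1"
  define k2 where "k2 = 6 * A^2 * (k + 1) + k + 1"
  define k1 where "k1 = k + k2^2 / 4"
  define C where "C = k + (k1 + k3 * A^4)^2 / 4"
  define B where "B = 180 * A^3 + 36 * A^3 + 48 * A^5 + k3^2 * A^2 + 12 * k3 * A^3 + (k1 + k2 + k3) * A"
  note defs = k_def c_def k3_def k2_def k1_def C_def B_def
  \<comment> \<open>The second entry absorbs the terms of order 6 in the interior, the third those
    at the boundary.\<close>
  define \<tau>0 where "\<tau>0 = Max {1, B / c, 2 * A / c0^2}"
  have c: "0 < c" using c0 by (simp add: c_def)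
  have "0 < k" using A by (simp add: k_def)
  then have C: "0 < C" unfolding C_def by (intro add_pos_nonneg) auto
  have \<tau>0: "1 \<le> \<tau>0" by (simp add: \<tau>0_def)
  show ?thesis
  proof (rule exI[of _ c], intro conjI c, rule exI[of _ C], intro conjI C, rule exI[of _ \<tau>0], intro conjI \<tau>0 allI impI)
    fix \<tau> L a1 a2 a3 e e' w0 w1 w2 w3 w4
    assume \<tau>: "\<tau>0 \<le> \<tau>" and L: "0 < L" and a: "ac L a1 a2" "ac L a2 a3" and e: "ac L e e'"
      and b: "\<forall>x\<in>{0..L}. \<bar>a1 x\<bar> \<le> A \<and> \<bar>a2 x\<bar> \<le> A \<and> \<bar>a3 x\<bar> \<le> A \<and> 0 \<le> e x \<and> e x \<le> A \<and> \<bar>e' x\<bar> \<le> A \<and>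
        (c0 \<le> a2 x \<and> c0 \<le> \<bar>a1 x\<bar> \<or> 1 \<le> e x)"
      and bd: "0 < a1 0" "a1 L < 0" "e 0 = 0" "e L = 0"
      and w: "ac L w0 w1" "ac L w1 w2" "ac L w2 w3" "ac L w3 w4"
      and w4: "set_integrable lborel {0..L} (\<lambda>x. (w4 x)^2)" and w0: "w0 0 = 0" "w0 L = 0"
    have \<tau>': "1 \<le> \<tau>" "B \<le> c * \<tau>" "2 * A \<le> c0^2 * \<tau>"
      using \<tau> c c0 by (auto simp: \<tau>0_def field_simps)
    let ?S = "\<lambda>x. sym_part \<tau> (a1 x) (a2 x) (w0 x) (w1 x) (w2 x) (w4 x)"
    let ?s = "\<lambda>x. sym_part \<tau> (a1 x) (a2 x) (w0 x) (w1 x) (w2 x) 0"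
    let ?A = "\<lambda>x. skew_part \<tau> (a1 x) (a2 x) (w0 x) (w1 x) (w3 x)"
    let ?I = "\<lambda>x. (?S x)^2 + 2 * ?S x * ?A x - c * energy \<tau> (w0 x) (w1 x) (w2 x) (w3 x) + C * (e x * \<tau>^7 * (w0 x)^2)"
    let ?F = "\<lambda>x. flux \<tau> (a1 x) (a2 x) (w0 x) (w1 x) (w2 x) (w3 x)
      + local_flux k1 k2 k3 \<tau> (e x) (w0 x) (w1 x) (w2 x) (w3 x)"
    note ac = ac_add[OF ac_flux[OF a w, of \<tau>] ac_local_flux[OF e w, of k1 k2 k3 \<tau>]]
    have cont: "continuous_on {0..L} a1" "continuous_on {0..L} a2" "continuous_on {0..L} e"
      "continuous_on {0..L} w0" "continuous_on {0..L} w1" "continuous_on {0..L} w2" "continuous_on {0..L} w3"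
      using a e w ac_continuous by blast+
    \<comment> \<open>As w4 is merely square integrable, the integrand is expanded into w4^2, a
      continuous multiple of w4 and a continuous rest.\<close>
    have iI: "set_integrable lborel {0..L} ?I"
    proof -
      have h1: "set_integrable lborel {0..L} (\<lambda>x. (2 * ?s x + 2 * ?A x) * w4 x)"
        by (intro set_integrable_mult_continuous ac_integrable[OF w(4)])
          (auto simp: sym_part_def skew_part_def intro!: continuous_intros cont)
      have h2: "set_integrable lborel {0..L} (\<lambda>x. (?s x)^2 + 2 * ?s x * ?A x
          - c * energy \<tau> (w0 x) (w1 x) (w2 x) (w3 x) + C * (e x * \<tau>^7 * (w0 x)^2))"
        by (intro ac_continuous_set_integrable)
          (auto simp: sym_part_def skew_part_def energy_def intro!: continuous_intros cont)
      have "set_integrable lborel {0..L} (\<lambda>x. (w4 x)^2 + (2 * ?s x + 2 * ?A x) * w4 x + ((?s x)^2 + 2 * ?s x * ?A x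
          - c * energy \<tau> (w0 x) (w1 x) (w2 x) (w3 x) + C * (e x * \<tau>^7 * (w0 x)^2)))"
        by (rule set_integral_add(1)[OF set_integral_add(1)[OF w4 h1] h2])
      moreover have "?S x = w4 x + ?s x" for x by (simp add: sym_part_def)
      ultimately show ?thesis by (simp add: power2_sum algebra_simps)
    qed
    have "0 \<in> {0..L}" "L \<in> {0..L}" using L by auto
    then have e0: "c0 \<le> \<bar>a1 0\<bar>" "c0 \<le> \<bar>a1 L\<bar>" "\<bar>a2 0\<bar> \<le> A" "\<bar>a2 L\<bar> \<le> A" using b bd by force+
    \<comment> \<open>The slope \<open>a1\<close> is positive at 0 and negative at L, which fixes
      both signs; the local flux is absent because \<open>e\<close> vanishes there.\<close>
    have "?F 0 \<le> 0" "0 \<le> ?F L"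
      using flux_boundary(2)[OF \<tau>'(1) c0(1) e0(1,3) \<tau>'(3) bd(1)] flux_boundary(1)[OF \<tau>'(1) c0(1) e0(2,4) \<tau>'(3) bd(2)]
      by (auto simp: local_flux_def bd w0)
    then have "0 \<le> ?F L - ?F 0" by linarith
    also have "\<dots> = (LINT x:{0..L}|lborel. 2 * ?S x * ?A x
      - commutator \<tau> (a1 x) (a2 x) (a3 x) (w0 x) (w1 x) (w2 x) (w3 x)
      + (- e' x * (k3 * \<tau> * w3 x * w2 x + k2 * \<tau>^3 * w2 x * w1 x + k1 * \<tau>^5 * w1 x * w0 x)
      - e x * (k3 * \<tau> * w4 x * w2 x + k3 * \<tau> * (w3 x)^2 + k2 * \<tau>^3 * w3 x * w1 x + k2 * \<tau>^3 * (w2 x)^2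
         + k1 * \<tau>^5 * w2 x * w0 x + k1 * \<tau>^5 * (w1 x)^2)))"
      using ac_ftc[OF ac] L by simp
    also have "\<dots> \<le> (LINT x:{0..L}|lborel. ?I x)"
    proof (rule set_integral_mono[OF ac_integrable[OF ac] iI])
      fix x assume x: "x \<in> {0..L}"
      have bx: "\<bar>a1 x\<bar> \<le> A" "\<bar>a2 x\<bar> \<le> A" "\<bar>a3 x\<bar> \<le> A" "0 \<le> e x" "e x \<le> A" "\<bar>e' x\<bar> \<le> A"
        "c0 \<le> a2 x \<and> c0 \<le> \<bar>a1 x\<bar> \<or> 1 \<le> e x" using b x by auto
      show "2 * ?S x * ?A x - commutator \<tau> (a1 x) (a2 x) (a3 x) (w0 x) (w1 x) (w2 x) (w3 x)
        + (- e' x * (k3 * \<tau> * w3 x * w2 x + k2 * \<tau>^3 * w2 x * w1 x + k1 * \<tau>^5 * w1 x * w0 x)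
        - e x * (k3 * \<tau> * w4 x * w2 x + k3 * \<tau> * (w3 x)^2 + k2 * \<tau>^3 * w3 x * w1 x + k2 * \<tau>^3 * (w2 x)^2
         + k1 * \<tau>^5 * w2 x * w0 x + k1 * \<tau>^5 * (w1 x)^2)) \<le> ?I x"
        unfolding C_def c_def k1_def k2_def k3_def k_def
        by (rule carleman_pointwise[OF A c0 _ \<tau>'(1) bx])
          (use \<tau>'(2) in \<open>simp add: B_def c_def k1_def k2_def k3_def k_def\<close>)
    qed
    finally show "0 \<le> (LINT x:{0..L}|lborel. ?I x)" .
  qed
qed

section \<open>The weight in time\<close>

definition tau :: "real \<Rightarrow> real \<Rightarrow> real \<Rightarrow> real" where
  "tau T lam t = lam / (t * (T - t))"

text \<open>Chosen such that \<tau>' = \<sigma> \<tau>^2 inside the time interval, with |\<sigma>|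
  \<le> T / lam there: a time derivative of the weight costs a power of \<tau> but gains 1 /
  lam.\<close>

definition sigma :: "real \<Rightarrow> real \<Rightarrow> real \<Rightarrow> real" where
  "sigma T lam t = - (T - 2 * t) / lam"

text \<open>For \<open>a < 0\<close> this is the smooth extension of exp (\<tau> a), flat at both
  end points; this removes all boundary terms in time.\<close>

definition time_weight :: "real \<Rightarrow> real \<Rightarrow> real \<Rightarrow> real \<Rightarrow> real" where
  "time_weight T lam a t = (if 0 < t \<and> t < T then exp (tau T lam t * a) else 0)"

text \<open>Partial fractions of \<open>1 / (t (T - t))\<close> reduce the behaviour at both end points to that of
  \<open>exp (- e / x)\<close> at \<open>0\<close>.\<close>

lemma time_weight_exp_flat:
  assumes "0 < T" "0 < lam" "a < 0"
  shows "tau T lam t ^ k * time_weight T lam a t =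
    lam ^ k * (exp_flat (- (lam * a) / T) (monom 1 k) t * exp_flat (- (lam * a) / T) (monom 1 k) (T - t))"
proof (cases "0 < t \<and> t < T")
  case True
  have "tau T lam t * a = - (- (lam * a) / T / t) + - (- (lam * a) / T / (T - t))"
    using True by (simp add: tau_def field_simps)
  then have "exp (tau T lam t * a) = exp (- (- (lam * a) / T / t)) * exp (- (- (lam * a) / T / (T - t)))"
    by (simp only: exp_add)
  moreover have "tau T lam t ^ k = lam ^ k * ((1 / t) ^ k * (1 / (T - t)) ^ k)"
    by (simp add: tau_def power_divide power_mult_distrib)
  ultimately show ?thesis using True
    by (simp add: time_weight_def exp_flat_def poly_monom)
qed (auto simp: time_weight_def exp_flat_def)

text \<open>Inside the interval this is the chain rule with \<tau>' = \<sigma> \<tau>^2. The detour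
  through flat exponentials gives differentiability at the end points as well, where \<tau> blows
  up.\<close>

lemma time_weight_deriv:
  assumes "0 < T" "0 < lam" "a < 0"
  shows "((\<lambda>t. tau T lam t ^ k * time_weight T lam a t) has_real_derivative
    sigma T lam t * (real k * tau T lam t ^ (k + 1) + a * tau T lam t ^ (k + 2)) * time_weight T lam a t) (at t)"
proof -
  define b where "b = - (lam * a) / T"
  have b: "0 < b" using assms by (simp add: b_def divide_neg_pos mult_pos_neg)
  let ?p = "monom 1 k :: real poly"
  define q where "q = [:0,0,1:] * (smult b ?p - pderiv ?p)"
  have d: "((\<lambda>t. exp_flat b ?p (T - t)) has_real_derivative - exp_flat b q (T - t)) (at t)"
    by (rule DERIV_chain2[of "exp_flat b ?p", THEN DERIV_cong, OF exp_flat_deriv[OF b, of ?p, folded q_def]])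
      (auto intro!: derivative_eq_intros)
  have "((\<lambda>t. lam ^ k * (exp_flat b ?p t * exp_flat b ?p (T - t))) has_real_derivative
      lam ^ k * (exp_flat b q t * exp_flat b ?p (T - t) + - exp_flat b q (T - t) * exp_flat b ?p t)) (at t)"
    by (intro DERIV_cmult DERIV_mult exp_flat_deriv[OF b, of ?p, folded q_def] d)
  moreover have "lam ^ k * (exp_flat b q t * exp_flat b ?p (T - t) + - exp_flat b q (T - t) * exp_flat b ?p t)
    = sigma T lam t * (real k * tau T lam t ^ (k + 1) + a * tau T lam t ^ (k + 2)) * time_weight T lam a t"
  proof (cases "0 < t \<and> t < T")
    case True
    \<comment> \<open>With these variables T u v = u + v and (T - 2 t) u v = u - v. The two flat
      exponentials produce b (u + v) (u - v), and T b = - lam a turns this into a multiple of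
      \<sigma> \<tau>^2.\<close>
    define u v e where "u = 1 / t" and "v = 1 / (T - t)" and "e = exp (- (b / t)) * exp (- (b / (T - t)))"
    have uv: "T * u * v = u + v" "0 < u" "0 < v" "(T - 2 * t) * (u * v) = u - v"
      using True by (auto simp: u_def v_def field_simps)
    have e: "time_weight T lam a t = e"
      using time_weight_exp_flat[OF assms, of t 0] True by (simp add: e_def exp_flat_def b_def)
    have tu: "tau T lam t = lam * (u * v)" by (simp add: tau_def u_def v_def)
    have pq: "exp_flat b ?p t * exp_flat b q (T - t) = u^k * poly q v * e" "exp_flat b q t * exp_flat b ?p (T - t) = poly q u * v^k * e"
      using True by (auto simp: exp_flat_def e_def u_def v_def poly_monom)
    have qx: "poly q x = b * x ^ (k + 2) - real k * x ^ (k + 1)" for x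
      by (cases k) (simp_all add: q_def pderiv_monom poly_monom algebra_simps power2_eq_square)
    have bT: "T * b = - (lam * a)" using assms by (simp add: b_def)
    have s: "sigma T lam t * (lam * (u * v)) = - (u - v)"
    proof -
      have "sigma T lam t * (lam * (u * v)) = - ((T - 2 * t) * (u * v))"
        using assms(2) by (simp add: sigma_def minus_mult_left)
      then show ?thesis using uv(4) by simp
    qed
    have "lam ^ k * (exp_flat b q t * exp_flat b ?p (T - t) + - exp_flat b q (T - t) * exp_flat b ?p t)
      = lam ^ k * (u * v) ^ k * e * (b * (u + v) * (u - v) - real k * (u - v))"
    proof -
      have "lam ^ k * (exp_flat b q t * exp_flat b ?p (T - t) + - exp_flat b q (T - t) * exp_flat b ?p t)
        = lam ^ k * (poly q u * v^k * e - u^k * poly q v * e)"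
        using pq by (simp add: mult.commute)
      then show ?thesis by (simp add: qx power_mult_distrib algebra_simps power2_eq_square)
    qed
    also have "b * (u + v) = - (lam * a) * (u * v)" using bT uv(1) by (metis mult.assoc mult.commute)
    also have "lam ^ k * (u * v) ^ k * e * (- (lam * a) * (u * v) * (u - v) - real k * (u - v))
      = (sigma T lam t * (lam * (u * v))) * (real k + a * (lam * (u * v))) * (lam * (u * v)) ^ k * e"
      unfolding s by (simp add: algebra_simps power_mult_distrib)
    also have "\<dots> = sigma T lam t * (real k * tau T lam t ^ (k + 1) + a * tau T lam t ^ (k + 2)) * time_weight T lam a t"
      unfolding e tu by (simp add: algebra_simps power2_eq_square)
    finally show ?thesis .
  next
    case False
    then have "exp_flat b q t * exp_flat b ?p (T - t) = 0" "exp_flat b q (T - t) * exp_flat b ?p t = 0"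
      "time_weight T lam a t = 0"
      by (auto simp: exp_flat_def time_weight_def)
    then show ?thesis by (simp only: mult_zero_right mult_minus_left add_0 minus_zero)
  qed
  ultimately show ?thesis
    unfolding time_weight_exp_flat[OF assms] b_def by simp
qed

lemma time_weight_ac:
  assumes "0 < T" "0 < lam" "a < 0"
  shows "ac T (\<lambda>t. tau T lam t ^ k * time_weight T lam a t)
    (\<lambda>t. sigma T lam t * (real k * tau T lam t ^ (k + 1) + a * tau T lam t ^ (k + 2)) * time_weight T lam a t)"
proof (rule ac_C1)
  show "((\<lambda>t. tau T lam t ^ k * time_weight T lam a t) has_real_derivative
    sigma T lam t * (real k * tau T lam t ^ (k + 1) + a * tau T lam t ^ (k + 2)) * time_weight T lam a t) (at t within {0..T})" for t
    by (rule has_field_derivative_at_within[OF time_weight_deriv[OF assms]])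
  have c: "continuous_on {0..T} (\<lambda>t. tau T lam t ^ k * time_weight T lam a t)" for k
    by (rule DERIV_continuous_on) (rule has_field_derivative_at_within[OF time_weight_deriv[OF assms]])
  have "continuous_on {0..T} (\<lambda>t. sigma T lam t * (real k * (tau T lam t ^ (k + 1) * time_weight T lam a t)
      + a * (tau T lam t ^ (k + 2) * time_weight T lam a t)))"
    unfolding sigma_def using assms by (intro continuous_intros c) auto
  then show "continuous_on {0..T} (\<lambda>t. sigma T lam t * (real k * tau T lam t ^ (k + 1) + a * tau T lam t ^ (k + 2)) * time_weight T lam a t)"
    by (simp add: algebra_simps)
qed

text \<open>A single term of the exponential series gives (m x)^k / k! \<le> exp (m x) for x \<ge>
  0, applied with x = \<tau>.\<close>

lemma time_weight_bounded:
  assumes "0 < m" "a \<le> - m" "0 < lam"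
  shows "0 \<le> tau T lam t ^ k * time_weight T lam a t" "tau T lam t ^ k * time_weight T lam a t \<le> fact k / m ^ k"
proof -
  have "0 \<le> tau T lam t ^ k * time_weight T lam a t \<and> tau T lam t ^ k * time_weight T lam a t \<le> fact k / m ^ k"
  proof (cases "0 < t \<and> t < T")
    case True
    define x where "x = tau T lam t"
    have x: "0 \<le> x" using True assms by (simp add: x_def tau_def)
    have "(m * x) ^ k / fact k \<le> exp (m * x)"
    proof -
      have "sum (\<lambda>n. (m * x) ^ n /\<^sub>R fact n) {k} \<le> suminf (\<lambda>n. (m * x) ^ n /\<^sub>R fact n)"
        using x assms by (intro sum_le_suminf sums_summable[OF exp_converges]) auto
      then show ?thesis by (simp add: exp_def divide_inverse mult.commute)
    qed
    then have "x ^ k * m ^ k \<le> fact k * exp (m * x)"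
      by (simp add: field_simps power_mult_distrib)
    moreover have "exp (x * a) \<le> exp (- (m * x))"
      using mult_left_mono[OF assms(2) x] by (simp add: mult.commute)
    ultimately have "x ^ k * m ^ k * exp (x * a) \<le> fact k * exp (m * x) * exp (- (m * x))"
      by (rule mult_mono) (use x assms in auto)
    then have "x ^ k * exp (x * a) * m ^ k \<le> fact k" by (simp add: exp_minus algebra_simps)
    then have "x ^ k * exp (x * a) \<le> fact k / m ^ k" using assms by (simp add: pos_le_divide_eq)
    then show ?thesis using True x by (simp add: time_weight_def x_def)
  qed (use assms in \<open>auto simp: time_weight_def\<close>)
  then show "0 \<le> tau T lam t ^ k * time_weight T lam a t" "tau T lam t ^ k * time_weight T lam a t \<le> fact k / m ^ k" by auto
qed

text \<open>Extension by constants makes a representative continuous on the whole line and hence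
  Borel, as exchanging derivatives almost everywhere requires.\<close>

lemma ac_clamp:
  assumes "ac L p g" "0 \<le> L"
  shows "\<exists>q. ac L q g \<and> continuous_on UNIV q \<and> (\<forall>x\<in>{0..L}. q x = p x)"
proof -
  define q where "q x = p (max 0 (min L x))" for x
  have "continuous_on UNIV q" unfolding q_def
    by (intro continuous_on_compose2[OF ac_continuous[OF assms(1)]] continuous_intros) (use assms in auto)
  moreover have "\<forall>x\<in>{0..L}. q x = p x" by (auto simp: q_def)
  ultimately show ?thesis using ac_cong[of L p q g] assms(1) by metis
qed

section \<open>Conjugation with the weight\<close>

definition conj1 :: "real \<Rightarrow> real \<Rightarrow> real \<Rightarrow> real \<Rightarrow> real" where
  "conj1 \<tau> a1 v0 v1 = v1 + \<tau> * a1 * v0"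

definition conj2 :: "real \<Rightarrow> real \<Rightarrow> real \<Rightarrow> real \<Rightarrow> real \<Rightarrow> real \<Rightarrow> real" where
  "conj2 \<tau> a1 a2 v0 v1 v2 = v2 + 2 * \<tau> * a1 * v1 + (\<tau>^2 * a1^2 + \<tau> * a2) * v0"

definition conj3 :: "real \<Rightarrow> real \<Rightarrow> real \<Rightarrow> real \<Rightarrow> real \<Rightarrow> real \<Rightarrow> real \<Rightarrow> real \<Rightarrow> real" where
  "conj3 \<tau> a1 a2 a3 v0 v1 v2 v3 = v3 + 3 * \<tau> * a1 * v2 + 3 * (\<tau>^2 * a1^2 + \<tau> * a2) * v1
     + (\<tau>^3 * a1^3 + 3 * \<tau>^2 * a1 * a2 + \<tau> * a3) * v0"

definition conj4 :: "real \<Rightarrow> real \<Rightarrow> real \<Rightarrow> real \<Rightarrow> real \<Rightarrow> real \<Rightarrow> real \<Rightarrow> real \<Rightarrow> real \<Rightarrow> real \<Rightarrow> real" where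
  "conj4 \<tau> a1 a2 a3 a4 v0 v1 v2 v3 v4 = v4 + 4 * \<tau> * a1 * v3 + 6 * (\<tau>^2 * a1^2 + \<tau> * a2) * v2
     + 4 * (\<tau>^3 * a1^3 + 3 * \<tau>^2 * a1 * a2 + \<tau> * a3) * v1
     + (\<tau>^4 * a1^4 + 6 * \<tau>^3 * a1^2 * a2 + \<tau>^2 * (3 * a2^2 + 4 * a1 * a3) + \<tau> * a4) * v0"

definition conj_t :: "real \<Rightarrow> real \<Rightarrow> real \<Rightarrow> real \<Rightarrow> real \<Rightarrow> real" where
  "conj_t \<tau> \<sigma> al v0 u0 = u0 + \<sigma> * \<tau>^2 * al * v0"

definition conj_tx :: "real \<Rightarrow> real \<Rightarrow> real \<Rightarrow> real \<Rightarrow> real \<Rightarrow> real \<Rightarrow> real \<Rightarrow> real \<Rightarrow> real" where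
  "conj_tx \<tau> \<sigma> al a1 v0 v1 u0 u1 = u1 + \<sigma> * \<tau>^2 * (al * v1 + a1 * v0) + \<tau> * a1 * conj_t \<tau> \<sigma> al v0 u0"

definition conj_txx :: "real \<Rightarrow> real \<Rightarrow> real \<Rightarrow> real \<Rightarrow> real \<Rightarrow> real \<Rightarrow> real \<Rightarrow> real \<Rightarrow> real \<Rightarrow> real \<Rightarrow> real \<Rightarrow> real" where
  "conj_txx \<tau> \<sigma> al a1 a2 v0 v1 v2 u0 u1 u2 = u2 + \<sigma> * \<tau>^2 * (al * v2 + 2 * a1 * v1 + a2 * v0)
     + 2 * \<tau> * a1 * (u1 + \<sigma> * \<tau>^2 * (al * v1 + a1 * v0)) + (\<tau>^2 * a1^2 + \<tau> * a2) * conj_t \<tau> \<sigma> al v0 u0"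

lemmas conj_defs = conj1_def conj2_def conj3_def conj4_def conj_t_def conj_tx_def conj_txx_def

text \<open>The products \<open>E * conjj\<close> are the \<open>x\<close>-derivatives of \<open>E * v\<close>, where \<open>E = exp (\<tau> \<alpha>)\<close>, and similarly
  for its \<open>t\<close>-derivative; here \<open>\<sigma> \<tau>\<^sup>2\<close> is the derivative of \<open>\<tau>\<close>.\<close>

lemma ac_conjugate:
  assumes E: "ac L E (\<lambda>x. \<tau> * a1 x * E x)" and a: "ac L a1 a2" "ac L a2 a3" "ac L a3 a4"
    and v: "ac L v0 v1" "ac L v1 v2" "ac L v2 v3" "ac L v3 v4"
  shows "ac L (\<lambda>x. E x * v0 x) (\<lambda>x. E x * conj1 \<tau> (a1 x) (v0 x) (v1 x))"
    and "ac L (\<lambda>x. E x * conj1 \<tau> (a1 x) (v0 x) (v1 x)) (\<lambda>x. E x * conj2 \<tau> (a1 x) (a2 x) (v0 x) (v1 x) (v2 x))"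
    and "ac L (\<lambda>x. E x * conj2 \<tau> (a1 x) (a2 x) (v0 x) (v1 x) (v2 x))
      (\<lambda>x. E x * conj3 \<tau> (a1 x) (a2 x) (a3 x) (v0 x) (v1 x) (v2 x) (v3 x))"
    and "ac L (\<lambda>x. E x * conj3 \<tau> (a1 x) (a2 x) (a3 x) (v0 x) (v1 x) (v2 x) (v3 x))
      (\<lambda>x. E x * conj4 \<tau> (a1 x) (a2 x) (a3 x) (a4 x) (v0 x) (v1 x) (v2 x) (v3 x) (v4 x))"
proof -
  show "ac L (\<lambda>x. E x * v0 x) (\<lambda>x. E x * conj1 \<tau> (a1 x) (v0 x) (v1 x))"
    unfolding conj_defs by (rule ac_eq_deriv, (rule E a v ac_intros)+, (algebra | simp, algebra))
  show "ac L (\<lambda>x. E x * conj1 \<tau> (a1 x) (v0 x) (v1 x)) (\<lambda>x. E x * conj2 \<tau> (a1 x) (a2 x) (v0 x) (v1 x) (v2 x))"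
    unfolding conj_defs by (rule ac_eq_deriv, (rule E a v ac_intros)+, (algebra | simp, algebra))
  show "ac L (\<lambda>x. E x * conj2 \<tau> (a1 x) (a2 x) (v0 x) (v1 x) (v2 x))
      (\<lambda>x. E x * conj3 \<tau> (a1 x) (a2 x) (a3 x) (v0 x) (v1 x) (v2 x) (v3 x))"
    unfolding conj_defs by (rule ac_eq_deriv, (rule E a v ac_intros)+, (algebra | simp, algebra))
  show "ac L (\<lambda>x. E x * conj3 \<tau> (a1 x) (a2 x) (a3 x) (v0 x) (v1 x) (v2 x) (v3 x))
      (\<lambda>x. E x * conj4 \<tau> (a1 x) (a2 x) (a3 x) (a4 x) (v0 x) (v1 x) (v2 x) (v3 x) (v4 x))"
    unfolding conj_defs by (rule ac_eq_deriv, (rule E a v ac_intros)+, (algebra | simp, algebra))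
qed

lemma ac_conjugate_t:
  assumes E: "ac L E (\<lambda>x. \<tau> * a1 x * E x)" and a: "ac L al a1" "ac L a1 a2" "ac L a2 a3"
    and v: "ac L v0 v1" "ac L v1 v2" and u: "ac L u0 u1" "ac L u1 u2"
  shows "ac L (\<lambda>x. E x * conj_t \<tau> \<sigma> (al x) (v0 x) (u0 x)) (\<lambda>x. E x * conj_tx \<tau> \<sigma> (al x) (a1 x) (v0 x) (v1 x) (u0 x) (u1 x))"
    and "ac L (\<lambda>x. E x * conj_tx \<tau> \<sigma> (al x) (a1 x) (v0 x) (v1 x) (u0 x) (u1 x))
      (\<lambda>x. E x * conj_txx \<tau> \<sigma> (al x) (a1 x) (a2 x) (v0 x) (v1 x) (v2 x) (u0 x) (u1 x) (u2 x))"
proof -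
  show "ac L (\<lambda>x. E x * conj_t \<tau> \<sigma> (al x) (v0 x) (u0 x)) (\<lambda>x. E x * conj_tx \<tau> \<sigma> (al x) (a1 x) (v0 x) (v1 x) (u0 x) (u1 x))"
    unfolding conj_defs by (rule ac_eq_deriv, (rule E a v u ac_intros)+, (algebra | simp, algebra))
  show "ac L (\<lambda>x. E x * conj_tx \<tau> \<sigma> (al x) (a1 x) (v0 x) (v1 x) (u0 x) (u1 x))
      (\<lambda>x. E x * conj_txx \<tau> \<sigma> (al x) (a1 x) (a2 x) (v0 x) (v1 x) (v2 x) (u0 x) (u1 x) (u2 x))"
    unfolding conj_defs by (rule ac_eq_deriv, (rule E a v u ac_intros)+, (algebra | simp, algebra))
qed

text \<open>Since \<tau> blows up at both ends it is never differentiated apart from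
  \<open>E\<close>: every term is written as a product of some \<tau>^k E with a derivative of v,
  and the powers are collected afterwards.\<close>

lemma ac_time_conjugate:
  assumes E: "\<And>k. ac T (\<lambda>t. \<tau> t ^ k * E t) (\<lambda>t. \<sigma> t * (real k * \<tau> t ^ (k + 1) + al * \<tau> t ^ (k + 2)) * E t)"
    and v: "ac T v0 u0" "ac T v1 u1" "ac T v2 u2"
  shows "ac T (\<lambda>t. \<tau> t ^ n * (E t * v0 t))
      (\<lambda>t. \<tau> t ^ n * (E t * conj_t (\<tau> t) (\<sigma> t) al (v0 t) (u0 t) + real n * \<sigma> t * \<tau> t * (E t * v0 t)))"
    and "ac T (\<lambda>t. \<tau> t ^ n * (E t * conj1 (\<tau> t) a1 (v0 t) (v1 t)))
      (\<lambda>t. \<tau> t ^ n * (E t * conj_tx (\<tau> t) (\<sigma> t) al a1 (v0 t) (v1 t) (u0 t) (u1 t)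
        + real n * \<sigma> t * \<tau> t * (E t * conj1 (\<tau> t) a1 (v0 t) (v1 t))))"
    and "ac T (\<lambda>t. \<tau> t ^ n * (E t * conj2 (\<tau> t) a1 a2 (v0 t) (v1 t) (v2 t)))
      (\<lambda>t. \<tau> t ^ n * (E t * conj_txx (\<tau> t) (\<sigma> t) al a1 a2 (v0 t) (v1 t) (v2 t) (u0 t) (u1 t) (u2 t)
        + real n * \<sigma> t * \<tau> t * (E t * conj2 (\<tau> t) a1 a2 (v0 t) (v1 t) (v2 t))))"
proof -
  have *: "ac T (\<lambda>t. (\<tau> t ^ k * E t) * v t) (\<lambda>t. (\<sigma> t * (real k * \<tau> t ^ (k + 1) + al * \<tau> t ^ (k + 2)) * E t) * v t + (\<tau> t ^ k * E t) * u t)"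
    if "ac T v u" for v u k
    by (intro ac_mult E that)
  show "ac T (\<lambda>t. \<tau> t ^ n * (E t * v0 t))
      (\<lambda>t. \<tau> t ^ n * (E t * conj_t (\<tau> t) (\<sigma> t) al (v0 t) (u0 t) + real n * \<sigma> t * \<tau> t * (E t * v0 t)))"
    using *[OF v(1), of n] by (simp add: conj_defs algebra_simps power2_eq_square)
  have "ac T (\<lambda>t. (\<tau> t ^ n * E t) * v1 t + a1 * ((\<tau> t ^ (n + 1) * E t) * v0 t))
    (\<lambda>t. ((\<sigma> t * (real n * \<tau> t ^ (n + 1) + al * \<tau> t ^ (n + 2)) * E t) * v1 t + (\<tau> t ^ n * E t) * u1 t)
      + a1 * ((\<sigma> t * (real (n + 1) * \<tau> t ^ (n + 1 + 1) + al * \<tau> t ^ (n + 1 + 2)) * E t) * v0 t + (\<tau> t ^ (n + 1) * E t) * u0 t))"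
    by (intro ac_add ac_cmult * v)
  then show "ac T (\<lambda>t. \<tau> t ^ n * (E t * conj1 (\<tau> t) a1 (v0 t) (v1 t)))
      (\<lambda>t. \<tau> t ^ n * (E t * conj_tx (\<tau> t) (\<sigma> t) al a1 (v0 t) (v1 t) (u0 t) (u1 t)
        + real n * \<sigma> t * \<tau> t * (E t * conj1 (\<tau> t) a1 (v0 t) (v1 t))))"
    by (simp add: conj_defs algebra_simps eval_nat_numeral)
  have "ac T (\<lambda>t. (\<tau> t ^ n * E t) * v2 t + 2 * a1 * ((\<tau> t ^ (n + 1) * E t) * v1 t)
      + (a1^2 * ((\<tau> t ^ (n + 2) * E t) * v0 t) + a2 * ((\<tau> t ^ (n + 1) * E t) * v0 t)))
    (\<lambda>t. ((\<sigma> t * (real n * \<tau> t ^ (n + 1) + al * \<tau> t ^ (n + 2)) * E t) * v2 t + (\<tau> t ^ n * E t) * u2 t)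
      + 2 * a1 * ((\<sigma> t * (real (n + 1) * \<tau> t ^ (n + 1 + 1) + al * \<tau> t ^ (n + 1 + 2)) * E t) * v1 t + (\<tau> t ^ (n + 1) * E t) * u1 t)
      + (a1^2 * ((\<sigma> t * (real (n + 2) * \<tau> t ^ (n + 2 + 1) + al * \<tau> t ^ (n + 2 + 2)) * E t) * v0 t + (\<tau> t ^ (n + 2) * E t) * u0 t)
      + a2 * ((\<sigma> t * (real (n + 1) * \<tau> t ^ (n + 1 + 1) + al * \<tau> t ^ (n + 1 + 2)) * E t) * v0 t + (\<tau> t ^ (n + 1) * E t) * u0 t)))"
    by (intro ac_add ac_cmult * v)
  then show "ac T (\<lambda>t. \<tau> t ^ n * (E t * conj2 (\<tau> t) a1 a2 (v0 t) (v1 t) (v2 t)))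
      (\<lambda>t. \<tau> t ^ n * (E t * conj_txx (\<tau> t) (\<sigma> t) al a1 a2 (v0 t) (v1 t) (v2 t) (u0 t) (u1 t) (u2 t)
        + real n * \<sigma> t * \<tau> t * (E t * conj2 (\<tau> t) a1 a2 (v0 t) (v1 t) (v2 t))))"
    by (simp add: conj_defs algebra_simps eval_nat_numeral)
qed

text \<open>The bilinear form of \<open>sym_part\<close>, with w4 and w2 integrated by parts against
  y and the derivative of - 2 \<tau> a1 w1 y1 added to adjust the boundary term. It is symmetric in
  w and y; so for y = w_t its double is a time derivative up to derivatives of \<tau>.\<close>

definition time_form :: "real \<Rightarrow> real \<Rightarrow> real \<Rightarrow> real \<Rightarrow> real \<Rightarrow> real \<Rightarrow> real \<Rightarrow> real \<Rightarrow> real \<Rightarrow> real" where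
  "time_form \<tau> a1 a2 w0 w1 w2 y0 y1 y2 = w2 * y2 - 2 * \<tau> * a1 * (w1 * y2 + w2 * y1) - 2 * \<tau> * a2 * w1 * y1
     - 6 * \<tau>^2 * a1^2 * w1 * y1 + \<tau>^4 * a1^4 * w0 * y0"

text \<open>Minus the terms in which the time derivative of the quadratic form falls on powers of
  \<tau>, computed from \<tau>' = \<sigma> \<tau>^2.\<close>

definition time_error :: "real \<Rightarrow> real \<Rightarrow> real \<Rightarrow> real \<Rightarrow> real \<Rightarrow> real \<Rightarrow> real \<Rightarrow> real" where
  "time_error \<tau> \<sigma> a1 a2 w0 w1 w2 = \<sigma> * (4 * \<tau>^2 * a1 * w1 * w2 + 2 * \<tau>^2 * a2 * w1^2
     + 12 * \<tau>^3 * a1^2 * w1^2 - 4 * \<tau>^5 * a1^4 * w0^2)"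

text \<open>Integrating \<open>w'''' y\<close> by parts twice leaves the boundary term \<open>w'' y'\<close>, which need not vanish.
  Subtracting \<open>2 \<tau> \<alpha>' w'\<close> from \<open>w''\<close> produces a boundary term that vanishes for both boundary conditions.\<close>

lemma ac_time_flux:
  assumes a: "ac L a1 a2" "ac L a2 a3" and w: "ac L w0 w1" "ac L w1 w2" "ac L w2 w3" "ac L w3 w4"
    and y: "ac L y0 y1" "ac L y1 y2"
  shows "ac L (\<lambda>x. w3 x * y0 x - (w2 x - 2 * \<tau> * a1 x * w1 x) * y1 x + 6 * \<tau>^2 * a1 x^2 * w1 x * y0 x)
    (\<lambda>x. sym_part \<tau> (a1 x) (a2 x) (w0 x) (w1 x) (w2 x) (w4 x) * y0 x
      - time_form \<tau> (a1 x) (a2 x) (w0 x) (w1 x) (w2 x) (y0 x) (y1 x) (y2 x))"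
  unfolding sym_part_def time_form_def
  by (rule ac_eq_deriv, (rule a w y ac_intros)+, (algebra | simp, algebra))

lemma ac_time_form:
  assumes w0: "\<And>n. ac T (\<lambda>t. \<tau> t ^ n * w0 t) (\<lambda>t. \<tau> t ^ n * (y0 t + real n * \<sigma> t * \<tau> t * w0 t))"
    and w1: "\<And>n. ac T (\<lambda>t. \<tau> t ^ n * w1 t) (\<lambda>t. \<tau> t ^ n * (y1 t + real n * \<sigma> t * \<tau> t * w1 t))"
    and w2: "\<And>n. ac T (\<lambda>t. \<tau> t ^ n * w2 t) (\<lambda>t. \<tau> t ^ n * (y2 t + real n * \<sigma> t * \<tau> t * w2 t))"
  shows "ac T (\<lambda>t. w2 t * w2 t - 4 * a1 * (\<tau> t * w1 t) * w2 t - 2 * a2 * (\<tau> t * w1 t) * w1 t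
      - 6 * a1^2 * (\<tau> t * w1 t)^2 + a1^4 * (\<tau> t ^2 * w0 t)^2)
    (\<lambda>t. 2 * time_form (\<tau> t) a1 a2 (w0 t) (w1 t) (w2 t) (y0 t) (y1 t) (y2 t)
      - time_error (\<tau> t) (\<sigma> t) a1 a2 (w0 t) (w1 t) (w2 t))"
proof -
  have a: "ac T w2 y2" "ac T w1 y1" "ac T (\<lambda>t. \<tau> t * w1 t) (\<lambda>t. \<tau> t * (y1 t + \<sigma> t * \<tau> t * w1 t))"
    "ac T (\<lambda>t. \<tau> t ^ 2 * w0 t) (\<lambda>t. \<tau> t ^ 2 * (y0 t + 2 * \<sigma> t * \<tau> t * w0 t))"
    using w2[of 0] w1[of 0] w1[of 1] w0[of 2] by simp_all
  show ?thesis
    unfolding time_form_def time_error_def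
    by (rule ac_eq_deriv, (rule a ac_intros)+, (algebra | simp, algebra))
qed

text \<open>The rest of the conjugated operator: the first term comes from the time derivative of
  the weight, the others are those parts of (\<partial>_x - \<tau> \<alpha>')^4 that neither
  \<open>sym_part\<close> nor \<open>skew_part\<close> contains. Their order is at most 3, so \<tau>
  times their square is bounded by the energy.\<close>

definition remainder :: "real \<Rightarrow> real \<Rightarrow> real \<Rightarrow> real \<Rightarrow> real \<Rightarrow> real \<Rightarrow> real \<Rightarrow> real \<Rightarrow> real \<Rightarrow> real \<Rightarrow> real \<Rightarrow> real" where
  "remainder \<tau> \<sigma> \<gamma> al a1 a2 a3 a4 w0 w1 w2 = - \<gamma> * \<sigma> * \<tau>^2 * al * w0 - 6 * \<tau> * a2 * w2 - 4 * \<tau> * a3 * w1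
     + (3 * \<tau>^2 * a2^2 + 4 * \<tau>^2 * a1 * a3 - \<tau> * a4) * w0"

lemma conjugated_equation:
  "E * (\<gamma> * u0 + v4) =
    sym_part \<tau> a1 a2 (E * v0) (E * conj1 \<tau> a1 v0 v1) (E * conj2 \<tau> a1 a2 v0 v1 v2) (E * conj4 \<tau> a1 a2 a3 a4 v0 v1 v2 v3 v4)
    + skew_part \<tau> a1 a2 (E * v0) (E * conj1 \<tau> a1 v0 v1) (E * conj3 \<tau> a1 a2 a3 v0 v1 v2 v3)
    + \<gamma> * (E * conj_t \<tau> \<sigma> al v0 u0)
    + remainder \<tau> \<sigma> \<gamma> al a1 a2 a3 a4 (E * v0) (E * conj1 \<tau> a1 v0 v1) (E * conj2 \<tau> a1 a2 v0 v1 v2)"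
  unfolding sym_part_def skew_part_def remainder_def conj_defs by algebra

text \<open>As \<tau> \<ge> 1, each monomial is at most A^4 times the energy; 22 is the sum of the
  coefficients 4, 2, 12 and 4.\<close>

lemma time_error_bound:
  assumes "1 \<le> A" "1 \<le> \<tau>" "\<bar>a1\<bar> \<le> A" "\<bar>a2\<bar> \<le> A"
  shows "\<bar>time_error \<tau> \<sigma> a1 a2 w0 w1 w2\<bar> \<le> \<bar>\<sigma>\<bar> * (22 * A^4 * energy \<tau> w0 w1 w2 w3)"
proof -
  let ?N = "energy \<tau> w0 w1 w2 w3"
  have p: "\<tau>^2 \<le> \<tau>^3" "\<tau>^3 \<le> \<tau>^5" "\<tau>^5 \<le> \<tau>^7" "0 \<le> \<tau>^2" using assms by (auto intro: power_increasing)
  have N: "\<tau>^3 * w2^2 \<le> ?N" "\<tau>^5 * w1^2 \<le> ?N" "\<tau>^7 * w0^2 \<le> ?N" "0 \<le> ?N" "\<tau>^3 * w2^2 + \<tau>^5 * w1^2 \<le> ?N"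
    using assms by (auto simp: energy_def)
  have "\<tau>^2 * w1^2 \<le> \<tau>^5 * w1^2" "\<tau>^3 * w1^2 \<le> \<tau>^5 * w1^2" "\<tau>^2 * w2^2 \<le> \<tau>^3 * w2^2" "\<tau>^5 * w0^2 \<le> \<tau>^7 * w0^2"
    using p by (auto intro!: mult_right_mono)
  then have q: "\<tau>^2 * w1^2 \<le> ?N" "\<tau>^3 * w1^2 \<le> ?N" "\<tau>^2 * w2^2 \<le> ?N" "\<tau>^5 * w0^2 \<le> ?N" "\<tau>^2 * w1^2 + \<tau>^2 * w2^2 \<le> ?N"
    using N by auto
  have A: "A \<le> A^4" "A^2 \<le> A^4" using assms power_increasing[of 1 4 A] by (auto intro: power_increasing)
  have "\<bar>\<tau>^2 * w1 * w2\<bar> \<le> ?N"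
  proof -
    have "2 * \<bar>w1 * w2\<bar> \<le> w1^2 + w2^2" using sum_squares_bound[of "\<bar>w1\<bar>" "\<bar>w2\<bar>"] by (simp add: abs_mult)
    then have "\<tau>^2 * \<bar>w1 * w2\<bar> \<le> \<tau>^2 * (w1^2 + w2^2)" using p by (intro mult_left_mono) auto
    then show ?thesis using q(5) by (simp add: abs_mult distrib_left mult.assoc)
  qed
  then have "\<bar>a1\<bar> * \<bar>\<tau>^2 * w1 * w2\<bar> \<le> A^4 * ?N" using assms A by (intro mult_mono) auto
  then have 1: "\<bar>4 * \<tau>^2 * a1 * w1 * w2\<bar> \<le> 4 * (A^4 * ?N)" by (simp add: abs_mult mult_ac)
  have "\<bar>a2\<bar> * (\<tau>^2 * w1^2) \<le> A^4 * ?N" using assms A q by (intro mult_mono) auto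
  then have 2: "\<bar>2 * \<tau>^2 * a2 * w1^2\<bar> \<le> 2 * (A^4 * ?N)" by (simp add: abs_mult mult_ac)
  have "\<bar>a1\<bar>^2 \<le> A^2" "\<bar>a1\<bar>^4 \<le> A^4" using power_mono[OF assms(3) abs_ge_zero] by blast+
  then have "\<bar>a1\<bar>^2 * (\<tau>^3 * w1^2) \<le> A^4 * ?N" "\<bar>a1\<bar>^4 * (\<tau>^5 * w0^2) \<le> A^4 * ?N" using assms A q by (auto intro!: mult_mono)
  then have 3: "\<bar>12 * \<tau>^3 * a1^2 * w1^2\<bar> \<le> 12 * (A^4 * ?N)" "\<bar>4 * \<tau>^5 * a1^4 * w0^2\<bar> \<le> 4 * (A^4 * ?N)"
    using assms by (simp_all add: abs_mult mult_ac power_abs)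
  have "\<bar>4 * \<tau>^2 * a1 * w1 * w2 + 2 * \<tau>^2 * a2 * w1^2 + 12 * \<tau>^3 * a1^2 * w1^2 - 4 * \<tau>^5 * a1^4 * w0^2\<bar> \<le> 22 * (A^4 * ?N)"
    using 1 2 3 by (smt (verit))
  then show ?thesis unfolding time_error_def abs_mult by (intro mult_left_mono) (auto simp: mult.assoc)
qed

lemma sum4_squared: "(x + y + z + w)^2 \<le> 4 * (x^2 + y^2 + z^2 + (w::real)^2)"
proof -
  have "0 \<le> (x - y)^2 + (x - z)^2 + (x - w)^2 + (y - z)^2 + (y - w)^2 + (z - w)^2" by simp
  then show ?thesis by (simp add: power2_eq_square algebra_simps)
qed

text \<open>The outer 4 is the number of squared summands. The numbers 36 and 16 are squares of the
  coefficients 6 and 4, and 64 is the square of 3 + 4 + 1, the coefficients in the factor of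
  \<open>w0\<close>.\<close>

lemma remainder_bound:
  assumes "1 \<le> A" "1 \<le> \<tau>" "\<bar>\<sigma>\<bar> \<le> 1" "\<bar>al\<bar> \<le> A" "\<bar>a1\<bar> \<le> A" "\<bar>a2\<bar> \<le> A" "\<bar>a3\<bar> \<le> A" "\<bar>a4\<bar> \<le> A"
  shows "\<tau> * (remainder \<tau> \<sigma> \<gamma> al a1 a2 a3 a4 w0 w1 w2)^2
    \<le> 4 * (\<gamma>^2 * A^2 + 36 * A^2 + 16 * A^2 + 64 * A^4) * energy \<tau> w0 w1 w2 w3"
proof -
  let ?N = "energy \<tau> w0 w1 w2 w3"
  have p: "\<tau>^3 \<le> \<tau>^5" "\<tau>^5 \<le> \<tau>^7" using assms by (auto intro: power_increasing)
  have N: "\<tau>^3 * w2^2 \<le> ?N" "\<tau>^5 * w1^2 \<le> ?N" "\<tau>^7 * w0^2 \<le> ?N" "0 \<le> ?N"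
    using assms by (auto simp: energy_def)
  have "\<tau>^3 * w1^2 \<le> \<tau>^5 * w1^2" "\<tau>^5 * w0^2 \<le> \<tau>^7 * w0^2"
    using p by (auto intro!: mult_right_mono)
  then have q: "\<tau>^3 * w1^2 \<le> ?N" "\<tau>^3 * w2^2 \<le> ?N" "\<tau>^5 * w0^2 \<le> ?N" using N by auto
  have sq: "x^2 \<le> A^2" if "\<bar>x\<bar> \<le> A" for x using power_mono[OF that, of 2] by simp
  have c: "\<bar>3 * \<tau>^2 * a2^2 + 4 * \<tau>^2 * a1 * a3 - \<tau> * a4\<bar> \<le> 8 * A^2 * \<tau>^2"
  proof -
    have "\<bar>a1\<bar> * \<bar>a3\<bar> \<le> A * A" using assms by (intro mult_mono) auto
    then have "\<tau>^2 * (\<bar>a1\<bar> * \<bar>a3\<bar>) \<le> \<tau>^2 * A^2" "\<tau>^2 * a2^2 \<le> \<tau>^2 * A^2"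
      using assms sq[of a2] by (auto intro!: mult_left_mono simp: power2_eq_square[of A])
    moreover have "\<tau> * \<bar>a4\<bar> \<le> \<tau>^2 * A^2"
      using assms self_le_power[of \<tau> 2] self_le_power[of A 2] by (intro mult_mono) auto
    moreover have "\<bar>3 * \<tau>^2 * a2^2 + 4 * \<tau>^2 * a1 * a3 - \<tau> * a4\<bar> \<le> 3 * (\<tau>^2 * a2^2) + 4 * (\<tau>^2 * (\<bar>a1\<bar> * \<bar>a3\<bar>)) + \<tau> * \<bar>a4\<bar>"
    proof -
      have "\<bar>\<tau>^2 * (a1 * a3)\<bar> = \<tau>^2 * (\<bar>a1\<bar> * \<bar>a3\<bar>)" "\<bar>\<tau> * a4\<bar> = \<tau> * \<bar>a4\<bar>" "0 \<le> \<tau>^2 * a2^2"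
        using assms by (auto simp: abs_mult)
      then show ?thesis by (simp only: mult.assoc)
    qed
    ultimately show ?thesis by argo
  qed
  have "(- \<gamma> * \<sigma> * \<tau>^2 * al * w0)^2 * \<tau> = \<gamma>^2 * (\<sigma>^2 * al^2) * (\<tau>^5 * w0^2)"
    by (simp add: power_mult_distrib eval_nat_numeral mult_ac)
  also have "\<dots> \<le> \<gamma>^2 * (1 * A^2) * ?N"
    using q(3) sq[OF assms(4)] power_mono[OF assms(3), of 2] assms N(4)
    by (intro mult_mono mult_nonneg_nonneg) auto
  finally have 1: "(- \<gamma> * \<sigma> * \<tau>^2 * al * w0)^2 * \<tau> \<le> \<gamma>^2 * A^2 * ?N" by simp
  have "(- 6 * \<tau> * a2 * w2)^2 * \<tau> = 36 * a2^2 * (\<tau>^3 * w2^2)" "(- 4 * \<tau> * a3 * w1)^2 * \<tau> = 16 * a3^2 * (\<tau>^3 * w1^2)"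
    by (simp_all add: power_mult_distrib eval_nat_numeral mult_ac)
  moreover have "36 * a2^2 * (\<tau>^3 * w2^2) \<le> 36 * A^2 * ?N" "16 * a3^2 * (\<tau>^3 * w1^2) \<le> 16 * A^2 * ?N"
    using q sq[OF assms(6)] sq[OF assms(7)] assms N(4) by (intro mult_mono mult_nonneg_nonneg; simp)+
  ultimately have 2: "(- 6 * \<tau> * a2 * w2)^2 * \<tau> \<le> 36 * A^2 * ?N" "(- 4 * \<tau> * a3 * w1)^2 * \<tau> \<le> 16 * A^2 * ?N" by simp_all
  let ?c = "3 * \<tau>^2 * a2^2 + 4 * \<tau>^2 * a1 * a3 - \<tau> * a4"
  have "?c^2 \<le> (8 * A^2 * \<tau>^2)^2" using power_mono[OF c, of 2] by simp
  then have "?c^2 * (\<tau> * w0^2) \<le> (8 * A^2 * \<tau>^2)^2 * (\<tau> * w0^2)" using assms by (intro mult_right_mono) auto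
  also have "\<dots> = 64 * A^4 * (\<tau>^5 * w0^2)" by (simp add: power_mult_distrib eval_nat_numeral mult_ac)
  also have "\<dots> \<le> 64 * A^4 * ?N" using q(3) by (intro mult_left_mono) auto
  finally have 3: "(?c * w0)^2 * \<tau> \<le> 64 * A^4 * ?N" by (simp add: power_mult_distrib mult_ac)
  have "(remainder \<tau> \<sigma> \<gamma> al a1 a2 a3 a4 w0 w1 w2)^2 \<le> 4 * ((- \<gamma> * \<sigma> * \<tau>^2 * al * w0)^2 + (- 6 * \<tau> * a2 * w2)^2
    + (- 4 * \<tau> * a3 * w1)^2 + (?c * w0)^2)"
    unfolding remainder_def
    using sum4_squared[of "- \<gamma> * \<sigma> * \<tau>^2 * al * w0" "- 6 * \<tau> * a2 * w2" "- 4 * \<tau> * a3 * w1" "?c * w0"] by simp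
  then have "(remainder \<tau> \<sigma> \<gamma> al a1 a2 a3 a4 w0 w1 w2)^2 * \<tau> \<le> 4 * ((- \<gamma> * \<sigma> * \<tau>^2 * al * w0)^2 + (- 6 * \<tau> * a2 * w2)^2
    + (- 4 * \<tau> * a3 * w1)^2 + (?c * w0)^2) * \<tau>"
    using assms by (intro mult_right_mono) auto
  also have "\<dots> = 4 * ((- \<gamma> * \<sigma> * \<tau>^2 * al * w0)^2 * \<tau> + (- 6 * \<tau> * a2 * w2)^2 * \<tau>
    + (- 4 * \<tau> * a3 * w1)^2 * \<tau> + (?c * w0)^2 * \<tau>)" by (simp only: distrib_right mult.assoc)
  also have "\<dots> \<le> 4 * (\<gamma>^2 * A^2 * ?N + 36 * A^2 * ?N + 16 * A^2 * ?N + 64 * A^4 * ?N)"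
    using 1 2 3 by argo
  finally show ?thesis by (simp only: distrib_right mult.assoc mult.commute[of \<tau>])
qed

section \<open>The conjugated solution on the rectangle\<close>

lemma set_integrable_square_mult:
  fixes f g :: "'a::euclidean_space \<Rightarrow> real"
  assumes [measurable]: "f \<in> borel_measurable borel" "g \<in> borel_measurable borel" "A \<in> sets borel"
    and "set_integrable lborel A (\<lambda>z. (f z)^2)" "set_integrable lborel A (\<lambda>z. (g z)^2)"
  shows "set_integrable lborel A (\<lambda>z. f z * g z)"
proof (rule set_integrable_bound[OF set_integral_add(1)[OF assms(4,5)]])
  show "set_borel_measurable lborel A (\<lambda>z. f z * g z)" unfolding set_borel_measurable_def by measurable
  show "AE x in lborel. x \<in> A \<longrightarrow> norm (f x * g x) \<le> norm ((f x)^2 + (g x)^2)"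
  proof (intro AE_I2 impI)
    fix x
    have "2 * \<bar>f x * g x\<bar> \<le> (f x)^2 + (g x)^2" using sum_squares_bound[of "\<bar>f x\<bar>" "\<bar>g x\<bar>"] by (simp add: abs_mult)
    then show "norm (f x * g x) \<le> norm ((f x)^2 + (g x)^2)" by simp
  qed
qed

lemma set_integrable_square_add:
  fixes f g :: "'a::euclidean_space \<Rightarrow> real"
  assumes "f \<in> borel_measurable borel" "g \<in> borel_measurable borel" "A \<in> sets borel"
    and "set_integrable lborel A (\<lambda>z. (f z)^2)" "set_integrable lborel A (\<lambda>z. (g z)^2)"
  shows "set_integrable lborel A (\<lambda>z. (f z + g z)^2)"
proof -
  have "set_integrable lborel A (\<lambda>z. (f z)^2 + (g z)^2 + 2 * (f z * g z))"
    by (intro set_integral_add(1) set_integrable_mult_right set_integrable_square_mult assms)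
  then show ?thesis by (simp add: power2_sum mult.assoc)
qed

lemma set_integrable_of_square:
  fixes f :: "real \<times> real \<Rightarrow> real"
  assumes "f \<in> borel_measurable borel" "set_integrable lborel ({0..T} \<times> {0..L}) (\<lambda>z. (f z)^2)"
  shows "set_integrable lborel ({0..T} \<times> {0..L}) f"
proof -
  have "set_integrable lborel ({0..T} \<times> {0..L}) (\<lambda>z. (1::real)^2)"
    using set_integrable_fst[of T "\<lambda>_. 1" L] ac_continuous_set_integrable[of T "\<lambda>_. 1"] by simp
  from set_integrable_square_mult[OF _ assms(1) borel_rectangle this assms(2)] show ?thesis by simp
qed

text \<open>The spatial weight for one fixed \<open>s\<close>. The slice inequality is an assumption
  here, so the analysis on the rectangle sees neither \<phi> nor the origin of the constants.
  Continuity on the whole line makes the weights Borel.\<close>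

locale carleman_weight =
  fixes T L m A c C \<tau>0 :: real and al a1 a2 a3 a4 e :: "real \<Rightarrow> real"
  assumes T: "0 < T" and L: "0 < L" and m: "0 < m" and A: "1 \<le> A" and c: "0 < c" and C: "0 < C" and \<tau>0: "1 \<le> \<tau>0"
    and cont: "continuous_on UNIV al" "continuous_on UNIV a1" "continuous_on UNIV a2" "continuous_on UNIV a3"
      "continuous_on UNIV a4" "continuous_on UNIV e"
    and al_deriv: "\<And>x. x \<in> {0..L} \<Longrightarrow> (al has_real_derivative a1 x) (at x within {0..L})"
    and ac_weight: "ac L al a1" "ac L a1 a2" "ac L a2 a3" "ac L a3 a4"
    and bounds: "\<And>x. x \<in> {0..L} \<Longrightarrow> al x \<le> - m \<and> \<bar>al x\<bar> \<le> A \<and> \<bar>a1 x\<bar> \<le> A \<and> \<bar>a2 x\<bar> \<le> A \<and> \<bar>a3 x\<bar> \<le> A \<and> \<bar>a4 x\<bar> \<le> A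
      \<and> 0 \<le> e x \<and> e x \<le> A"
    and slice: "\<And>\<tau> w0 w1 w2 w3 w4. \<tau>0 \<le> \<tau> \<Longrightarrow> ac L w0 w1 \<Longrightarrow> ac L w1 w2 \<Longrightarrow> ac L w2 w3 \<Longrightarrow> ac L w3 w4 \<Longrightarrow>
      set_integrable lborel {0..L} (\<lambda>x. (w4 x)^2) \<Longrightarrow> w0 0 = 0 \<Longrightarrow> w0 L = 0 \<Longrightarrow>
      0 \<le> (LINT x:{0..L}|lborel. (sym_part \<tau> (a1 x) (a2 x) (w0 x) (w1 x) (w2 x) (w4 x))^2
      + 2 * sym_part \<tau> (a1 x) (a2 x) (w0 x) (w1 x) (w2 x) (w4 x) * skew_part \<tau> (a1 x) (a2 x) (w0 x) (w1 x) (w3 x)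
      - c * energy \<tau> (w0 x) (w1 x) (w2 x) (w3 x) + C * (e x * \<tau>^7 * (w0 x)^2))"
begin

lemma borel_weights [measurable]: "al \<in> borel_measurable borel" "a1 \<in> borel_measurable borel" "a2 \<in> borel_measurable borel"
  "a3 \<in> borel_measurable borel" "a4 \<in> borel_measurable borel" "e \<in> borel_measurable borel"
  using cont by (auto intro: borel_measurable_continuous_onI)

end

text \<open>\<open>v0\<close> to \<open>v4\<close> stand for the x-derivatives of the solution,
  \<open>u0\<close> to \<open>u2\<close> for those of its time derivative. No equation is imposed:
  the right-hand side is whatever \<open>\<gamma> * u0 + v4\<close> is. The conditions on
  \<open>lam\<close> give \<tau> \<ge> \<open>\<tau>0\<close> and |\<sigma>| \<le> 1.\<close>

locale carleman_solution = carleman_weight +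
  fixes lam \<gamma> :: real and v0 v1 v2 v3 v4 u0 u1 u2 :: "real \<times> real \<Rightarrow> real"
  assumes lam: "0 < lam" "\<tau>0 \<le> 4 * lam / T^2" "T \<le> lam"
    and borel_sol [measurable]: "v0 \<in> borel_measurable borel" "v1 \<in> borel_measurable borel" "v2 \<in> borel_measurable borel"
      "v3 \<in> borel_measurable borel" "v4 \<in> borel_measurable borel"
      "u0 \<in> borel_measurable borel" "u1 \<in> borel_measurable borel" "u2 \<in> borel_measurable borel"
    and square_sol: "set_integrable lborel ({0..T} \<times> {0..L}) (\<lambda>z. (v0 z)^2)" "set_integrable lborel ({0..T} \<times> {0..L}) (\<lambda>z. (v1 z)^2)"
      "set_integrable lborel ({0..T} \<times> {0..L}) (\<lambda>z. (v2 z)^2)" "set_integrable lborel ({0..T} \<times> {0..L}) (\<lambda>z. (v3 z)^2)"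
      "set_integrable lborel ({0..T} \<times> {0..L}) (\<lambda>z. (v4 z)^2)" "set_integrable lborel ({0..T} \<times> {0..L}) (\<lambda>z. (u0 z)^2)"
      "set_integrable lborel ({0..T} \<times> {0..L}) (\<lambda>z. (u1 z)^2)" "set_integrable lborel ({0..T} \<times> {0..L}) (\<lambda>z. (u2 z)^2)"
    and weak_x: "weak_dx T L v0 v1" "weak_dx T L v1 v2" "weak_dx T L v2 v3" "weak_dx T L v3 v4" "weak_dx T L u0 u1" "weak_dx T L u1 u2"
    and weak_t: "weak_dt T L v0 u0" "weak_dt T L v1 u1" "weak_dt T L v2 u2"
    and bdry: "zero_bdry T L v0 v1" "zero_bdry T L v1 v2 \<or> zero_bdry T L v2 v3"
begin

abbreviation Q :: "(real \<times> real) set" where "Q \<equiv> {0..T} \<times> {0..L}"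

definition \<tau> :: "real \<times> real \<Rightarrow> real" where "\<tau> z = tau T lam (fst z)"
definition \<sigma> :: "real \<times> real \<Rightarrow> real" where "\<sigma> z = sigma T lam (fst z)"
definition E :: "real \<times> real \<Rightarrow> real" where "E z = time_weight T lam (al (snd z)) (fst z)"
definition w0 :: "real \<times> real \<Rightarrow> real" where "w0 z = E z * v0 z"
definition w1 :: "real \<times> real \<Rightarrow> real" where "w1 z = E z * conj1 (\<tau> z) (a1 (snd z)) (v0 z) (v1 z)"
definition w2 :: "real \<times> real \<Rightarrow> real" where
  "w2 z = E z * conj2 (\<tau> z) (a1 (snd z)) (a2 (snd z)) (v0 z) (v1 z) (v2 z)"
definition w3 :: "real \<times> real \<Rightarrow> real" where
  "w3 z = E z * conj3 (\<tau> z) (a1 (snd z)) (a2 (snd z)) (a3 (snd z)) (v0 z) (v1 z) (v2 z) (v3 z)"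
definition w4 :: "real \<times> real \<Rightarrow> real" where
  "w4 z = E z * conj4 (\<tau> z) (a1 (snd z)) (a2 (snd z)) (a3 (snd z)) (a4 (snd z)) (v0 z) (v1 z) (v2 z) (v3 z) (v4 z)"
definition y0 :: "real \<times> real \<Rightarrow> real" where "y0 z = E z * conj_t (\<tau> z) (\<sigma> z) (al (snd z)) (v0 z) (u0 z)"
definition y1 :: "real \<times> real \<Rightarrow> real" where
  "y1 z = E z * conj_tx (\<tau> z) (\<sigma> z) (al (snd z)) (a1 (snd z)) (v0 z) (v1 z) (u0 z) (u1 z)"
definition y2 :: "real \<times> real \<Rightarrow> real" where
  "y2 z = E z * conj_txx (\<tau> z) (\<sigma> z) (al (snd z)) (a1 (snd z)) (a2 (snd z)) (v0 z) (v1 z) (v2 z) (u0 z) (u1 z) (u2 z)"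

lemma borel_tau [measurable]: "\<tau> \<in> borel_measurable borel" "\<sigma> \<in> borel_measurable borel" "E \<in> borel_measurable borel"
  unfolding \<tau>_def[abs_def] \<sigma>_def[abs_def] E_def[abs_def] tau_def sigma_def time_weight_def by measurable

text \<open>A class closed under multiplication with \<open>\<tau>\<close>, which blows up at the end points of the time interval;
  \<open>E\<close> times a square integrable function belongs to it.\<close>

definition wl2 :: "(real \<times> real \<Rightarrow> real) \<Rightarrow> bool" where
  "wl2 f \<longleftrightarrow> f \<in> borel_measurable borel \<and> (\<forall>k. set_integrable lborel Q (\<lambda>z. (\<tau> z ^ k * f z)^2))"

lemma wl2_borel: "wl2 f \<Longrightarrow> f \<in> borel_measurable borel"
  by (simp add: wl2_def)

text \<open>As \<open>al\<close> stays below - m, the weight \<open>E\<close> compensates any power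
  of \<tau> uniformly on the rectangle.\<close>

lemma wl2_E:
  assumes [measurable]: "h \<in> borel_measurable borel" and h: "set_integrable lborel Q (\<lambda>z. (h z)^2)"
  shows "wl2 (\<lambda>z. E z * h z)"
proof -
  have "set_integrable lborel Q (\<lambda>z. (\<tau> z ^ k * (E z * h z))^2)" for k
  proof -
    have "set_integrable lborel Q (\<lambda>z. (\<tau> z ^ k * E z)^2 * (h z)^2)"
    proof (rule set_integrable_bounded_mult[where B = "(fact k / m ^ k)^2", OF _ borel_rectangle _ h])
      fix z assume z: "z \<in> Q"
      then have "al (snd z) \<le> - m" using bounds[of "snd z"] by auto
      from time_weight_bounded[OF m this lam(1)]
      have "0 \<le> \<tau> z ^ k * E z" "\<tau> z ^ k * E z \<le> fact k / m ^ k" by (auto simp: \<tau>_def E_def)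
      then show "\<bar>(\<tau> z ^ k * E z)^2\<bar> \<le> (fact k / m ^ k)^2" by (simp add: power_mono)
    qed measurable
    then show ?thesis by (simp add: power_mult_distrib mult.assoc)
  qed
  then show ?thesis by (simp add: wl2_def)
qed

lemma wl2_eq: "wl2 f \<Longrightarrow> (\<And>z. f z = g z) \<Longrightarrow> wl2 g"
  by (metis ext)

lemma wl2_add: "wl2 f \<Longrightarrow> wl2 g \<Longrightarrow> wl2 (\<lambda>z. f z + g z)"
proof -
  assume f: "wl2 f" and g: "wl2 g"
  have [measurable]: "f \<in> borel_measurable borel" "g \<in> borel_measurable borel" using f g by (auto simp: wl2_def)
  have "set_integrable lborel Q (\<lambda>z. (\<tau> z ^ k * f z + \<tau> z ^ k * g z)^2)" for k
    by (rule set_integrable_square_add) (use f g in \<open>auto simp: wl2_def\<close>)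
  then show ?thesis by (simp add: wl2_def distrib_left)
qed

lemma wl2_tau: "wl2 f \<Longrightarrow> wl2 (\<lambda>z. \<tau> z ^ n * f z)"
  by (auto simp: wl2_def power_add[symmetric] mult.assoc[symmetric])

lemma wl2_bounded:
  assumes f: "wl2 f" and [measurable]: "g \<in> borel_measurable borel" and B: "\<And>z. z \<in> Q \<Longrightarrow> \<bar>g z\<bar> \<le> B"
  shows "wl2 (\<lambda>z. g z * f z)"
proof -
  have [measurable]: "f \<in> borel_measurable borel" using f by (rule wl2_borel)
  have "set_integrable lborel Q (\<lambda>z. (g z)^2 * (\<tau> z ^ k * f z)^2)" for k
  proof (rule set_integrable_bounded_mult[where B = "B^2"])
    fix z assume "z \<in> Q"
    then show "\<bar>(g z)^2\<bar> \<le> B^2" using power_mono[OF B, of z 2] by simp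
  qed (use f in \<open>auto simp: wl2_def\<close>)
  then show ?thesis by (simp add: wl2_def power_mult_distrib mult_ac)
qed

lemma wl2_coeff:
  assumes "wl2 f"
  shows "wl2 (\<lambda>z. al (snd z) * f z)" "wl2 (\<lambda>z. a1 (snd z) * f z)" "wl2 (\<lambda>z. a2 (snd z) * f z)" "wl2 (\<lambda>z. a3 (snd z) * f z)"
    "wl2 (\<lambda>z. a4 (snd z) * f z)" "wl2 (\<lambda>z. e (snd z) * f z)" "wl2 (\<lambda>z. \<sigma> z * f z)" "wl2 (\<lambda>z. k * f z)"
proof -
  show "wl2 (\<lambda>z. al (snd z) * f z)" "wl2 (\<lambda>z. a1 (snd z) * f z)" "wl2 (\<lambda>z. a2 (snd z) * f z)" "wl2 (\<lambda>z. a3 (snd z) * f z)"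
    "wl2 (\<lambda>z. a4 (snd z) * f z)" "wl2 (\<lambda>z. e (snd z) * f z)"
    by (intro wl2_bounded[OF assms, where B = A]; use bounds in force)+
  have "\<bar>\<sigma> z\<bar> \<le> 1" if "z \<in> Q" for z
    using that lam by (auto simp: \<sigma>_def sigma_def abs_le_iff field_simps)
  then show "wl2 (\<lambda>z. \<sigma> z * f z)"
    by (intro wl2_bounded[OF assms, where B = 1]) auto
  show "wl2 (\<lambda>z. k * f z)" by (intro wl2_bounded[OF assms, where B = "\<bar>k\<bar>"]) auto
qed

lemma wl2_tau1: "wl2 f \<Longrightarrow> wl2 (\<lambda>z. \<tau> z * f z)"
  using wl2_tau[of f 1] by simp

lemmas wl2_intros = wl2_add wl2_tau1 wl2_coeff

lemma wl2_solution: "wl2 w0" "wl2 w1" "wl2 w2" "wl2 w3" "wl2 w4" "wl2 y0" "wl2 y1" "wl2 y2"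
proof -
  note b = wl2_E[OF borel_sol(1) square_sol(1)] wl2_E[OF borel_sol(2) square_sol(2)] wl2_E[OF borel_sol(3) square_sol(3)]
    wl2_E[OF borel_sol(4) square_sol(4)] wl2_E[OF borel_sol(5) square_sol(5)] wl2_E[OF borel_sol(6) square_sol(6)]
    wl2_E[OF borel_sol(7) square_sol(7)] wl2_E[OF borel_sol(8) square_sol(8)]
  \<comment> \<open>\<open>A1\<close> to \<open>A4\<close> multiply by the coefficients of v0 in
    \<open>conj1\<close> to \<open>conj4\<close>, and \<open>D\<close> by \<sigma> \<tau>^2. They
    are written as compositions of multiplications that preserve the class.\<close>
  define A1 where "A1 f z = \<tau> z * (a1 (snd z) * f z)" for f z
  define A2 where "A2 f z = A1 (A1 f) z + \<tau> z * (a2 (snd z) * f z)" for f z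
  define A3 where "A3 f z = A1 (A1 (A1 f)) z + 3 * (\<tau> z * A1 (\<lambda>z. a2 (snd z) * f z) z) + \<tau> z * (a3 (snd z) * f z)" for f z
  define A4 where "A4 f z = A1 (A1 (A1 (A1 f))) z + 6 * (\<tau> z * A1 (A1 (\<lambda>z. a2 (snd z) * f z)) z)
    + (3 * (\<tau> z * (a2 (snd z) * (\<tau> z * (a2 (snd z) * f z)))) + 4 * (\<tau> z * A1 (\<lambda>z. a3 (snd z) * f z) z))
    + \<tau> z * (a4 (snd z) * f z)" for f z
  define D where "D f z = \<sigma> z * (\<tau> z * (\<tau> z * f z))" for f z
  have A1: "wl2 (A1 f)" if "wl2 f" for f unfolding A1_def by (intro wl2_intros that)
  have A2: "wl2 (A2 f)" if "wl2 f" for f unfolding A2_def by (intro wl2_intros that A1)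
  have A3: "wl2 (A3 f)" if "wl2 f" for f unfolding A3_def by (intro wl2_intros that A1)
  have A4: "wl2 (A4 f)" if "wl2 f" for f unfolding A4_def by (intro wl2_intros that A1)
  have D: "wl2 (D f)" if "wl2 f" for f unfolding D_def by (intro wl2_intros that)
  note ops = wl2_add wl2_coeff(8) A1 A2 A3 A4 D b wl2_coeff(1,2,3)
  show w0: "wl2 w0" unfolding w0_def[abs_def] by (rule b)
  have "wl2 (\<lambda>z. E z * v1 z + A1 (\<lambda>z. E z * v0 z) z)" by (intro ops)
  then show "wl2 w1" by (rule wl2_eq) (simp add: w1_def A1_def conj_defs algebra_simps)
  have "wl2 (\<lambda>z. E z * v2 z + 2 * A1 (\<lambda>z. E z * v1 z) z + A2 (\<lambda>z. E z * v0 z) z)" by (intro ops)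
  then show "wl2 w2" by (rule wl2_eq) (simp add: w2_def A1_def A2_def conj_defs algebra_simps power2_eq_square)
  have "wl2 (\<lambda>z. E z * v3 z + 3 * A1 (\<lambda>z. E z * v2 z) z + 3 * A2 (\<lambda>z. E z * v1 z) z + A3 (\<lambda>z. E z * v0 z) z)" by (intro ops)
  then show "wl2 w3" by (rule wl2_eq) (simp add: w3_def A1_def A2_def A3_def conj_defs algebra_simps eval_nat_numeral)
  have "wl2 (\<lambda>z. E z * v4 z + 4 * A1 (\<lambda>z. E z * v3 z) z + 6 * A2 (\<lambda>z. E z * v2 z) z + 4 * A3 (\<lambda>z. E z * v1 z) z + A4 (\<lambda>z. E z * v0 z) z)"
    by (intro ops)
  then show "wl2 w4" by (rule wl2_eq) (simp add: w4_def A1_def A2_def A3_def A4_def conj_defs algebra_simps eval_nat_numeral)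
  define Z where "Z z = E z * u0 z + D (\<lambda>z. al (snd z) * (E z * v0 z)) z" for z
  have Z: "wl2 Z" unfolding Z_def by (intro ops)
  then show y0: "wl2 y0" by (rule wl2_eq) (simp add: Z_def y0_def D_def conj_defs algebra_simps power2_eq_square)
  define Y where "Y z = E z * u1 z + D (\<lambda>z. al (snd z) * (E z * v1 z)) z + D (\<lambda>z. a1 (snd z) * (E z * v0 z)) z" for z
  have Y: "wl2 Y" unfolding Y_def by (intro ops)
  have "wl2 (\<lambda>z. Y z + A1 y0 z)" by (intro wl2_add Y A1 y0)
  then show "wl2 y1" by (rule wl2_eq) (simp add: Y_def y1_def y0_def D_def A1_def conj_defs algebra_simps power2_eq_square)
  have "wl2 (\<lambda>z. E z * u2 z + D (\<lambda>z. al (snd z) * (E z * v2 z)) z + 2 * D (\<lambda>z. a1 (snd z) * (E z * v1 z)) z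
     + D (\<lambda>z. a2 (snd z) * (E z * v0 z)) z + 2 * A1 Y z + A2 y0 z)" by (intro ops Y y0)
  then show "wl2 y2" by (rule wl2_eq) (simp add: Y_def y2_def y0_def D_def A1_def A2_def conj_defs algebra_simps eval_nat_numeral)
qed

lemma wl2_mult_integrable: "wl2 f \<Longrightarrow> wl2 g \<Longrightarrow> set_integrable lborel Q (\<lambda>z. f z * g z)"
  by (intro set_integrable_square_mult) (auto simp: wl2_def dest: spec[of _ 0])

lemma borel_conj [measurable]: "w0 \<in> borel_measurable borel" "w1 \<in> borel_measurable borel" "w2 \<in> borel_measurable borel"
  "w3 \<in> borel_measurable borel" "w4 \<in> borel_measurable borel" "y0 \<in> borel_measurable borel" "y1 \<in> borel_measurable borel"
  "y2 \<in> borel_measurable borel"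
  by (intro wl2_borel wl2_solution)+

end

section \<open>Slices of the solution and the boundary conditions on them\<close>

lemma slices_continuous:
  assumes "0 < T" "0 < L" "u \<in> borel_measurable borel" "g \<in> borel_measurable borel"
    and "set_integrable lborel ({0..T} \<times> {0..L}) u" "set_integrable lborel ({0..T} \<times> {0..L}) g"
    and "weak_dx T L u g"
  shows "AE t in lborel. t \<in> {0..T} \<longrightarrow> (\<exists>p. continuous_on UNIV p \<and> ac L p (\<lambda>x. g (t, x)) \<and>
    (AE x in lborel. x \<in> {0..L} \<longrightarrow> p x = u (t, x)))"
  using ac_slices[OF assms]
proof eventually_elim
  case (elim t)
  show ?case
  proof
    assume "t \<in> {0..T}"
    then obtain p where p: "ac L p (\<lambda>x. g (t, x))" "AE x in lborel. x \<in> {0..L} \<longrightarrow> p x = u (t, x)" using elim by auto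
    obtain q where q: "ac L q (\<lambda>x. g (t, x))" "continuous_on UNIV q" "\<forall>x\<in>{0..L}. q x = p x"
      using ac_clamp[OF p(1)] assms by auto
    have "AE x in lborel. x \<in> {0..L} \<longrightarrow> q x = u (t, x)" using p(2) by eventually_elim (use q in auto)
    then show "\<exists>p. continuous_on UNIV p \<and> ac L p (\<lambda>x. g (t, x)) \<and> (AE x in lborel. x \<in> {0..L} \<longrightarrow> p x = u (t, x))"
      using q by blast
  qed
qed

lemma slices_continuous_t:
  assumes "0 < T" "0 < L" "u \<in> borel_measurable borel" "g \<in> borel_measurable borel"
    and "set_integrable lborel ({0..T} \<times> {0..L}) u" "set_integrable lborel ({0..T} \<times> {0..L}) g"
    and "weak_dt T L u g"
  shows "AE x in lborel. x \<in> {0..L} \<longrightarrow> (\<exists>p. continuous_on UNIV p \<and> ac T p (\<lambda>t. g (t, x)) \<and>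
    (AE t in lborel. t \<in> {0..T} \<longrightarrow> p t = u (t, x)))"
proof -
  have m: "(\<lambda>z. u (snd z, fst z)) \<in> borel_measurable borel" "(\<lambda>z. g (snd z, fst z)) \<in> borel_measurable borel"
    using assms(3,4) by measurable
  from slices_continuous[OF assms(2,1) m rectangle_swap(1)[OF assms(5)] rectangle_swap(1)[OF assms(6)]] assms(7)
  show ?thesis by (simp add: weak_dt_def)
qed

context carleman_solution
begin

lemmas integrable_sol = set_integrable_of_square[OF borel_sol(1) square_sol(1)] set_integrable_of_square[OF borel_sol(2) square_sol(2)]
  set_integrable_of_square[OF borel_sol(3) square_sol(3)] set_integrable_of_square[OF borel_sol(4) square_sol(4)]
  set_integrable_of_square[OF borel_sol(5) square_sol(5)] set_integrable_of_square[OF borel_sol(6) square_sol(6)]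
  set_integrable_of_square[OF borel_sol(7) square_sol(7)] set_integrable_of_square[OF borel_sol(8) square_sol(8)]

text \<open>The last clause distinguishes clamped from hinged ends. In the clamped case both
  \<open>r1\<close> and \<open>p1\<close> have to vanish, because the x-derivative of the conjugated
  time derivative contains the two of them.\<close>

definition slice_at :: "real \<Rightarrow> (real \<Rightarrow> real) \<Rightarrow> (real \<Rightarrow> real) \<Rightarrow> (real \<Rightarrow> real) \<Rightarrow> (real \<Rightarrow> real)
    \<Rightarrow> (real \<Rightarrow> real) \<Rightarrow> (real \<Rightarrow> real) \<Rightarrow> bool" where
  "slice_at t p0 p1 p2 p3 r0 r1 \<longleftrightarrow> continuous_on UNIV p0 \<and> continuous_on UNIV p1 \<and> continuous_on UNIV p2 \<and> continuous_on UNIV p3 \<and>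
    continuous_on UNIV r0 \<and> continuous_on UNIV r1 \<and>
    ac L p0 p1 \<and> ac L p1 p2 \<and> ac L p2 p3 \<and> ac L p3 (\<lambda>x. v4 (t, x)) \<and> ac L r0 r1 \<and> ac L r1 (\<lambda>x. u2 (t, x)) \<and>
    (AE x in lborel. x \<in> {0..L} \<longrightarrow> p0 x = v0 (t, x) \<and> p1 x = v1 (t, x) \<and> p2 x = v2 (t, x) \<and> p3 x = v3 (t, x)
      \<and> r0 x = u0 (t, x) \<and> r1 x = u1 (t, x)) \<and>
    p0 0 = 0 \<and> p0 L = 0 \<and> r0 0 = 0 \<and> r0 L = 0 \<and>
    (r1 0 = 0 \<and> r1 L = 0 \<and> p1 0 = 0 \<and> p1 L = 0 \<or> p2 0 = 0 \<and> p2 L = 0)"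

lemma x_slices:
  "AE t in lborel. t \<in> {0..T} \<longrightarrow> (\<exists>p0 p1 p2 p3 r0 r1. slice_at t p0 p1 p2 p3 r0 r1)"
proof -
  note i = integrable_sol and b = borel_sol
  note s0 = slices_continuous[OF T L b(1,2) i(1,2) weak_x(1)] and s1 = slices_continuous[OF T L b(2,3) i(2,3) weak_x(2)]
    and s2 = slices_continuous[OF T L b(3,4) i(3,4) weak_x(3)] and s3 = slices_continuous[OF T L b(4,5) i(4,5) weak_x(4)]
    and q0 = slices_continuous[OF T L b(6,7) i(6,7) weak_x(5)] and q1 = slices_continuous[OF T L b(7,8) i(7,8) weak_x(6)]
  \<comment> \<open>Vanishing traces pass to the time derivative; in the clamped case the same is
    done below for the x-derivative.\<close>
  have z0: "zero_bdry T L u0 u1"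
    by (rule zero_bdry_dt[OF T L b(1,2,6,7) i(1,2,6,7) weak_t(1,2) bdry(1)])
  have "zero_bdry T L v1 v2 \<and> zero_bdry T L u1 u2 \<or> zero_bdry T L v2 v3"
    using bdry(2) zero_bdry_dt[OF T L b(2,3,7,8) i(2,3,7,8) weak_t(2,3)] by blast
  then have z1: "AE t in lborel. t \<in> {0..T} \<longrightarrow>
      ((\<forall>p. ac L p (\<lambda>x. v2 (t, x)) \<longrightarrow> (AE x in lborel. x \<in> {0..L} \<longrightarrow> p x = v1 (t, x)) \<longrightarrow> p 0 = 0 \<and> p L = 0) \<and>
       (\<forall>p. ac L p (\<lambda>x. u2 (t, x)) \<longrightarrow> (AE x in lborel. x \<in> {0..L} \<longrightarrow> p x = u1 (t, x)) \<longrightarrow> p 0 = 0 \<and> p L = 0)) \<or>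
      (\<forall>p. ac L p (\<lambda>x. v3 (t, x)) \<longrightarrow> (AE x in lborel. x \<in> {0..L} \<longrightarrow> p x = v2 (t, x)) \<longrightarrow> p 0 = 0 \<and> p L = 0)"
  proof
    assume a: "zero_bdry T L v1 v2 \<and> zero_bdry T L u1 u2"
    from zero_bdry_slices[OF T L b(2,3) i(2,3)] zero_bdry_slices[OF T L b(7,8) i(7,8)] a show ?thesis
      by (auto elim!: eventually_elim2)
  next
    assume a: "zero_bdry T L v2 v3"
    from zero_bdry_slices[OF T L b(3,4) i(3,4) a] show ?thesis by (auto elim!: eventually_mono)
  qed
  show ?thesis
    using s0 s1 s2 s3 q0 q1 zero_bdry_slices[OF T L b(1,2) i(1,2) bdry(1)] zero_bdry_slices[OF T L b(6,7) i(6,7) z0] z1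
  proof eventually_elim
    case (elim t)
    show ?case
    proof
      assume t: "t \<in> {0..T}"
      obtain p0 where p0: "continuous_on UNIV p0" "ac L p0 (\<lambda>x. v1 (t, x))" "AE x in lborel. x \<in> {0..L} \<longrightarrow> p0 x = v0 (t, x)"
        using elim(1) t by blast
      obtain p1 where p1: "continuous_on UNIV p1" "ac L p1 (\<lambda>x. v2 (t, x))" "AE x in lborel. x \<in> {0..L} \<longrightarrow> p1 x = v1 (t, x)"
        using elim(2) t by blast
      obtain p2 where p2: "continuous_on UNIV p2" "ac L p2 (\<lambda>x. v3 (t, x))" "AE x in lborel. x \<in> {0..L} \<longrightarrow> p2 x = v2 (t, x)"
        using elim(3) t by blast
      obtain p3 where p3: "continuous_on UNIV p3" "ac L p3 (\<lambda>x. v4 (t, x))" "AE x in lborel. x \<in> {0..L} \<longrightarrow> p3 x = v3 (t, x)"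
        using elim(4) t by blast
      obtain r0 where r0: "continuous_on UNIV r0" "ac L r0 (\<lambda>x. u1 (t, x))" "AE x in lborel. x \<in> {0..L} \<longrightarrow> r0 x = u0 (t, x)"
        using elim(5) t by blast
      obtain r1 where r1: "continuous_on UNIV r1" "ac L r1 (\<lambda>x. u2 (t, x))" "AE x in lborel. x \<in> {0..L} \<longrightarrow> r1 x = u1 (t, x)"
        using elim(6) t by blast
      \<comment> \<open>Each derivative is replaced by its own continuous representative, so that
        the representatives form a chain under \<open>ac\<close>.\<close>
      have *: "ac L p q" if "ac L p (\<lambda>x. g (t, x))" "continuous_on UNIV q" "AE x in lborel. x \<in> {0..L} \<longrightarrow> q x = g (t, x)" for p q g
        by (rule ac_cong_AE[OF that(1) borel_measurable_continuous_onI[OF that(2)]]) (use that(3) in \<open>auto elim!: eventually_mono\<close>)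
      have "ac L p0 p1" "ac L p1 p2" "ac L p2 p3" "ac L r0 r1"
        by (rule *[OF p0(2) p1(1,3)], rule *[OF p1(2) p2(1,3)], rule *[OF p2(2) p3(1,3)], rule *[OF r0(2) r1(1,3)])
      moreover have "p0 0 = 0 \<and> p0 L = 0" using elim(7) t p0 by blast
      moreover have "r0 0 = 0 \<and> r0 L = 0" using elim(8) t r0 by blast
      moreover have "r1 0 = 0 \<and> r1 L = 0 \<and> p1 0 = 0 \<and> p1 L = 0 \<or> p2 0 = 0 \<and> p2 L = 0"
        using elim(9) t p1(2,3) p2(2,3) r1(2,3) by blast
      moreover have "AE x in lborel. x \<in> {0..L} \<longrightarrow> p0 x = v0 (t, x) \<and> p1 x = v1 (t, x) \<and> p2 x = v2 (t, x) \<and> p3 x = v3 (t, x)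
          \<and> r0 x = u0 (t, x) \<and> r1 x = u1 (t, x)"
        using p0(3) p1(3) p2(3) p3(3) r0(3) r1(3) by eventually_elim auto
      ultimately have "slice_at t p0 p1 p2 p3 r0 r1"
        unfolding slice_at_def
        using p0(1) p1(1) p2(1) p3(1,2) r0(1) r1(1,2) by (intro conjI) (assumption | simp)+
      then show "\<exists>p0 p1 p2 p3 r0 r1. slice_at t p0 p1 p2 p3 r0 r1" by blast
    qed
  qed
qed

section \<open>Integrated identities for the conjugated solution\<close>

definition S :: "real \<times> real \<Rightarrow> real" where
  "S z = sym_part (\<tau> z) (a1 (snd z)) (a2 (snd z)) (w0 z) (w1 z) (w2 z) (w4 z)"
definition K :: "real \<times> real \<Rightarrow> real" where
  "K z = skew_part (\<tau> z) (a1 (snd z)) (a2 (snd z)) (w0 z) (w1 z) (w3 z)"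
definition N :: "real \<times> real \<Rightarrow> real" where "N z = energy (\<tau> z) (w0 z) (w1 z) (w2 z) (w3 z)"
definition H :: "real \<times> real \<Rightarrow> real" where
  "H z = time_form (\<tau> z) (a1 (snd z)) (a2 (snd z)) (w0 z) (w1 z) (w2 z) (y0 z) (y1 z) (y2 z)"
definition J :: "real \<times> real \<Rightarrow> real" where
  "J z = time_error (\<tau> z) (\<sigma> z) (a1 (snd z)) (a2 (snd z)) (w0 z) (w1 z) (w2 z)"
definition Obs :: "real \<times> real \<Rightarrow> real" where "Obs z = e (snd z) * \<tau> z ^ 7 * (w0 z)^2"

lemma wl2_SK: "wl2 S" "wl2 K"
proof -
  have "wl2 (\<lambda>z. w4 z + 6 * (\<tau> z^2 * (a1 (snd z) * (a1 (snd z) * w2 z))) + 12 * (\<tau> z^2 * (a1 (snd z) * (a2 (snd z) * w1 z)))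
     + \<tau> z^4 * (a1 (snd z) * (a1 (snd z) * (a1 (snd z) * (a1 (snd z) * w0 z)))))"
    by (intro wl2_add wl2_tau wl2_coeff(2,3,8) wl2_solution)
  then show "wl2 S" by (rule wl2_eq) (simp add: S_def sym_part_def eval_nat_numeral mult_ac)
  have "wl2 (\<lambda>z. (- 4) * (\<tau> z^1 * (a1 (snd z) * w3 z)) + (- 4) * (\<tau> z^3 * (a1 (snd z) * (a1 (snd z) * (a1 (snd z) * w1 z))))
     + (- 6) * (\<tau> z^3 * (a1 (snd z) * (a1 (snd z) * (a2 (snd z) * w0 z)))))"
    by (intro wl2_add wl2_tau wl2_coeff(2,3,8) wl2_solution)
  then show "wl2 K" by (rule wl2_eq) (simp add: K_def skew_part_def eval_nat_numeral mult_ac)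
qed

lemma integrable_N: "set_integrable lborel Q N"
proof -
  note i = wl2_mult_integrable[OF wl2_tau[OF wl2_solution(4), of 1] wl2_solution(4)]
    wl2_mult_integrable[OF wl2_tau[OF wl2_solution(3), of 3] wl2_solution(3)]
    wl2_mult_integrable[OF wl2_tau[OF wl2_solution(2), of 5] wl2_solution(2)]
    wl2_mult_integrable[OF wl2_tau[OF wl2_solution(1), of 7] wl2_solution(1)]
  from set_integral_add(1)[OF set_integral_add(1)[OF set_integral_add(1)[OF i(1,2)] i(3)] i(4)]
  show ?thesis by (simp add: N_def[abs_def] energy_def power2_eq_square mult.assoc)
qed

lemma integrable_Obs: "set_integrable lborel Q Obs"
  using wl2_mult_integrable[OF wl2_coeff(6)[OF wl2_tau[OF wl2_solution(1), of 7]] wl2_solution(1)]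
  by (simp add: Obs_def[abs_def] power2_eq_square mult.assoc)

lemma integrable_SK: "set_integrable lborel Q (\<lambda>z. (S z)^2)" "set_integrable lborel Q (\<lambda>z. S z * K z)" "set_integrable lborel Q (\<lambda>z. S z * y0 z)"
  using wl2_mult_integrable[OF wl2_SK(1) wl2_SK(1)] wl2_mult_integrable[OF wl2_SK] wl2_mult_integrable[OF wl2_SK(1) wl2_solution(6)]
  by (simp_all add: power2_eq_square)

lemma integrable_H: "set_integrable lborel Q H"
proof -
  have t: "wl2 (\<lambda>z. \<tau> z * (a1 (snd z) * w1 z))" "wl2 (\<lambda>z. \<tau> z * (a1 (snd z) * w2 z))" "wl2 (\<lambda>z. \<tau> z * (a2 (snd z) * w1 z))"
     "wl2 (\<lambda>z. \<tau> z^2 * (a1 (snd z) * (a1 (snd z) * w1 z)))" "wl2 (\<lambda>z. \<tau> z^4 * (a1 (snd z) * (a1 (snd z) * (a1 (snd z) * (a1 (snd z) * w0 z)))))"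
    by (intro wl2_tau1 wl2_tau wl2_coeff wl2_solution)+
  note w = wl2_mult_integrable and y = wl2_solution(6,7,8)
  have "set_integrable lborel Q (\<lambda>z. w2 z * y2 z + (- 2) * (\<tau> z * (a1 (snd z) * w1 z) * y2 z) + (- 2) * (\<tau> z * (a1 (snd z) * w2 z) * y1 z)
    + (- 2) * (\<tau> z * (a2 (snd z) * w1 z) * y1 z) + (- 6) * (\<tau> z^2 * (a1 (snd z) * (a1 (snd z) * w1 z)) * y1 z)
    + \<tau> z^4 * (a1 (snd z) * (a1 (snd z) * (a1 (snd z) * (a1 (snd z) * w0 z)))) * y0 z)"
    by (intro set_integral_add(1) set_integrable_mult_right w t y wl2_solution)
  then show ?thesis by (simp add: H_def[abs_def] time_form_def eval_nat_numeral algebra_simps)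
qed

lemma integrable_J: "set_integrable lborel Q J"
proof -
  note w = wl2_mult_integrable and s = wl2_solution
  have "set_integrable lborel Q (\<lambda>z. 4 * (\<sigma> z * (\<tau> z^2 * (a1 (snd z) * w1 z)) * w2 z) + 2 * (\<sigma> z * (\<tau> z^2 * (a2 (snd z) * w1 z)) * w1 z)
     + 12 * (\<sigma> z * (\<tau> z^3 * (a1 (snd z) * (a1 (snd z) * w1 z))) * w1 z)
     + (- 4) * (\<sigma> z * (\<tau> z^5 * (a1 (snd z) * (a1 (snd z) * (a1 (snd z) * (a1 (snd z) * w0 z))))) * w0 z))"
    by (intro set_integral_add(1) set_integrable_mult_right w wl2_tau wl2_coeff s)
  then show ?thesis by (simp add: J_def[abs_def] time_error_def eval_nat_numeral algebra_simps)
qed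

lemma tau_ge: "z \<in> {0<..<T} \<times> {0..L} \<Longrightarrow> \<tau>0 \<le> \<tau> z"
proof -
  assume z: "z \<in> {0<..<T} \<times> {0..L}"
  define t where "t = fst z"
  have t: "0 < t" "t < T" using z by (auto simp: t_def)
  have "0 \<le> (T - 2 * t)^2" by simp
  then have "4 * (t * (T - t)) \<le> T^2" by (simp add: power2_eq_square algebra_simps)
  then have "4 * lam * (t * (T - t)) \<le> lam * T^2" using mult_left_mono[of _ _ lam] lam by (simp add: mult.left_commute mult.assoc)
  then have "4 * lam / T^2 \<le> lam / (t * (T - t))" using t T by (simp add: field_simps)
  then show ?thesis using lam by (simp add: \<tau>_def tau_def t_def)
qed

lemma ac_E_x:
  assumes "0 < t" "t < T"
  shows "ac L (\<lambda>x. E (t, x)) (\<lambda>x. \<tau> (t, x) * a1 x * E (t, x))"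
proof -
  have "ac L (\<lambda>x. exp (\<tau> (t, 0) * al x)) (\<lambda>x. exp (\<tau> (t, 0) * al x) * (\<tau> (t, 0) * a1 x))"
    by (rule ac_C1) (auto intro!: derivative_eq_intros al_deriv continuous_intros continuous_on_subset[OF cont(1)] continuous_on_subset[OF cont(2)])
  then show ?thesis using assms by (simp add: E_def time_weight_def \<tau>_def mult_ac)
qed

lemma E_continuous: "0 < t \<Longrightarrow> t < T \<Longrightarrow> continuous_on UNIV (\<lambda>x. E (t, x))"
  unfolding E_def time_weight_def by (simp, intro continuous_intros cont)

lemma integral_time_x: "(LINT z:Q|lborel. S z * y0 z - H z) = 0"
proof (rule rectangle_integral_zero)
  show "set_integrable lborel Q (\<lambda>z. S z * y0 z - H z)"
    by (intro set_integral_diff(1) integrable_SK integrable_H)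
  show "AE t in lborel. t \<in> {0..T} \<longrightarrow> (LINT x:{0..L}|lborel. S (t, x) * y0 (t, x) - H (t, x)) = 0"
    using x_slices AE_lborel_singleton[of 0] AE_lborel_singleton[of T]
  proof eventually_elim
    case (elim t)
    show ?case
    proof
      assume "t \<in> {0..T}"
      then have t: "0 < t" "t < T" "t \<in> {0..T}" using elim by auto
      obtain p0 p1 p2 p3 r0 r1 where sl: "slice_at t p0 p1 p2 p3 r0 r1" using elim(1) t by blast
      then have p: "ac L p0 p1" "ac L p1 p2" "ac L p2 p3" "ac L p3 (\<lambda>x. v4 (t, x))"
        and r: "ac L r0 r1" "ac L r1 (\<lambda>x. u2 (t, x))"
        and bd: "p0 0 = 0" "p0 L = 0" "r0 0 = 0" "r0 L = 0"
          "r1 0 = 0 \<and> r1 L = 0 \<and> p1 0 = 0 \<and> p1 L = 0 \<or> p2 0 = 0 \<and> p2 L = 0"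
        and ae: "AE x in lborel. x \<in> {0..L} \<longrightarrow> p0 x = v0 (t, x) \<and> p1 x = v1 (t, x) \<and> p2 x = v2 (t, x) \<and> p3 x = v3 (t, x)
          \<and> r0 x = u0 (t, x) \<and> r1 x = u1 (t, x)"
        by (simp_all add: slice_at_def)
      define \<theta> where "\<theta> = \<tau> (t, 0)"
      define s where "s = \<sigma> (t, 0)"
      have \<theta>: "\<tau> (t, x) = \<theta>" "\<sigma> (t, x) = s" for x by (simp_all add: \<theta>_def \<tau>_def s_def \<sigma>_def)
      have E: "ac L (\<lambda>x. E (t, x)) (\<lambda>x. \<theta> * a1 x * E (t, x))" using ac_E_x[OF t(1,2)] by (simp add: \<theta>)
      note ac = ac_conjugate[OF E ac_weight(2,3,4) p]
      note act = ac_conjugate_t[OF E ac_weight(1,2,3) p(1,2) r, of s]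
      note flux = ac_time_flux[OF ac_weight(2,3) ac act, of \<theta>]
      have "(LINT x:{0..L}|lborel. S (t, x) * y0 (t, x) - H (t, x)) = 0 - 0"
        using ac_ftc[OF ac_cong_AE[OF flux, of "\<lambda>x. S (t, x) * y0 (t, x) - H (t, x)"]]
      proof (rule trans)
        show "(\<lambda>x. S (t, x) * y0 (t, x) - H (t, x)) \<in> borel_measurable borel"
          unfolding S_def H_def sym_part_def time_form_def by measurable
        show "0 \<le> L" using L by simp
        show "AE x in lborel. x \<in> {0..L} \<longrightarrow>
          sym_part \<theta> (a1 x) (a2 x) (E (t, x) * p0 x) (E (t, x) * conj1 \<theta> (a1 x) (p0 x) (p1 x))
            (E (t, x) * conj2 \<theta> (a1 x) (a2 x) (p0 x) (p1 x) (p2 x))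
            (E (t, x) * conj4 \<theta> (a1 x) (a2 x) (a3 x) (a4 x) (p0 x) (p1 x) (p2 x) (p3 x) (v4 (t, x)))
            * (E (t, x) * conj_t \<theta> s (al x) (p0 x) (r0 x))
          - time_form \<theta> (a1 x) (a2 x) (E (t, x) * p0 x) (E (t, x) * conj1 \<theta> (a1 x) (p0 x) (p1 x))
            (E (t, x) * conj2 \<theta> (a1 x) (a2 x) (p0 x) (p1 x) (p2 x))
            (E (t, x) * conj_t \<theta> s (al x) (p0 x) (r0 x)) (E (t, x) * conj_tx \<theta> s (al x) (a1 x) (p0 x) (p1 x) (r0 x) (r1 x))
            (E (t, x) * conj_txx \<theta> s (al x) (a1 x) (a2 x) (p0 x) (p1 x) (p2 x) (r0 x) (r1 x) (u2 (t, x)))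
          = S (t, x) * y0 (t, x) - H (t, x)"
          using ae by eventually_elim
            (simp add: S_def H_def w0_def w1_def w2_def w4_def y0_def y1_def y2_def \<theta>)
      \<comment> \<open>At the ends v0 = u0 = 0, so y0 = 0, w2 - 2 \<tau> a1 w1 reduces to E v2, and
        y1 to E (u1 + \<sigma> \<tau>^2 al v1). Clamped ends annihilate y1, hinged ends annihilate E
        v2.\<close>
      qed (use bd in \<open>auto simp: conj_defs\<close>)
      then show "(LINT x:{0..L}|lborel. S (t, x) * y0 (t, x) - H (t, x)) = 0" by simp
    qed
  qed
qed

lemma t_slices:
  "AE x in lborel. x \<in> {0..L} \<longrightarrow> (\<exists>p0 p1 p2. continuous_on UNIV p0 \<and> continuous_on UNIV p1 \<and> continuous_on UNIV p2 \<and>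
    ac T p0 (\<lambda>t. u0 (t, x)) \<and> ac T p1 (\<lambda>t. u1 (t, x)) \<and> ac T p2 (\<lambda>t. u2 (t, x)) \<and>
    (AE t in lborel. t \<in> {0..T} \<longrightarrow> p0 t = v0 (t, x) \<and> p1 t = v1 (t, x) \<and> p2 t = v2 (t, x)))"
  using slices_continuous_t[OF T L borel_sol(1,6) integrable_sol(1,6) weak_t(1)]
    slices_continuous_t[OF T L borel_sol(2,7) integrable_sol(2,7) weak_t(2)]
    slices_continuous_t[OF T L borel_sol(3,8) integrable_sol(3,8) weak_t(3)]
proof eventually_elim
  case (elim x)
  show ?case
  proof
    assume x: "x \<in> {0..L}"
    obtain p0 where p0: "continuous_on UNIV p0" "ac T p0 (\<lambda>t. u0 (t, x))" "AE t in lborel. t \<in> {0..T} \<longrightarrow> p0 t = v0 (t, x)"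
      using elim(1) x by blast
    obtain p1 where p1: "continuous_on UNIV p1" "ac T p1 (\<lambda>t. u1 (t, x))" "AE t in lborel. t \<in> {0..T} \<longrightarrow> p1 t = v1 (t, x)"
      using elim(2) x by blast
    obtain p2 where p2: "continuous_on UNIV p2" "ac T p2 (\<lambda>t. u2 (t, x))" "AE t in lborel. t \<in> {0..T} \<longrightarrow> p2 t = v2 (t, x)"
      using elim(3) x by blast
    have "AE t in lborel. t \<in> {0..T} \<longrightarrow> p0 t = v0 (t, x) \<and> p1 t = v1 (t, x) \<and> p2 t = v2 (t, x)"
      using p0(3) p1(3) p2(3) by eventually_elim auto
    then show "\<exists>p0 p1 p2. continuous_on UNIV p0 \<and> continuous_on UNIV p1 \<and> continuous_on UNIV p2 \<and>
      ac T p0 (\<lambda>t. u0 (t, x)) \<and> ac T p1 (\<lambda>t. u1 (t, x)) \<and> ac T p2 (\<lambda>t. u2 (t, x)) \<and>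
      (AE t in lborel. t \<in> {0..T} \<longrightarrow> p0 t = v0 (t, x) \<and> p1 t = v1 (t, x) \<and> p2 t = v2 (t, x))"
      using p0 p1 p2 by blast
  qed
qed

text \<open>On almost every line of constant x the integrand is a total time derivative, and its
  primitive vanishes at both ends together with \<open>E\<close>.\<close>

lemma integral_time_t: "(LINT z:Q|lborel. 2 * H z - J z) = 0"
proof (rule rectangle_integral_zero_t)
  show "set_integrable lborel Q (\<lambda>z. 2 * H z - J z)"
    by (intro set_integral_diff(1) set_integrable_mult_right integrable_J integrable_H)
  show "AE x in lborel. x \<in> {0..L} \<longrightarrow> (LINT t:{0..T}|lborel. 2 * H (t, x) - J (t, x)) = 0"
    using t_slices
  proof eventually_elim
    case (elim x)
    show ?case
    proof
      assume x: "x \<in> {0..L}"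
      obtain p0 p1 p2 where p: "ac T p0 (\<lambda>t. u0 (t, x))" "ac T p1 (\<lambda>t. u1 (t, x))" "ac T p2 (\<lambda>t. u2 (t, x))"
        and ae: "AE t in lborel. t \<in> {0..T} \<longrightarrow> p0 t = v0 (t, x) \<and> p1 t = v1 (t, x) \<and> p2 t = v2 (t, x)"
        using elim x by blast
      have al: "al x < 0" using bounds[OF x] m by linarith
      have E: "ac T (\<lambda>t. \<tau> (t, x) ^ k * E (t, x))
        (\<lambda>t. \<sigma> (t, x) * (real k * \<tau> (t, x) ^ (k + 1) + al x * \<tau> (t, x) ^ (k + 2)) * E (t, x))" for k
        using time_weight_ac[OF T lam(1) al, of k] by (simp add: \<tau>_def \<sigma>_def E_def)
      note tc = ac_time_conjugate[where \<tau> = "\<lambda>t. \<tau> (t, x)" and E = "\<lambda>t. E (t, x)" and \<sigma> = "\<lambda>t. \<sigma> (t, x)", OF E p]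
      note form = ac_time_form[OF tc(1) tc(2)[of _ "a1 x"] tc(3)[of _ "a1 x" "a2 x"], of "a1 x" "a2 x"]
      have z: "E (0, x) = 0" "E (T, x) = 0" by (simp_all add: E_def time_weight_def)
      have "(LINT t:{0..T}|lborel. 2 * H (t, x) - J (t, x)) = 0 - 0"
        using ac_ftc[OF ac_cong_AE[OF form, of "\<lambda>t. 2 * H (t, x) - J (t, x)"]]
      proof (rule trans)
        show "(\<lambda>t. 2 * H (t, x) - J (t, x)) \<in> borel_measurable borel"
          unfolding J_def H_def time_error_def time_form_def by measurable
        show "0 \<le> T" using T by simp
        show "AE t in lborel. t \<in> {0..T} \<longrightarrow>
          2 * time_form (\<tau> (t, x)) (a1 x) (a2 x) (E (t, x) * p0 t) (E (t, x) * conj1 (\<tau> (t, x)) (a1 x) (p0 t) (p1 t))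
            (E (t, x) * conj2 (\<tau> (t, x)) (a1 x) (a2 x) (p0 t) (p1 t) (p2 t))
            (E (t, x) * conj_t (\<tau> (t, x)) (\<sigma> (t, x)) (al x) (p0 t) (u0 (t, x)))
            (E (t, x) * conj_tx (\<tau> (t, x)) (\<sigma> (t, x)) (al x) (a1 x) (p0 t) (p1 t) (u0 (t, x)) (u1 (t, x)))
            (E (t, x) * conj_txx (\<tau> (t, x)) (\<sigma> (t, x)) (al x) (a1 x) (a2 x) (p0 t) (p1 t) (p2 t) (u0 (t, x)) (u1 (t, x)) (u2 (t, x)))
          - time_error (\<tau> (t, x)) (\<sigma> (t, x)) (a1 x) (a2 x) (E (t, x) * p0 t) (E (t, x) * conj1 (\<tau> (t, x)) (a1 x) (p0 t) (p1 t))
            (E (t, x) * conj2 (\<tau> (t, x)) (a1 x) (a2 x) (p0 t) (p1 t) (p2 t))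
          = 2 * H (t, x) - J (t, x)"
          using ae by eventually_elim
            (simp add: J_def H_def w0_def w1_def w2_def y0_def y1_def y2_def)
      qed (use z in simp)
      then show "(LINT t:{0..T}|lborel. 2 * H (t, x) - J (t, x)) = 0" by simp
    qed
  qed
qed

text \<open>On a line of constant t the parameter \<tau> is a number not below
  \<open>\<tau>0\<close>, so the slice inequality applies for almost every t.\<close>

lemma integral_S_K: "0 \<le> (LINT z:Q|lborel. (S z)^2 + 2 * (S z * K z) - c * N z + C * Obs z)"
proof (rule rectangle_integral_nonneg)
  show "set_integrable lborel Q (\<lambda>z. (S z)^2 + 2 * (S z * K z) - c * N z + C * Obs z)"
    by (intro set_integral_add(1) set_integral_diff(1) set_integrable_mult_right integrable_SK integrable_N integrable_Obs)
  have w4: "AE t in lborel. t \<in> {0..T} \<longrightarrow> set_integrable lborel {0..L} (\<lambda>x. (w4 (t, x))^2)"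
    using wl2_solution(5) by (intro rectangle_fubini(2)) (auto simp: wl2_def dest: spec[of _ 0])
  show "AE t in lborel. t \<in> {0..T} \<longrightarrow> 0 \<le> (LINT x:{0..L}|lborel. (S (t, x))^2 + 2 * (S (t, x) * K (t, x)) - c * N (t, x) + C * Obs (t, x))"
    using x_slices w4 AE_lborel_singleton[of 0] AE_lborel_singleton[of T]
  proof eventually_elim
    case (elim t)
    show ?case
    proof
      assume "t \<in> {0..T}"
      then have t: "0 < t" "t < T" "t \<in> {0..T}" using elim by auto
      obtain p0 p1 p2 p3 r0 r1 where sl: "slice_at t p0 p1 p2 p3 r0 r1" using elim(1) t by blast
      then have cp: "continuous_on UNIV p0" "continuous_on UNIV p1" "continuous_on UNIV p2" "continuous_on UNIV p3"
        and p: "ac L p0 p1" "ac L p1 p2" "ac L p2 p3" "ac L p3 (\<lambda>x. v4 (t, x))" and bd: "p0 0 = 0" "p0 L = 0"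
        and ae: "AE x in lborel. x \<in> {0..L} \<longrightarrow> p0 x = v0 (t, x) \<and> p1 x = v1 (t, x) \<and> p2 x = v2 (t, x) \<and> p3 x = v3 (t, x)
          \<and> r0 x = u0 (t, x) \<and> r1 x = u1 (t, x)"
        by (simp_all add: slice_at_def)
      define \<theta> where "\<theta> = \<tau> (t, 0)"
      have \<theta>: "\<tau> (t, x) = \<theta>" for x by (simp add: \<theta>_def \<tau>_def)
      let ?E = "\<lambda>x. E (t, x)"
      have E: "ac L ?E (\<lambda>x. \<theta> * a1 x * ?E x)" using ac_E_x[OF t(1,2)] by (simp add: \<theta>)
      note ac = ac_conjugate[OF E ac_weight(2,3,4) p]
      define q0 where "q0 x = ?E x * p0 x" for x
      define q1 where "q1 x = ?E x * conj1 \<theta> (a1 x) (p0 x) (p1 x)" for x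
      define q2 where "q2 x = ?E x * conj2 \<theta> (a1 x) (a2 x) (p0 x) (p1 x) (p2 x)" for x
      define q3 where "q3 x = ?E x * conj3 \<theta> (a1 x) (a2 x) (a3 x) (p0 x) (p1 x) (p2 x) (p3 x)" for x
      have q: "ac L q0 q1" "ac L q1 q2" "ac L q2 q3" "ac L q3 (\<lambda>x. w4 (t, x))"
      proof -
        show "ac L q0 q1" "ac L q1 q2" "ac L q2 q3" using ac(1,2,3) by (simp_all add: q0_def[abs_def] q1_def[abs_def] q2_def[abs_def] q3_def[abs_def])
        have "AE x in lborel. x \<in> {0..L} \<longrightarrow> ?E x * conj4 \<theta> (a1 x) (a2 x) (a3 x) (a4 x) (p0 x) (p1 x) (p2 x) (p3 x) (v4 (t, x)) = w4 (t, x)"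
          using ae by eventually_elim (simp add: w4_def \<theta>)
        then show "ac L q3 (\<lambda>x. w4 (t, x))" unfolding q3_def[abs_def]
          by (intro ac_cong_AE[OF ac(4)]) auto
      qed
      \<comment> \<open>The slice functions equal the \<open>w0\<close> to \<open>w3\<close> only
        almost everywhere, so comparing the integrals below requires both integrands to be
        measurable.\<close>
      have m: "q0 \<in> borel_measurable borel" "q1 \<in> borel_measurable borel" "q2 \<in> borel_measurable borel" "q3 \<in> borel_measurable borel"
        unfolding q0_def[abs_def] q1_def[abs_def] q2_def[abs_def] q3_def[abs_def] conj_defs
        by (intro borel_measurable_continuous_onI continuous_intros E_continuous t cp cont)+
      have "\<tau>0 \<le> \<theta>" using tau_ge[of "(t, 0)"] t L by (simp add: \<theta>)
      from slice[OF this q] elim(2) t bd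
      have "0 \<le> (LINT x:{0..L}|lborel. (sym_part \<theta> (a1 x) (a2 x) (q0 x) (q1 x) (q2 x) (w4 (t, x)))^2
        + 2 * sym_part \<theta> (a1 x) (a2 x) (q0 x) (q1 x) (q2 x) (w4 (t, x)) * skew_part \<theta> (a1 x) (a2 x) (q0 x) (q1 x) (q3 x)
        - c * energy \<theta> (q0 x) (q1 x) (q2 x) (q3 x) + C * (e x * \<theta>^7 * (q0 x)^2))"
        by (simp add: q0_def)
      also have "\<dots> = (LINT x:{0..L}|lborel. (S (t, x))^2 + 2 * (S (t, x) * K (t, x)) - c * N (t, x) + C * Obs (t, x))"
      proof (rule set_lebesgue_integral_cong_AE)
        show "(\<lambda>x. (sym_part \<theta> (a1 x) (a2 x) (q0 x) (q1 x) (q2 x) (w4 (t, x)))^2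
          + 2 * sym_part \<theta> (a1 x) (a2 x) (q0 x) (q1 x) (q2 x) (w4 (t, x)) * skew_part \<theta> (a1 x) (a2 x) (q0 x) (q1 x) (q3 x)
          - c * energy \<theta> (q0 x) (q1 x) (q2 x) (q3 x) + C * (e x * \<theta>^7 * (q0 x)^2)) \<in> borel_measurable lborel"
          unfolding sym_part_def skew_part_def energy_def using m by measurable
        show "(\<lambda>x. (S (t, x))^2 + 2 * (S (t, x) * K (t, x)) - c * N (t, x) + C * Obs (t, x)) \<in> borel_measurable lborel"
          unfolding S_def K_def N_def Obs_def sym_part_def skew_part_def energy_def by measurable
        show "AE x\<in>{0..L} in lborel. (sym_part \<theta> (a1 x) (a2 x) (q0 x) (q1 x) (q2 x) (w4 (t, x)))^2
          + 2 * sym_part \<theta> (a1 x) (a2 x) (q0 x) (q1 x) (q2 x) (w4 (t, x)) * skew_part \<theta> (a1 x) (a2 x) (q0 x) (q1 x) (q3 x)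
          - c * energy \<theta> (q0 x) (q1 x) (q2 x) (q3 x) + C * (e x * \<theta>^7 * (q0 x)^2)
          = (S (t, x))^2 + 2 * (S (t, x) * K (t, x)) - c * N (t, x) + C * Obs (t, x)"
          using ae
        proof eventually_elim
          case (elim x)
          show ?case
          proof
            assume "x \<in> {0..L}"
            then have "q0 x = w0 (t, x)" "q1 x = w1 (t, x)" "q2 x = w2 (t, x)" "q3 x = w3 (t, x)"
              using elim by (simp_all add: q0_def q1_def q2_def q3_def w0_def w1_def w2_def w3_def \<theta>)
            then show "(sym_part \<theta> (a1 x) (a2 x) (q0 x) (q1 x) (q2 x) (w4 (t, x)))^2
              + 2 * sym_part \<theta> (a1 x) (a2 x) (q0 x) (q1 x) (q2 x) (w4 (t, x)) * skew_part \<theta> (a1 x) (a2 x) (q0 x) (q1 x) (q3 x)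
              - c * energy \<theta> (q0 x) (q1 x) (q2 x) (q3 x) + C * (e x * \<theta>^7 * (q0 x)^2)
              = (S (t, x))^2 + 2 * (S (t, x) * K (t, x)) - c * N (t, x) + C * Obs (t, x)"
              by (simp add: S_def K_def N_def Obs_def \<theta>)
          qed
        qed
      qed simp
      finally show "0 \<le> (LINT x:{0..L}|lborel. (S (t, x))^2 + 2 * (S (t, x) * K (t, x)) - c * N (t, x) + C * Obs (t, x))" .
    qed
  qed
qed

end

section \<open>From the conjugated function back to the solution\<close>

lemma sum3_squared: "(x + y + z)^2 \<le> 3 * (x^2 + y^2 + (z::real)^2)"
proof -
  have "0 \<le> (x - y)^2 + (x - z)^2 + (y - z)^2" by simp
  then show ?thesis by (simp add: power2_eq_square algebra_simps)
qed

text \<open>The triangular system is solved for v1, v2, v3 in turn. The constants are 39 = 3 + 12 *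
  2 + 3 * 4 and 1796 = 4 + 36 * 39 + 36 * 8 + 4 * 25; the total 1796 + 39 + 2 + 1 is rounded up to
  2000.\<close>

lemma conj_inverse_bound:
  assumes A: "1 \<le> A" and \<tau>: "1 \<le> \<tau>" and a: "\<bar>a1\<bar> \<le> A" "\<bar>a2\<bar> \<le> A" "\<bar>a3\<bar> \<le> A"
  shows "E^2 * (\<tau> * v3^2 + \<tau>^3 * v2^2 + \<tau>^5 * v1^2 + \<tau>^7 * v0^2)
    \<le> 2000 * A^6 * energy \<tau> (E * v0) (E * conj1 \<tau> a1 v0 v1) (E * conj2 \<tau> a1 a2 v0 v1 v2) (E * conj3 \<tau> a1 a2 a3 v0 v1 v2 v3)"
proof -
  define V0 V1 V2 V3 where "V0 = E * v0" and "V1 = E * v1" and "V2 = E * v2" and "V3 = E * v3"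
  define W1 W2 W3 where "W1 = E * conj1 \<tau> a1 v0 v1" and "W2 = E * conj2 \<tau> a1 a2 v0 v1 v2"
    and "W3 = E * conj3 \<tau> a1 a2 a3 v0 v1 v2 v3"
  define N where "N = energy \<tau> V0 W1 W2 W3"
  \<comment> \<open>The coefficients of \<open>conj2\<close> and \<open>conj3\<close> with one
    factor \<tau> taken out; they are of size \<tau> A^2 and \<tau>^2 A^3.\<close>
  define q where "q = \<tau> * a1^2 + a2"
  define p where "p = \<tau>^2 * a1^3 + 3 * \<tau> * a1 * a2 + a3"
  have W: "W1 + (- (\<tau> * a1 * V0)) = V1" "W2 + (- (2 * \<tau> * a1 * V1)) + (- (\<tau> * q * V0)) = V2"
    "W3 + (- (3 * \<tau> * a1 * V2)) + (- (3 * \<tau> * q * V1)) + (- (\<tau> * p * V0)) = V3"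
    by (simp_all add: W1_def W2_def W3_def V0_def V1_def V2_def V3_def q_def p_def conj_defs algebra_simps eval_nat_numeral)
  have n: "\<tau> * W3^2 \<le> N" "\<tau>^3 * W2^2 \<le> N" "\<tau>^5 * W1^2 \<le> N" "\<tau>^7 * V0^2 \<le> N" "0 \<le> N"
    "\<tau>^5 * W1^2 + \<tau>^7 * V0^2 \<le> N"
    using \<tau> by (auto simp: N_def energy_def)
  have Ap: "1 \<le> A^n" for n using A by (rule one_le_power)
  have a1: "a1^2 \<le> A^2" using power_mono[OF a(1), of 2] by simp
  have q: "\<bar>q\<bar> \<le> 2 * \<tau> * A^2"
  proof -
    have "\<tau> * a1^2 \<le> \<tau> * A^2" using a1 \<tau> by (intro mult_left_mono) auto
    moreover have "1 * A \<le> \<tau> * A^2" using \<tau> A self_le_power[of A 2] by (intro mult_mono) auto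
    moreover have "0 \<le> \<tau> * a1^2" using \<tau> by simp
    ultimately show ?thesis unfolding q_def using a(2) by argo
  qed
  have p: "\<bar>p\<bar> \<le> 5 * \<tau>^2 * A^3"
  proof -
    have "\<tau>^2 * \<bar>a1\<bar>^3 \<le> \<tau>^2 * A^3" using a \<tau> by (intro mult_left_mono power_mono) auto
    moreover have "\<tau> * (\<bar>a1\<bar> * \<bar>a2\<bar>) \<le> \<tau>^2 * A^3"
    proof -
      have "\<bar>a1\<bar> * \<bar>a2\<bar> \<le> A * A" using a A by (intro mult_mono) auto
      also have "\<dots> \<le> A^3" using power_increasing[of 2 3 A] A by (simp add: power2_eq_square)
      finally show ?thesis using \<tau> self_le_power[of \<tau> 2] A by (intro mult_mono) auto
    qed
    moreover have "\<bar>a3\<bar> \<le> \<tau>^2 * A^3"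
    proof -
      have "1 * A \<le> \<tau>^2 * A^3" using one_le_power[OF \<tau>, of 2] self_le_power[of A 3] A by (intro mult_mono) auto
      then show ?thesis using a by simp
    qed
    moreover have "\<bar>p\<bar> \<le> \<tau>^2 * \<bar>a1\<bar>^3 + 3 * (\<tau> * (\<bar>a1\<bar> * \<bar>a2\<bar>)) + \<bar>a3\<bar>"
    proof -
      have "\<bar>\<tau>^2 * a1^3\<bar> = \<tau>^2 * \<bar>a1\<bar>^3" "\<bar>3 * \<tau> * a1 * a2\<bar> = 3 * (\<tau> * (\<bar>a1\<bar> * \<bar>a2\<bar>))"
        using \<tau> by (auto simp: abs_mult power_abs)
      then show ?thesis unfolding p_def by argo
    qed
    ultimately show ?thesis by argo
  qed
  have q2: "q^2 \<le> 4 * \<tau>^2 * A^4" using power_mono[OF q, of 2] by (simp add: power_mult_distrib flip: power_mult)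
  have p2: "p^2 \<le> 25 * \<tau>^4 * A^6" using power_mono[OF p, of 2] by (simp add: power_mult_distrib flip: power_mult)
  have b1: "\<tau>^5 * V1^2 \<le> 2 * A^2 * N"
  proof -
    have "V1^2 \<le> 2 * (W1^2 + (\<tau> * a1 * V0)^2)"
      unfolding W(1)[symmetric] using sum_squares_bound[of W1 "- (\<tau> * a1 * V0)"] by (simp add: power2_sum power2_diff)
    then have "\<tau>^5 * V1^2 \<le> \<tau>^5 * (2 * (W1^2 + (\<tau> * a1 * V0)^2))" using \<tau> by (intro mult_left_mono) auto
    also have "\<dots> = 2 * (\<tau>^5 * W1^2) + 2 * (a1^2 * (\<tau>^7 * V0^2))" by (simp add: power_mult_distrib algebra_simps eval_nat_numeral)
    also have "\<dots> \<le> 2 * (A^2 * (\<tau>^5 * W1^2)) + 2 * (A^2 * (\<tau>^7 * V0^2))"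
    proof -
      have "1 * (\<tau>^5 * W1^2) \<le> A^2 * (\<tau>^5 * W1^2)" "a1^2 * (\<tau>^7 * V0^2) \<le> A^2 * (\<tau>^7 * V0^2)"
        using Ap[of 2] a1 \<tau> by (intro mult_right_mono; simp)+
      then show ?thesis by argo
    qed
    also have "\<dots> = 2 * A^2 * (\<tau>^5 * W1^2 + \<tau>^7 * V0^2)" by (simp add: algebra_simps)
    also have "\<dots> \<le> 2 * A^2 * N" using n by (intro mult_left_mono) auto
    finally show ?thesis .
  qed
  have b2: "\<tau>^3 * V2^2 \<le> 39 * A^4 * N"
  proof -
    have "V2^2 \<le> 3 * (W2^2 + (2 * \<tau> * a1 * V1)^2 + (\<tau> * q * V0)^2)"
      using sum3_squared[of W2 "- (2 * \<tau> * a1 * V1)" "- (\<tau> * q * V0)"] unfolding W(2) by simp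
    then have "\<tau>^3 * V2^2 \<le> \<tau>^3 * (3 * (W2^2 + (2 * \<tau> * a1 * V1)^2 + (\<tau> * q * V0)^2))" using \<tau> by (intro mult_left_mono) auto
    also have "\<dots> = 3 * (\<tau>^3 * W2^2) + 12 * (a1^2 * (\<tau>^5 * V1^2)) + 3 * (q^2 * (\<tau>^5 * V0^2))"
      by (simp add: power_mult_distrib algebra_simps eval_nat_numeral)
    also have "\<dots> \<le> 3 * (A^4 * N) + 12 * (2 * (A^4 * N)) + 3 * (4 * (A^4 * N))"
    proof -
      have "\<tau>^3 * W2^2 \<le> A^4 * N" using mult_mono[OF Ap[of 4] n(2)] \<tau> A by simp
      moreover have "a1^2 * (\<tau>^5 * V1^2) \<le> A^2 * (2 * A^2 * N)" by (rule mult_mono[OF a1 b1]) (use \<tau> in auto)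
      moreover have "A^2 * (2 * A^2 * N) = 2 * (A^4 * N)" by (simp add: eval_nat_numeral)
      moreover have "q^2 * (\<tau>^5 * V0^2) \<le> (4 * \<tau>^2 * A^4) * (\<tau>^5 * V0^2)" using q2 \<tau> by (intro mult_right_mono) auto
      moreover have "(4 * \<tau>^2 * A^4) * (\<tau>^5 * V0^2) = 4 * (A^4 * (\<tau>^7 * V0^2))" by (simp add: eval_nat_numeral)
      moreover have "A^4 * (\<tau>^7 * V0^2) \<le> A^4 * N" using n A by (intro mult_left_mono) auto
      ultimately show ?thesis by argo
    qed
    finally show ?thesis by (simp add: mult_ac)
  qed
  have b3: "\<tau> * V3^2 \<le> 1796 * A^6 * N"
  proof -
    have "V3^2 \<le> 4 * (W3^2 + (3 * \<tau> * a1 * V2)^2 + (3 * \<tau> * q * V1)^2 + (\<tau> * p * V0)^2)"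
      using sum4_squared[of W3 "- (3 * \<tau> * a1 * V2)" "- (3 * \<tau> * q * V1)" "- (\<tau> * p * V0)"] unfolding W(3) by simp
    then have "\<tau> * V3^2 \<le> \<tau> * (4 * (W3^2 + (3 * \<tau> * a1 * V2)^2 + (3 * \<tau> * q * V1)^2 + (\<tau> * p * V0)^2))" using \<tau> by (intro mult_left_mono) auto
    also have "\<dots> = 4 * (\<tau> * W3^2) + 36 * (a1^2 * (\<tau>^3 * V2^2)) + 36 * (q^2 * (\<tau>^3 * V1^2)) + 4 * (p^2 * (\<tau>^3 * V0^2))"
      by (simp add: power_mult_distrib algebra_simps eval_nat_numeral)
    also have "\<dots> \<le> 4 * (A^6 * N) + 36 * (39 * (A^6 * N)) + 36 * (8 * (A^6 * N)) + 4 * (25 * (A^6 * N))"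
    proof -
      have "\<tau> * W3^2 \<le> A^6 * N" using mult_mono[OF Ap[of 6] n(1)] \<tau> A by simp
      moreover have "a1^2 * (\<tau>^3 * V2^2) \<le> A^2 * (39 * A^4 * N)" by (rule mult_mono[OF a1 b2]) (use \<tau> in auto)
      moreover have "A^2 * (39 * A^4 * N) = 39 * (A^6 * N)" by (simp add: eval_nat_numeral)
      moreover have "q^2 * (\<tau>^3 * V1^2) \<le> (4 * \<tau>^2 * A^4) * (\<tau>^3 * V1^2)" using q2 \<tau> by (intro mult_right_mono) auto
      moreover have "(4 * \<tau>^2 * A^4) * (\<tau>^3 * V1^2) = 4 * (A^4 * (\<tau>^5 * V1^2))" by (simp add: eval_nat_numeral)
      moreover have "A^4 * (\<tau>^5 * V1^2) \<le> A^4 * (2 * A^2 * N)" using b1 A by (intro mult_left_mono) auto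
      moreover have "A^4 * (2 * A^2 * N) = 2 * (A^6 * N)" by (simp add: eval_nat_numeral)
      moreover have "p^2 * (\<tau>^3 * V0^2) \<le> (25 * \<tau>^4 * A^6) * (\<tau>^3 * V0^2)" using p2 \<tau> by (intro mult_right_mono) auto
      moreover have "(25 * \<tau>^4 * A^6) * (\<tau>^3 * V0^2) = 25 * (A^6 * (\<tau>^7 * V0^2))" by (simp add: eval_nat_numeral)
      moreover have "A^6 * (\<tau>^7 * V0^2) \<le> A^6 * N" using n A by (intro mult_left_mono) auto
      ultimately show ?thesis by argo
    qed
    finally show ?thesis by (simp add: mult_ac)
  qed
  have "A^2 \<le> A^6" "A^4 \<le> A^6" using A by (auto intro: power_increasing)
  then have m: "A^2 * N \<le> A^6 * N" "A^4 * N \<le> A^6 * N" "1 * N \<le> A^6 * N" using n(5) Ap[of 6] by (intro mult_right_mono; simp)+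
  have "E^2 * (\<tau> * v3^2 + \<tau>^3 * v2^2 + \<tau>^5 * v1^2 + \<tau>^7 * v0^2) = \<tau> * V3^2 + \<tau>^3 * V2^2 + \<tau>^5 * V1^2 + \<tau>^7 * V0^2"
    by (simp add: V0_def V1_def V2_def V3_def power_mult_distrib algebra_simps)
  also have "\<dots> \<le> 1796 * (A^6 * N) + 39 * (A^4 * N) + 2 * (A^2 * N) + N" using b1 b2 b3 n by argo
  also have "\<dots> \<le> 2000 * (A^6 * N)" using m n(5) by argo
  finally show ?thesis by (simp add: N_def V0_def W1_def W2_def W3_def)
qed

context carleman_solution
begin

text \<open>Expanding the square of S + (K + \<gamma> y0) and dropping the square of the bracket
  leaves the products whose integrals are known, while S + K + \<gamma> y0 = F - R by the conjugated
  equation. The factor 88 is four times the 22 in \<open>time_error_bound\<close>.\<close>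

lemma estimate:
  assumes l1: "8 * (4 * (\<gamma>^2 * A^2 + 36 * A^2 + 16 * A^2 + 64 * A^4)) \<le> c * (4 * lam / T^2)"
    and l2: "88 * \<bar>\<gamma>\<bar> * A^4 * T \<le> c * lam"
  shows "c / 2 * (LINT z:Q|lborel. N z) \<le> 2 * (LINT z:Q|lborel. (E z * (\<gamma> * u0 z + v4 z))^2) + C * (LINT z:Q|lborel. Obs z)"
proof -
  define F where "F z = E z * (\<gamma> * u0 z + v4 z)" for z
  \<comment> \<open>The integral of \<open>k1\<close> is nonnegative, those of \<open>k2\<close> and
    \<open>k3\<close> vanish. Subtracting k1 + 2 \<gamma> k2 + \<gamma> k3 therefore turns the
    integral estimate into a pointwise one.\<close>
  define k1 where "k1 z = (S z)^2 + 2 * (S z * K z) - c * N z + C * Obs z" for z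
  define k2 where "k2 z = S z * y0 z - H z" for z
  define k3 where "k3 z = 2 * H z - J z" for z
  have iF: "set_integrable lborel Q (\<lambda>z. (F z)^2)"
  proof -
    have "wl2 (\<lambda>z. \<gamma> * (E z * u0 z) + E z * v4 z)"
      by (intro wl2_add wl2_coeff(8) wl2_E borel_sol square_sol)
    then have "wl2 F" by (rule wl2_eq) (simp add: F_def algebra_simps)
    from wl2_mult_integrable[OF this this] show ?thesis by (simp add: power2_eq_square)
  qed
  have ik: "set_integrable lborel Q k1" "set_integrable lborel Q k2" "set_integrable lborel Q k3"
    unfolding k1_def k2_def k3_def
    by (intro set_integral_add(1) set_integral_diff(1) set_integrable_mult_right integrable_SK integrable_N integrable_Obs integrable_H integrable_J)+
  \<comment> \<open>Half of c N survives: the remainder consumes one quarter by the first largeness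
    condition on \<open>lam\<close>, the time error another quarter by the second.\<close>
  have pw: "c / 2 * N z \<le> 2 * (F z)^2 + C * Obs z - k1 z - 2 * \<gamma> * k2 z - \<gamma> * k3 z" if z: "z \<in> Q" for z
  proof (cases "0 < fst z \<and> fst z < T")
    case False
    then have E0: "E z = 0" by (auto simp: E_def time_weight_def)
    then have "w0 z = 0" "w1 z = 0" "w2 z = 0" "w3 z = 0" "w4 z = 0" "y0 z = 0" "y1 z = 0" "y2 z = 0"
      by (simp_all add: w0_def w1_def w2_def w3_def w4_def y0_def y1_def y2_def)
    then show ?thesis
      by (simp add: k1_def k2_def k3_def F_def E0 S_def K_def N_def H_def J_def Obs_def sym_part_def skew_part_def
          energy_def time_form_def time_error_def)
  next
    case True
    define R where "R = remainder (\<tau> z) (\<sigma> z) \<gamma> (al (snd z)) (a1 (snd z)) (a2 (snd z)) (a3 (snd z)) (a4 (snd z)) (w0 z) (w1 z) (w2 z)"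
    have x: "snd z \<in> {0..L}" using z by auto
    note b = bounds[OF x]
    have "\<tau>0 \<le> \<tau> z" using tau_ge[of z] True z by (cases z) auto
    then have \<tau>1: "1 \<le> \<tau> z" using \<tau>0 by linarith
    have \<tau>l: "4 * lam / T^2 \<le> \<tau> z"
    proof -
      define t where "t = fst z"
      have t: "0 < t" "t < T" using True by (auto simp: t_def)
      have "0 \<le> (T - 2 * t)^2" by simp
      then have "4 * (t * (T - t)) \<le> T^2" by (simp add: power2_eq_square algebra_simps)
      then have "lam * (4 * (t * (T - t))) \<le> lam * T^2" using lam by (intro mult_left_mono) auto
      then show ?thesis using t T by (simp add: \<tau>_def tau_def t_def[symmetric] field_simps)
    qed
    have \<sigma>: "\<bar>\<sigma> z\<bar> \<le> T / lam"
      using True lam by (auto simp: \<sigma>_def sigma_def abs_le_iff divide_right_mono)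
    have "\<bar>\<sigma> z\<bar> \<le> 1" using \<sigma> lam by (smt (verit) divide_le_eq_1)
    have N0: "0 \<le> N z" using \<tau>1 by (simp add: N_def energy_nonneg)
    let ?KR = "4 * (\<gamma>^2 * A^2 + 36 * A^2 + 16 * A^2 + 64 * A^4)"
    have "\<tau> z * R^2 \<le> ?KR * N z"
      unfolding R_def N_def using b A \<tau>1 \<open>\<bar>\<sigma> z\<bar> \<le> 1\<close> by (intro remainder_bound) auto
    then have "8 * (\<tau> z * R^2) \<le> 8 * (?KR * N z)" by (intro mult_left_mono) auto
    then have "8 * (\<tau> z * R^2) \<le> (8 * ?KR) * N z" by (simp only: mult.assoc)
    also have "\<dots> \<le> (c * \<tau> z) * N z"
    proof (intro mult_right_mono N0)
      have "c * (4 * lam / T^2) \<le> c * \<tau> z" using \<tau>l c by (intro mult_left_mono) auto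
      then show "8 * ?KR \<le> c * \<tau> z" using l1 by linarith
    qed
    finally have "\<tau> z * (8 * R^2) \<le> \<tau> z * (c * N z)" by (simp add: mult_ac)
    then have R: "8 * R^2 \<le> c * N z" using \<tau>1 by simp
    have "\<bar>J z\<bar> \<le> \<bar>\<sigma> z\<bar> * (22 * A^4 * N z)"
      unfolding J_def N_def using b A \<tau>1 by (intro time_error_bound) auto
    also have "\<dots> \<le> T / lam * (22 * A^4 * N z)" using \<sigma> N0 A by (intro mult_right_mono) auto
    finally have "\<bar>\<gamma>\<bar> * \<bar>J z\<bar> \<le> \<bar>\<gamma>\<bar> * (T / lam * (22 * A^4 * N z))" by (intro mult_left_mono) auto
    also have "4 * \<dots> = (88 * \<bar>\<gamma>\<bar> * A^4 * T) / lam * N z" by simp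
    also have "\<dots> \<le> c * N z"
      using l2 lam N0 by (intro mult_right_mono) (auto simp: divide_le_eq)
    finally have J: "4 * (\<bar>\<gamma>\<bar> * \<bar>J z\<bar>) \<le> c * N z" by simp
    have F: "F z = S z + K z + \<gamma> * y0 z + R"
      unfolding F_def S_def K_def R_def w0_def w1_def w2_def w3_def w4_def y0_def by (rule conjugated_equation)
    have "(S z)^2 + 2 * (S z * K z) + 2 * \<gamma> * (S z * y0 z) \<le> (S z + (K z + \<gamma> * y0 z))^2"
    proof -
      have "(S z + (K z + \<gamma> * y0 z))^2 = (S z)^2 + 2 * (S z * K z) + 2 * \<gamma> * (S z * y0 z) + (K z + \<gamma> * y0 z)^2"
        by algebra
      then show ?thesis by simp
    qed
    also have "S z + (K z + \<gamma> * y0 z) = F z - R" using F by simp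
    also have "(F z - R)^2 \<le> 2 * (F z)^2 + 2 * R^2"
    proof -
      have "0 \<le> (F z + R)^2" by simp
      then show ?thesis by (simp add: power2_sum power2_diff)
    qed
    finally have "(S z)^2 + 2 * (S z * K z) + 2 * \<gamma> * (S z * y0 z) \<le> 2 * (F z)^2 + 2 * R^2" .
    moreover have "- (\<gamma> * J z) \<le> \<bar>\<gamma>\<bar> * \<bar>J z\<bar>" by (simp flip: abs_mult)
    moreover have "k1 z + 2 * \<gamma> * k2 z + \<gamma> * k3 z = (S z)^2 + 2 * (S z * K z) + 2 * \<gamma> * (S z * y0 z) - c * N z + C * Obs z - \<gamma> * J z"
      by (simp add: k1_def k2_def k3_def algebra_simps)
    ultimately show ?thesis using R J by argo
  qed
  have i: "set_integrable lborel Q (\<lambda>z. 2 * (F z)^2 + C * Obs z - k1 z - 2 * \<gamma> * k2 z - \<gamma> * k3 z)"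
    by (intro set_integral_add(1) set_integral_diff(1) set_integrable_mult_right iF integrable_Obs ik)
  have "(LINT z:Q|lborel. c / 2 * N z) \<le> (LINT z:Q|lborel. 2 * (F z)^2 + C * Obs z - k1 z - 2 * \<gamma> * k2 z - \<gamma> * k3 z)"
    by (intro set_integral_mono i set_integrable_mult_right integrable_N pw)
  also have "\<dots> = 2 * (LINT z:Q|lborel. (F z)^2) + C * (LINT z:Q|lborel. Obs z) - (LINT z:Q|lborel. k1 z)
      - 2 * \<gamma> * (LINT z:Q|lborel. k2 z) - \<gamma> * (LINT z:Q|lborel. k3 z)"
    by (subst set_integral_diff set_integral_add set_integral_mult_right,
        (intro set_integral_add(1) set_integral_diff(1) set_integrable_mult_right iF integrable_Obs ik)+)+ simp
  also have "\<dots> \<le> 2 * (LINT z:Q|lborel. (F z)^2) + C * (LINT z:Q|lborel. Obs z)"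
    using integral_S_K integral_time_x integral_time_t by (simp add: k1_def k2_def k3_def)
  finally show ?thesis by (simp add: F_def)
qed

lemma solution_bound:
  assumes "z \<in> Q"
  shows "(E z)^2 * (\<tau> z * (v3 z)^2 + \<tau> z^3 * (v2 z)^2 + \<tau> z^5 * (v1 z)^2 + \<tau> z^7 * (v0 z)^2)
    \<le> 2000 * A^6 * N z"
proof (cases "0 < fst z \<and> fst z < T")
  case False
  then have "E z = 0" by (auto simp: E_def time_weight_def)
  then show ?thesis by (simp add: N_def energy_def w0_def w1_def w2_def w3_def)
next
  case True
  have "\<tau>0 \<le> \<tau> z" using tau_ge[of z] True assms by (cases z) auto
  then have "1 \<le> \<tau> z" using \<tau>0 by linarith
  then show ?thesis
    unfolding N_def w0_def w1_def w2_def w3_def using A bounds[of "snd z"] assms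
    by (intro conj_inverse_bound) auto
qed

end

section \<open>Sobolev functions and traces\<close>

lemma borel_open_rectangle [measurable]: "{a<..<b} \<times> {c<..<d} \<in> sets (borel :: (real \<times> real) measure)"
  by (intro borel_open open_Times open_greaterThanLessThan)

lemma AE_rectangle_interior:
  "AE z in lborel. z \<in> {0..T} \<times> {0..L} \<longrightarrow> z \<in> {0<..<T :: real} \<times> {0<..<L :: real}"
proof -
  have 1: "AE z in lborel. fst (z :: real \<times> real) \<noteq> c" for c
    by (rule AE_lift_fst[OF AE_lborel_singleton])
  have 2: "AE z in lborel. snd (z :: real \<times> real) \<noteq> c" for c
    using AE_swap[OF 1[of c]] by simp
  show ?thesis using 1[of 0] 1[of T] 2[of 0] 2[of L] by eventually_elim auto
qed

text \<open>Fubini's theorem is available for \<open>lborel\<close>, which is a product measure, but not for its completion; hence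
  all functions are replaced by Borel representatives.\<close>

definition borel_rep :: "real \<Rightarrow> real \<Rightarrow> (real \<times> real \<Rightarrow> real) \<Rightarrow> (real \<times> real \<Rightarrow> real) \<Rightarrow> bool" where
  "borel_rep T L g h \<longleftrightarrow> h \<in> borel_measurable borel \<and>
     (AE z in lborel. indicator ({0<..<T} \<times> {0<..<L}) z * g z = indicator ({0..T} \<times> {0..L}) z * h z) \<and>
     (\<lambda>z. indicator ({0<..<T} \<times> {0<..<L}) z * g z) \<in> borel_measurable lebesgue"

lemma borel_repD: "borel_rep T L g h \<Longrightarrow> AE z in lborel. z \<in> {0<..<T} \<times> {0<..<L} \<longrightarrow> g z = h z"
  unfolding borel_rep_def by (elim conjE) (auto elim!: eventually_mono simp: indicator_def)

lemma borel_repI: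
  assumes g: "(\<lambda>z. indicator ({0<..<T} \<times> {0<..<L}) z * g z) \<in> borel_measurable lebesgue"
    and h: "h \<in> borel_measurable borel" and ae: "AE z in lborel. z \<in> {0<..<T} \<times> {0<..<L} \<longrightarrow> g z = h z"
  shows "borel_rep T L g h"
proof -
  have "AE z in lborel. indicator ({0<..<T} \<times> {0<..<L}) z * g z = indicator ({0..T} \<times> {0..L}) z * h z"
    using ae AE_rectangle_interior[of T L] by eventually_elim (auto simp: indicator_def)
  then show ?thesis using g h by (simp add: borel_rep_def)
qed

lemma borel_rep_exists:
  assumes "(\<lambda>z. indicator ({0<..<T} \<times> {0<..<L}) z * g z) \<in> borel_measurable lebesgue"
  shows "\<exists>h. borel_rep T L g h"
proof -
  obtain h where h: "h \<in> borel_measurable lborel" "AE z in lborel. indicator ({0<..<T} \<times> {0<..<L}) z * g z = h z"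
    using completion_ex_borel_measurable_real[OF assms] by blast
  have "AE z in lborel. z \<in> {0<..<T} \<times> {0<..<L} \<longrightarrow> g z = h z"
    using h(2) by eventually_elim (auto simp: indicator_def)
  then show ?thesis using h assms by (auto intro!: borel_repI)
qed

lemma borel_rep_integral:
  assumes "borel_rep T L g h"
  shows "(LINT z:{0<..<T} \<times> {0<..<L}|lebesgue. g z) = (LINT z:{0..T} \<times> {0..L}|lborel. h z)"
    and "set_integrable lebesgue ({0<..<T} \<times> {0<..<L}) g \<longleftrightarrow> set_integrable lborel ({0..T} \<times> {0..L}) h"
proof -
  have [measurable]: "h \<in> borel_measurable borel" using assms by (simp add: borel_rep_def)
  have m: "(\<lambda>z. indicator ({0..T} \<times> {0..L}) z * h z) \<in> borel_measurable lborel" by measurable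
  have ae: "AE z in lebesgue. indicator ({0<..<T} \<times> {0<..<L}) z * g z = indicator ({0..T} \<times> {0..L}) z * h z"
    using assms by (auto simp: borel_rep_def intro: AE_completion)
  have gm: "(\<lambda>z. indicator ({0<..<T} \<times> {0<..<L}) z * g z) \<in> borel_measurable lebesgue"
    using assms by (simp add: borel_rep_def)
  show "(LINT z:{0<..<T} \<times> {0<..<L}|lebesgue. g z) = (LINT z:{0..T} \<times> {0..L}|lborel. h z)"
    using integral_cong_AE[OF gm measurable_completion[OF m] ae] integral_completion[OF m]
    by (simp add: set_lebesgue_integral_def)
  show "set_integrable lebesgue ({0<..<T} \<times> {0<..<L}) g \<longleftrightarrow> set_integrable lborel ({0..T} \<times> {0..L}) h"
    using integrable_cong_AE[OF gm measurable_completion[OF m] ae] integrable_completion[OF m]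
    by (simp add: set_integrable_def)
qed

lemma borel_rep_compose:
  assumes g: "borel_rep T L g h" and Fm: "(\<lambda>p. F (fst p) (snd p)) \<in> borel_measurable (borel \<Otimes>\<^sub>M borel)"
  shows "borel_rep T L (\<lambda>z. F z (g z)) (\<lambda>z. F (z :: real \<times> real) (h z) :: real)"
proof -
  have [measurable]: "h \<in> borel_measurable borel" using g by (simp add: borel_rep_def)
  have [measurable]: "(\<lambda>z. indicator ({0<..<T} \<times> {0<..<L}) z * g z) \<in> borel_measurable lebesgue"
    using g by (simp add: borel_rep_def)
  have id: "(\<lambda>z::real \<times> real. z) \<in> lebesgue \<rightarrow>\<^sub>M borel" by (rule measurable_completion) simp
  have "(\<lambda>z. (z, indicator ({0<..<T} \<times> {0<..<L}) z * g z)) \<in> lebesgue \<rightarrow>\<^sub>M borel \<Otimes>\<^sub>M borel"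
    by (intro measurable_Pair id) measurable
  from measurable_compose[OF this Fm]
  have "(\<lambda>z. F z (indicator ({0<..<T} \<times> {0<..<L}) z * g z)) \<in> borel_measurable lebesgue" by simp
  then have "(\<lambda>z. indicator ({0<..<T} \<times> {0<..<L}) z * F z (indicator ({0<..<T} \<times> {0<..<L}) z * g z)) \<in> borel_measurable lebesgue"
    by (intro borel_measurable_times borel_measurable_indicator) auto
  also have "(\<lambda>z. indicator ({0<..<T} \<times> {0<..<L}) z * F z (indicator ({0<..<T} \<times> {0<..<L}) z * g z))
    = (\<lambda>z. indicator ({0<..<T} \<times> {0<..<L}) z * F z (g z))"
    by (auto simp: indicator_def fun_eq_iff)
  finally have 1: "(\<lambda>z. indicator ({0<..<T} \<times> {0<..<L}) z * F z (g z)) \<in> borel_measurable lebesgue" .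
  have "(\<lambda>z. (z, h z)) \<in> borel \<rightarrow>\<^sub>M borel \<Otimes>\<^sub>M borel" by measurable
  from measurable_compose[OF this Fm] have 2: "(\<lambda>z. F z (h z)) \<in> borel_measurable borel" by simp
  show ?thesis
    by (rule borel_repI[OF 1 2]) (use borel_repD[OF g] in \<open>auto elim!: eventually_mono\<close>)
qed

lemma borel_rep_mult:
  assumes "borel_rep T L g h" and [measurable]: "k \<in> borel_measurable borel"
  shows "borel_rep T L (\<lambda>z. k z * g z) (\<lambda>z. k z * h z)"
  by (rule borel_rep_compose[OF assms(1), of "\<lambda>z x. k z * x"]) measurable

lemma borel_rep_square: "borel_rep T L g h \<Longrightarrow> borel_rep T L (\<lambda>z. (g z)^2) (\<lambda>z. (h z)^2)"
  by (rule borel_rep_compose[of T L g h "\<lambda>z x. x^2"]) (assumption, measurable)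

lemma borel_rep_add:
  assumes a: "borel_rep T L g h" and b: "borel_rep T L g' h'"
  shows "borel_rep T L (\<lambda>z. g z + g' z) (\<lambda>z. h z + h' z)"
proof (rule borel_repI)
  have "(\<lambda>z. indicator ({0<..<T} \<times> {0<..<L}) z * g z + indicator ({0<..<T} \<times> {0<..<L}) z * g' z) \<in> borel_measurable lebesgue"
    using a b by (intro borel_measurable_add) (auto simp: borel_rep_def)
  then show "(\<lambda>z. indicator ({0<..<T} \<times> {0<..<L}) z * (g z + g' z)) \<in> borel_measurable lebesgue"
    by (simp add: distrib_left)
  show "(\<lambda>z. h z + h' z) \<in> borel_measurable borel" using a b unfolding borel_rep_def by (intro borel_measurable_add) auto
  show "AE z in lborel. z \<in> {0<..<T} \<times> {0<..<L} \<longrightarrow> g z + g' z = h z + h' z"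
    using borel_repD[OF a] borel_repD[OF b] by eventually_elim auto
qed

lemma borel_rep_borel: "borel_rep T L g h \<Longrightarrow> h \<in> borel_measurable borel"
  by (simp add: borel_rep_def)

lemma L2_on_rep:
  assumes "L2_on ({0<..<T} \<times> {0<..<L}) g"
  shows "\<exists>h. borel_rep T L g h \<and> set_integrable lborel ({0..T} \<times> {0..L}) (\<lambda>z. (h z)^2)"
proof -
  have "(\<lambda>z. indicator ({0<..<T} \<times> {0<..<L}) z * g z) \<in> borel_measurable lebesgue"
    using assms by (simp add: L2_on_def set_borel_measurable_def)
  then obtain h where h: "borel_rep T L g h" using borel_rep_exists by blast
  then show ?thesis using borel_rep_integral(2)[OF borel_rep_square[OF h]] assms by (auto simp: L2_on_def)
qed

text \<open>Measurability on the whole open rectangle is obtained as a limit over an exhaustion by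
  compact rectangles, on each of which the function is integrable.\<close>

lemma locally_integrable_rep:
  assumes "locally_integrable ({0<..<T} \<times> {0<..<L}) g"
  shows "\<exists>h. borel_rep T L g h" and "borel_rep T L g h \<Longrightarrow> 0 < c \<Longrightarrow> d < T \<Longrightarrow> 0 < c' \<Longrightarrow> d' < L \<Longrightarrow>
    set_integrable lborel ({c..d} \<times> {c'..d'}) h"
proof -
  have i: "set_integrable lebesgue ({c..d} \<times> {c'..d'}) g" if "0 < c" "d < T" "0 < c'" "d' < L" for c d c' d'
    using assms that unfolding locally_integrable_def
    by (auto intro!: compact_Times dest!: spec[of _ "{c..d} \<times> {c'..d'}"])
  have "(\<lambda>z. indicator ({0<..<T} \<times> {0<..<L}) z * g z) \<in> borel_measurable lebesgue"
  proof (rule borel_measurable_LIMSEQ_real)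
    let ?K = "\<lambda>n. {1 / Suc n..T - 1 / Suc n} \<times> {1 / Suc n..L - 1 / Suc n}"
    show "(\<lambda>z. indicator (?K n) z * g z) \<in> borel_measurable lebesgue" for n
      using i[of "1 / Suc n" "T - 1 / Suc n" "1 / Suc n" "L - 1 / Suc n"] by (simp add: set_integrable_def del: of_nat_Suc)
    show "(\<lambda>n. indicator (?K n) z * g z) \<longlonglongrightarrow> indicator ({0<..<T} \<times> {0<..<L}) z * g z" for z
    proof (cases "z \<in> {0<..<T} \<times> {0<..<L}")
      case True
      obtain t x where tx: "z = (t, x)" by (cases z)
      let ?m = "min (min t (T - t)) (min x (L - x))"
      have "0 < ?m" using True tx by auto
      then have "eventually (\<lambda>n. 1 / Suc n < ?m) sequentially"
        using LIMSEQ_Suc[OF lim_1_over_n[where 'a = real]] by (rule order_tendstoD(2)[rotated])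
      then have "eventually (\<lambda>n. indicator (?K n) z * g z = indicator ({0<..<T} \<times> {0<..<L}) z * g z) sequentially"
      proof eventually_elim
        case (elim n)
        then have "1 / Suc n \<le> t" "1 / Suc n \<le> T - t" "1 / Suc n \<le> x" "1 / Suc n \<le> L - x" by linarith+
        then have "z \<in> ?K n" by (simp add: tx)
        then show ?case using True by (simp only: indicator_simps)
      qed
      then show ?thesis by (rule tendsto_eventually)
    next
      case False
      have "z \<notin> ?K n" for n
      proof -
        define \<epsilon> where "\<epsilon> = 1 / real (Suc n)"
        have "0 < \<epsilon>" by (simp add: \<epsilon>_def)
        then show ?thesis using False unfolding \<epsilon>_def[symmetric] by (cases z) auto
      qed
      then have "(\<lambda>n. indicator (?K n) z * g z) = (\<lambda>n. 0)"
        by (intro ext) (metis indicator_simps(2) mult_zero_left)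
      moreover have "indicator ({0<..<T} \<times> {0<..<L}) z * g z = 0" using False by (metis indicator_simps(2) mult_zero_left)
      ultimately show ?thesis by (simp only: tendsto_const)
    qed
  qed
  then show "\<exists>h. borel_rep T L g h" by (rule borel_rep_exists)
  assume h: "borel_rep T L g h" and cd: "0 < c" "d < T" "0 < c'" "d' < L"
  have [measurable]: "h \<in> borel_measurable borel" by (rule borel_rep_borel[OF h])
  have ae: "AE z in lebesgue. indicator ({c..d} \<times> {c'..d'}) z * g z = indicator ({c..d} \<times> {c'..d'}) z * h z"
    using AE_completion[OF borel_repD[OF h]] by eventually_elim (use cd in \<open>auto simp: indicator_def\<close>)
  have m: "(\<lambda>z. indicator ({c..d} \<times> {c'..d'}) z * h z) \<in> borel_measurable lborel" by measurable
  have g: "integrable lebesgue (\<lambda>z. indicator ({c..d} \<times> {c'..d'}) z * g z)"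
    using i[OF cd] by (simp add: set_integrable_def)
  from g integrable_cong_AE[OF borel_measurable_integrable[OF g] measurable_completion[OF m] ae] integrable_completion[OF m]
  show "set_integrable lborel ({c..d} \<times> {c'..d'}) h" by (simp add: set_integrable_def)
qed

section \<open>Weak derivatives and their representatives\<close>

lemma weak_deriv_test:
  assumes w: "has_weak_deriv ({0<..<T} \<times> {0<..<L}) i j u g" and u: "borel_rep T L u u'" and g: "borel_rep T L g g'"
    and ab: "test_line T a" "test_line L b"
  shows "(LINT z:{0..T} \<times> {0..L}|lborel. (deriv ^^ i) a (fst z) * (deriv ^^ j) b (snd z) * u' z)
    = (- 1) ^ (i + j) * (LINT z:{0..T} \<times> {0..L}|lborel. a (fst z) * b (snd z) * g' z)"
proof -
  let ?\<psi> = "\<lambda>z. a (fst z) * b (snd z)"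
  have s: "smooth_line a" "smooth_line b" using ab by (auto simp: test_line_def)
  have "(LINT z:{0<..<T} \<times> {0<..<L}|lebesgue. u z * (pd_t ^^ i) ((pd_x ^^ j) ?\<psi>) z)
    = (- 1) ^ (i + j) * (LINT z:{0<..<T} \<times> {0<..<L}|lebesgue. g z * ?\<psi> z)"
    using w test_function_product[OF ab] unfolding has_weak_deriv_def by blast
  then have "(LINT z:{0<..<T} \<times> {0<..<L}|lebesgue. ((deriv ^^ i) a (fst z) * (deriv ^^ j) b (snd z)) * u z)
    = (- 1) ^ (i + j) * (LINT z:{0<..<T} \<times> {0<..<L}|lebesgue. ?\<psi> z * g z)"
    by (simp only: pds_product[OF s] mult.commute)
  moreover have m: "(\<lambda>z. p (fst z) * q (snd z)) \<in> borel_measurable borel" if "smooth_line p" "smooth_line q" for p q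
    using continuous_on_product_smooth[OF that] by (rule borel_measurable_continuous_onI)
  ultimately show ?thesis
    using borel_rep_integral(1)[OF borel_rep_mult[OF u m[OF smooth_line_derivs[OF s(1)] smooth_line_derivs[OF s(2)]]], of i j]
      borel_rep_integral(1)[OF borel_rep_mult[OF g m[OF s]]] by simp
qed

lemma test_product_locally_integrable:
  fixes h :: "real \<times> real \<Rightarrow> real"
  assumes ab: "test_line T a" "test_line L b" and [measurable]: "h \<in> borel_measurable borel"
    and int: "\<And>c d c' d'. 0 < c \<Longrightarrow> d < T \<Longrightarrow> 0 < c' \<Longrightarrow> d' < L \<Longrightarrow> set_integrable lborel ({c..d} \<times> {c'..d'}) h"
  shows "set_integrable lborel ({0..T} \<times> {0..L}) (\<lambda>z. a (fst z) * b (snd z) * h z)"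
proof -
  obtain c d where cd: "0 < c" "d < T" "\<And>x. x \<notin> {c..d} \<Longrightarrow> a x = 0" using ab by (auto simp: test_line_def)
  obtain c' d' where cd': "0 < c'" "d' < L" "\<And>x. x \<notin> {c'..d'} \<Longrightarrow> b x = 0" using ab by (auto simp: test_line_def)
  obtain B where "\<And>z. \<bar>a (fst z) * b (snd z)\<bar> \<le> B" using test_product_bounded ab by metis
  then have "set_integrable lborel ({c..d} \<times> {c'..d'}) (\<lambda>z. a (fst z) * b (snd z) * h z)"
    by (intro set_integrable_bounded_mult[where B = B] test_product_borel[OF ab] int cd cd') auto
  moreover have eq: "indicator ({c..d} \<times> {c'..d'}) z *\<^sub>R (a (fst z) * b (snd z) * h z)
    = indicator ({0..T} \<times> {0..L}) z *\<^sub>R (a (fst z) * b (snd z) * h z)" for z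
  proof (cases "z \<in> {c..d} \<times> {c'..d'}")
    case True
    then show ?thesis using cd cd' by (auto simp: indicator_def)
  next
    case False
    then have "a (fst z) * b (snd z) = 0" using cd(3)[of "fst z"] cd'(3)[of "snd z"] by (cases z) auto
    then show ?thesis by simp
  qed
  ultimately show ?thesis unfolding set_integrable_def eq by simp
qed

lemma variational_equal:
  assumes g: "g \<in> borel_measurable borel" "g2 \<in> borel_measurable borel"
    and i: "\<And>c d c' d'. 0 < c \<Longrightarrow> d < T \<Longrightarrow> 0 < c' \<Longrightarrow> d' < L \<Longrightarrow> set_integrable lborel ({c..d} \<times> {c'..d'}) g"
    and i2: "\<And>c d c' d'. 0 < c \<Longrightarrow> d < T \<Longrightarrow> 0 < c' \<Longrightarrow> d' < L \<Longrightarrow> set_integrable lborel ({c..d} \<times> {c'..d'}) g2"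
    and e: "\<And>a b. test_line T a \<Longrightarrow> test_line L b \<Longrightarrow> (LINT z:{0..T} \<times> {0..L}|lborel. a (fst z) * b (snd z) * g z)
      = (LINT z:{0..T} \<times> {0..L}|lborel. a (fst z) * b (snd z) * g2 z)"
  shows "AE z in lborel. z \<in> {0<..<T} \<times> {0<..<L} \<longrightarrow> g z = g2 z"
proof -
  have "AE z in lborel. z \<in> {0<..<T} \<times> {0<..<L} \<longrightarrow> g z - g2 z = 0"
  proof (rule variational_zero)
    show "(\<lambda>z. g z - g2 z) \<in> borel_measurable borel" using g by measurable
    show "set_integrable lborel ({c..d} \<times> {c'..d'}) (\<lambda>z. g z - g2 z)" if "0 < c" "d < T" "0 < c'" "d' < L" for c d c' d'
      using i[OF that] i2[OF that] by (rule set_integral_diff(1))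
    fix a b assume ab: "test_line T a" "test_line L b"
    have "(LINT z:{0<..<T} \<times> {0<..<L}|lborel. (g z - g2 z) * (a (fst z) * b (snd z)))
      = (LINT z:{0..T} \<times> {0..L}|lborel. a (fst z) * b (snd z) * g z - a (fst z) * b (snd z) * g2 z)"
      unfolding set_lebesgue_integral_def
    proof (intro Bochner_Integration.integral_cong refl)
      fix z :: "real \<times> real"
      show "indicat_real ({0<..<T} \<times> {0<..<L}) z *\<^sub>R ((g z - g2 z) * (a (fst z) * b (snd z)))
        = indicat_real ({0..T} \<times> {0..L}) z *\<^sub>R (a (fst z) * b (snd z) * g z - a (fst z) * b (snd z) * g2 z)"
      proof (cases "z \<in> {0<..<T} \<times> {0<..<L}")
        case True
        then show ?thesis by (auto simp: indicator_def algebra_simps)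
      next
        case False
        then have "a (fst z) * b (snd z) = 0"
          using test_line_zero[OF ab(1), of "fst z"] test_line_zero[OF ab(2), of "snd z"]
          by (cases z) (auto simp: not_less)
        then show ?thesis using False by auto
      qed
    qed
    also have "\<dots> = 0"
      using set_integral_diff(2)[OF test_product_locally_integrable[OF ab g(1) i] test_product_locally_integrable[OF ab g(2) i2]] e[OF ab]
      by simp
    finally show "(LINT z:{0<..<T} \<times> {0<..<L}|lborel. (g z - g2 z) * (a (fst z) * b (snd z))) = 0" .
  qed
  then show ?thesis by eventually_elim auto
qed

lemma weak_deriv_unique:
  assumes w: "has_weak_deriv ({0<..<T} \<times> {0<..<L}) i j u g" "has_weak_deriv ({0<..<T} \<times> {0<..<L}) i j u g2"
    and u: "borel_rep T L u u'" and g: "borel_rep T L g g'" and g2: "borel_rep T L g2 g2'"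
  shows "AE z in lborel. z \<in> {0<..<T} \<times> {0<..<L} \<longrightarrow> g' z = g2' z"
proof (rule variational_equal)
  have l: "locally_integrable ({0<..<T} \<times> {0<..<L}) g" "locally_integrable ({0<..<T} \<times> {0<..<L}) g2"
    using w by (auto simp: has_weak_deriv_def)
  show "set_integrable lborel ({c..d} \<times> {c'..d'}) g'" "set_integrable lborel ({c..d} \<times> {c'..d'}) g2'"
    if "0 < c" "d < T" "0 < c'" "d' < L" for c d c' d'
    using locally_integrable_rep(2)[OF l(1) g that] locally_integrable_rep(2)[OF l(2) g2 that] by auto
  show "(LINT z:{0..T} \<times> {0..L}|lborel. a (fst z) * b (snd z) * g' z) = (LINT z:{0..T} \<times> {0..L}|lborel. a (fst z) * b (snd z) * g2' z)"
    if "test_line T a" "test_line L b" for a b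
    using weak_deriv_test[OF w(1) u g that] weak_deriv_test[OF w(2) u g2 that] by simp
qed (use g g2 in \<open>auto dest: borel_rep_borel\<close>)

text \<open>The Sobolev condition provides some square integrable derivative, whereas
  \<open>weak_deriv\<close> chooses an arbitrary one. Uniqueness almost everywhere transfers square
  integrability to the chosen one.\<close>

lemma sobolev_rep:
  assumes s: "sobolev ({0<..<T} \<times> {0<..<L}) k v" and ij: "i + j \<le> k"
  shows "has_weak_deriv ({0<..<T} \<times> {0<..<L}) i j v (weak_deriv ({0<..<T} \<times> {0<..<L}) i j v)"
    and "\<exists>h. borel_rep T L (weak_deriv ({0<..<T} \<times> {0<..<L}) i j v) h \<and> set_integrable lborel ({0..T} \<times> {0..L}) (\<lambda>z. (h z)^2)"
proof -
  let ?w = "weak_deriv ({0<..<T} \<times> {0<..<L}) i j v"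
  obtain g where g: "has_weak_deriv ({0<..<T} \<times> {0<..<L}) i j v g" "L2_on ({0<..<T} \<times> {0<..<L}) g"
    using s ij by (auto simp: sobolev_def)
  show w: "has_weak_deriv ({0<..<T} \<times> {0<..<L}) i j v ?w"
    unfolding weak_deriv_def by (rule someI[of "has_weak_deriv ({0<..<T} \<times> {0<..<L}) i j v", OF g(1)])
  obtain v' where v': "borel_rep T L v v'" using s L2_on_rep[of T L v] by (auto simp: sobolev_def)
  obtain h where h: "borel_rep T L g h" "set_integrable lborel ({0..T} \<times> {0..L}) (\<lambda>z. (h z)^2)" using L2_on_rep[OF g(2)] by blast
  obtain k where k: "borel_rep T L ?w k" using locally_integrable_rep(1)[of T L ?w] w by (auto simp: has_weak_deriv_def)
  have "borel_rep T L ?w h"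
  proof (rule borel_repI)
    show "(\<lambda>z. indicator ({0<..<T} \<times> {0<..<L}) z * ?w z) \<in> borel_measurable lebesgue" using k by (simp add: borel_rep_def)
    show "h \<in> borel_measurable borel" using h(1) by (rule borel_rep_borel)
    show "AE z in lborel. z \<in> {0<..<T} \<times> {0<..<L} \<longrightarrow> ?w z = h z"
      using weak_deriv_unique[OF w g(1) v' k h(1)] borel_repD[OF k] by eventually_elim auto
  qed
  then show "\<exists>h. borel_rep T L ?w h \<and> set_integrable lborel ({0..T} \<times> {0..L}) (\<lambda>z. (h z)^2)" using h by blast
qed

text \<open>Both functions are known only as derivatives of \<open>v\<close>. Testing the first with
  \<open>deriv b\<close> and the second with \<open>b\<close> gives the same integral of
  \<open>v\<close>, and the common sign cancels.\<close>

lemma weak_dx_of: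
  assumes w: "has_weak_deriv ({0<..<T} \<times> {0<..<L}) i j v g" "has_weak_deriv ({0<..<T} \<times> {0<..<L}) i (Suc j) v g2"
    and r: "borel_rep T L v v'" "borel_rep T L g g'" "borel_rep T L g2 g2'"
  shows "weak_dx T L g' g2'"
  unfolding weak_dx_def
proof (intro allI impI)
  fix a b assume ab: "test_line T a" "test_line L b"
  note 1 = weak_deriv_test[OF w(1) r(1,2) ab(1) test_line_deriv[OF ab(2)]]
  note 2 = weak_deriv_test[OF w(2) r(1,3) ab]
  have "(deriv ^^ j) (deriv b) = (deriv ^^ Suc j) b" by (simp only: funpow_Suc_right o_apply)
  then have "(- 1) ^ (i + j) * (LINT z:{0..T} \<times> {0..L}|lborel. a (fst z) * deriv b (snd z) * g' z)
    = (- 1) ^ (i + j) * (- (LINT z:{0..T} \<times> {0..L}|lborel. a (fst z) * b (snd z) * g2' z))"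
    using 1 2 by simp
  then show "(LINT z:{0..T} \<times> {0..L}|lborel. a (fst z) * deriv b (snd z) * g' z)
    = - (LINT z:{0..T} \<times> {0..L}|lborel. a (fst z) * b (snd z) * g2' z)"
    by (subst (asm) mult_cancel_left) simp
qed

lemma weak_dt_of:
  assumes w: "has_weak_deriv ({0<..<T} \<times> {0<..<L}) i j v g" "has_weak_deriv ({0<..<T} \<times> {0<..<L}) (Suc i) j v g2"
    and r: "borel_rep T L v v'" "borel_rep T L g g'" "borel_rep T L g2 g2'"
    and i: "set_integrable lborel ({0..T} \<times> {0..L}) g'" "set_integrable lborel ({0..T} \<times> {0..L}) g2'"
  shows "weak_dt T L g' g2'"
  unfolding weak_dt_def weak_dx_def
proof (intro allI impI)
  fix b a assume ab: "test_line L b" "test_line T a"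
  note 1 = weak_deriv_test[OF w(1) r(1,2) test_line_deriv[OF ab(2)] ab(1)]
  note 2 = weak_deriv_test[OF w(2) r(1,3) ab(2,1)]
  have "(deriv ^^ i) (deriv a) = (deriv ^^ Suc i) a" by (simp only: funpow_Suc_right o_apply)
  then have "(- 1) ^ (i + j) * (LINT z:{0..T} \<times> {0..L}|lborel. deriv a (fst z) * b (snd z) * g' z)
    = (- 1) ^ (i + j) * (- (LINT z:{0..T} \<times> {0..L}|lborel. a (fst z) * b (snd z) * g2' z))"
    using 1 2 by simp
  then have "(LINT z:{0..T} \<times> {0..L}|lborel. deriv a (fst z) * b (snd z) * g' z)
    = - (LINT z:{0..T} \<times> {0..L}|lborel. a (fst z) * b (snd z) * g2' z)"
    by (subst (asm) mult_cancel_left) simp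
  then show "(LINT z:{0..L} \<times> {0..T}|lborel. b (fst z) * deriv a (snd z) * g' (snd z, fst z))
    = - (LINT z:{0..L} \<times> {0..T}|lborel. b (fst z) * a (snd z) * g2' (snd z, fst z))"
    using rectangle_swap(2)[OF test_product_integrable[OF test_line_deriv[OF ab(2)] ab(1) i(1)]]
      rectangle_swap(2)[OF test_product_integrable[OF ab(2,1) i(2)]] by (simp add: mult.commute)
qed

section \<open>Traces as integral identities\<close>

lemma abs_le_square_div: "0 < (\<delta>::real) \<Longrightarrow> \<bar>p\<bar> \<le> \<delta> + p^2 / \<delta>"
proof -
  assume d: "0 < \<delta>"
  have "\<bar>p\<bar> * \<delta> \<le> \<delta> * \<delta> + p^2"
  proof -
    have "2 * \<bar>p\<bar> * \<delta> \<le> \<bar>p\<bar>^2 + \<delta>^2" by (rule sum_squares_bound)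
    moreover have "0 \<le> \<bar>p\<bar> * \<delta>" using d by simp
    ultimately show ?thesis by (simp add: power2_eq_square)
  qed
  then show ?thesis using d by (simp add: field_simps power2_eq_square)
qed

lemma smooth_plane_regular:
  assumes "smooth_plane w"
  shows "continuous_on UNIV w" "continuous_on UNIV (pd_t w)" "continuous_on UNIV (pd_x w)"
    "((\<lambda>x. w (t, x)) has_real_derivative pd_x w (t, x)) (at x)"
proof -
  have "Ck_plane (Suc 0) w" using assms by (simp only: smooth_plane_def)
  then show "continuous_on UNIV w" "continuous_on UNIV (pd_t w)" "continuous_on UNIV (pd_x w)"
    and "((\<lambda>x. w (t, x)) has_real_derivative pd_x w (t, x)) (at x)"
    by (auto simp: pd_x_def DERIV_deriv_iff_real_differentiable)
qed

lemma continuous_rectangle_integrable: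
  fixes f :: "real \<times> real \<Rightarrow> real"
  assumes "continuous_on UNIV f"
  shows "set_integrable lborel ({0..T} \<times> {0..L}) f"
proof -
  have [measurable]: "f \<in> borel_measurable borel" using assms by (rule borel_measurable_continuous_onI)
  have "bounded (f ` ({0..T} \<times> {0..L}))"
    by (intro compact_imp_bounded compact_continuous_image continuous_on_subset[OF assms] compact_Times) auto
  then obtain B where B: "\<And>z. z \<in> {0..T} \<times> {0..L} \<Longrightarrow> \<bar>f z\<bar> \<le> B" by (force simp: bounded_iff)
  have "set_integrable lborel ({0..T} \<times> {0..L}) (\<lambda>z. f z * 1)"
    by (rule set_integrable_bounded_mult[OF _ borel_rectangle B])
      (use set_integrable_fst[of T "\<lambda>_. 1" L] ac_continuous_set_integrable[of T "\<lambda>_. 1"] in auto)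
  then show ?thesis by simp
qed

lemma lebesgue_interval_integral:
  assumes "continuous_on UNIV (f :: real \<Rightarrow> real)"
  shows "(LINT t:{0<..<T}|lebesgue. f t) = (LINT t:{0..T}|lborel. f t)"
proof -
  have [measurable]: "f \<in> borel_measurable borel" using assms by (rule borel_measurable_continuous_onI)
  have "(LINT t:{0<..<T}|lebesgue. f t) = (LINT t:{0<..<T}|lborel. f t)"
    unfolding set_lebesgue_integral_def by (rule integral_completion) measurable
  also have "\<dots> = (LINT t:{0..T}|lborel. f t)"
    unfolding set_lebesgue_integral_def
  proof (rule integral_cong_AE)
    show "AE t in lborel. indicat_real {0<..<T} t *\<^sub>R f t = indicat_real {0..T} t *\<^sub>R f t"
      using AE_lborel_singleton[of 0] AE_lborel_singleton[of T] by eventually_elim (auto simp: indicator_def)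
  qed measurable
  finally show ?thesis .
qed

text \<open>Two limits in this order: n to infinity for fixed \<delta> removes the squared errors,
  then \<delta> to 0 removes the rest. Together with |p| \<le> \<delta> + p^2 / \<delta> this plays
  the role of the Cauchy-Schwarz inequality.\<close>

lemma tendsto_small_bound:
  fixes X :: real
  assumes "\<And>\<delta> n. 0 < \<delta> \<Longrightarrow> \<bar>X\<bar> \<le> P * (\<delta> * R + I n / \<delta>) + P' * (\<delta> * R' + B n / \<delta>)"
    and "I \<longlonglongrightarrow> 0" "B \<longlonglongrightarrow> 0"
  shows "X = 0"
proof -
  have 1: "\<bar>X\<bar> \<le> \<delta> * (P * R + P' * R')" if "0 < \<delta>" for \<delta>
  proof -
    have "(\<lambda>n. P * (\<delta> * R + I n / \<delta>) + P' * (\<delta> * R' + B n / \<delta>)) \<longlonglongrightarrow> P * (\<delta> * R + 0 / \<delta>) + P' * (\<delta> * R' + 0 / \<delta>)"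
      using that by (intro tendsto_intros assms) auto
    then have "\<bar>X\<bar> \<le> P * (\<delta> * R + 0 / \<delta>) + P' * (\<delta> * R' + 0 / \<delta>)"
      by (rule LIMSEQ_le_const) (use assms(1)[OF that] in blast)
    then show ?thesis by (simp add: algebra_simps)
  qed
  have "\<bar>X\<bar> \<le> 0"
  proof (rule tendsto_lowerbound[of "\<lambda>\<delta>. \<delta> * (P * R + P' * R')" _ "at_right 0"])
    have "((\<lambda>\<delta>. \<delta> * (P * R + P' * R')) \<longlongrightarrow> 0 * (P * R + P' * R')) (at_right 0)" by (intro tendsto_intros)
    then show "((\<lambda>\<delta>. \<delta> * (P * R + P' * R')) \<longlongrightarrow> 0) (at_right 0)" by simp
    show "\<forall>\<^sub>F \<delta> in at_right 0. \<bar>X\<bar> \<le> \<delta> * (P * R + P' * R')"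
      using 1 by (auto simp: eventually_at_right_less intro!: eventually_at_rightI[of 0 1])
  qed simp
  then show ?thesis by simp
qed

text \<open>For the smooth approximants the integral is a boundary integral by parts, because the
  factor k + m x vanishes at the end opposite to \<open>b\<close>. Both sides converge, and the
  boundary values tend to 0 in L^2.\<close>

lemma trace_identity:
  assumes TL: "0 < T" "0 < L" and tr: "has_trace T L b u (\<lambda>_. 0)"
    and u: "borel_rep T L u u'" "set_integrable lborel ({0..T} \<times> {0..L}) (\<lambda>z. (u' z)^2)"
    and g: "borel_rep T L (weak_deriv ({0<..<T} \<times> {0<..<L}) 0 1 u) g'" "set_integrable lborel ({0..T} \<times> {0..L}) (\<lambda>z. (g' z)^2)"
    and a: "test_line T a" and bd: "b = 0 \<and> k = L \<and> m = -1 \<or> b = L \<and> k = 0 \<and> m = 1"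
  shows "(LINT z:{0..T} \<times> {0..L}|lborel. a (fst z) * ((k + m * snd z) * g' z + m * u' z)) = 0"
proof -
  let ?Q = "{0..T} \<times> {0..L}" and ?O = "{0<..<T} \<times> {0<..<L}"
  have s1: "sobolev ?O 1 u" using tr by (simp add: has_trace_def Let_def)
  obtain h where h: "borel_rep T L (weak_deriv ?O 1 0 u) h" "set_integrable lborel ?Q (\<lambda>z. (h z)^2)"
    using sobolev_rep(2)[OF s1, of 1 0] by auto
  obtain w :: "nat \<Rightarrow> real \<times> real \<Rightarrow> real" where w: "\<And>n. smooth_plane (w n)"
    and lim1: "(\<lambda>n. LINT z:?O|lebesgue. (w n z - u z)\<^sup>2 + (pd_t (w n) z - weak_deriv ?O 1 0 u z)\<^sup>2
                + (pd_x (w n) z - weak_deriv ?O 0 1 u z)\<^sup>2) \<longlonglongrightarrow> 0"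
    and lim2: "(\<lambda>n. LINT t:{0<..<T}|lebesgue. (w n (t, b) - 0)\<^sup>2) \<longlonglongrightarrow> 0"
    using tr by (auto simp: has_trace_def Let_def)
  have [measurable]: "u' \<in> borel_measurable borel" "g' \<in> borel_measurable borel" "h \<in> borel_measurable borel" "a \<in> borel_measurable borel"
    using u g h a by (auto intro: borel_rep_borel test_line_borel)
  have [measurable]: "w n \<in> borel_measurable borel" "pd_t (w n) \<in> borel_measurable borel" "pd_x (w n) \<in> borel_measurable borel" for n
    using smooth_plane_regular[OF w] by (auto intro: borel_measurable_continuous_onI)
  define D where "D n z = (w n z - u' z)\<^sup>2 + (pd_t (w n) z - h z)\<^sup>2 + (pd_x (w n) z - g' z)\<^sup>2" for n z
  have sq: "set_integrable lborel ?Q (\<lambda>z. (p z - q z)^2)"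
    if "continuous_on UNIV p" "q \<in> borel_measurable borel" "set_integrable lborel ?Q (\<lambda>z. (q z)^2)" for p q :: "real \<times> real \<Rightarrow> real"
  proof -
    have "set_integrable lborel ?Q (\<lambda>z. (p z + - q z)^2)"
    proof (rule set_integrable_square_add)
      show "p \<in> borel_measurable borel" using that(1) by (rule borel_measurable_continuous_onI)
      show "set_integrable lborel ?Q (\<lambda>z. (p z)^2)"
        by (intro continuous_rectangle_integrable continuous_on_power that)
    qed (use that in auto)
    then show ?thesis by simp
  qed
  have iD: "set_integrable lborel ?Q (D n)" for n
    unfolding D_def by (intro set_integral_add(1) sq smooth_plane_regular[OF w] u(2) g(2) h(2)) auto
  have rD: "borel_rep T L (\<lambda>z. (w n z - u z)\<^sup>2 + (pd_t (w n) z - weak_deriv ?O 1 0 u z)\<^sup>2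
                + (pd_x (w n) z - weak_deriv ?O 0 1 u z)\<^sup>2) (D n)" for n
    unfolding D_def
    by (intro borel_rep_add borel_rep_compose[OF u(1), of "\<lambda>z x. (w n z - x)^2"]
      borel_rep_compose[OF h(1), of "\<lambda>z x. (pd_t (w n) z - x)^2"] borel_rep_compose[OF g(1), of "\<lambda>z x. (pd_x (w n) z - x)^2"]) measurable
  have lim1': "(\<lambda>n. LINT z:?Q|lborel. D n z) \<longlonglongrightarrow> 0"
    using lim1 borel_rep_integral(1)[OF rD] by simp
  have cw: "continuous_on UNIV (\<lambda>t. w n (t, b))" for n
    by (intro continuous_on_compose2[OF smooth_plane_regular(1)[OF w]] continuous_intros) auto
  have lim2': "(\<lambda>n. LINT t:{0..T}|lborel. (w n (t, b))^2) \<longlonglongrightarrow> 0"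
    using lim2 lebesgue_interval_integral[of "\<lambda>t. (w _ (t, b))^2"] cw by (simp add: continuous_on_power)
  obtain A0 where A0: "\<And>t. \<bar>a t\<bar> \<le> A0" using test_line_bounded a by meson
  have A0p: "0 \<le> A0" using A0[of 0] by linarith
  define X where "X = (LINT z:?Q|lborel. a (fst z) * ((k + m * snd z) * g' z + m * u' z))"
  have iu: "set_integrable lborel ?Q u'" "set_integrable lborel ?Q g'"
    using u(2) g(2) by (auto intro: set_integrable_of_square)
  have km: "\<bar>k + m * x\<bar> \<le> L" "\<bar>m\<bar> = 1" if "x \<in> {0..L}" for x using bd that by auto
  have bm: "set_integrable lborel ?Q (\<lambda>z. a (fst z) * ((k + m * snd z) * p z + m * q z))"
    if "set_integrable lborel ?Q p" "set_integrable lborel ?Q q" for p q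
  proof -
    have "set_integrable lborel ?Q (\<lambda>z. (a (fst z) * (k + m * snd z)) * p z)"
    proof (rule set_integrable_bounded_mult[where B = "A0 * L", OF _ borel_rectangle _ that(1)])
      fix z assume "z \<in> ?Q"
      then show "\<bar>a (fst z) * (k + m * snd z)\<bar> \<le> A0 * L"
        unfolding abs_mult using A0 km(1)[of "snd z"] A0p by (intro mult_mono) auto
    qed measurable
    moreover have "set_integrable lborel ?Q (\<lambda>z. (a (fst z) * m) * q z)"
    proof (rule set_integrable_bounded_mult[where B = "A0", OF _ borel_rectangle _ that(2)])
      fix z assume "z \<in> ?Q"
      then show "\<bar>a (fst z) * m\<bar> \<le> A0" unfolding abs_mult using A0 km(2)[of "snd z"] by auto
    qed measurable
    ultimately have "set_integrable lborel ?Q (\<lambda>z. (a (fst z) * (k + m * snd z)) * p z + (a (fst z) * m) * q z)"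
      by (rule set_integral_add(1))
    then show ?thesis by (simp add: algebra_simps)
  qed
  \<comment> \<open>The signed boundary value of k + m x at \<open>b\<close>: plus L at the right
    end, minus L at the left end.\<close>
  define \<kappa> where "\<kappa> = (if b = L then L else - L)"
  have id: "(LINT z:?Q|lborel. a (fst z) * ((k + m * snd z) * pd_x (w n) z + m * w n z)) = (LINT t:{0..T}|lborel. a t * \<kappa> * w n (t, b))" for n
  proof -
    note i = bm[OF continuous_rectangle_integrable[OF smooth_plane_regular(3)[OF w]] continuous_rectangle_integrable[OF smooth_plane_regular(1)[OF w]], of n n]
    have sl: "(LINT x:{0..L}|lborel. a t * ((k + m * x) * pd_x (w n) (t, x) + m * w n (t, x))) = a t * \<kappa> * w n (t, b)" for t
    proof -
      have c: "continuous_on {0..L} (\<lambda>x. pd_x (w n) (t, x))"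
        by (intro continuous_on_compose2[OF smooth_plane_regular(3)[OF w]] continuous_intros) auto
      have "ac L (\<lambda>x. w n (t, x)) (\<lambda>x. pd_x (w n) (t, x))"
        by (intro ac_C1 c has_field_derivative_at_within[OF smooth_plane_regular(4)[OF w]])
      moreover have "ac L (\<lambda>x. k + m * x) (\<lambda>x. m)" by (auto intro!: ac_C1 derivative_eq_intros)
      ultimately have "ac L (\<lambda>x. a t * ((k + m * x) * w n (t, x))) (\<lambda>x. a t * (m * w n (t, x) + (k + m * x) * pd_x (w n) (t, x)))"
        by (intro ac_cmult ac_mult)
      from ac_ftc[OF this] TL
      have "(LINT x:{0..L}|lborel. a t * (m * w n (t, x) + (k + m * x) * pd_x (w n) (t, x))) = a t * ((k + m * L) * w n (t, L)) - a t * (k * w n (t, 0))"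
        by simp
      also have "\<dots> = a t * \<kappa> * w n (t, b)" using bd TL by (auto simp: \<kappa>_def)
      finally show ?thesis by (simp add: add.commute)
    qed
    show ?thesis unfolding rectangle_fubini(1)[OF i] fst_conv snd_conv sl by (rule refl)
  qed
  have bound: "\<bar>X\<bar> \<le> (A0 * (L + 1)) * (\<delta> * (T * L) + (LINT z:?Q|lborel. D n z) / \<delta>)
      + (A0 * L) * (\<delta> * T + (LINT t:{0..T}|lborel. (w n (t, b))^2) / \<delta>)" if d: "0 < \<delta>" for \<delta> n
  proof -
    have one: "set_integrable lborel ?Q (\<lambda>z. \<delta>)" by (intro continuous_rectangle_integrable continuous_intros)
    have oneI: "(LINT z:?Q|lborel. \<delta>) = \<delta> * (T * L)"
    proof -
      have c: "(LINT x:{0..l}|lborel. y) = y * l" if "0 < l" for l y :: real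
        using that by (simp add: set_lebesgue_integral_def mult.commute)
      show ?thesis unfolding rectangle_fubini(1)[OF one] c[OF TL(2)] c[OF TL(1)] by simp
    qed
    let ?R = "\<lambda>z. a (fst z) * ((k + m * snd z) * (g' z - pd_x (w n) z) + m * (u' z - w n z))"
    have iR: "set_integrable lborel ?Q ?R"
      by (intro bm set_integral_diff(1) iu continuous_rectangle_integrable smooth_plane_regular[OF w])
    have "X - (LINT t:{0..T}|lborel. a t * \<kappa> * w n (t, b)) = (LINT z:?Q|lborel. ?R z)"
    proof -
      note M = bm[OF iu(2,1)] bm[OF continuous_rectangle_integrable[OF smooth_plane_regular(3)[OF w]]
          continuous_rectangle_integrable[OF smooth_plane_regular(1)[OF w]], of n n]
      have "?R = (\<lambda>z. a (fst z) * ((k + m * snd z) * g' z + m * u' z) - a (fst z) * ((k + m * snd z) * pd_x (w n) z + m * w n z))"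
        by (auto simp: fun_eq_iff algebra_simps)
      then show ?thesis unfolding X_def id[symmetric] using set_integral_diff(2)[OF M] by (simp only:)
    qed
    moreover have "\<bar>LINT z:?Q|lborel. ?R z\<bar> \<le> (A0 * (L + 1)) * (\<delta> * (T * L) + (LINT z:?Q|lborel. D n z) / \<delta>)"
    proof -
      have iB: "set_integrable lborel ?Q (\<lambda>z. (A0 * (L + 1)) * (\<delta> + D n z / \<delta>))"
        by (intro set_integrable_mult_right set_integral_add(1) one set_integrable_divide iD)
      have "\<bar>LINT z:?Q|lborel. ?R z\<bar> \<le> (LINT z:?Q|lborel. \<bar>?R z\<bar>)"
        using set_integral_norm_bound[OF iR] by simp
      also have "\<dots> \<le> (LINT z:?Q|lborel. (A0 * (L + 1)) * (\<delta> + D n z / \<delta>))"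
      proof (rule set_integral_mono[OF set_integrable_abs[OF iR] iB])
        fix z assume z: "z \<in> ?Q"
        \<comment> \<open>\<open>D n\<close> controls squares of the errors, while they enter
          linearly; Young's inequality bridges this.\<close>
        have d1: "\<bar>p\<bar> \<le> \<delta> + D n z / \<delta>" if "p^2 \<le> D n z" for p
          using abs_le_square_div[OF d, of p] divide_right_mono[OF that, of \<delta>] d by linarith
        have gen: "\<bar>x + y\<bar> \<le> (L + 1) * q" if "\<bar>x\<bar> \<le> L * q" "\<bar>y\<bar> \<le> q" for x y q
          using that abs_triangle_ineq[of x y] by (simp add: distrib_right)
        have 1: "\<bar>g' z - pd_x (w n) z\<bar> \<le> \<delta> + D n z / \<delta>" "\<bar>u' z - w n z\<bar> \<le> \<delta> + D n z / \<delta>"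
          by (rule d1, simp add: D_def power2_commute)+
        have "\<bar>(k + m * snd z) * (g' z - pd_x (w n) z)\<bar> \<le> L * (\<delta> + D n z / \<delta>)"
          unfolding abs_mult using z km(1)[of "snd z"] 1 TL by (intro mult_mono) auto
        moreover have "\<bar>m * (u' z - w n z)\<bar> \<le> \<delta> + D n z / \<delta>" unfolding abs_mult using z km(2)[of "snd z"] 1 by auto
        ultimately have "\<bar>(k + m * snd z) * (g' z - pd_x (w n) z) + m * (u' z - w n z)\<bar> \<le> (L + 1) * (\<delta> + D n z / \<delta>)"
          by (rule gen)
        then have "\<bar>?R z\<bar> \<le> A0 * ((L + 1) * (\<delta> + D n z / \<delta>))"
          unfolding abs_mult[of "a (fst z)"] using A0 A0p by (intro mult_mono) auto
        then show "\<bar>?R z\<bar> \<le> (A0 * (L + 1)) * (\<delta> + D n z / \<delta>)" by (simp only: mult.assoc)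
      qed
      also have "\<dots> = (A0 * (L + 1)) * (\<delta> * (T * L) + (LINT z:?Q|lborel. D n z) / \<delta>)"
        using set_integral_add(2)[OF one set_integrable_divide[OF iD], of n \<delta>] oneI by simp
      finally show ?thesis .
    qed
    moreover have "\<bar>LINT t:{0..T}|lborel. a t * \<kappa> * w n (t, b)\<bar> \<le> (A0 * L) * (\<delta> * T + (LINT t:{0..T}|lborel. (w n (t, b))^2) / \<delta>)"
    proof -
      have c: "continuous_on {0..T} (\<lambda>t. w n (t, b))" using cw by (rule continuous_on_subset) auto
      have ca: "continuous_on {0..T} a" using a by (rule test_line_continuous)
      have i: "set_integrable lborel {0..T} (\<lambda>t. a t * \<kappa> * w n (t, b))"
        by (intro ac_continuous_set_integrable continuous_intros c ca)
      have i2: "set_integrable lborel {0..T} (\<lambda>t. (w n (t, b))^2)" "set_integrable lborel {0..T} (\<lambda>t. \<delta>)"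
        by (intro ac_continuous_set_integrable continuous_intros c)+
      have iB: "set_integrable lborel {0..T} (\<lambda>t. (A0 * L) * (\<delta> + (w n (t, b))^2 / \<delta>))"
        by (intro set_integrable_mult_right set_integral_add(1) set_integrable_divide i2)
      have "\<bar>LINT t:{0..T}|lborel. a t * \<kappa> * w n (t, b)\<bar> \<le> (LINT t:{0..T}|lborel. \<bar>a t * \<kappa> * w n (t, b)\<bar>)"
        using set_integral_norm_bound[OF i] by simp
      also have "\<dots> \<le> (LINT t:{0..T}|lborel. (A0 * L) * (\<delta> + (w n (t, b))^2 / \<delta>))"
      proof (rule set_integral_mono[OF set_integrable_abs[OF i] iB])
        fix t
        have "\<bar>\<kappa>\<bar> = L" using TL by (simp add: \<kappa>_def)
        then show "\<bar>a t * \<kappa> * w n (t, b)\<bar> \<le> (A0 * L) * (\<delta> + (w n (t, b))^2 / \<delta>)"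
          unfolding abs_mult using A0[of t] A0p TL abs_le_square_div[OF d, of "w n (t, b)"]
          by (intro mult_mono) auto
      qed
      also have "\<dots> = (A0 * L) * (\<delta> * T + (LINT t:{0..T}|lborel. (w n (t, b))^2) / \<delta>)"
      proof -
        have "(LINT t:{0..T}|lborel. \<delta>) = \<delta> * T" using TL by (simp add: set_lebesgue_integral_def)
        then show ?thesis
          using set_integral_add(2)[OF i2(2) set_integrable_divide[OF i2(1)], of \<delta>] by simp
      qed
      finally show ?thesis .
    qed
    ultimately show ?thesis by linarith
  qed
  have "X = 0" by (rule tendsto_small_bound[OF bound lim1' lim2'])
  then show ?thesis by (simp add: X_def)
qed

lemma zero_bdry_of_trace:
  assumes "0 < T" "0 < L" and tr: "vanishes_on_lateral_boundary T L u"
    and u: "borel_rep T L u u'" "set_integrable lborel ({0..T} \<times> {0..L}) (\<lambda>z. (u' z)^2)"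
    and g: "borel_rep T L (weak_deriv ({0<..<T} \<times> {0<..<L}) 0 1 u) g'" "set_integrable lborel ({0..T} \<times> {0..L}) (\<lambda>z. (g' z)^2)"
  shows "zero_bdry T L u' g'"
  unfolding zero_bdry_def
proof (intro allI impI conjI)
  fix a assume a: "test_line T a"
  have t: "has_trace T L 0 u (\<lambda>_. 0)" "has_trace T L L u (\<lambda>_. 0)"
    using tr by (auto simp: vanishes_on_lateral_boundary_def)
  show "(LINT z:{0..T} \<times> {0..L}|lborel. a (fst z) * (snd z * g' z + u' z)) = 0"
    using trace_identity[OF assms(1,2) t(2) u g a, of 0 1] by simp
  show "(LINT z:{0..T} \<times> {0..L}|lborel. a (fst z) * ((L - snd z) * g' z - u' z)) = 0"
    using trace_identity[OF assms(1,2) t(1) u g a, of L "-1"] by simp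
qed

text \<open>The trace condition on a derivative of \<open>v\<close> brings in a weak derivative of
  that weak derivative; this exchanges it for the corresponding higher derivative of
  \<open>v\<close>.\<close>

lemma zero_bdry_cong:
  assumes z: "zero_bdry T L u g" and ae: "AE z in lborel. z \<in> {0<..<T} \<times> {0<..<L} \<longrightarrow> g z = g2 z"
    and [measurable]: "u \<in> borel_measurable borel" "g \<in> borel_measurable borel" "g2 \<in> borel_measurable borel"
  shows "zero_bdry T L u g2"
  unfolding zero_bdry_def
proof (intro allI impI)
  fix a assume a: "test_line T a"
  then have [measurable]: "a \<in> borel_measurable borel" by (rule test_line_borel)
  have ae': "AE z in lborel. z \<in> {0..T} \<times> {0..L} \<longrightarrow> g z = g2 z"
    using ae AE_rectangle_interior[of T L] by eventually_elim auto
  have e: "(LINT z:{0..T} \<times> {0..L}|lborel. a (fst z) * (h (snd z) * g z + k * u z))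
    = (LINT z:{0..T} \<times> {0..L}|lborel. a (fst z) * (h (snd z) * g2 z + k * u z))"
    if [measurable]: "h \<in> borel_measurable borel" for h k
  proof (rule set_lebesgue_integral_cong_AE)
    have "(\<lambda>z. a (fst z) * (h (snd z) * q z + k * u z)) \<in> borel_measurable borel" if [measurable]: "q \<in> borel_measurable borel" for q
      by measurable
    then show "(\<lambda>z. a (fst z) * (h (snd z) * g z + k * u z)) \<in> borel_measurable lborel"
      "(\<lambda>z. a (fst z) * (h (snd z) * g2 z + k * u z)) \<in> borel_measurable lborel" by simp_all
    show "AE z\<in>{0..T} \<times> {0..L} in lborel. a (fst z) * (h (snd z) * g z + k * u z) = a (fst z) * (h (snd z) * g2 z + k * u z)"
      using ae' by eventually_elim auto
  qed simp
  then show "(LINT z:{0..T} \<times> {0..L}|lborel. a (fst z) * (snd z * g2 z + u z)) = 0 \<and>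
    (LINT z:{0..T} \<times> {0..L}|lborel. a (fst z) * ((L - snd z) * g2 z - u z)) = 0"
    using z a e[of "\<lambda>x. x" 1] e[of "\<lambda>x. L - x" "-1"] by (simp add: zero_bdry_def)
qed

text \<open>Here \<open>\<psi>\<close> stands for exp (s \<phi>). As the constant may depend on
  \<open>s\<close>, all powers of \<open>s\<close> and \<open>\<psi>\<close> on the left are bounded
  by their largest values, which gives the factor in \<open>G\<close> next to 2000 A^6 from
  \<open>solution_bound\<close>.\<close>

lemma (in carleman_solution) weighted_estimate:
  fixes \<psi> :: "real \<Rightarrow> real" and \<omega> :: "real set" and s \<Psi> :: real
  defines "G \<equiv> s^8 * \<Psi>^7 * (2000 * A^6)"
  assumes l1: "8 * (4 * (\<gamma>^2 * A^2 + 36 * A^2 + 16 * A^2 + 64 * A^4)) \<le> c * (4 * lam / T^2)"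
    and l2: "88 * \<bar>\<gamma>\<bar> * A^4 * T \<le> c * lam"
    and \<psi>[measurable]: "\<psi> \<in> borel_measurable borel" and \<psi>b: "\<And>x. x \<in> {0..L} \<Longrightarrow> 1 \<le> \<psi> x \<and> \<psi> x \<le> \<Psi>"
    and \<omega>[measurable]: "\<omega> \<in> sets borel" and e0: "\<And>x. x \<notin> \<omega> \<Longrightarrow> e x = 0" and s: "1 \<le> s"
  shows "(LINT z:Q|lborel. s^2 * \<psi> (snd z) * (E z)^2 * (\<tau> z * (v3 z)^2 + s^2 * \<psi> (snd z)^2 * \<tau> z^3 * (v2 z)^2
      + s^4 * \<psi> (snd z)^4 * \<tau> z^5 * (v1 z)^2 + s^6 * \<psi> (snd z)^6 * \<tau> z^7 * (v0 z)^2))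
    \<le> G * (2 / c) * (2 + C * A) * (LINT z:Q|lborel. (E z)^2 * (\<gamma> * u0 z + v4 z)^2)
      + G * (2 / c) * (2 + C * A) * (LINT z:Q|lborel. indicator \<omega> (snd z) * (s^8 * \<psi> (snd z)^7 * \<tau> z^7 * (E z)^2 * (v0 z)^2))"
proof -
  have \<Psi>: "1 \<le> \<Psi>" using \<psi>b[of 0] L by auto
  have G: "0 < G" using s \<Psi> A by (simp add: G_def)
  let ?F = "\<lambda>z. s^2 * \<psi> (snd z) * (E z)^2 * (\<tau> z * (v3 z)^2 + s^2 * \<psi> (snd z)^2 * \<tau> z^3 * (v2 z)^2
      + s^4 * \<psi> (snd z)^4 * \<tau> z^5 * (v1 z)^2 + s^6 * \<psi> (snd z)^6 * \<tau> z^7 * (v0 z)^2)"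
  have \<tau>0: "0 \<le> \<tau> z" if "z \<in> Q" for z
    using that lam T by (auto simp: \<tau>_def tau_def)
  have N0: "0 \<le> N z" if "z \<in> Q" for z using energy_nonneg[OF \<tau>0[OF that]] by (simp add: N_def)
  have pw: "?F z \<le> G * N z" if z: "z \<in> Q" for z
  proof -
    have p: "1 \<le> \<psi> (snd z)" "\<psi> (snd z) \<le> \<Psi>" using \<psi>b[of "snd z"] z by auto
    \<comment> \<open>The exponents of \<open>s\<close> do not exceed 8 and those of
      \<open>\<psi>\<close> do not exceed 7, so one product bounds all four coefficients.\<close>
    have k: "s^i * \<psi> (snd z)^j \<le> s^8 * \<Psi>^7" if "i \<le> 8" "j \<le> 7" for i j
    proof (intro mult_mono)
      show "s^i \<le> s^8" using s that by (intro power_increasing) auto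
      have "\<psi> (snd z)^j \<le> \<psi> (snd z)^7" using p that by (intro power_increasing) auto
      also have "\<dots> \<le> \<Psi>^7" using p by (intro power_mono) auto
      finally show "\<psi> (snd z)^j \<le> \<Psi>^7" .
    qed (use s p in auto)
    define X3 X2 X1 X0 where "X3 = (E z)^2 * (\<tau> z * (v3 z)^2)" and "X2 = (E z)^2 * (\<tau> z^3 * (v2 z)^2)"
      and "X1 = (E z)^2 * (\<tau> z^5 * (v1 z)^2)" and "X0 = (E z)^2 * (\<tau> z^7 * (v0 z)^2)"
    have X: "0 \<le> X3" "0 \<le> X2" "0 \<le> X1" "0 \<le> X0"
      using \<tau>0[OF z] by (auto simp: X3_def X2_def X1_def X0_def)
    have "?F z = s^2 * \<psi> (snd z)^1 * X3 + s^4 * \<psi> (snd z)^3 * X2 + s^6 * \<psi> (snd z)^5 * X1 + s^8 * \<psi> (snd z)^7 * X0"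
      by (simp add: X3_def X2_def X1_def X0_def algebra_simps eval_nat_numeral)
    also have "\<dots> \<le> s^8 * \<Psi>^7 * X3 + s^8 * \<Psi>^7 * X2 + s^8 * \<Psi>^7 * X1 + s^8 * \<Psi>^7 * X0"
      using X by (intro add_mono mult_right_mono k) auto
    also have "\<dots> = s^8 * \<Psi>^7 * ((E z)^2 * (\<tau> z * (v3 z)^2 + \<tau> z^3 * (v2 z)^2 + \<tau> z^5 * (v1 z)^2 + \<tau> z^7 * (v0 z)^2))"
      by (simp add: X3_def X2_def X1_def X0_def algebra_simps)
    also have "\<dots> \<le> s^8 * \<Psi>^7 * (2000 * A^6 * N z)"
      using solution_bound[OF z] s \<Psi> by (intro mult_left_mono) auto
    finally show ?thesis by (simp add: G_def mult.assoc)
  qed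
  have 1: "(LINT z:Q|lborel. ?F z) \<le> G * (LINT z:Q|lborel. N z)"
  proof -
    have "(LINT z:Q|lborel. ?F z) \<le> (LINT z:Q|lborel. G * N z)"
      unfolding set_lebesgue_integral_def
      by (rule integral_mono')
        (use set_integrable_mult_right[OF integrable_N, of G] pw N0 G in \<open>auto simp: set_integrable_def indicator_def\<close>)
    then show ?thesis by simp
  qed
  let ?W = "\<lambda>z. indicator \<omega> (snd z) * (s^8 * \<psi> (snd z)^7 * \<tau> z^7 * (E z)^2 * (v0 z)^2)"
  have iW: "set_integrable lborel Q ?W"
  proof -
    have "set_integrable lborel Q (\<lambda>z. (indicator \<omega> (snd z) * (s^8 * \<psi> (snd z)^7)) * ((\<tau> z^7 * w0 z) * w0 z))"
    proof (rule set_integrable_bounded_mult[where B = "s^8 * \<Psi>^7"])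
      show "(\<lambda>z. indicator \<omega> (snd z) * (s^8 * \<psi> (snd z)^7)) \<in> borel_measurable (borel :: (real \<times> real) measure)"
      proof -
        have "(\<lambda>z. indicat_real \<omega> (snd z)) \<in> borel_measurable (borel :: (real \<times> real) measure)"
          "(\<lambda>z. \<psi> (snd z)) \<in> borel_measurable (borel :: (real \<times> real) measure)"
          by (rule measurable_compose[OF borel_measurable_fst_snd(2)], measurable)+
        then show ?thesis by (intro borel_measurable_times borel_measurable_power borel_measurable_const) simp_all
      qed
      fix z assume z: "z \<in> Q"
      then have p: "1 \<le> \<psi> (snd z)" "\<psi> (snd z) \<le> \<Psi>" using \<psi>b[of "snd z"] by auto
      then have "s^8 * \<psi> (snd z)^7 \<le> s^8 * \<Psi>^7" using s by (intro mult_left_mono power_mono) auto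
      then show "\<bar>indicator \<omega> (snd z) * (s^8 * \<psi> (snd z)^7)\<bar> \<le> s^8 * \<Psi>^7"
        using p s \<Psi> by (auto simp: indicator_def abs_mult)
    qed (use wl2_mult_integrable[OF wl2_tau[OF wl2_solution(1), of 7] wl2_solution(1)] in auto)
    then show ?thesis by (simp add: w0_def power2_eq_square mult_ac)
  qed
  have W0: "0 \<le> (LINT z:Q|lborel. ?W z)" "(LINT z:Q|lborel. Obs z) \<le> A * (LINT z:Q|lborel. ?W z)"
  proof -
    \<comment> \<open>The cut-off is at most \<open>A\<close> on \<open>\<omega>\<close> and zero
      outside, and the factor s^8 \<psi>^7 may be inserted because it is at least 1.\<close>
    have W: "0 \<le> ?W z \<and> Obs z \<le> A * ?W z" if z: "z \<in> Q" for z
    proof -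
      have p: "1 \<le> \<psi> (snd z)" using \<psi>b[of "snd z"] z by auto
      have e: "0 \<le> e (snd z)" "e (snd z) \<le> A * indicator \<omega> (snd z)"
        using bounds[of "snd z"] z e0[of "snd z"] by (auto simp: indicator_def)
      have X: "0 \<le> \<tau> z^7 * (w0 z)^2" using \<tau>0[OF z] by auto
      have "1 \<le> s^8 * \<psi> (snd z)^7" using one_le_power[OF s, of 8] one_le_power[OF p, of 7]
        by (metis mult_mono[of 1 "s^8" 1 "\<psi> (snd z)^7"] mult_1 order_trans zero_le_one)
      then have Y: "1 * (\<tau> z^7 * (w0 z)^2) \<le> s^8 * \<psi> (snd z)^7 * (\<tau> z^7 * (w0 z)^2)" using X by (rule mult_right_mono)
      have "e (snd z) * (\<tau> z^7 * (w0 z)^2) \<le> (A * indicator \<omega> (snd z)) * (s^8 * \<psi> (snd z)^7 * (\<tau> z^7 * (w0 z)^2))"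
        by (rule mult_mono[OF e(2)]) (use X Y A in auto)
      moreover have "0 \<le> ?W z" using \<tau>0[OF z] p s by (auto simp: indicator_def)
      ultimately show ?thesis by (simp add: Obs_def w0_def power_mult_distrib mult_ac)
    qed
    show "0 \<le> (LINT z:Q|lborel. ?W z)"
      unfolding set_lebesgue_integral_def using W by (intro integral_nonneg_AE) (auto simp: indicator_def)
    have "(LINT z:Q|lborel. Obs z) \<le> (LINT z:Q|lborel. A * ?W z)"
      using W by (intro set_integral_mono integrable_Obs set_integrable_mult_right iW) auto
    then show "(LINT z:Q|lborel. Obs z) \<le> A * (LINT z:Q|lborel. ?W z)" by simp
  qed
  define I where "I = (LINT z:Q|lborel. (E z)^2 * (\<gamma> * u0 z + v4 z)^2)"
  define J where "J = (LINT z:Q|lborel. ?W z)"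
  have I: "0 \<le> I" unfolding I_def set_lebesgue_integral_def by (intro integral_nonneg_AE) (auto simp: indicator_def)
  have J: "0 \<le> J" using W0 by (simp add: J_def)
  have "c / 2 * (LINT z:Q|lborel. N z) \<le> 2 * I + C * (LINT z:Q|lborel. Obs z)"
    using estimate[OF l1 l2] by (simp add: I_def power_mult_distrib)
  also have "\<dots> \<le> 2 * I + C * (A * J)" using W0 C by (auto simp: J_def)
  also have "\<dots> \<le> (2 + C * A) * I + (2 + C * A) * J"
    using I J C A by (simp add: algebra_simps)
  finally have step: "c / 2 * (LINT z:Q|lborel. N z) \<le> (2 + C * A) * I + (2 + C * A) * J" .
  have gen: "G * (q * (r * I + r * J)) = G * q * r * I + G * q * r * J" for q r by (simp add: algebra_simps)
  have "(LINT z:Q|lborel. N z) \<le> 2 / c * ((2 + C * A) * I + (2 + C * A) * J)"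
    using step c by (simp add: field_simps)
  then have "G * (LINT z:Q|lborel. N z) \<le> G * (2 / c * ((2 + C * A) * I + (2 + C * A) * J))"
    using G by (intro mult_left_mono) auto
  also have "\<dots> = G * (2 / c) * (2 + C * A) * I + G * (2 / c) * (2 + C * A) * J" by (rule gen)
  finally show ?thesis using 1 unfolding I_def J_def by linarith
qed

section \<open>Cut-off functions\<close>

lemma test_line_add: "test_line L f \<Longrightarrow> test_line L g \<Longrightarrow> test_line L (\<lambda>x. f x + g x)"
proof -
  assume fg: "test_line L f" "test_line L g"
  obtain c d where cd: "0 < c" "d < L" "\<And>x. x \<notin> {c..d} \<Longrightarrow> f x = 0" using fg by (auto simp: test_line_def)
  obtain c' d' where cd': "0 < c'" "d' < L" "\<And>x. x \<notin> {c'..d'} \<Longrightarrow> g x = 0" using fg by (auto simp: test_line_def)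
  have "f x + g x = 0" if "x \<notin> {min c c'..max d d'}" for x
    using that cd(3)[of x] cd'(3)[of x] by force
  moreover have "smooth_line (\<lambda>x. f x + g x)" using fg by (auto simp: test_line_def smooth_line_def intro: Ck_line_add)
  ultimately show ?thesis unfolding test_line_def using cd cd'
    by (intro conjI exI[of _ "min c c'"] exI[of _ "max d d'"]) auto
qed

lemma test_line_cmult: "test_line L f \<Longrightarrow> test_line L (\<lambda>x. k * f x)"
proof -
  assume f: "test_line L f"
  then have "smooth_line (\<lambda>x. k * f x)" by (auto simp: test_line_def smooth_line_def intro: Ck_line_mult Ck_line_const)
  then show ?thesis using f unfolding test_line_def by (auto; metis)
qed

lemma test_line_sum: "finite I \<Longrightarrow> (\<And>i. i \<in> I \<Longrightarrow> test_line L (F i)) \<Longrightarrow> test_line L (\<lambda>x. \<Sum>i\<in>I. F i x)"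
proof (induction I rule: finite_induct)
  case empty
  have "smooth_line (\<lambda>x. 0)" by (simp add: smooth_line_def Ck_line_const)
  moreover have "\<exists>c d. 0 < c \<and> d < L \<and> (\<forall>x. x \<notin> {c..d} \<longrightarrow> (0::real) = 0)"
    by (rule exI[of _ 1], rule exI[of _ "L - 1"]) simp
  ultimately show ?case by (simp add: test_line_def)
next
  case (insert i I)
  then show ?case by (auto intro!: test_line_add)
qed

text \<open>A finite subcover of \<open>K\<close> by intervals inside \<open>\<omega>\<close> gives
  a sum of bumps that is positive on \<open>K\<close>; dividing by its minimum over \<open>K\<close>
  makes it at least 1 there. It may exceed 1 elsewhere.\<close>

lemma cutoff_exists:
  assumes K: "compact K" "K \<noteq> {}" "K \<subseteq> \<omega>" and \<omega>: "open \<omega>" "\<omega> \<subseteq> {0<..<L}"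
  obtains e where "test_line L e" "\<And>x. 0 \<le> e x" "\<And>x. x \<in> K \<Longrightarrow> 1 \<le> e x" "\<And>x. x \<notin> \<omega> \<Longrightarrow> e x = 0"
proof -
  have "\<forall>x\<in>K. \<exists>r>0. {x - r..x + r} \<subseteq> \<omega>"
  proof
    fix x assume "x \<in> K"
    then obtain r where "0 < r" "cball x r \<subseteq> \<omega>" using K \<omega> open_contains_cball by blast
    then show "\<exists>r>0. {x - r..x + r} \<subseteq> \<omega>" by (auto simp: cball_eq_atLeastAtMost)
  qed
  then obtain r where r: "\<And>x. x \<in> K \<Longrightarrow> 0 < r x" "\<And>x. x \<in> K \<Longrightarrow> {x - r x..x + r x} \<subseteq> \<omega>" by metis
  have "K \<subseteq> (\<Union>x\<in>K. {x - r x<..<x + r x})" using r(1) by force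
  then obtain I where I: "I \<subseteq> K" "finite I" "K \<subseteq> (\<Union>x\<in>I. {x - r x<..<x + r x})"
    using compactE_image[OF K(1), of K "\<lambda>x. {x - r x<..<x + r x}"] by auto
  define f where "f y = (\<Sum>x\<in>I. bump 1 (x - r x) (x + r x) y)" for y
  have f: "test_line L f" unfolding f_def
  proof (intro test_line_sum I test_line_bump)
    fix x assume x: "x \<in> I"
    have "0 < r x" "{x - r x..x + r x} \<subseteq> \<omega>" using r x I(1) by blast+
    then have "0 < r x" "x - r x \<in> \<omega>" "x + r x \<in> \<omega>" by auto
    then show "0 < x - r x" "x - r x < x + r x" "x + r x < L" using \<omega>(2) by auto
  qed auto
  have f0: "0 \<le> f y" for y unfolding f_def by (intro sum_nonneg bump_bounds) auto
  have fp: "0 < f y" if yK: "y \<in> K" for y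
  proof -
    obtain x where x: "x \<in> I" "y \<in> {x - r x<..<x + r x}" using I yK by blast
    have "0 < bump 1 (x - r x) (x + r x) y" using x by (intro bump_pos) auto
    also have "\<dots> \<le> f y" unfolding f_def by (intro member_le_sum x I bump_bounds) auto
    finally show ?thesis .
  qed
  obtain y where y: "y \<in> K" "\<And>z. z \<in> K \<Longrightarrow> f y \<le> f z"
    using continuous_attains_inf[OF K(1,2) test_line_continuous[OF f]] by auto
  have fo: "f z = 0" if "z \<notin> \<omega>" for z
    unfolding f_def
  proof (intro sum.neutral ballI bump_outside)
    fix x assume "x \<in> I"
    then have "{x - r x..x + r x} \<subseteq> \<omega>" using r(2) I(1) by blast
    then show "z \<notin> {x - r x<..<x + r x}"
      using that by (meson atLeastAtMost_iff greaterThanLessThan_iff less_imp_le subsetD)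
  qed
  show ?thesis
  proof (rule that[of "\<lambda>x. 1 / f y * f x"])
    show "test_line L (\<lambda>x. 1 / f y * f x)" by (rule test_line_cmult[OF f])
    show "0 \<le> 1 / f y * f x" for x using f0 by simp
    show "1 \<le> 1 / f y * f x" if "x \<in> K" for x using fp[OF y(1)] y(2)[OF that] by (simp add: field_simps)
    show "1 / f y * f x = 0" if "x \<notin> \<omega>" for x using fo[OF that] by simp
  qed
qed

section \<open>Construction of the weight\<close>

lemma has_real_derivative_transform_on:
  fixes f g :: "real \<Rightarrow> real"
  assumes "(f has_real_derivative D) (at x within S)" "x \<in> S" "\<And>y. y \<in> S \<Longrightarrow> g y = f y"
  shows "(g has_real_derivative D) (at x within S)"
  using assms unfolding has_field_derivative_def by (intro has_derivative_transform[of x S g f]) auto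

lemma Ck_on_Suc_D:
  assumes "Ck_on (Suc k) S g"
  shows "Ck_on k S (\<lambda>x. vector_derivative g (at x within S))"
    and "x \<in> S \<Longrightarrow> (g has_real_derivative vector_derivative g (at x within S)) (at x within S)"
  using assms by (auto simp: has_real_derivative_iff_has_vector_derivative vector_derivative_works)

lemma continuous_interval_bound:
  fixes f :: "real \<Rightarrow> real"
  assumes "continuous_on {0..L} f"
  obtains B where "0 \<le> B" "\<And>x. x \<in> {0..L} \<Longrightarrow> \<bar>f x\<bar> \<le> B"
proof -
  obtain B where B: "\<And>x. x \<in> {0..L} \<Longrightarrow> \<bar>f x\<bar> \<le> B"
    using compact_imp_bounded[OF compact_continuous_image[OF assms]] by (force simp: bounded_iff)
  show ?thesis by (rule that[of "max B 0"]) (use B in force)+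
qed

text \<open>The weights are needed at all real arguments; \<open>clamp_x\<close> extends them from \<open>[0, L]\<close> by constants.\<close>

definition clamp_x :: "real \<Rightarrow> real \<Rightarrow> real" where
  "clamp_x L x = max 0 (min L x)"

lemma clamp_x_simps: "x \<in> {0..L} \<Longrightarrow> clamp_x L x = x" "0 \<le> L \<Longrightarrow> clamp_x L x \<in> {0..L}"
  by (auto simp: clamp_x_def)

lemma continuous_clamp:
  assumes "continuous_on {0..L} f" "0 \<le> L"
  shows "continuous_on UNIV (\<lambda>x. f (clamp_x L x))"
  by (rule continuous_on_compose2[OF assms(1)])
    (auto simp: clamp_x_def intro!: continuous_intros assms(2))

text \<open>Off \<open>\<omega>\<^sub>0\<close> the slope of \<phi> is bounded below by compactness,
  so a large \<open>s\<close> makes \<alpha>'' and |\<alpha>'| bounded below; on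
  \<open>\<omega>\<^sub>0\<close> the cut-off takes over. The constants are chosen after
  \<open>s\<close>, when all derivatives of the weight are bounded.\<close>

lemma carleman_weight_exists:
  fixes \<phi> :: "real \<Rightarrow> real"
  assumes T: "T > 0" and L: "L > 0"
    and \<omega>0: "open \<omega>\<^sub>0" "\<omega>\<^sub>0 \<noteq> {}" "\<omega>\<^sub>0 \<subseteq> {0<..<L}" and \<omega>: "open \<omega>" "\<omega> \<subseteq> {0<..<L}" and cl: "closure \<omega>\<^sub>0 \<subseteq> \<omega>"
    and C4: "Ck_on 4 {0..L} \<phi>" and pos: "\<And>x. x \<in> {0<..<L} \<Longrightarrow> \<phi> x > 0" and bd: "\<phi> 0 = 0" "\<phi> L = 0"
    and nz: "\<And>x. x \<in> closure ({0<..<L} - \<omega>\<^sub>0) \<Longrightarrow> \<bar>vector_derivative \<phi> (at x within {0..L})\<bar> > 0"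
  shows "\<exists>s0\<ge>1. \<forall>s\<ge>s0. \<exists>m A c C \<tau>0 al a1 a2 a3 a4 e. carleman_weight T L m A c C \<tau>0 al a1 a2 a3 a4 e \<and>
    (\<forall>x\<in>{0..L}. al x = exp (s * \<phi> x) - exp (2 * s * sup_norm L \<phi>)) \<and> (\<forall>x. x \<notin> \<omega> \<longrightarrow> e x = 0)"
proof -
  let ?S = "{0..L}"
  define d1 where "d1 x = vector_derivative \<phi> (at x within ?S)" for x
  define d2 where "d2 x = vector_derivative d1 (at x within ?S)" for x
  define d3 where "d3 x = vector_derivative d2 (at x within ?S)" for x
  define d4 where "d4 x = vector_derivative d3 (at x within ?S)" for x
  have k4: "Ck_on (Suc (Suc (Suc (Suc 0)))) ?S \<phi>" using C4 by (simp add: eval_nat_numeral del: Ck_on.simps)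
  note k3 = Ck_on_Suc_D(1)[OF k4, folded d1_def[abs_def]]
  note k2 = Ck_on_Suc_D(1)[OF k3, folded d2_def[abs_def]]
  note k1 = Ck_on_Suc_D(1)[OF k2, folded d3_def[abs_def]]
  note k0 = Ck_on_Suc_D(1)[OF k1, folded d4_def[abs_def]]
  have der: "(\<phi> has_real_derivative d1 x) (at x within ?S)" "(d1 has_real_derivative d2 x) (at x within ?S)"
    "(d2 has_real_derivative d3 x) (at x within ?S)" "(d3 has_real_derivative d4 x) (at x within ?S)" if "x \<in> ?S" for x
    using Ck_on_Suc_D(2)[OF k4 that] Ck_on_Suc_D(2)[OF k3 that] Ck_on_Suc_D(2)[OF k2 that] Ck_on_Suc_D(2)[OF k1 that]
    by (simp_all add: d1_def d2_def d3_def d4_def)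
  have cont: "continuous_on ?S \<phi>" "continuous_on ?S d1" "continuous_on ?S d2" "continuous_on ?S d3" "continuous_on ?S d4"
    using DERIV_continuous_on[of ?S \<phi> d1] DERIV_continuous_on[of ?S d1 d2] DERIV_continuous_on[of ?S d2 d3]
      DERIV_continuous_on[of ?S d3 d4] der k0 by auto
  have bK: "bounded \<omega>\<^sub>0" using \<omega>0(3) by (intro bounded_subset[of "{0..L}" \<omega>\<^sub>0]) auto
  have K: "compact (closure \<omega>\<^sub>0)" "closure \<omega>\<^sub>0 \<noteq> {}" using bK \<omega>0(2) by (auto simp: compact_closure)
  obtain e where e: "test_line L e" "\<And>x. 0 \<le> e x" "\<And>x. x \<in> closure \<omega>\<^sub>0 \<Longrightarrow> 1 \<le> e x" "\<And>x. x \<notin> \<omega> \<Longrightarrow> e x = 0"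
    using cutoff_exists[OF K cl \<omega>] by metis
  let ?K = "closure ({0<..<L} - \<omega>\<^sub>0)"
  have sub: "?K \<subseteq> ?S"
    using closure_mono[of "{0<..<L} - \<omega>\<^sub>0" "{0<..<L}"] L by (auto simp: closure_greaterThanLessThan)
  \<comment> \<open>Since the closure of \<open>\<omega>\<^sub>0\<close> lies inside the open
    interval, points near either end are outside \<open>\<omega>\<^sub>0\<close>; so the slope
    condition reaches the end points.\<close>
  have ends: "0 \<in> ?K" "L \<in> ?K"
  proof -
    have o: "open (- closure \<omega>\<^sub>0)" by (intro open_Compl closed_closure)
    have n: "0 \<in> - closure \<omega>\<^sub>0" "L \<in> - closure \<omega>\<^sub>0" using cl \<omega>(2) by auto
    obtain r where r: "0 < r" "ball 0 r \<subseteq> - closure \<omega>\<^sub>0" using o n(1) open_contains_ball by blast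
    obtain r' where r': "0 < r'" "ball L r' \<subseteq> - closure \<omega>\<^sub>0" using o n(2) open_contains_ball by blast
    show "0 \<in> ?K" unfolding closure_approachable
    proof (intro allI impI)
      fix \<epsilon> :: real assume "0 < \<epsilon>"
      define y where "y = min (min r \<epsilon>) L / 2"
      have y: "0 < y" "y < r" "y < \<epsilon>" "y < L" using \<open>0 < \<epsilon>\<close> r L by (auto simp: y_def)
      then have "y \<in> ball 0 r" by (simp add: dist_real_def)
      then have "y \<notin> \<omega>\<^sub>0" using r(2) closure_subset[of \<omega>\<^sub>0] by blast
      then show "\<exists>y\<in>{0<..<L} - \<omega>\<^sub>0. dist y 0 < \<epsilon>" using y by (intro bexI[of _ y]) auto
    qed
    show "L \<in> ?K" unfolding closure_approachable
    proof (intro allI impI)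
      fix \<epsilon> :: real assume "0 < \<epsilon>"
      define y where "y = L - min (min r' \<epsilon>) L / 2"
      have y: "0 < y" "L - r' < y" "L - \<epsilon> < y" "y < L" using \<open>0 < \<epsilon>\<close> r' L by (auto simp: y_def min_def)
      then have "y \<in> ball L r'" by (simp add: dist_real_def)
      then have "y \<notin> \<omega>\<^sub>0" using r'(2) closure_subset[of \<omega>\<^sub>0] by blast
      then show "\<exists>y\<in>{0<..<L} - \<omega>\<^sub>0. dist y L < \<epsilon>" using y by (intro bexI[of _ y]) (auto simp: dist_real_def)
    qed
  qed
  have cover: "x \<in> ?K \<or> 1 \<le> e x" if "x \<in> ?S" for x
  proof (cases "x \<in> \<omega>\<^sub>0")
    case True
    then show ?thesis using e(3) closure_subset[of \<omega>\<^sub>0] by blast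
  next
    case False
    show ?thesis
    proof (cases "x = 0 \<or> x = L")
      case True
      then show ?thesis using ends by auto
    next
      case F2: False
      then have "x \<in> {0<..<L} - \<omega>\<^sub>0" using False that by auto
      then show ?thesis using closure_subset[of "{0<..<L} - \<omega>\<^sub>0"] by blast
    qed
  qed
  have cK: "compact ?K" using closed_Int_compact[of ?K ?S] sub by (simp add: Int_absorb2)
  have "?K \<noteq> {}" using ends(1) by (metis empty_iff)
  have "continuous_on ?K (\<lambda>x. \<bar>d1 x\<bar>)" by (intro continuous_intros continuous_on_subset[OF cont(2) sub])
  then obtain y where y: "y \<in> ?K" "\<And>x. x \<in> ?K \<Longrightarrow> \<bar>d1 y\<bar> \<le> \<bar>d1 x\<bar>"
    using continuous_attains_inf[OF cK \<open>?K \<noteq> {}\<close>] by blast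
  define \<delta> where "\<delta> = \<bar>d1 y\<bar>"
  have \<delta>: "0 < \<delta>" "\<And>x. x \<in> ?K \<Longrightarrow> \<delta> \<le> \<bar>d1 x\<bar>" using nz[OF y(1)] y(2) by (auto simp: \<delta>_def d1_def)
  obtain D where D: "0 \<le> D" "\<And>x. x \<in> ?S \<Longrightarrow> \<bar>d2 x\<bar> \<le> D" using continuous_interval_bound[OF cont(3)] by metis
  have \<phi>0: "0 \<le> \<phi> x" if "x \<in> ?S" for x
  proof -
    have "x = 0 \<or> x = L \<or> x \<in> {0<..<L}" using that by auto
    then show ?thesis using pos[of x] bd by (elim disjE) simp_all
  qed
  \<comment> \<open>\<phi> has its minimum over [0, L] at both ends, which gives the one-sided
    slopes a weak sign; it is strict because they do not vanish there.\<close>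
  have d0: "0 < d1 0"
  proof -
    have "\<not> d1 0 < 0"
    proof
      assume "d1 0 < 0"
      then obtain d where d: "0 < d" "\<And>h. 0 < h \<Longrightarrow> 0 + h \<in> ?S \<Longrightarrow> h < d \<Longrightarrow> \<phi> (0 + h) < \<phi> 0"
        using has_real_derivative_neg_dec_right[OF der(1)[of 0]] L by auto
      define h where "h = min d L / 2"
      have h: "0 < h" "h < d" "h < L" using d(1) L by (auto simp: h_def)
      then show False using d(2)[of h] \<phi>0[of h] bd by auto
    qed
    then show ?thesis using nz[OF ends(1)] by (simp add: d1_def)
  qed
  have dL: "d1 L < 0"
  proof -
    have "\<not> 0 < d1 L"
    proof
      assume "0 < d1 L"
      then obtain d where d: "0 < d" "\<And>h. 0 < h \<Longrightarrow> L - h \<in> ?S \<Longrightarrow> h < d \<Longrightarrow> \<phi> (L - h) < \<phi> L"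
        using has_real_derivative_pos_inc_left[OF der(1)[of L]] L by auto
      define h where "h = min d L / 2"
      have h: "0 < h" "h < d" "h < L" using d(1) L by (auto simp: h_def)
      then show False using d(2)[of h] \<phi>0[of "L - h"] bd by auto
    qed
    then show ?thesis using nz[OF ends(2)] by (simp add: d1_def)
  qed
  define M where "M = sup_norm L \<phi>"
  have M: "\<phi> x \<le> M" if "x \<in> ?S" for x
  proof -
    obtain B where "\<And>x. x \<in> ?S \<Longrightarrow> \<bar>\<phi> x\<bar> \<le> B" using continuous_interval_bound[OF cont(1)] by metis
    then have "bdd_above ((\<lambda>x. \<bar>\<phi> x\<bar>) ` ?S)" by (intro bdd_aboveI2[of _ _ B])
    then have "\<bar>\<phi> x\<bar> \<le> M" unfolding M_def sup_norm_def using that by (rule cSUP_upper[rotated])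
    then show ?thesis by simp
  qed
  have M0: "0 < M" using M[of "L / 2"] pos[of "L / 2"] L by auto
  \<comment> \<open>Then s \<phi>'^2 \<ge> D + 1 off \<open>\<omega>\<^sub>0\<close>, which
    outweighs \<phi>'' and leaves at least 1.\<close>
  define s0 where "s0 = max 1 ((D + 1) / \<delta>^2)"
  show ?thesis
  proof (rule exI[of _ s0], intro conjI allI impI)
    show "1 \<le> s0" by (simp add: s0_def)
    fix s assume ss: "s0 \<le> s"
    have s: "1 \<le> s" "D + 1 \<le> s * \<delta>^2" using ss \<delta>(1) by (auto simp: s0_def field_simps)
    define \<psi> where "\<psi> x = exp (s * \<phi> x)" for x
    define A0 where "A0 x = \<psi> x - exp (2 * s * M)" for x
    define A1 where "A1 x = s * d1 x * \<psi> x" for x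
    define A2 where "A2 x = (s * d2 x + s^2 * d1 x^2) * \<psi> x" for x
    define A3 where "A3 x = (s * d3 x + 3 * s^2 * d1 x * d2 x + s^3 * d1 x^3) * \<psi> x" for x
    define A4 where "A4 x = (s * d4 x + s^2 * (3 * d2 x^2 + 4 * d1 x * d3 x) + 6 * s^3 * d1 x^2 * d2 x + s^4 * d1 x^4) * \<psi> x" for x
    have d\<psi>: "(\<psi> has_real_derivative s * d1 x * \<psi> x) (at x within ?S)" if "x \<in> ?S" for x
      unfolding \<psi>_def by (auto intro!: derivative_eq_intros der(1)[OF that])
    have dA: "(A0 has_real_derivative A1 x) (at x within ?S)" "(A1 has_real_derivative A2 x) (at x within ?S)"
      "(A2 has_real_derivative A3 x) (at x within ?S)" "(A3 has_real_derivative A4 x) (at x within ?S)" if x: "x \<in> ?S" for x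
    proof -
      show "(A0 has_real_derivative A1 x) (at x within ?S)"
        unfolding A0_def[abs_def] A1_def
        by (auto intro!: derivative_eq_intros d\<psi>[OF x] der[OF x] simp: algebra_simps eval_nat_numeral)
      show "(A1 has_real_derivative A2 x) (at x within ?S)"
        unfolding A1_def[abs_def] A2_def
        by (auto intro!: derivative_eq_intros d\<psi>[OF x] der[OF x] simp: algebra_simps eval_nat_numeral)
      show "(A2 has_real_derivative A3 x) (at x within ?S)"
        unfolding A2_def[abs_def] A3_def
        by (auto intro!: derivative_eq_intros d\<psi>[OF x] der[OF x] simp: algebra_simps eval_nat_numeral)
      show "(A3 has_real_derivative A4 x) (at x within ?S)"
        unfolding A3_def[abs_def] A4_def
        by (auto intro!: derivative_eq_intros d\<psi>[OF x] der[OF x] simp: algebra_simps eval_nat_numeral)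
    qed
    have c\<psi>: "continuous_on ?S \<psi>" unfolding \<psi>_def by (intro continuous_intros cont)
    have cA: "continuous_on ?S A0" "continuous_on ?S A1" "continuous_on ?S A2" "continuous_on ?S A3" "continuous_on ?S A4"
      unfolding A0_def A1_def A2_def A3_def A4_def by (intro continuous_intros cont c\<psi>)+
    obtain B0 where B0: "0 \<le> B0" "\<And>x. x \<in> ?S \<Longrightarrow> \<bar>A0 x\<bar> \<le> B0" using continuous_interval_bound[OF cA(1)] by metis
    obtain B1 where B1: "0 \<le> B1" "\<And>x. x \<in> ?S \<Longrightarrow> \<bar>A1 x\<bar> \<le> B1" using continuous_interval_bound[OF cA(2)] by metis
    obtain B2 where B2: "0 \<le> B2" "\<And>x. x \<in> ?S \<Longrightarrow> \<bar>A2 x\<bar> \<le> B2" using continuous_interval_bound[OF cA(3)] by metis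
    obtain B3 where B3: "0 \<le> B3" "\<And>x. x \<in> ?S \<Longrightarrow> \<bar>A3 x\<bar> \<le> B3" using continuous_interval_bound[OF cA(4)] by metis
    obtain B4 where B4: "0 \<le> B4" "\<And>x. x \<in> ?S \<Longrightarrow> \<bar>A4 x\<bar> \<le> B4" using continuous_interval_bound[OF cA(5)] by metis
    obtain B5 where B5: "0 \<le> B5" "\<And>x. x \<in> ?S \<Longrightarrow> \<bar>e x\<bar> \<le> B5" using continuous_interval_bound[OF test_line_continuous[OF e(1)]] by metis
    obtain B6 where B6: "0 \<le> B6" "\<And>x. x \<in> ?S \<Longrightarrow> \<bar>deriv e x\<bar> \<le> B6"
      using continuous_interval_bound[OF test_line_continuous[OF test_line_deriv[OF e(1)]]] by metis
    define A where "A = 1 + B0 + B1 + B2 + B3 + B4 + B5 + B6"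
    have A: "1 \<le> A" using B0(1) B1(1) B2(1) B3(1) B4(1) B5(1) B6(1) by (simp add: A_def)
    have Ab: "\<bar>A0 x\<bar> \<le> A \<and> \<bar>A1 x\<bar> \<le> A \<and> \<bar>A2 x\<bar> \<le> A \<and> \<bar>A3 x\<bar> \<le> A \<and> \<bar>A4 x\<bar> \<le> A \<and> \<bar>e x\<bar> \<le> A \<and> \<bar>deriv e x\<bar> \<le> A" if "x \<in> ?S" for x
      using B0(2)[OF that] B1(2)[OF that] B2(2)[OF that] B3(2)[OF that] B4(2)[OF that] B5(2)[OF that] B6(2)[OF that]
        B0(1) B1(1) B2(1) B3(1) B4(1) B5(1) B6(1) unfolding A_def by linarith
    \<comment> \<open>Off \<open>\<omega>\<^sub>0\<close> the second derivative of the weight is at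
      least 1 and its slope at least \<open>\<delta>\<close> in modulus, as \<open>s\<close> and exp
      (s \<phi>) are at least 1.\<close>
    define c0 where "c0 = min 1 \<delta>"
    have c0: "0 < c0" "c0 \<le> 1" using \<delta> by (auto simp: c0_def)
    have \<psi>1: "1 \<le> \<psi> x" if "x \<in> ?S" for x using \<phi>0[OF that] s by (simp add: \<psi>_def)
    have good: "c0 \<le> A2 x \<and> c0 \<le> \<bar>A1 x\<bar> \<or> 1 \<le> e x" if x: "x \<in> ?S" for x
    proof (cases "x \<in> ?K")
      case True
      have "\<delta>^2 \<le> d1 x^2" using power_mono[OF \<delta>(2)[OF True], of 2] \<delta>(1) by simp
      then have "s * \<delta>^2 \<le> s * d1 x^2" using s by (intro mult_left_mono) auto
      then have "1 \<le> d2 x + s * d1 x^2" using s D(2)[OF x] by linarith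
      then have "1 * 1 \<le> s * (d2 x + s * d1 x^2)" using s by (intro mult_mono) auto
      then have "1 * 1 \<le> (s * (d2 x + s * d1 x^2)) * \<psi> x" using \<psi>1[OF x] by (intro mult_mono) auto
      then have "1 \<le> A2 x" by (simp add: A2_def algebra_simps power2_eq_square)
      moreover have "1 * \<delta> * 1 \<le> s * \<bar>d1 x\<bar> * \<psi> x" using s \<delta>(1) \<delta>(2)[OF True] \<psi>1[OF x] by (intro mult_mono mult_nonneg_nonneg) auto
      then have "\<delta> \<le> \<bar>A1 x\<bar>" using s \<psi>1[OF x] by (simp add: A1_def abs_mult)
      ultimately show ?thesis by (auto simp: c0_def)
    qed (use cover[OF x] in auto)
    obtain c C \<tau>0 where c: "0 < c" "0 < C" "1 \<le> \<tau>0" and sl: "\<forall>\<tau>\<ge>\<tau>0. \<forall>L a1 a2 a3 e e' w0 w1 w2 w3 w4.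
      0 < L \<longrightarrow> ac L a1 a2 \<longrightarrow> ac L a2 a3 \<longrightarrow> ac L e e' \<longrightarrow>
      (\<forall>x\<in>{0..L}. \<bar>a1 x\<bar> \<le> A \<and> \<bar>a2 x\<bar> \<le> A \<and> \<bar>a3 x\<bar> \<le> A \<and> 0 \<le> e x \<and> e x \<le> A \<and> \<bar>e' x\<bar> \<le> A \<and>
        (c0 \<le> a2 x \<and> c0 \<le> \<bar>a1 x\<bar> \<or> 1 \<le> e x)) \<longrightarrow>
      0 < a1 0 \<longrightarrow> a1 L < 0 \<longrightarrow> e 0 = 0 \<longrightarrow> e L = 0 \<longrightarrow>
      ac L w0 w1 \<longrightarrow> ac L w1 w2 \<longrightarrow> ac L w2 w3 \<longrightarrow> ac L w3 w4 \<longrightarrow> set_integrable lborel {0..L} (\<lambda>x. (w4 x)^2) \<longrightarrow>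
      w0 0 = 0 \<longrightarrow> w0 L = 0 \<longrightarrow>
      0 \<le> (LINT x:{0..L}|lborel. (sym_part \<tau> (a1 x) (a2 x) (w0 x) (w1 x) (w2 x) (w4 x))^2
        + 2 * sym_part \<tau> (a1 x) (a2 x) (w0 x) (w1 x) (w2 x) (w4 x) * skew_part \<tau> (a1 x) (a2 x) (w0 x) (w1 x) (w3 x)
        - c * energy \<tau> (w0 x) (w1 x) (w2 x) (w3 x) + C * (e x * \<tau>^7 * (w0 x)^2))"
      using carleman_slice_ex[OF A c0] by (elim exE conjE) (rule that)
    \<comment> \<open>The doubled exponent in the definition of \<rho>, with M > 0, keeps \<alpha>
      below a negative constant.\<close>
    define m where "m = exp (2 * s * M) - exp (s * M)"
    have m: "0 < m" using s M0 by (simp add: m_def)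
    define al a1 a2 a3 a4 where "al x = A0 (clamp_x L x)" and "a1 x = A1 (clamp_x L x)" and "a2 x = A2 (clamp_x L x)"
      and "a3 x = A3 (clamp_x L x)" and "a4 x = A4 (clamp_x L x)" for x
    have eq: "al x = A0 x" "a1 x = A1 x" "a2 x = A2 x" "a3 x = A3 x" "a4 x = A4 x" if "x \<in> ?S" for x
      using clamp_x_simps(1)[OF that] by (simp_all add: al_def a1_def a2_def a3_def a4_def)
    have cc: "continuous_on UNIV al" "continuous_on UNIV a1" "continuous_on UNIV a2" "continuous_on UNIV a3" "continuous_on UNIV a4"
      using L unfolding al_def a1_def a2_def a3_def a4_def by (intro continuous_clamp cA; simp)+
    have dc: "(al has_real_derivative a1 x) (at x within ?S)" "(a1 has_real_derivative a2 x) (at x within ?S)"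
      "(a2 has_real_derivative a3 x) (at x within ?S)" "(a3 has_real_derivative a4 x) (at x within ?S)" if x: "x \<in> ?S" for x
      unfolding eq[OF x] using dA[OF x] x eq by (blast intro: has_real_derivative_transform_on)+
    have ac: "ac L al a1" "ac L a1 a2" "ac L a2 a3" "ac L a3 a4"
      using dc continuous_on_subset[OF cc(2)] continuous_on_subset[OF cc(3)] continuous_on_subset[OF cc(4)] continuous_on_subset[OF cc(5)]
      by (blast intro: ac_C1 subset_UNIV)+
    have "carleman_weight T L m A c C \<tau>0 al a1 a2 a3 a4 e"
    proof
      show "al x \<le> - m \<and> \<bar>al x\<bar> \<le> A \<and> \<bar>a1 x\<bar> \<le> A \<and> \<bar>a2 x\<bar> \<le> A \<and> \<bar>a3 x\<bar> \<le> A \<and> \<bar>a4 x\<bar> \<le> A \<and> 0 \<le> e x \<and> e x \<le> A"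
        if x: "x \<in> ?S" for x
      proof -
        have "\<psi> x \<le> exp (s * M)" using M[OF x] s by (simp add: \<psi>_def)
        then have "A0 x \<le> - m" by (simp add: A0_def m_def)
        then show ?thesis using Ab[OF x] e(2)[of x] unfolding eq[OF x] by auto
      qed
      fix \<tau> w0 w1 w2 w3 w4
      assume h: "\<tau>0 \<le> \<tau>" "ac L w0 w1" "ac L w1 w2" "ac L w2 w3" "ac L w3 w4"
        "set_integrable lborel {0..L} (\<lambda>x. (w4 x)^2)" "w0 0 = 0" "w0 L = 0"
      have be: "\<forall>x\<in>{0..L}. \<bar>a1 x\<bar> \<le> A \<and> \<bar>a2 x\<bar> \<le> A \<and> \<bar>a3 x\<bar> \<le> A \<and> 0 \<le> e x \<and> e x \<le> A \<and> \<bar>deriv e x\<bar> \<le> A \<and>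
        (c0 \<le> a2 x \<and> c0 \<le> \<bar>a1 x\<bar> \<or> 1 \<le> e x)"
      proof
        fix x assume x: "x \<in> {0..L}"
        show "\<bar>a1 x\<bar> \<le> A \<and> \<bar>a2 x\<bar> \<le> A \<and> \<bar>a3 x\<bar> \<le> A \<and> 0 \<le> e x \<and> e x \<le> A \<and> \<bar>deriv e x\<bar> \<le> A \<and>
          (c0 \<le> a2 x \<and> c0 \<le> \<bar>a1 x\<bar> \<or> 1 \<le> e x)"
          using Ab[OF x] good[OF x] e(2)[of x] unfolding eq[OF x] by auto
      qed
      have sg: "0 < a1 0" "a1 L < 0" "e 0 = 0" "e L = 0"
        using d0 dL s L eq(2)[of 0] eq(2)[of L] test_line_zero[OF e(1)] by (auto simp: A1_def \<psi>_def mult_pos_neg mult_neg_pos)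
      show "0 \<le> (LINT x:{0..L}|lborel. (sym_part \<tau> (a1 x) (a2 x) (w0 x) (w1 x) (w2 x) (w4 x))^2
        + 2 * sym_part \<tau> (a1 x) (a2 x) (w0 x) (w1 x) (w2 x) (w4 x) * skew_part \<tau> (a1 x) (a2 x) (w0 x) (w1 x) (w3 x)
        - c * energy \<tau> (w0 x) (w1 x) (w2 x) (w3 x) + C * (e x * \<tau>^7 * (w0 x)^2))"
        using sl[rule_format, OF h(1) L ac(2,3) test_line_ac[OF e(1)] be[rule_format] sg h(2-8)] by blast
    qed (use T L m A c cc dc ac test_line_continuous[OF e(1)] in auto)
    moreover have "\<forall>x\<in>?S. al x = exp (s * \<phi> x) - exp (2 * s * sup_norm L \<phi>)"
      using eq(1) by (auto simp: A0_def \<psi>_def M_def)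
    ultimately show "\<exists>m A c C \<tau>0 al a1 a2 a3 a4 e. carleman_weight T L m A c C \<tau>0 al a1 a2 a3 a4 e \<and>
      (\<forall>x\<in>?S. al x = exp (s * \<phi> x) - exp (2 * s * sup_norm L \<phi>)) \<and> (\<forall>x. x \<notin> \<omega> \<longrightarrow> e x = 0)"
      using e(4) by blast
  qed
qed

section \<open>The Carleman estimate for Sobolev functions\<close>

lemma borel_rep_cong:
  assumes "borel_rep T L g h" "\<And>z. z \<in> {0<..<T} \<times> {0<..<L} \<Longrightarrow> g2 z = g z"
  shows "borel_rep T L g2 h"
proof -
  have "indicat_real ({0<..<T} \<times> {0<..<L}) z * g2 z = indicator ({0<..<T} \<times> {0<..<L}) z * g z" for z
    using assms(2)[of z] by (auto simp: indicator_def)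
  then show ?thesis using assms(1) by (simp only: borel_rep_def)
qed

text \<open>A translation: Borel representatives of \<open>v\<close> and its weak derivatives
  instantiate the estimate on the rectangle, and its integrals are identified with the Lebesgue
  integrals of the statement.\<close>

lemma sobolev_estimate:
  fixes \<phi> :: "real \<Rightarrow> real" and \<omega> :: "real set" and s \<Psi> A :: real
  defines "G \<equiv> s^8 * \<Psi>^7 * (2000 * A^6)"
  assumes weight: "carleman_weight T L m A c C \<tau>0 al a1 a2 a3 a4 e"
    and al: "\<And>x. x \<in> {0..L} \<Longrightarrow> al x = exp (s * \<phi> x) - exp (2 * s * sup_norm L \<phi>)"
    and e0: "\<And>x. x \<notin> \<omega> \<Longrightarrow> e x = 0" and \<omega>: "open \<omega>" "\<omega> \<subseteq> {0<..<L}" and s: "1 \<le> s"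
    and \<phi>: "continuous_on {0..L} \<phi>" "\<And>x. x \<in> {0..L} \<Longrightarrow> 0 \<le> \<phi> x \<and> exp (s * \<phi> x) \<le> \<Psi>"
    and lam: "0 < lam" "\<tau>0 \<le> 4 * lam / T^2" "T \<le> lam"
    and l1: "8 * (4 * (\<gamma>^2 * A^2 + 36 * A^2 + 16 * A^2 + 64 * A^4)) \<le> c * (4 * lam / T^2)"
    and l2: "88 * \<bar>\<gamma>\<bar> * A^4 * T \<le> c * lam"
    and Q: "Q = {0<..<T} \<times> {0<..<L}" and sob: "sobolev Q 4 v" and f: "L2_on Q f"
    and eqn: "AE z in lebesgue. z \<in> Q \<longrightarrow> \<gamma> * weak_deriv Q 1 0 v z + weak_deriv Q 0 4 v z = f z"
    and bc: "vanishes_on_lateral_boundary T L v"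
      "vanishes_on_lateral_boundary T L (weak_deriv Q 0 1 v) \<or> vanishes_on_lateral_boundary T L (weak_deriv Q 0 2 v)"
  shows "(LINT z:Q|lebesgue. lam * s^2 * weight_phi T \<phi> s z * exp (2 * lam * weight_rho T L \<phi> s z) *
         (\<bar>weak_deriv Q 0 3 v z\<bar>^2
          + lam^2 * s^2 * (weight_phi T \<phi> s z)^2 * \<bar>weak_deriv Q 0 2 v z\<bar>^2
          + lam^4 * s^4 * (weight_phi T \<phi> s z)^4 * \<bar>weak_deriv Q 0 1 v z\<bar>^2
          + lam^6 * s^6 * (weight_phi T \<phi> s z)^6 * \<bar>v z\<bar>^2))
      \<le> G * (2 / c) * (2 + C * A) * (LINT z:Q|lebesgue. exp (2 * lam * weight_rho T L \<phi> s z) * \<bar>f z\<bar>^2)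
        + G * (2 / c) * (2 + C * A) * (LINT z:{0<..<T} \<times> \<omega>|lebesgue.
            lam^7 * s^8 * (weight_phi T \<phi> s z)^7 * exp (2 * lam * weight_rho T L \<phi> s z) * \<bar>v z\<bar>^2)"
proof -
  interpret W: carleman_weight T L m A c C \<tau>0 al a1 a2 a3 a4 e by (rule weight)
  note T = W.T and L = W.L
  let ?Q = "{0..T} \<times> {0..L}"
  \<comment> \<open>At order zero \<open>v\<close> itself is taken, since
    \<open>weak_deriv Q 0 0 v\<close> is a chosen representative that may differ from it on a null
    set.\<close>
  define D where "D i j = (if i = 0 \<and> j = 0 then v else weak_deriv Q i j v)" for i j :: nat
  have W: "has_weak_deriv Q i j v (D i j)" if "i + j \<le> 4" for i j
  proof (cases "i = 0 \<and> j = 0")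
    case True
    have "locally_integrable Q v" using sobolev_rep(1)[OF sob[unfolded Q], of 0 1] by (simp add: Q has_weak_deriv_def)
    then show ?thesis using True by (simp add: D_def has_weak_deriv_def)
  next
    case False
    have "has_weak_deriv Q i j v (weak_deriv Q i j v)" unfolding Q by (rule sobolev_rep(1)[OF sob[unfolded Q] that])
    then show ?thesis by (simp only: D_def False if_False)
  qed
  have "\<exists>h. borel_rep T L (D i j) h \<and> set_integrable lborel ?Q (\<lambda>z. (h z)^2)" if "i + j \<le> 4" for i j
  proof (cases "i = 0 \<and> j = 0")
    case True
    have "L2_on ({0<..<T} \<times> {0<..<L}) v" using sob by (simp add: sobolev_def Q)
    from L2_on_rep[OF this] show ?thesis using True by (simp add: D_def)
  next
    case False
    from sobolev_rep(2)[OF sob[unfolded Q] that] show ?thesis by (simp only: D_def False if_False Q)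
  qed
  then have "\<forall>i j. \<exists>h. i + j \<le> 4 \<longrightarrow> borel_rep T L (D i j) h \<and> set_integrable lborel ?Q (\<lambda>z. (h z)^2)" by blast
  then obtain U where U: "\<And>i j. i + j \<le> 4 \<Longrightarrow> borel_rep T L (D i j) (U i j)"
    "\<And>i j. i + j \<le> 4 \<Longrightarrow> set_integrable lborel ?Q (\<lambda>z. (U i j z)^2)" by metis
  have Ub: "U i j \<in> borel_measurable borel" if "i + j \<le> 4" for i j using U(1)[OF that] by (rule borel_rep_borel)
  have Ui: "set_integrable lborel ?Q (U i j)" if "i + j \<le> 4" for i j
    using Ub[OF that] U(2)[OF that] by (rule set_integrable_of_square)
  have U0: "borel_rep T L v (U 0 0)" using U(1)[of 0 0] by (simp add: D_def)
  have dx: "weak_dx T L (U i j) (U i (Suc j))" if "i + Suc j \<le> 4" for i j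
    using that by (intro weak_dx_of[OF W[unfolded Q] W[unfolded Q] U0 U(1) U(1)]) auto
  have dt: "weak_dt T L (U i j) (U (Suc i) j)" if "Suc i + j \<le> 4" for i j
    using that by (intro weak_dt_of[OF W[unfolded Q] W[unfolded Q] U0 U(1) U(1)] Ui) auto
  have zb0: "zero_bdry T L (U 0 0) (U 0 1)"
    using zero_bdry_of_trace[OF T L bc(1) U0 U(2)[of 0 0], of "U 0 1"] U[of 0 1] by (simp add: D_def Q)
  \<comment> \<open>The trace of \<open>weak_deriv Q 0 j v\<close> is formulated with its own weak
    x-derivative; both that function and \<open>U 0 (Suc j)\<close> are weak x-derivatives of the
    same function, hence equal almost everywhere.\<close>
  have zb: "zero_bdry T L (U 0 j) (U 0 (Suc j))"
    if tr: "vanishes_on_lateral_boundary T L (weak_deriv Q 0 j v)" and j: "0 < j" "j \<le> 3" for j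
  proof -
    define u where "u = weak_deriv Q 0 j v"
    have ru: "borel_rep T L u (U 0 j)" using U(1)[of 0 j] j by (simp add: D_def u_def)
    have s1: "sobolev ({0<..<T} \<times> {0<..<L}) 1 u" using tr by (simp add: vanishes_on_lateral_boundary_def has_trace_def Let_def u_def)
    obtain g where g: "borel_rep T L (weak_deriv ({0<..<T} \<times> {0<..<L}) 0 1 u) g" "set_integrable lborel ?Q (\<lambda>z. (g z)^2)"
      using sobolev_rep(2)[OF s1, of 0 1] by auto
    have gb: "g \<in> borel_measurable borel" using g(1) by (rule borel_rep_borel)
    have gi: "set_integrable lborel ?Q g" using gb g(2) by (rule set_integrable_of_square)
    have w1: "has_weak_deriv ({0<..<T} \<times> {0<..<L}) 0 (Suc 0) u (weak_deriv ({0<..<T} \<times> {0<..<L}) 0 1 u)"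
      using sobolev_rep(1)[OF s1, of 0 1] by simp
    \<comment> \<open>Every locally integrable function is its own weak derivative of order zero;
      this puts \<open>u\<close> into the form that \<open>weak_dx_of\<close> expects.\<close>
    then have w0: "has_weak_deriv ({0<..<T} \<times> {0<..<L}) 0 0 u u" by (simp add: has_weak_deriv_def)
    have dg: "weak_dx T L (U 0 j) g" by (rule weak_dx_of[OF w0 w1 ru ru g(1)])
    have "zero_bdry T L (U 0 j) g"
      using zero_bdry_of_trace[OF T L tr[folded u_def] ru U(2) g] j by simp
    moreover have "AE z in lborel. z \<in> {0<..<T} \<times> {0<..<L} \<longrightarrow> g z = U 0 (Suc j) z"
    proof (rule variational_equal)
      show "g \<in> borel_measurable borel" "U 0 (Suc j) \<in> borel_measurable borel" using gb Ub j by auto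
      show "set_integrable lborel ({p..q} \<times> {p'..q'}) g" "set_integrable lborel ({p..q} \<times> {p'..q'}) (U 0 (Suc j))"
        if "0 < p" "q < T" "0 < p'" "q' < L" for p q p' q'
        by (rule set_integrable_subset[OF gi] set_integrable_subset[OF Ui]; use that j in auto)+
      show "(LINT z:?Q|lborel. a (fst z) * b (snd z) * g z) = (LINT z:?Q|lborel. a (fst z) * b (snd z) * U 0 (Suc j) z)"
        if "test_line T a" "test_line L b" for a b
        using dg dx[of 0 j] j that by (simp add: weak_dx_def)
    qed
    ultimately show ?thesis by (rule zero_bdry_cong) (use gb Ub j in auto)
  qed
  have bc': "zero_bdry T L (U 0 1) (U 0 2) \<or> zero_bdry T L (U 0 2) (U 0 3)"
    using bc(2) zb[of 1] zb[of 2] by (auto simp: numeral_2_eq_2 numeral_3_eq_3)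
  interpret S: carleman_solution T L m A c C \<tau>0 al a1 a2 a3 a4 e lam \<gamma> "U 0 0" "U 0 1" "U 0 2" "U 0 3" "U 0 4" "U 1 0" "U 1 1" "U 1 2"
  proof
    show "weak_dx T L (U 0 0) (U 0 1)" "weak_dx T L (U 0 1) (U 0 2)" "weak_dx T L (U 0 2) (U 0 3)" "weak_dx T L (U 0 3) (U 0 4)"
      "weak_dx T L (U 1 0) (U 1 1)" "weak_dx T L (U 1 1) (U 1 2)"
      using dx[of 0 0] dx[of 0 1] dx[of 0 2] dx[of 0 3] dx[of 1 0] dx[of 1 1] by (simp_all add: eval_nat_numeral)
    show "weak_dt T L (U 0 0) (U 1 0)" "weak_dt T L (U 0 1) (U 1 1)" "weak_dt T L (U 0 2) (U 1 2)"
      using dt[of 0 0] dt[of 0 1] dt[of 0 2] by simp_all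
    show "zero_bdry T L (U 0 0) (U 0 1)" by (rule zb0)
    show "zero_bdry T L (U 0 1) (U 0 2) \<or> zero_bdry T L (U 0 2) (U 0 3)" by (rule bc')
  qed (use lam Ub U(2) in simp_all)
  define \<psi> where "\<psi> x = exp (s * \<phi> (clamp_x L x))" for x
  have \<psi>c: "continuous_on UNIV \<psi>" unfolding \<psi>_def
    by (intro continuous_intros continuous_clamp \<phi>(1)) (use L in simp)
  have [measurable]: "\<psi> \<in> borel_measurable borel" using \<psi>c by (rule borel_measurable_continuous_onI)
  have \<psi>b: "1 \<le> \<psi> x \<and> \<psi> x \<le> \<Psi>" if "x \<in> {0..L}" for x
    using \<phi>(2)[OF that] clamp_x_simps(1)[OF that] s by (simp add: \<psi>_def)
  have [measurable]: "\<omega> \<in> sets borel" using \<omega>(1) by (rule borel_open)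
  note main = S.weighted_estimate[OF l1 l2 _ \<psi>b _ e0 s, folded G_def]
  \<comment> \<open>The dictionary between the weights of the statement and those of the conjugated
    problem; it is used only inside the open rectangle, where no denominator vanishes.\<close>
  have wt: "lam * weight_phi T \<phi> s z = \<psi> (snd z) * S.\<tau> z" "exp (2 * lam * weight_rho T L \<phi> s z) = (S.E z)^2"
    "0 < S.\<tau> z" if z: "z \<in> Q" for z
  proof -
    obtain t x where tx: "z = (t, x)" "0 < t" "t < T" "0 < x" "x < L" using z by (cases z) (auto simp: Q)
    have x: "x \<in> {0..L}" using tx by auto
    show "lam * weight_phi T \<phi> s z = \<psi> (snd z) * S.\<tau> z"
      using tx clamp_x_simps(1)[OF x] by (simp add: weight_phi_def \<psi>_def S.\<tau>_def tau_def)
    have "S.E z = exp (lam / (t * (T - t)) * al x)" using tx by (simp add: S.E_def time_weight_def tau_def)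
    moreover have "2 * lam * weight_rho T L \<phi> s z = 2 * (lam / (t * (T - t)) * al x)"
      using tx al[OF x] by (simp add: weight_rho_def)
    ultimately show "exp (2 * lam * weight_rho T L \<phi> s z) = (S.E z)^2"
      by (simp only: exp_double)
    show "0 < S.\<tau> z" using tx lam by (simp add: S.\<tau>_def tau_def)
  qed
  have sndm: "(\<lambda>z. \<psi> (snd z)) \<in> borel_measurable (borel :: (real \<times> real) measure)"
    "(\<lambda>z. indicat_real \<omega> (snd z)) \<in> borel_measurable (borel :: (real \<times> real) measure)"
    by (rule measurable_compose[OF borel_measurable_fst_snd(2)], measurable)+
  note meas = borel_measurable_times borel_measurable_power borel_measurable_const S.borel_tau sndm
  have r: "borel_rep T L v (U 0 0)" "borel_rep T L (weak_deriv Q 0 1 v) (U 0 1)" "borel_rep T L (weak_deriv Q 0 2 v) (U 0 2)"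
    "borel_rep T L (weak_deriv Q 0 3 v) (U 0 3)"
    using U0 U(1)[of 0 1] U(1)[of 0 2] U(1)[of 0 3] by (simp_all add: D_def)
  have rf: "borel_rep T L f (\<lambda>z. \<gamma> * U 1 0 z + U 0 4 z)"
  proof (rule borel_repI)
    show "(\<lambda>z. indicator ({0<..<T} \<times> {0<..<L}) z * f z) \<in> borel_measurable lebesgue"
      using f by (simp add: L2_on_def set_borel_measurable_def Q)
    show "(\<lambda>z. \<gamma> * U 1 0 z + U 0 4 z) \<in> borel_measurable borel"
      by (intro borel_measurable_add borel_measurable_times borel_measurable_const Ub) auto
    have "AE z in lborel. z \<in> Q \<longrightarrow> \<gamma> * weak_deriv Q 1 0 v z + weak_deriv Q 0 4 v z = f z"
      using eqn by (simp add: AE_completion_iff)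
    moreover have "AE z in lborel. z \<in> {0<..<T} \<times> {0<..<L} \<longrightarrow> weak_deriv Q 1 0 v z = U 1 0 z"
      "AE z in lborel. z \<in> {0<..<T} \<times> {0<..<L} \<longrightarrow> weak_deriv Q 0 4 v z = U 0 4 z"
      using borel_repD[OF U(1)[of 1 0]] borel_repD[OF U(1)[of 0 4]] by (simp_all add: D_def)
    ultimately show "AE z in lborel. z \<in> {0<..<T} \<times> {0<..<L} \<longrightarrow> f z = \<gamma> * U 1 0 z + U 0 4 z"
      by eventually_elim (auto simp: Q)
  qed
  have "borel_rep T L (\<lambda>z. (s^2 * \<psi> (snd z) * (S.E z)^2) * (S.\<tau> z * (weak_deriv Q 0 3 v z)^2
      + (s^2 * \<psi> (snd z)^2 * S.\<tau> z^3) * (weak_deriv Q 0 2 v z)^2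
      + (s^4 * \<psi> (snd z)^4 * S.\<tau> z^5) * (weak_deriv Q 0 1 v z)^2 + (s^6 * \<psi> (snd z)^6 * S.\<tau> z^7) * (v z)^2))
    (\<lambda>z. (s^2 * \<psi> (snd z) * (S.E z)^2) * (S.\<tau> z * (U 0 3 z)^2 + (s^2 * \<psi> (snd z)^2 * S.\<tau> z^3) * (U 0 2 z)^2
      + (s^4 * \<psi> (snd z)^4 * S.\<tau> z^5) * (U 0 1 z)^2 + (s^6 * \<psi> (snd z)^6 * S.\<tau> z^7) * (U 0 0 z)^2))"
    by (intro borel_rep_mult borel_rep_add borel_rep_square r meas)
  then have R1: "borel_rep T L (\<lambda>z. lam * s^2 * weight_phi T \<phi> s z * exp (2 * lam * weight_rho T L \<phi> s z) *
         (\<bar>weak_deriv Q 0 3 v z\<bar>^2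
          + lam^2 * s^2 * (weight_phi T \<phi> s z)^2 * \<bar>weak_deriv Q 0 2 v z\<bar>^2
          + lam^4 * s^4 * (weight_phi T \<phi> s z)^4 * \<bar>weak_deriv Q 0 1 v z\<bar>^2
          + lam^6 * s^6 * (weight_phi T \<phi> s z)^6 * \<bar>v z\<bar>^2))
    (\<lambda>z. s^2 * \<psi> (snd z) * (S.E z)^2 * (S.\<tau> z * (U 0 3 z)^2 + s^2 * \<psi> (snd z)^2 * S.\<tau> z^3 * (U 0 2 z)^2
      + s^4 * \<psi> (snd z)^4 * S.\<tau> z^5 * (U 0 1 z)^2 + s^6 * \<psi> (snd z)^6 * S.\<tau> z^7 * (U 0 0 z)^2))"
  proof (rule borel_rep_cong)
    fix z assume "z \<in> {0<..<T} \<times> {0<..<L}"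
    then have z: "z \<in> Q" by (simp add: Q)
    define X where "X = \<psi> (snd z) * S.\<tau> z"
    have p: "lam^k * y * (weight_phi T \<phi> s z)^k = y * X^k" for k y
      using wt(1)[OF z] by (simp add: X_def power_mult_distrib[symmetric] mult.assoc mult.left_commute[of y])
    have p1: "lam * y * weight_phi T \<phi> s z = y * X" for y using p[of 1 y] by simp
    show "lam * s^2 * weight_phi T \<phi> s z * exp (2 * lam * weight_rho T L \<phi> s z) *
         (\<bar>weak_deriv Q 0 3 v z\<bar>^2
          + lam^2 * s^2 * (weight_phi T \<phi> s z)^2 * \<bar>weak_deriv Q 0 2 v z\<bar>^2
          + lam^4 * s^4 * (weight_phi T \<phi> s z)^4 * \<bar>weak_deriv Q 0 1 v z\<bar>^2
          + lam^6 * s^6 * (weight_phi T \<phi> s z)^6 * \<bar>v z\<bar>^2)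
      = (s^2 * \<psi> (snd z) * (S.E z)^2) * (S.\<tau> z * (weak_deriv Q 0 3 v z)^2
      + (s^2 * \<psi> (snd z)^2 * S.\<tau> z^3) * (weak_deriv Q 0 2 v z)^2
      + (s^4 * \<psi> (snd z)^4 * S.\<tau> z^5) * (weak_deriv Q 0 1 v z)^2 + (s^6 * \<psi> (snd z)^6 * S.\<tau> z^7) * (v z)^2)"
      unfolding p p1 wt(2)[OF z] power2_abs X_def by (simp add: power_mult_distrib algebra_simps eval_nat_numeral)
  qed
  have "borel_rep T L (\<lambda>z. (S.E z)^2 * (f z)^2) (\<lambda>z. (S.E z)^2 * (\<gamma> * U 1 0 z + U 0 4 z)^2)"
    by (intro borel_rep_mult borel_rep_square rf meas)
  then have R2: "borel_rep T L (\<lambda>z. exp (2 * lam * weight_rho T L \<phi> s z) * \<bar>f z\<bar>^2) (\<lambda>z. (S.E z)^2 * (\<gamma> * U 1 0 z + U 0 4 z)^2)"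
    by (rule borel_rep_cong) (use wt(2) in \<open>simp add: Q\<close>)
  let ?g = "\<lambda>z. lam^7 * s^8 * (weight_phi T \<phi> s z)^7 * exp (2 * lam * weight_rho T L \<phi> s z) * \<bar>v z\<bar>^2"
  have "borel_rep T L (\<lambda>z. (indicator \<omega> (snd z) * (s^8 * \<psi> (snd z)^7 * S.\<tau> z^7 * (S.E z)^2)) * (v z)^2)
    (\<lambda>z. (indicator \<omega> (snd z) * (s^8 * \<psi> (snd z)^7 * S.\<tau> z^7 * (S.E z)^2)) * (U 0 0 z)^2)"
    by (intro borel_rep_mult borel_rep_square r meas)
  then have R3: "borel_rep T L (\<lambda>z. indicator \<omega> (snd z) * ?g z)
    (\<lambda>z. indicator \<omega> (snd z) * (s^8 * \<psi> (snd z)^7 * S.\<tau> z^7 * (S.E z)^2 * (U 0 0 z)^2))"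
    unfolding mult.assoc[of "indicator \<omega> (snd _)"]
  proof (rule borel_rep_cong)
    fix z assume "z \<in> {0<..<T} \<times> {0<..<L}"
    then have z: "z \<in> Q" by (simp add: Q)
    have p: "lam^7 * s^8 * (weight_phi T \<phi> s z)^7 = s^8 * (\<psi> (snd z) * S.\<tau> z)^7"
      using wt(1)[OF z] by (simp add: power_mult_distrib[symmetric] mult.assoc mult.left_commute[of "s^8"])
    show "indicator \<omega> (snd z) * ?g z = indicator \<omega> (snd z) * (s^8 * \<psi> (snd z)^7 * S.\<tau> z^7 * (S.E z)^2 * (v z)^2)"
      unfolding p wt(2)[OF z] power2_abs by (simp add: power_mult_distrib)
  qed
  \<comment> \<open>The restriction to \<open>\<omega>\<close> is moved into the integrand, so that
    all three integrals run over the same rectangle.\<close>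
  have I3: "(LINT z:{0<..<T} \<times> \<omega>|lebesgue. ?g z) = (LINT z:Q|lebesgue. indicator \<omega> (snd z) * ?g z)"
    unfolding set_lebesgue_integral_def Q
    by (intro Bochner_Integration.integral_cong refl) (use \<omega>(2) in \<open>auto simp: indicator_def\<close>)
  show ?thesis
    unfolding I3 unfolding Q
    unfolding borel_rep_integral(1)[OF R1, unfolded Q] borel_rep_integral(1)[OF R2, unfolded Q] borel_rep_integral(1)[OF R3, unfolded Q]
    by (rule main) auto
qed

theorem theorem1p2:
  fixes T L \<gamma> :: real
    and \<omega>\<^sub>0 \<omega> :: "real set"
    and \<phi> :: "real \<Rightarrow> real"
    and Q :: "(real \<times> real) set"
  assumes "T > 0" and "L > 0"
    and "Q = {0<..<T} \<times> {0<..<L}"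
    and "open \<omega>\<^sub>0" and "\<omega>\<^sub>0 \<noteq> {}" and "\<omega>\<^sub>0 \<subseteq> {0<..<L}"
    and "open \<omega>" and "\<omega> \<noteq> {}" and "\<omega> \<subseteq> {0<..<L}"
    and "closure \<omega>\<^sub>0 \<subseteq> \<omega>"
    and "Ck_on 4 {0..L} \<phi>"
    and "\<And>x. x \<in> {0<..<L} \<Longrightarrow> \<phi> x > 0"
    and "\<phi> 0 = 0" and "\<phi> L = 0"
    and "\<And>x. x \<in> closure ({0<..<L} - \<omega>\<^sub>0) \<Longrightarrow> \<bar>vector_derivative \<phi> (at x within {0..L})\<bar> > 0"
  shows "\<exists>s\<^sub>0>0. \<forall>s\<ge>s\<^sub>0. \<exists>lam0>0. \<exists>C>0. \<forall>v f.
    sobolev Q 4 v \<longrightarrow>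
    L2_on Q f \<longrightarrow>
    (AE z in lebesgue. z \<in> Q \<longrightarrow> \<gamma> * weak_deriv Q 1 0 v z + weak_deriv Q 0 4 v z = f z) \<longrightarrow>
    (vanishes_on_lateral_boundary T L v \<and> vanishes_on_lateral_boundary T L (weak_deriv Q 0 1 v) \<or>
     vanishes_on_lateral_boundary T L v \<and> vanishes_on_lateral_boundary T L (weak_deriv Q 0 2 v)) \<longrightarrow>
    (\<forall>lam\<ge>lam0.
      (LINT z:Q|lebesgue. lam * s^2 * weight_phi T \<phi> s z * exp (2 * lam * weight_rho T L \<phi> s z) *
         (\<bar>weak_deriv Q 0 3 v z\<bar>^2
          + lam^2 * s^2 * (weight_phi T \<phi> s z)^2 * \<bar>weak_deriv Q 0 2 v z\<bar>^2
          + lam^4 * s^4 * (weight_phi T \<phi> s z)^4 * \<bar>weak_deriv Q 0 1 v z\<bar>^2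
          + lam^6 * s^6 * (weight_phi T \<phi> s z)^6 * \<bar>v z\<bar>^2))
      \<le> C * (LINT z:Q|lebesgue. exp (2 * lam * weight_rho T L \<phi> s z) * \<bar>f z\<bar>^2)
        + C * (LINT z:{0<..<T} \<times> \<omega>|lebesgue.
            lam^7 * s^8 * (weight_phi T \<phi> s z)^7 * exp (2 * lam * weight_rho T L \<phi> s z) * \<bar>v z\<bar>^2))"
proof -
  obtain s0 where s0: "1 \<le> s0" and weights: "\<And>s. s0 \<le> s \<Longrightarrow> \<exists>m A c C \<tau>0 al a1 a2 a3 a4 e.
    carleman_weight T L m A c C \<tau>0 al a1 a2 a3 a4 e \<and>
    (\<forall>x\<in>{0..L}. al x = exp (s * \<phi> x) - exp (2 * s * sup_norm L \<phi>)) \<and> (\<forall>x. x \<notin> \<omega> \<longrightarrow> e x = 0)"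
    using carleman_weight_exists[OF assms(1,2,4-7,9-15)] by blast
  have \<phi>c: "continuous_on {0..L} \<phi>"
  proof -
    have "Ck_on (Suc 3) {0..L} \<phi>" using assms(11) by (simp add: eval_nat_numeral del: Ck_on.simps)
    then show ?thesis by (intro DERIV_continuous_on[OF Ck_on_Suc_D(2)])
  qed
  have \<phi>0: "0 \<le> \<phi> x" if "x \<in> {0..L}" for x
  proof -
    have "x = 0 \<or> x = L \<or> x \<in> {0<..<L}" using that by auto
    then show ?thesis using assms(12)[of x] assms(13,14) by (elim disjE) simp_all
  qed
  show ?thesis
  proof (rule exI[of _ s0], intro conjI allI impI)
    show "0 < s0" using s0 by simp
    fix s assume ss: "s0 \<le> s"
    then have s: "1 \<le> s" using s0 by simp
    obtain m A c C \<tau>0 al a1 a2 a3 a4 e where w: "carleman_weight T L m A c C \<tau>0 al a1 a2 a3 a4 e"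
      and al: "\<And>x. x \<in> {0..L} \<Longrightarrow> al x = exp (s * \<phi> x) - exp (2 * s * sup_norm L \<phi>)" and e: "\<And>x. x \<notin> \<omega> \<Longrightarrow> e x = 0"
      using weights[OF ss] by blast
    interpret W: carleman_weight T L m A c C \<tau>0 al a1 a2 a3 a4 e by (rule w)
    obtain B where B: "\<And>x. x \<in> {0..L} \<Longrightarrow> \<bar>exp (s * \<phi> x)\<bar> \<le> B"
      using continuous_interval_bound[of L "\<lambda>x. exp (s * \<phi> x)"] \<phi>c by (metis continuous_on_exp continuous_on_mult_left)
    define \<Psi> where "\<Psi> = max 1 B"
    have \<Psi>: "exp (s * \<phi> x) \<le> \<Psi>" if "x \<in> {0..L}" for x using B[OF that] by (simp add: \<Psi>_def)
    have \<Psi>1: "1 \<le> \<Psi>" by (simp add: \<Psi>_def)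
    define G where "G = s^8 * \<Psi>^7 * (2000 * A^6)"
    define KR where "KR = 4 * (\<gamma>^2 * A^2 + 36 * A^2 + 16 * A^2 + 64 * A^4)"
    define J where "J = 88 * \<bar>\<gamma>\<bar> * A^4 * T"
    \<comment> \<open>One summand for each requirement on \<open>lam\<close>: positivity, |\<sigma>|
      \<le> 1, \<tau> \<ge> \<open>\<tau>0\<close>, and the absorption of the remainder and of the
      time error.\<close>
    define lam0 where "lam0 = 1 + T + \<tau>0 * T^2 + 8 * KR * T^2 / c + J / c"
    define C' where "C' = G * (2 / c) * (2 + C * A)"
    have pos: "0 \<le> KR" "0 \<le> J" "0 < c" "0 < T" "1 \<le> \<tau>0" "0 < C" "1 \<le> A"
      using W.A W.c W.T W.\<tau>0 W.C by (auto simp: KR_def J_def)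
    have terms: "0 \<le> \<tau>0 * T^2" "0 \<le> 8 * KR * T^2 / c" "0 \<le> J / c" using pos by auto
    have l0: "0 < lam0" unfolding lam0_def using terms pos by linarith
    have C': "0 < C'"
      unfolding C'_def G_def using pos s \<Psi>1 by (intro mult_pos_pos add_pos_pos) auto
    show "\<exists>lam0>0. \<exists>C>0. \<forall>v f.
      sobolev Q 4 v \<longrightarrow>
      L2_on Q f \<longrightarrow>
      (AE z in lebesgue. z \<in> Q \<longrightarrow> \<gamma> * weak_deriv Q 1 0 v z + weak_deriv Q 0 4 v z = f z) \<longrightarrow>
      (vanishes_on_lateral_boundary T L v \<and> vanishes_on_lateral_boundary T L (weak_deriv Q 0 1 v) \<or>
       vanishes_on_lateral_boundary T L v \<and> vanishes_on_lateral_boundary T L (weak_deriv Q 0 2 v)) \<longrightarrow>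
      (\<forall>lam\<ge>lam0.
        (LINT z:Q|lebesgue. lam * s^2 * weight_phi T \<phi> s z * exp (2 * lam * weight_rho T L \<phi> s z) *
           (\<bar>weak_deriv Q 0 3 v z\<bar>^2
            + lam^2 * s^2 * (weight_phi T \<phi> s z)^2 * \<bar>weak_deriv Q 0 2 v z\<bar>^2
            + lam^4 * s^4 * (weight_phi T \<phi> s z)^4 * \<bar>weak_deriv Q 0 1 v z\<bar>^2
            + lam^6 * s^6 * (weight_phi T \<phi> s z)^6 * \<bar>v z\<bar>^2))
        \<le> C * (LINT z:Q|lebesgue. exp (2 * lam * weight_rho T L \<phi> s z) * \<bar>f z\<bar>^2)
          + C * (LINT z:{0<..<T} \<times> \<omega>|lebesgue.
              lam^7 * s^8 * (weight_phi T \<phi> s z)^7 * exp (2 * lam * weight_rho T L \<phi> s z) * \<bar>v z\<bar>^2))"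
    proof (rule exI[of _ lam0], rule conjI[OF l0], rule exI[of _ C'], rule conjI[OF C'], intro allI impI)
      fix v f lam
      assume v: "sobolev Q 4 v" and f: "L2_on Q f"
        and eqn: "AE z in lebesgue. z \<in> Q \<longrightarrow> \<gamma> * weak_deriv Q 1 0 v z + weak_deriv Q 0 4 v z = f z"
        and bc: "vanishes_on_lateral_boundary T L v \<and> vanishes_on_lateral_boundary T L (weak_deriv Q 0 1 v) \<or>
          vanishes_on_lateral_boundary T L v \<and> vanishes_on_lateral_boundary T L (weak_deriv Q 0 2 v)"
        and lam: "lam0 \<le> lam"
      have lb: "0 < lam" "T \<le> lam" "\<tau>0 * T^2 \<le> lam" "8 * KR * T^2 / c \<le> lam" "J / c \<le> lam"
        using lam l0 terms pos unfolding lam0_def by linarith+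
      have h1: "\<tau>0 \<le> 4 * lam / T^2" using lb(1,3) pos by (simp add: pos_le_divide_eq)
      have "8 * KR \<le> c * lam / T^2" using lb(4) pos by (simp add: pos_le_divide_eq pos_divide_le_eq mult.commute)
      also have "\<dots> \<le> c * (4 * lam / T^2)" using lb(1) pos by (simp add: divide_right_mono)
      finally have h2: "8 * KR \<le> c * (4 * lam / T^2)" .
      have h3: "J \<le> c * lam" using lb(5) pos by (simp add: pos_divide_le_eq mult.commute)
      have bc': "vanishes_on_lateral_boundary T L v"
        "vanishes_on_lateral_boundary T L (weak_deriv Q 0 1 v) \<or> vanishes_on_lateral_boundary T L (weak_deriv Q 0 2 v)"
        using bc by auto
      show "(LINT z:Q|lebesgue. lam * s^2 * weight_phi T \<phi> s z * exp (2 * lam * weight_rho T L \<phi> s z) *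
           (\<bar>weak_deriv Q 0 3 v z\<bar>^2
            + lam^2 * s^2 * (weight_phi T \<phi> s z)^2 * \<bar>weak_deriv Q 0 2 v z\<bar>^2
            + lam^4 * s^4 * (weight_phi T \<phi> s z)^4 * \<bar>weak_deriv Q 0 1 v z\<bar>^2
            + lam^6 * s^6 * (weight_phi T \<phi> s z)^6 * \<bar>v z\<bar>^2))
        \<le> C' * (LINT z:Q|lebesgue. exp (2 * lam * weight_rho T L \<phi> s z) * \<bar>f z\<bar>^2)
          + C' * (LINT z:{0<..<T} \<times> \<omega>|lebesgue.
              lam^7 * s^8 * (weight_phi T \<phi> s z)^7 * exp (2 * lam * weight_rho T L \<phi> s z) * \<bar>v z\<bar>^2)"
        unfolding C'_def G_def
        by (rule sobolev_estimate[OF w al e assms(7,9) s \<phi>c _ lb(1) h1 lb(2) h2[unfolded KR_def] h3[unfolded J_def] assms(3) v f eqn bc'])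
          (use \<phi>0 \<Psi> in auto)
    qed
  qed
qed

end
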